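(* Let $(\mathcal E,\mathcal F)$ be the Dirichlet form on $L^2(K,\mu)$ associated with a regular harmonic structure $(D,\boldsymbol r)$ on a connected post-critically finite self-similar structure $(K,S,\{\psi_i\}_{i\in S})$ (all as defined in the context). Suppose that: (B1) $\#V_0=3$; (B2) for all $p\in V_0$, $K\setminus\{p\}$ is connected; (B3) $\#S_0=3$, that is, each $p\in V_0$ is the fixed point of $\psi_i$ for some $i\in S_0$; moreover, for every $i\in S_0$ with fixed point $p=p_i$, $Dv_i(q)<0$ for every $q\in V_0\setminus\{p\}$; (B4) for every $i\in S_0$, $A_i$ is invertible. Let $N\in\mathbb N$ and take $\boldsymbol h=(h_1,\dots,h_N)$ such that each $h_j$ is a harmonic function. Then $\mathsf d_{\boldsymbol h}(x,y)=\rho_{\boldsymbol h}(x,y)$ for all $x,y\in K$.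
   Context: Self-similar structure. $K$ is a compact metrizable connected space, $S$ a finite set with $\#S\ge2$, and for $i\in S$, $\psi_i\colon K\to K$ is continuous and injective. $\Sigma=S^{\mathbb N}$ (product topology), $\sigma_i(\omega_1\omega_2\cdots)=i\omega_1\omega_2\cdots$, $\sigma^m(\omega_1\omega_2\cdots)=\omega_{m+1}\omega_{m+2}\cdots$. It is assumed that there is a continuous surjective map $\pi\colon\Sigma\to K$ with $\psi_i\circ\pi=\pi\circ\sigma_i$ for every $i\in S$. Put $W_0=\{\emptyset\}$, $W_m=S^m$; for $w=w_1\cdots w_m\in W_m$, $\psi_w=\psi_{w_1}\circ\cdots\circ\psi_{w_m}$ ($\psi_\emptyset=\mathrm{id}$) and $K_w=\psi_w(K)$. Let $\mathcal P=\bigcup_{m=1}^\infty\sigma^m\bigl(\pi^{-1}(\bigcup_{i\ne j\in S}(K_i\cap K_j))\bigr)$ and $V_0=\pi(\mathcal P)$. The structure is assumed post-critically finite, i.e. $\mathcal P$ is finite. For $m\in\mathbb N$, $V_m=\bigcup_{w\in W_m}\psi_w(V_0)$. Harmonic structure. For a finite set $V$, $l(V)$ is the space of real functions on $V$ with inner product $(u,v)_{l(V)}=\sum_{q\in V}u(q)v(q)$. $D=(D_{qq'})_{q,q'\in V_0}$ is a symmetric linear operator on $l(V_0)$ that is nonpositive definite, with $Du=0$ if and only if $u$ is constant on $V_0$, and $D_{qq'}\ge0$ for $q\ne q'$. $\mathcal E^{(0)}(u,v)=(-Du,v)_{l(V_0)}$. For $\boldsymbol r=\{r_i\}_{i\in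 S}$ with $r_i>0$, $r_w=r_{w_1}\cdots r_{w_m}$ ($r_\emptyset=1$) and $\mathcal E^{(m)}(u,v)=\sum_{w\in W_m}r_w^{-1}\mathcal E^{(0)}(u\circ\psi_w|_{V_0},v\circ\psi_w|_{V_0})$ for $u,v\in l(V_m)$. $(D,\boldsymbol r)$ is a regular harmonic structure if $0<r_i<1$ for all $i\in S$ and $\mathcal E^{(0)}(v,v)=\inf\{\mathcal E^{(1)}(u,u)\mid u\in l(V_1),\ u|_{V_0}=v\}$ for every $v\in l(V_0)$. Dirichlet form. Let $\mu$ be a finite Borel measure on $K$ with full support. Then $\mathcal F=\{u\in C(K)\mid\lim_{m\to\infty}\mathcal E^{(m)}(u|_{V_m},u|_{V_m})<\infty\}$ and $\mathcal E(u,v)=\lim_{m\to\infty}\mathcal E^{(m)}(u|_{V_m},v|_{V_m})$ define a strong local regular Dirichlet form on $L^2(K,\mu)$. Write $\mathcal E(f)=\mathcal E(f,f)$. The energy measure $\mu_{\langle f\rangle}$ of $f\in\mathcal F$ is characterized by $\int_K\varphi\,d\mu_{\langle f\rangle}=2\mathcal E(f,f\varphi)-\mathcal E(f^2,\varphi)$ for all $\varphi\in\mathcal F$. Harmonic functions. For $u\in l(V_0)$ there is a unique $h\in\mathcal F$, called a harmonic function, with $h|_{V_0}=u$ and $\mathcal E(h)=\inf\{\mathcal E(g)\mid g\in\mathcal F,\ g|_{V_0}=u\}$; write $h=\iota(u)$. $\mathcal H=\iota(l(V_0))$ is the space of harmonic functions, and $\iota\colon l(V_0)\to\mathcal H$ is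 a linear bijection. For $i\in S$, $A_i=\iota^{-1}\circ\psi_i^*\circ\iota\colon l(V_0)\to l(V_0)$, where $\psi_i^*f=f\circ\psi_i$. $p_i$ denotes the fixed point of $\psi_i$, and $S_0=\{i\in S\mid p_i\in V_0\}$. For $i\in S_0$, $r_i$ is an eigenvalue of $A_i$, and $v_i\in l(V_0)$ denotes a corresponding eigenvector whose components are all nonnegative (then $v_i(p_i)=0$). Distances. For $\boldsymbol h=(h_1,\dots,h_N)$ with $h_j\in\mathcal F$, put $\mu_{\langle\boldsymbol h\rangle}=\sum_{j=1}^N\mu_{\langle h_j\rangle}$ and $\mathsf d_{\boldsymbol h}(x,y)=\sup\{f(y)-f(x)\mid f\in\mathcal F\cap C(K),\ \mu_{\langle f\rangle}\le\mu_{\langle\boldsymbol h\rangle}\}$. For $\gamma\in C([s,t]\to K)$, $\ell_{\boldsymbol h}(\gamma)=\sup\{\sum_{i=1}^n|\boldsymbol h(\gamma(t_i))-\boldsymbol h(\gamma(t_{i-1}))|_{\mathbb R^N}\mid n\in\mathbb N,\ s=t_0<\dots<t_n=t\}$, and $\rho_{\boldsymbol h}(x,y)=\inf\{\ell_{\boldsymbol h}(\gamma)\mid\gamma\in C([0,1]\to K),\ \gamma(0)=x,\ \gamma(1)=y\}$ ($\inf\emptyset=\infty$). *)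

theory Defs
  imports "HOL-Analysis.Analysis"
begin

text \<open>
  Conventions.  The compact metrizable space is a subset \<open>K\<close> of a metric space; only its topology
  is used.  A real function on \<open>V \<subseteq> K\<close> is represented by a total function of which only the values
  on \<open>V\<close> matter; where functions themselves have to be counted (bijectivity of operators on
  \<open>l(V)\<close>), the library's \<open>extensional V\<close> is used, which has exactly one representative for each
  function on \<open>V\<close>.  Infinite words are indexed from 0.
\<close>

locale self_similar_structure =
  fixes K :: "'a::metric_space set"
    and S :: "'s set"
    and \<psi> :: "'s \<Rightarrow> 'a \<Rightarrow> 'a"
    and \<pi> :: "(nat \<Rightarrow> 's) \<Rightarrow> 'a"
  assumes compact_K: "compact K"
    and connected_K: "connected K"
    and finite_S: "finite S"
    and card_S: "2 \<le> card S"
    and psi_into: "\<And>i. i \<in> S \<Longrightarrow> \<psi> i \<in> K \<rightarrow> K"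
    and psi_continuous: "\<And>i. i \<in> S \<Longrightarrow> continuous_on K (\<psi> i)"
    and psi_inj: "\<And>i. i \<in> S \<Longrightarrow> inj_on (\<psi> i) K"
    and pi_continuous:
      "continuous_map (product_topology (\<lambda>_::nat. discrete_topology S) UNIV) (top_of_set K) \<pi>"
    and pi_surj: "\<pi> ` (UNIV \<rightarrow> S) = K"
    and pi_conj: "\<And>i \<omega>. i \<in> S \<Longrightarrow> \<omega> \<in> UNIV \<rightarrow> S \<Longrightarrow> \<psi> i (\<pi> \<omega>) = \<pi> (case_nat i \<omega>)"
begin

definition words :: "nat \<Rightarrow> 's list set" where
  "words m = {w. set w \<subseteq> S \<and> length w = m}"

definition psi_word :: "'s list \<Rightarrow> 'a \<Rightarrow> 'a" where
  "psi_word w = foldr (\<lambda>i f. \<psi> i \<circ> f) w id"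

definition critical_set :: "(nat \<Rightarrow> 's) set" where
  "critical_set =
     {\<omega> \<in> UNIV \<rightarrow> S. \<pi> \<omega> \<in> (\<Union>i\<in>S. \<Union>j\<in>S - {i}. \<psi> i ` K \<inter> \<psi> j ` K)}"

definition post_critical_set :: "(nat \<Rightarrow> 's) set" where
  "post_critical_set = (\<Union>m\<in>{1..}. (\<lambda>\<omega> n. \<omega> (n + m)) ` critical_set)"

definition V0 :: "'a set" where
  "V0 = \<pi> ` post_critical_set"

text \<open>The fixed point \<open>p\<^sub>i\<close> of \<open>\<psi>\<^sub>i\<close>; it is unique, being \<open>\<pi>(iii\<dots>)\<close>.\<close>

definition fixpt :: "'s \<Rightarrow> 'a" where
  "fixpt i = (THE x. x \<in> K \<and> \<psi> i x = x)"

definition S0 :: "'s set" where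
  "S0 = {i \<in> S. fixpt i \<in> V0}"

definition Dop :: "('a \<Rightarrow> 'a \<Rightarrow> real) \<Rightarrow> ('a \<Rightarrow> real) \<Rightarrow> 'a \<Rightarrow> real" where
  "Dop D u q = (\<Sum>q'\<in>V0. D q q' * u q')"

definition E0 :: "('a \<Rightarrow> 'a \<Rightarrow> real) \<Rightarrow> ('a \<Rightarrow> real) \<Rightarrow> ('a \<Rightarrow> real) \<Rightarrow> real" where
  "E0 D u v = (\<Sum>q\<in>V0. - Dop D u q * v q)"

text \<open>
  The form \<open>\<E>\<^sup>(\<^sup>m\<^sup>)\<close> uses the values of its arguments only on
  \<open>V\<^sub>m = (\<Union>w\<in>words m. psi_word w ` V0)\<close>, so it is applied to functions on \<open>K\<close> without restricting
  them.
\<close>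

definition Em ::
  "('a \<Rightarrow> 'a \<Rightarrow> real) \<Rightarrow> ('s \<Rightarrow> real) \<Rightarrow> nat \<Rightarrow> ('a \<Rightarrow> real) \<Rightarrow> ('a \<Rightarrow> real) \<Rightarrow> real" where
  "Em D r m u v =
     (\<Sum>w\<in>words m. inverse (prod_list (map r w)) * E0 D (u \<circ> psi_word w) (v \<circ> psi_word w))"

end

locale pcf_self_similar_structure = self_similar_structure +
  assumes post_critically_finite: "finite post_critical_set"

locale regular_harmonic_structure = pcf_self_similar_structure K S \<psi> \<pi>
  for K :: "'a::metric_space set" and S :: "'s set" and \<psi> \<pi> +
  fixes D :: "'a \<Rightarrow> 'a \<Rightarrow> real"
    and r :: "'s \<Rightarrow> real"
  assumes D_symmetric: "\<And>q q'. q \<in> V0 \<Longrightarrow> q' \<in> V0 \<Longrightarrow> D q q' = D q' q"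
    and D_nonpositive: "\<And>u. (\<Sum>q\<in>V0. Dop D u q * u q) \<le> 0"
    and D_kernel: "\<And>u. (\<forall>q\<in>V0. Dop D u q = 0) \<longleftrightarrow> u constant_on V0"
    and D_off_diagonal: "\<And>q q'. q \<in> V0 \<Longrightarrow> q' \<in> V0 \<Longrightarrow> q \<noteq> q' \<Longrightarrow> 0 \<le> D q q'"
    and r_pos: "\<And>i. i \<in> S \<Longrightarrow> 0 < r i"
    and r_less_1: "\<And>i. i \<in> S \<Longrightarrow> r i < 1"
    and E0_eq_Inf_E1:
      "\<And>v. E0 D v v = (INF u\<in>{u. \<forall>q\<in>V0. u q = v q}. Em D r 1 u u)"
begin

text \<open>
  The sequence \<open>\<E>\<^sup>(\<^sup>m\<^sup>)(u, u)\<close> is nondecreasing, so that its limit is finite iff it converges in the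
  reals.
\<close>

definition form_domain :: "('a \<Rightarrow> real) set" where
  "form_domain = {u. continuous_on K u \<and> convergent (\<lambda>m. Em D r m u u)}"

definition energy :: "('a \<Rightarrow> real) \<Rightarrow> ('a \<Rightarrow> real) \<Rightarrow> real" where
  "energy u v = lim (\<lambda>m. Em D r m u v)"

definition energy_measure :: "('a \<Rightarrow> real) \<Rightarrow> 'a measure" where
  "energy_measure f = (THE M. sets M = sets (restrict_space borel K) \<and> finite_measure M \<and>
     (\<forall>\<phi>\<in>form_domain. integral\<^sup>L M \<phi> = 2 * energy f (\<lambda>x. f x * \<phi> x) - energy (\<lambda>x. (f x)\<^sup>2) \<phi>))"

definition harmonic_extension :: "('a \<Rightarrow> real) \<Rightarrow> ('a \<Rightarrow> real) \<Rightarrow> bool" where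
  "harmonic_extension u h \<longleftrightarrow> h \<in> form_domain \<and> (\<forall>q\<in>V0. h q = u q) \<and>
     energy h h = (INF g\<in>{g \<in> form_domain. \<forall>q\<in>V0. g q = u q}. energy g g)"

definition harmonic :: "('a \<Rightarrow> real) \<Rightarrow> bool" where
  "harmonic h \<longleftrightarrow> (\<exists>u. harmonic_extension u h)"

text \<open>A harmonic extension is unique on \<open>K\<close>; its values outside \<open>K\<close> are irrelevant.\<close>

definition iota :: "('a \<Rightarrow> real) \<Rightarrow> 'a \<Rightarrow> real" where
  "iota u = (SOME h. harmonic_extension u h)"

text \<open>\<open>A\<^sub>i = \<iota>\<^sup>-\<^sup>1 \<circ> \<psi>\<^sub>i\<^sup>* \<circ> \<iota>\<close>, where \<open>\<iota>\<^sup>-\<^sup>1\<close> is the restriction of harmonic functions to \<open>V0\<close>.\<close>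

definition A :: "'s \<Rightarrow> ('a \<Rightarrow> real) \<Rightarrow> 'a \<Rightarrow> real" where
  "A i u = restrict (iota u \<circ> \<psi> i) V0"

definition nonneg_eigenvector :: "'s \<Rightarrow> ('a \<Rightarrow> real) \<Rightarrow> bool" where
  "nonneg_eigenvector i v \<longleftrightarrow> v \<in> extensional V0 \<and> (\<exists>q\<in>V0. v q \<noteq> 0) \<and>
     (\<forall>q\<in>V0. A i v q = r i * v q) \<and> (\<forall>q\<in>V0. 0 \<le> v q)"

definition intrinsic_dist :: "('a \<Rightarrow> real ^ 'n) \<Rightarrow> 'a \<Rightarrow> 'a \<Rightarrow> ereal" where
  "intrinsic_dist h x y =
     (SUP f\<in>{f \<in> form_domain. \<forall>B\<in>sets (restrict_space borel K).
          emeasure (energy_measure f) B \<le> (\<Sum>j\<in>UNIV. emeasure (energy_measure (\<lambda>z. h z $ j)) B)}.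
        ereal (f y - f x))"

end

definition curve_length :: "('a \<Rightarrow> real ^ 'n) \<Rightarrow> real \<Rightarrow> real \<Rightarrow> (real \<Rightarrow> 'a) \<Rightarrow> ereal" where
  "curve_length h a b \<gamma> =
     (SUP (n, t)\<in>{(n, t). 1 \<le> n \<and> t 0 = a \<and> t n = b \<and> (\<forall>i<n. t i < t (Suc i))}.
        ereal (\<Sum>i = 1..n. norm (h (\<gamma> (t i)) - h (\<gamma> (t (i - 1))))))"

definition geodesic_dist ::
  "'a::topological_space set \<Rightarrow> ('a \<Rightarrow> real ^ 'n) \<Rightarrow> 'a \<Rightarrow> 'a \<Rightarrow> ereal" where
  "geodesic_dist K h x y =
     (INF \<gamma>\<in>{\<gamma>. path \<gamma> \<and> path_image \<gamma> \<subseteq> K \<and> pathstart \<gamma> = x \<and> pathfinish \<gamma> = y}.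
        curve_length h 0 1 \<gamma>)"

end

theory Submission
  imports Defs
begin

text \<open>
  Testing with cutoffs and using that energy measures do not charge vertices, \<open>\<mu>\<^sub>f \<le> \<mu>\<^sub>h\<close> is equivalent to
  the cellwise inequality \<open>cell_energy w f \<le> (\<Sum>j. cell_energy w (h\<^sub>j))\<close> for all words \<open>w\<close>.

  For \<open>d \<le> \<rho>\<close>: blowing up at a vertex \<open>p\<close> where the normal derivative of \<open>h\<close> is not small, \<open>h\<close> becomes
  a vector multiple of the eigenfunction \<open>v\<^sub>i\<close>, and since \<open>Dv\<^sub>i < 0\<close> away from \<open>p\<close>, comparison with \<open>v\<^sub>i\<close>
  bounds the increments of a dominated \<open>f\<close> there by \<open>1 + \<epsilon>\<close> times those of \<open>h\<close>. With three boundary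
  vertices, the normal derivatives at any two of them control the energy of \<open>h\<close>, so every passage of a
  curve between vertices has such a good end, which makes up a fixed proportion of its length. Hence a
  Lipschitz bound \<open>|f(\<gamma> b) - f(\<gamma> a)| \<le> Q \<ell>(\<gamma>)\<close> improves itself until \<open>Q = 1\<close>.

  For \<open>\<rho> \<le> d\<close>: the shortest chains through cells of level \<open>m\<close> define distances \<open>\<rho>\<^sub>m\<close>, increasing in \<open>m\<close>.
  A McShane extension on each level turns \<open>\<rho>\<^sub>m\<close> into functions with cellwise dominated energy, whose
  limit shows \<open>lim \<rho>\<^sub>m \<le> d\<close>. As there are finitely many simple chains, a minimal chain for the limit
  exists in every cell, and refining it recursively gives a curve of length at most \<open>lim \<rho>\<^sub>m\<close>.
\<close>

section \<open>Words and cells\<close>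

context self_similar_structure
begin

text \<open>Domination of energy measures bounds energies, not slopes, so no pointwise Lipschitz
  estimate of \<open>f\<close> against \<open>h\<close> is at hand. What makes up for it is
  invariance: on a cell, zoomed to \<open>K\<close>, a harmonic \<open>h\<close> stays harmonic, a
  dominated \<open>f\<close> stays dominated, and increments and lengths carry no scaling factor. An
  estimate that is uniform in \<open>h\<close> and \<open>f\<close> for curves between points of
  \<open>V0\<close> thus holds in every cell with the same constant.

  Uniformity is why the normal derivative is measured against the total energy. Where it is
  relatively small, the remainder of the blow-up need not be negligible against the multiple of
  \<open>v i\<close>; since the normal derivatives over \<open>V0\<close> sum to zero, at most one
  vertex can be of this kind. The remainder itself decays by a Perron-Frobenius argument:
  \<open>B i\<close> contracts functions with zero value and zero normal derivative at the vertex by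
  a factor strictly below \<open>r i\<close>, provided that \<open>D\<close> is strictly positive
  off the diagonal, and this positivity comes from connectedness of \<open>K\<close> without a
  vertex.\<close>

lemma psi_word_Nil [simp]: "psi_word [] = id"
  by (simp add: psi_word_def)

lemma psi_word_Cons: "psi_word (i # w) = \<psi> i \<circ> psi_word w"
  by (simp add: psi_word_def)

lemma psi_word_append: "psi_word (u @ w) = psi_word u \<circ> psi_word w"
  by (induction u) (auto simp: psi_word_Cons o_assoc)

lemma psi_word_snoc: "psi_word (w @ [i]) = psi_word w \<circ> \<psi> i"
  by (simp add: psi_word_append psi_word_Cons)

lemma words_0 [simp]: "words 0 = {[]}"
  by (auto simp: words_def)

lemma words_Suc: "words (Suc n) = (\<lambda>(i, w). i # w) ` (S \<times> words n)"
  by (auto simp: words_def image_iff length_Suc_conv)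

lemma words_1: "words (Suc 0) = (\<lambda>i. [i]) ` S"
  by (auto simp: words_Suc image_iff)

lemma finite_words [simp]: "finite (words n)"
  unfolding words_def using finite_lists_length_eq[OF finite_S] by simp

lemma words_Cons_iff: "i # w \<in> words (Suc n) \<longleftrightarrow> i \<in> S \<and> w \<in> words n"
  by (auto simp: words_def)

lemma words_append: "u \<in> words m \<Longrightarrow> w \<in> words n \<Longrightarrow> u @ w \<in> words (m + n)"
  by (auto simp: words_def)

lemma words_add: "words (m + n) = (\<lambda>(u, w). u @ w) ` (words m \<times> words n)"
proof -
  have "w \<in> (\<lambda>(u, w). u @ w) ` (words m \<times> words n)" if "w \<in> words (m + n)" for w
    by (rule image_eqI[where x = "(take m w, drop m w)"])
      (use that in \<open>auto simp: words_def dest: in_set_takeD in_set_dropD\<close>)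
  then show ?thesis
    by (auto simp: words_append)
qed

lemma words_imp: "w \<in> words n \<Longrightarrow> set w \<subseteq> S"
  by (auto simp: words_def)

lemma S_nonempty: "S \<noteq> {}"
  using card_S by auto

lemma psi_in_K: "i \<in> S \<Longrightarrow> x \<in> K \<Longrightarrow> \<psi> i x \<in> K"
  using psi_into by auto

lemma psi_word_in_K: "set w \<subseteq> S \<Longrightarrow> x \<in> K \<Longrightarrow> psi_word w x \<in> K"
  by (induction w) (auto simp: psi_word_Cons psi_in_K)

lemma psi_word_image: "set w \<subseteq> S \<Longrightarrow> psi_word w ` K \<subseteq> K"
  using psi_word_in_K by auto

lemma psi_word_continuous: "set w \<subseteq> S \<Longrightarrow> continuous_on K (psi_word w)"
proof (induction w)
  case (Cons i w)
  then show ?case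
    unfolding psi_word_Cons
    by (intro continuous_on_compose continuous_on_subset[OF psi_continuous]) (auto simp: psi_word_in_K)
qed simp

lemma psi_word_inj: "set w \<subseteq> S \<Longrightarrow> inj_on (psi_word w) K"
proof (induction w)
  case (Cons i w)
  then show ?case
    unfolding psi_word_Cons
    by (intro comp_inj_on) (auto intro: inj_on_subset[OF psi_inj] simp: psi_word_in_K)
qed simp

lemma psi_word_eq_iff: "set w \<subseteq> S \<Longrightarrow> x \<in> K \<Longrightarrow> y \<in> K \<Longrightarrow> psi_word w x = psi_word w y \<longleftrightarrow> x = y"
  using psi_word_inj by (auto dest: inj_onD)

lemma psi_eq_iff: "i \<in> S \<Longrightarrow> x \<in> K \<Longrightarrow> y \<in> K \<Longrightarrow> \<psi> i x = \<psi> i y \<longleftrightarrow> x = y"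
  using psi_inj by (auto dest: inj_onD)

lemma pi_in_K: "\<omega> \<in> UNIV \<rightarrow> S \<Longrightarrow> \<pi> \<omega> \<in> K"
  using pi_surj by blast

lemma pi_obtain:
  assumes "x \<in> K" obtains \<omega> where "\<omega> \<in> UNIV \<rightarrow> S" "x = \<pi> \<omega>"
  using assms pi_surj by blast

lemma seq_decomp: "(case_nat (\<omega> 0) (\<lambda>n. \<omega> (n + 1))) = (\<omega> :: nat \<Rightarrow> 's)"
  by (auto split: nat.split)

lemma pi_decomp:
  assumes "\<omega> \<in> UNIV \<rightarrow> S"
  shows "\<pi> \<omega> = \<psi> (\<omega> 0) (\<pi> (\<lambda>n. \<omega> (n + 1)))"
proof -
  have "\<omega> 0 \<in> S" "(\<lambda>n. \<omega> (n + 1)) \<in> UNIV \<rightarrow> S"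
    using assms by auto
  from pi_conj[OF this] show ?thesis
    by (simp only: seq_decomp)
qed

definition prefix :: "(nat \<Rightarrow> 's) \<Rightarrow> nat \<Rightarrow> 's list" where
  "prefix \<omega> n = map \<omega> [0..<n]"

lemma prefix_0 [simp]: "prefix \<omega> 0 = []"
  by (simp add: prefix_def)

lemma prefix_Suc: "prefix \<omega> (Suc n) = prefix \<omega> n @ [\<omega> n]"
  by (simp add: prefix_def)

lemma prefix_words: "\<omega> \<in> UNIV \<rightarrow> S \<Longrightarrow> prefix \<omega> n \<in> words n"
  by (auto simp: prefix_def words_def)

lemma pi_prefix:
  assumes "\<omega> \<in> UNIV \<rightarrow> S"
  shows "\<pi> \<omega> = psi_word (prefix \<omega> n) (\<pi> (\<lambda>k. \<omega> (k + n)))"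
  using assms
proof (induction n)
  case (Suc n)
  have "\<pi> (\<lambda>k. \<omega> (k + n)) = \<psi> (\<omega> n) (\<pi> (\<lambda>k. \<omega> (k + Suc n)))"
    using pi_decomp[of "\<lambda>k. \<omega> (k + n)"] Suc.prems by auto
  then show ?case
    using Suc by (simp add: prefix_Suc psi_word_snoc)
qed simp

lemma ex_cell:
  assumes "x \<in> K" obtains w y where "w \<in> words n" "y \<in> K" "x = psi_word w y"
proof -
  obtain \<omega> where "\<omega> \<in> UNIV \<rightarrow> S" "x = \<pi> \<omega>"
    using assms by (rule pi_obtain)
  then show ?thesis
    using that[of "prefix \<omega> n" "\<pi> (\<lambda>k. \<omega> (k + n))"] pi_prefix[of \<omega> n] prefix_words
    by (auto intro!: pi_in_K)
qed

lemma ex_cell1: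
  assumes "x \<in> K" obtains i y where "i \<in> S" "y \<in> K" "x = \<psi> i y"
proof -
  obtain w y where "w \<in> words (Suc 0)" "y \<in> K" "x = psi_word w y"
    using assms by (rule ex_cell)
  then show ?thesis
    using that by (auto simp: words_1 psi_word_Cons)
qed

lemma cells_cover: "K = (\<Union>w\<in>words n. psi_word w ` K)"
proof -
  have "x \<in> (\<Union>w\<in>words n. psi_word w ` K)" if "x \<in> K" for x
    using ex_cell[OF that, of n] by (metis UN_I imageI)
  then show ?thesis
    using psi_word_in_K words_imp by fastforce
qed

lemma K_nonempty: "K \<noteq> {}"
  using pi_surj S_nonempty by fastforce

lemma compact_cell: "set w \<subseteq> S \<Longrightarrow> compact (psi_word w ` K)"
  by (intro compact_continuous_image psi_word_continuous compact_K)

lemma closed_K: "closed K"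
  using compact_K by (rule compact_imp_closed)

lemma closed_cell: "set w \<subseteq> S \<Longrightarrow> closed (psi_word w ` K)"
  by (intro compact_imp_closed compact_cell)

text \<open>A basic open set of the product topology restricts finitely many coordinates only;
  \<open>n\<close> exceeds all of them.\<close>

lemma pi_cylinder_continuous:
  assumes \<omega>: "\<omega> \<in> UNIV \<rightarrow> S" and "\<epsilon> > 0"
  obtains n where "\<And>\<omega>'. \<omega>' \<in> UNIV \<rightarrow> S \<Longrightarrow> prefix \<omega>' n = prefix \<omega> n \<Longrightarrow> dist (\<pi> \<omega>') (\<pi> \<omega>) < \<epsilon>"
proof -
  let ?T = "product_topology (\<lambda>_::nat. discrete_topology S) UNIV"
  have top: "topspace ?T = UNIV \<rightarrow> S"
    by (simp add: PiE_UNIV_domain)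
  have "openin (top_of_set K) (K \<inter> ball (\<pi> \<omega>) \<epsilon>)"
    by (auto intro: openin_open_Int)
  then have "openin ?T {x \<in> topspace ?T. \<pi> x \<in> K \<inter> ball (\<pi> \<omega>) \<epsilon>}"
    using pi_continuous openin_continuous_map_preimage by blast
  moreover have "\<omega> \<in> {x \<in> topspace ?T. \<pi> x \<in> K \<inter> ball (\<pi> \<omega>) \<epsilon>}"
    using \<omega> \<open>\<epsilon> > 0\<close> by (auto simp: top pi_in_K)
  ultimately obtain U where U: "finite {i. U i \<noteq> S}" "\<And>i. U i \<subseteq> S" "\<omega> \<in> Pi\<^sub>E UNIV U"
    "Pi\<^sub>E UNIV U \<subseteq> {x \<in> topspace ?T. \<pi> x \<in> K \<inter> ball (\<pi> \<omega>) \<epsilon>}"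
    unfolding openin_product_topology_alt by (force simp: Ball_def)
  obtain n where n: "\<And>i. U i \<noteq> S \<Longrightarrow> i < n"
    using U(1) finite_nat_set_iff_bounded by auto
  show ?thesis
  proof
    fix \<omega>' assume a: "\<omega>' \<in> UNIV \<rightarrow> S" "prefix \<omega>' n = prefix \<omega> n"
    have "\<omega>' i \<in> U i" for i
    proof (cases "i < n")
      case True
      then have "\<omega>' i = \<omega> i"
        using a(2) by (auto simp: prefix_def)
      then show ?thesis
        using U(3) by auto
    next
      case False
      then have "U i = S" using n by blast
      then show ?thesis using a(1) by auto
    qed
    then show "dist (\<pi> \<omega>') (\<pi> \<omega>) < \<epsilon>"
      using subsetD[OF U(4), of \<omega>'] by (auto simp: dist_commute PiE_UNIV_domain)
  qed
qed

text \<open>A compactness argument in the tree of finite words: if cells of diameter at least \<open>\<epsilon>\<close> existed at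
  all levels, an infinite branch of such cells would contradict the continuity of \<open>\<pi>\<close>.\<close>

lemma cells_small:
  assumes "\<epsilon> > 0"
  shows "\<exists>n. \<forall>w\<in>words n. \<forall>x\<in>K. \<forall>y\<in>K. dist (psi_word w x) (psi_word w y) < \<epsilon>"
proof (rule ccontr)
  define bad where "bad w \<longleftrightarrow> (\<exists>x\<in>K. \<exists>y\<in>K. dist (psi_word w x) (psi_word w y) \<ge> \<epsilon>)" for w
  assume "\<not> ?thesis"
  then have ex_bad: "\<exists>w\<in>words n. bad w" for n
    unfolding bad_def by (meson not_less)
  have bad_append: "bad u" if "bad (u @ w)" "set w \<subseteq> S" for u w
    using that psi_word_in_K[OF that(2)] unfolding bad_def psi_word_append by fastforce
  \<comment> \<open>\<open>inf u\<close> says that bad cells occur below \<open>u\<close> at every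
    depth. As subcells of a good cell are good and \<open>S\<close> is finite, some child of
    \<open>u\<close> inherits this, as in Koenig's lemma.\<close>
  define inf where "inf u \<longleftrightarrow> set u \<subseteq> S \<and> (\<forall>n. \<exists>w\<in>words n. bad (u @ w))" for u
  have step: "\<exists>i\<in>S. inf (u @ [i])" if u: "inf u" for u
  proof (rule ccontr)
    assume "\<not> ?thesis"
    then have "\<forall>i\<in>S. \<exists>n. \<forall>w\<in>words n. \<not> bad (u @ [i] @ w)"
      using that by (auto simp: inf_def)
    then obtain N where N: "\<And>i w. i \<in> S \<Longrightarrow> w \<in> words (N i) \<Longrightarrow> \<not> bad (u @ [i] @ w)"
      by metis
    define M where "M = Max (N ` S)"
    have M: "N i \<le> M" if "i \<in> S" for i
      using that finite_S by (auto simp: M_def)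
    obtain w where w: "w \<in> words (Suc M)" "bad (u @ w)"
      using u unfolding inf_def by blast
    then obtain i w' where iw: "i \<in> S" "w' \<in> words M" "w = i # w'"
      by (auto simp: words_Suc)
    have "words M = (\<lambda>(u, w). u @ w) ` (words (N i) \<times> words (M - N i))"
      using words_add[of "N i" "M - N i"] M[OF iw(1)] by simp
    with iw(2) obtain w1 w2 where "w' = w1 @ w2" "w1 \<in> words (N i)" "set w2 \<subseteq> S"
      by (auto simp: words_imp)
    then have "bad ((u @ [i] @ w1) @ w2)"
      using w(2) iw(3) by simp
    then have "bad (u @ [i] @ w1)"
      using \<open>set w2 \<subseteq> S\<close> by (rule bad_append)
    with N[OF iw(1)] \<open>w1 \<in> words (N i)\<close> show False by blast
  qed
  have "\<exists>f. f 0 = [] \<and> (\<forall>n. inf (f n) \<and> (\<exists>i\<in>S. f (Suc n) = f n @ [i]))"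
  proof -
    have "inf []"
      using ex_bad by (simp add: inf_def)
    then have "\<exists>f. \<forall>n. (inf (f n) \<and> (n = 0 \<longrightarrow> f n = [])) \<and> (\<exists>i\<in>S. f (Suc n) = f n @ [i])"
      using step dependent_nat_choice[of "\<lambda>n x. inf x \<and> (n = 0 \<longrightarrow> x = [])" "\<lambda>n x y. \<exists>i\<in>S. y = x @ [i]"]
      by blast
    then show ?thesis by blast
  qed
  then obtain f where f: "f 0 = []" "\<And>n. inf (f n)" "\<And>n. \<exists>i\<in>S. f (Suc n) = f n @ [i]"
    by blast
  define \<omega> where "\<omega> n = last (f (Suc n))" for n
  have fS: "f (Suc n) = f n @ [\<omega> n]" "\<omega> n \<in> S" for n
    using f(3)[of n] by (auto simp: \<omega>_def)
  have pre: "prefix \<omega> n = f n" for n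
    by (induction n) (auto simp: f(1) fS prefix_Suc)
  have \<omega>: "\<omega> \<in> UNIV \<rightarrow> S"
    using fS by auto
  obtain n where n: "\<And>\<omega>'. \<omega>' \<in> UNIV \<rightarrow> S \<Longrightarrow> prefix \<omega>' n = prefix \<omega> n \<Longrightarrow> dist (\<pi> \<omega>') (\<pi> \<omega>) < \<epsilon> / 2"
    using pi_cylinder_continuous[OF \<omega>, of "\<epsilon> / 2"] assms by auto
  have close: "dist (psi_word (f n) x) (\<pi> \<omega>) < \<epsilon> / 2" if x: "x \<in> K" for x
  proof -
    obtain \<eta> where \<eta>: "\<eta> \<in> UNIV \<rightarrow> S" "x = \<pi> \<eta>"
      using x by (rule pi_obtain)
    define \<omega>' where "\<omega>' k = (if k < n then \<omega> k else \<eta> (k - n))" for k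
    have "\<omega>' \<in> UNIV \<rightarrow> S"
      using \<omega> \<eta> by (auto simp: \<omega>'_def Pi_iff)
    moreover have "prefix \<omega>' n = f n"
      by (subst pre[symmetric]) (auto simp: prefix_def \<omega>'_def)
    moreover have "(\<lambda>k. \<omega>' (k + n)) = \<eta>"
      by (auto simp: \<omega>'_def)
    ultimately show ?thesis
      using pi_prefix[of \<omega>' n] n[of \<omega>'] \<eta> by (simp add: pre)
  qed
  have "\<not> bad (f n)"
  proof
    assume "bad (f n)"
    then obtain x y where "x \<in> K" "y \<in> K" "dist (psi_word (f n) x) (psi_word (f n) y) \<ge> \<epsilon>"
      by (auto simp: bad_def)
    with close[of x] close[of y] dist_triangle2[of "psi_word (f n) x" "psi_word (f n) y" "\<pi> \<omega>"]
    show False by linarith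
  qed
  moreover have "bad (f n)"
    using f(2)[of n] by (auto simp: inf_def dest!: spec[of _ 0])
  ultimately show False by blast
qed

lemma uniform_on_cells:
  fixes f :: "'a \<Rightarrow> 'b::metric_space"
  assumes "continuous_on K f" "\<epsilon> > 0"
  shows "\<exists>n. \<forall>w\<in>words n. \<forall>x\<in>K. \<forall>y\<in>K. dist (f (psi_word w x)) (f (psi_word w y)) < \<epsilon>"
proof -
  have "uniformly_continuous_on K f"
    using assms compact_K compact_uniformly_continuous by blast
  then obtain d where d: "d > 0" "\<And>x y. x \<in> K \<Longrightarrow> y \<in> K \<Longrightarrow> dist y x < d \<Longrightarrow> dist (f y) (f x) < \<epsilon>"
    using assms(2) unfolding uniformly_continuous_on_def by metis
  show ?thesis
    using cells_small[OF d(1)] by (meson d(2) psi_word_in_K words_imp)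
qed

lemma uniform_on_cells_ge:
  fixes f :: "'a \<Rightarrow> 'b::metric_space"
  assumes "continuous_on K f" "\<epsilon> > 0"
  shows "\<exists>n0. \<forall>n\<ge>n0. \<forall>w\<in>words n. \<forall>x\<in>K. \<forall>y\<in>K. dist (f (psi_word w x)) (f (psi_word w y)) < \<epsilon>"
proof -
  obtain n0 where n0: "\<And>w x y. w \<in> words n0 \<Longrightarrow> x \<in> K \<Longrightarrow> y \<in> K \<Longrightarrow> dist (f (psi_word w x)) (f (psi_word w y)) < \<epsilon>"
    using uniform_on_cells[OF assms] by blast
  show ?thesis
  proof (intro exI allI impI ballI)
    fix n w x y assume a: "n \<ge> n0" "w \<in> words n" "x \<in> K" "y \<in> K"
    then have "w \<in> (\<lambda>(u, w). u @ w) ` (words n0 \<times> words (n - n0))"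
      using words_add[of n0 "n - n0"] by simp
    then obtain u u' where "w = u @ u'" "u \<in> words n0" "u' \<in> words (n - n0)"
      by auto
    then show "dist (f (psi_word w x)) (f (psi_word w y)) < \<epsilon>"
      using n0[of u "psi_word u' x" "psi_word u' y"] a by (auto simp: psi_word_append psi_word_in_K words_imp)
  qed
qed

section \<open>Fixed points and post-critical points\<close>

lemma const_seq: "i \<in> S \<Longrightarrow> (\<lambda>_. i) \<in> UNIV \<rightarrow> S"
  by auto

lemma prefix_const [simp]: "prefix (\<lambda>_. i) n = replicate n i"
  by (simp add: prefix_def map_replicate_const)

text \<open>Every fixed point of \<open>\<psi> i\<close> lies in the cells of all words
  \<open>replicate n i\<close>, and these become arbitrarily small.\<close>

lemma fixpt_unique:
  assumes "i \<in> S" "x \<in> K" "\<psi> i x = x"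
  shows "x = \<pi> (\<lambda>_. i)"
proof (rule ccontr)
  assume ne: "x \<noteq> \<pi> (\<lambda>_. i)"
  then have "0 < dist x (\<pi> (\<lambda>_. i))"
    by simp
  from cells_small[OF this] obtain n where n: "\<forall>w\<in>words n. \<forall>y\<in>K. \<forall>z\<in>K.
      dist (psi_word w y) (psi_word w z) < dist x (\<pi> (\<lambda>_. i))"
    by blast
  have 1: "psi_word (replicate n i) y = y" if "\<psi> i y = y" for y
    using that by (induction n) (auto simp: psi_word_Cons)
  have "\<psi> i (\<pi> (\<lambda>_. i)) = \<pi> (\<lambda>_. i)"
    using pi_decomp[of "\<lambda>_. i"] assms(1) by auto
  then have "psi_word (replicate n i) x = x" "psi_word (replicate n i) (\<pi> (\<lambda>_. i)) = \<pi> (\<lambda>_. i)"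
    using 1 assms by auto
  moreover have "replicate n i \<in> words n" "\<pi> (\<lambda>_. i) \<in> K"
    using assms by (auto simp: words_def intro!: pi_in_K)
  ultimately show False
    using n assms by fastforce
qed

lemma fixpt_eq: "i \<in> S \<Longrightarrow> fixpt i = \<pi> (\<lambda>_. i)"
  unfolding fixpt_def
  using fixpt_unique pi_decomp[of "\<lambda>_. i"] by (intro the_equality) (auto intro!: pi_in_K)

lemma fixpt_in_K: "i \<in> S \<Longrightarrow> fixpt i \<in> K"
  by (simp add: fixpt_eq pi_in_K const_seq)

lemma psi_fixpt: "i \<in> S \<Longrightarrow> \<psi> i (fixpt i) = fixpt i"
  using pi_decomp[of "\<lambda>_. i"] by (simp add: fixpt_eq)

lemma psi_replicate_fixpt: "i \<in> S \<Longrightarrow> psi_word (replicate n i) (fixpt i) = fixpt i"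
  by (induction n) (auto simp: psi_word_Cons psi_fixpt)

lemma V0_subset: "V0 \<subseteq> K"
proof -
  have "(\<lambda>n. \<omega> (n + m)) \<in> UNIV \<rightarrow> S" if "\<omega> \<in> critical_set" for \<omega> m
    using that by (auto simp: critical_set_def)
  then show ?thesis
    unfolding V0_def post_critical_set_def by (auto intro!: pi_in_K)
qed

lemma critical_setI:
  assumes "i \<in> S" "j \<in> S" "i \<noteq> j" "x \<in> K" "y \<in> K" "\<psi> i x = \<psi> j y" "\<omega> \<in> UNIV \<rightarrow> S" "\<pi> \<omega> = \<psi> i x"
  shows "\<omega> \<in> critical_set"
  unfolding critical_set_def using assms by fastforce

lemma critical_shift: "\<omega> \<in> critical_set \<Longrightarrow> (\<lambda>n. \<omega> (Suc n)) \<in> post_critical_set"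
  unfolding post_critical_set_def by (auto intro!: bexI[of _ "Suc 0"])

text \<open>An address of \<open>x\<close> prefixed by \<open>i\<close> is a critical word, so the
  address itself, being its shift, is post-critical.\<close>

lemma cell_meet:
  assumes "i \<in> S" "j \<in> S" "i \<noteq> j" "x \<in> K" "y \<in> K" "\<psi> i x = \<psi> j y"
  shows "x \<in> V0"
proof -
  obtain \<omega> where \<omega>: "\<omega> \<in> UNIV \<rightarrow> S" "x = \<pi> \<omega>"
    using assms(4) by (rule pi_obtain)
  then have "\<pi> (case_nat i \<omega>) = \<psi> i x"
    using pi_conj assms by auto
  then have "case_nat i \<omega> \<in> critical_set"
    using assms \<omega> by (intro critical_setI[of i j x y]) (auto split: nat.split simp: Pi_iff)
  from critical_shift[OF this] show ?thesis
    using \<omega> by (auto simp: V0_def)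
qed

end

context pcf_self_similar_structure
begin

lemma finite_V0 [simp]: "finite V0"
  using post_critically_finite by (simp add: V0_def)

text \<open>Otherwise the fixed point lies in a second cell, and pulling the corresponding word back along
  \<open>\<psi>\<^sub>i\<close> produces infinitely many post-critical words.\<close>

lemma pi_eq_fixpt:
  assumes i: "i \<in> S" and \<omega>: "\<omega> \<in> UNIV \<rightarrow> S" and eq: "\<pi> \<omega> = fixpt i"
  shows "\<omega> = (\<lambda>_. i)"
proof (rule ccontr)
  assume "\<omega> \<noteq> (\<lambda>_. i)"
  then obtain k0 where "\<omega> k0 \<noteq> i" by auto
  define k where "k = (LEAST k. \<omega> k \<noteq> i)"
  have k: "\<omega> k \<noteq> i"
    unfolding k_def using \<open>\<omega> k0 \<noteq> i\<close> by (rule LeastI)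
  have "\<omega> n = i" if "n < k" for n
    using that not_less_Least k_def by blast
  then have "prefix \<omega> k = replicate k i"
    by (auto simp: prefix_def intro!: nth_equalityI)
  define \<eta> where "\<eta> = (\<lambda>n. \<omega> (n + k))"
  have \<eta>: "\<eta> \<in> UNIV \<rightarrow> S" "\<eta> 0 \<noteq> i"
    using \<omega> k by (auto simp: \<eta>_def)
  have "psi_word (replicate k i) (\<pi> \<eta>) = psi_word (replicate k i) (fixpt i)"
    using pi_prefix[OF \<omega>, of k] eq \<open>prefix \<omega> k = _\<close> psi_replicate_fixpt[OF i] by (simp add: \<eta>_def)
  then have p\<eta>: "\<pi> \<eta> = fixpt i"
    using i \<eta> psi_word_eq_iff[of "replicate k i"] fixpt_in_K
    by (metis pi_in_K set_replicate_conv_if empty_subsetI insert_subset)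
  \<comment> \<open>\<open>sh n\<close> is \<open>n\<close> letters \<open>i\<close> followed by
    \<open>\<eta>\<close>, again an address of the fixed point. Since the point has
    \<open>\<eta>\<close> as an address with another first letter, each \<open>sh (Suc n)\<close> is
    critical, and its shift is \<open>sh n\<close>. The position of the first letter different from
    \<open>i\<close> tells these words apart.\<close>
  define sh where "sh n m = (if m < n then i else \<eta> (m - n))" for n m
  have sh: "sh n \<in> UNIV \<rightarrow> S" for n
    using i \<eta> by (auto simp: sh_def)
  have psh: "\<pi> (sh n) = fixpt i" for n
  proof -
    have "prefix (sh n) n = replicate n i"
      by (auto simp: prefix_def sh_def intro!: nth_equalityI)
    moreover have "(\<lambda>k. sh n (k + n)) = \<eta>"
      by (auto simp: sh_def)
    ultimately show ?thesis
      using pi_prefix[OF sh, of n n] p\<eta> psi_replicate_fixpt[OF i] by simp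
  qed
  have "sh n \<in> critical_set" for n
  proof (rule critical_setI[of i "\<eta> 0"])
    show "\<psi> i (fixpt i) = \<psi> (\<eta> 0) (\<pi> (\<lambda>n. \<eta> (n + 1)))"
      using pi_decomp[OF \<eta>(1)] p\<eta> psi_fixpt[OF i] by simp
  qed (use \<eta> i sh psh fixpt_in_K psi_fixpt in \<open>auto intro!: pi_in_K\<close>)
  from critical_shift[OF this] have "(\<lambda>m. sh (Suc n) (Suc m)) \<in> post_critical_set" for n .
  moreover have "(\<lambda>m. sh (Suc n) (Suc m)) = sh n" for n
    by (auto simp: sh_def)
  ultimately have "range sh \<subseteq> post_critical_set"
    by auto
  moreover have "inj sh"
  proof (rule injI)
    fix a b assume ab: "sh a = sh b"
    have "\<not> a < b" if "sh a = sh b" for a b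
    proof
      assume "a < b"
      then have "sh b a = i" "sh a a \<noteq> i"
        using \<eta> by (auto simp: sh_def)
      then show False using that by auto
    qed
    from this[of a b] this[of b a] ab show "a = b" by auto
  qed
  ultimately show False
    using post_critically_finite finite_subset range_inj_infinite by blast
qed

end

section \<open>Discrete energies\<close>

lemma quadratic_nonneg_discriminant:
  fixes a b c :: real
  assumes "\<And>t. 0 \<le> a + 2 * b * t + c * t\<^sup>2"
  shows "b\<^sup>2 \<le> a * c"
proof (cases "c = 0")
  case True
  have "b = 0"
  proof (rule ccontr)
    assume "b \<noteq> 0"
    then show False
      using assms[of "- (a + 1) / (2 * b)"] True by (simp add: field_simps)
  qed
  then show ?thesis by (simp add: True)
next
  case False
  have "c \<ge> 0"
  proof (rule ccontr)
    assume "\<not> c \<ge> 0"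
    then have c: "c < 0" by simp
    \<comment> \<open>With this choice \<open>- c * t\<^sup>2\<close> exceeds
      \<open>\<bar>a\<bar> + 2 * \<bar>b\<bar> * t\<close>, so the quadratic is negative at
      \<open>t\<close>.\<close>
    define t where "t = (\<bar>a\<bar> + 2 * \<bar>b\<bar> + 1) / (- c) + 1"
    have t: "t \<ge> 1"
      using c by (simp add: t_def field_simps)
    have ct: "- c * t \<ge> \<bar>a\<bar> + 2 * \<bar>b\<bar> + 1"
      using c by (simp add: t_def field_simps)
    have "- c * t\<^sup>2 = (- c * t) * t" by (simp add: power2_eq_square)
    also have "\<dots> \<ge> (\<bar>a\<bar> + 2 * \<bar>b\<bar> + 1) * t"
      using ct t by (intro mult_right_mono) auto
    finally have 1: "(\<bar>a\<bar> + 2 * \<bar>b\<bar> + 1) * t \<le> - c * t\<^sup>2" .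
    have "\<bar>a\<bar> * 1 \<le> \<bar>a\<bar> * t" using t by (intro mult_left_mono) auto
    moreover have "b * t \<le> \<bar>b\<bar> * t" using t by (intro mult_right_mono) auto
    moreover have "(\<bar>a\<bar> + 2 * \<bar>b\<bar> + 1) * t = \<bar>a\<bar> * t + 2 * (\<bar>b\<bar> * t) + t"
      by (simp add: algebra_simps)
    moreover have "0 \<le> a + 2 * (b * t) + c * t\<^sup>2"
      using assms[of t] by (simp add: mult.assoc)
    moreover have "- a \<le> \<bar>a\<bar>" "- c * t\<^sup>2 = - (c * t\<^sup>2)" by auto
    ultimately show False
      using 1 t by linarith
  qed
  then have c: "c > 0" using False by simp
  have "0 \<le> (a + 2 * b * (- b / c) + c * (- b / c)\<^sup>2) * c"
    using assms[of "- b / c"] c by (intro mult_nonneg_nonneg) auto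
  also have "\<dots> = a * c - b\<^sup>2"
    using c by (simp add: field_simps power2_eq_square)
  finally show ?thesis by simp
qed

text \<open>Used as the Euler-Lagrange equation: the linear coefficient of a quadratic perturbation
  vanishes at a minimum.\<close>

lemma linear_nonneg_imp_zero:
  fixes b c :: real
  assumes "\<And>t. 0 \<le> 2 * b * t + c * t\<^sup>2"
  shows "b = 0"
  using quadratic_nonneg_discriminant[of 0 b c] assms by simp

text \<open>Bolzano-Weierstrass on finitely many coordinates, by extracting one subsequence after
  another.\<close>

lemma bounded_seq_finite_set:
  fixes f :: "nat \<Rightarrow> 'b \<Rightarrow> real"
  assumes "finite X" "\<And>k x. x \<in> X \<Longrightarrow> \<bar>f k x\<bar> \<le> M"
  shows "\<exists>s l. strict_mono s \<and> (\<forall>x\<in>X. (\<lambda>k. f (s k) x) \<longlonglongrightarrow> l x)"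
  using assms
proof (induction X rule: finite_induct)
  case empty
  show ?case by (rule exI[of _ id]) (auto simp: strict_mono_def)
next
  case (insert y X)
  then obtain s l where s: "strict_mono s" "\<forall>x\<in>X. (\<lambda>k. f (s k) x) \<longlonglongrightarrow> l x"
    by auto
  have "bounded (range (\<lambda>k. f (s k) y))"
    using insert.prems by (auto simp: bounded_iff)
  then obtain a t where t: "strict_mono t" "((\<lambda>k. f (s k) y) \<circ> t) \<longlonglongrightarrow> a"
    using bounded_imp_convergent_subsequence by blast
  show ?case
  proof (intro exI conjI ballI)
    show "strict_mono (s \<circ> t)"
      using s(1) t(1) by (rule strict_mono_o)
    fix x assume x: "x \<in> insert y X"
    show "(\<lambda>k. f ((s \<circ> t) k) x) \<longlonglongrightarrow> (l(y := a)) x"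
    proof (cases "x = y")
      case True
      then show ?thesis using t by (simp add: o_def)
    next
      case False
      then have "(\<lambda>k. f (s k) x) \<longlonglongrightarrow> l x" using s x by auto
      from LIMSEQ_subseq_LIMSEQ[OF this t(1)] show ?thesis
        using False by (simp add: o_def)
    qed
  qed
qed

section \<open>Connectedness of the first-level cells\<close>

context self_similar_structure
begin

definition link :: "('s \<Rightarrow> 'a set) \<Rightarrow> ('a \<times> 'a) set" where
  "link Q = {(\<psi> i c, \<psi> i d) |i c d. i \<in> S \<and> c \<in> Q i \<and> d \<in> Q i}"

text \<open>Distinct first-level cells meet only in images of points of \<open>V0\<close>. Were
  \<open>A\<close> proper, the unions of the cells inside and outside of \<open>A\<close> would be
  disjoint nonempty closed sets covering \<open>K\<close>.\<close>

lemma cells_connected: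
  assumes "A \<subseteq> S" "A \<noteq> {}"
    and step: "\<And>i j c d. i \<in> A \<Longrightarrow> j \<in> S \<Longrightarrow> c \<in> V0 \<Longrightarrow> d \<in> V0 \<Longrightarrow> \<psi> i c = \<psi> j d \<Longrightarrow> j \<in> A"
  shows "A = S"
proof (rule ccontr)
  assume "A \<noteq> S"
  then obtain j where j: "j \<in> S" "j \<notin> A" using assms by auto
  obtain i where i: "i \<in> A" using assms by auto
  define X where "X = (\<Union>i\<in>A. \<psi> i ` K)"
  define Y where "Y = (\<Union>i\<in>S - A. \<psi> i ` K)"
  have clo: "closed (\<psi> i ` K)" if "i \<in> S" for i
    using closed_cell[of "[i]"] that by (simp add: psi_word_Cons)
  have "closed X" "closed Y"
    unfolding X_def Y_def using assms(1) finite_S finite_subset clo by (auto intro!: closed_UN)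
  moreover have "K \<subseteq> X \<union> Y"
  proof
    fix x assume "x \<in> K"
    then obtain i y where "i \<in> S" "y \<in> K" "x = \<psi> i y" by (rule ex_cell1)
    then show "x \<in> X \<union> Y" by (auto simp: X_def Y_def)
  qed
  moreover have "X \<inter> Y \<inter> K = {}"
  proof -
    have False if a: "i \<in> A" "j \<in> S - A" "x \<in> K" "y \<in> K" "\<psi> i x = \<psi> j y" for i j x y
    proof -
      have "i \<in> S" "j \<in> S" "i \<noteq> j" using a assms(1) by auto
      then have "x \<in> V0" "y \<in> V0"
        using cell_meet[of i j x y] cell_meet[of j i y x] a by auto
      then show False using step[of i j x y] a by auto
    qed
    then show ?thesis unfolding X_def Y_def by blast
  qed
  moreover have "X \<inter> K \<noteq> {} \<and> Y \<inter> K \<noteq> {}"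
  proof -
    obtain x where "x \<in> K" using K_nonempty by auto
    then have "\<psi> i x \<in> X \<inter> K" "\<psi> j x \<in> Y \<inter> K"
      using i j assms(1) psi_in_K by (auto simp: X_def Y_def)
    then show ?thesis by blast
  qed
  ultimately show False
    using connected_closedD[OF connected_K, of X Y] by blast
qed

lemma link_connected:
  assumes Q: "\<And>i. i \<in> S \<Longrightarrow> V0 \<subseteq> Q i" and "i \<in> S" "c \<in> Q i" "j \<in> S" "d \<in> Q j"
  shows "(\<psi> i c, \<psi> j d) \<in> (link Q)\<^sup>*"
proof -
  define A where "A = {j \<in> S. \<forall>d\<in>Q j. (\<psi> i c, \<psi> j d) \<in> (link Q)\<^sup>*}"
  have "A = S"
  proof (rule cells_connected)
    show "A \<subseteq> S" by (auto simp: A_def)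
    have "i \<in> A"
      using assms by (auto simp: A_def link_def intro!: r_into_rtrancl)
    then show "A \<noteq> {}" by auto
    fix i' j c' d' assume a: "i' \<in> A" "j \<in> S" "c' \<in> V0" "d' \<in> V0" "\<psi> i' c' = \<psi> j d'"
    then have "(\<psi> i c, \<psi> j d') \<in> (link Q)\<^sup>*"
      using Q by (force simp: A_def)
    moreover have "(\<psi> j d', \<psi> j d) \<in> link Q" if "d \<in> Q j" for d
      using that a Q by (force simp: link_def)
    ultimately show "j \<in> A"
      using a by (auto simp: A_def intro: rtrancl_into_rtrancl)
  qed
  then show ?thesis using assms by (auto simp: A_def)
qed

text \<open>Without boundary points any single letter would be closed under adjacency and hence be
  all of \<open>S\<close>, against \<open>card_S\<close>.\<close>

lemma V0_nonempty: "V0 \<noteq> {}"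
proof
  assume "V0 = {}"
  obtain i where "i \<in> S" using S_nonempty by auto
  with \<open>V0 = {}\<close> have "{i} = S"
    by (intro cells_connected) auto
  then have "card S = 1" by (metis card_1_singleton_iff One_nat_def)
  then show False using card_S by simp
qed

text \<open>Post-critical words are closed under the shift, so dropping the first letter of an
  address in \<open>post_critical_set\<close> gives a point of \<open>V0\<close> again.\<close>

lemma V0_subset_V1:
  assumes "q \<in> V0" obtains i c where "i \<in> S" "c \<in> V0" "q = \<psi> i c"
proof -
  obtain m \<omega> where m: "m \<ge> 1" "\<omega> \<in> critical_set" "q = \<pi> (\<lambda>n. \<omega> (n + m))"
    using assms by (auto simp: V0_def post_critical_set_def)
  have \<omega>: "\<omega> k \<in> S" for k using m(2) by (auto simp: critical_set_def)
  then have "(\<lambda>n. \<omega> (n + m)) \<in> UNIV \<rightarrow> S" by auto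
  from pi_decomp[OF this] have "q = \<psi> (\<omega> m) (\<pi> (\<lambda>n. \<omega> (n + Suc m)))"
    using m by simp
  moreover have "\<pi> (\<lambda>n. \<omega> (n + Suc m)) \<in> V0"
    using m unfolding V0_def post_critical_set_def
    by (intro imageI UN_I[of "Suc m"]) auto
  ultimately show ?thesis using that \<omega> by blast
qed

end

section \<open>Quadratic forms on the vertices of the cells\<close>

context pcf_self_similar_structure
begin

lemma E0_cong:
  "(\<And>q. q \<in> V0 \<Longrightarrow> u q = u' q) \<Longrightarrow> (\<And>q. q \<in> V0 \<Longrightarrow> v q = v' q) \<Longrightarrow> E0 D u v = E0 D u' v'"
  by (auto simp: E0_def Dop_def intro!: sum.cong)

lemma E0_add_left: "E0 D (\<lambda>x. u x + u' x) v = E0 D u v + E0 D u' v"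
  by (simp add: E0_def Dop_def algebra_simps sum.distrib sum_subtractf sum_negf flip: sum_distrib_left)

lemma E0_add_right: "E0 D u (\<lambda>x. v x + v' x) = E0 D u v + E0 D u v'"
  by (simp add: E0_def algebra_simps sum.distrib sum_subtractf sum_negf)

lemma E0_scale_left: "E0 D (\<lambda>x. c * u x) v = c * E0 D u v"
  by (simp add: E0_def Dop_def sum_distrib_left algebra_simps sum_negf)

lemma E0_scale_right: "E0 D u (\<lambda>x. c * v x) = c * E0 D u v"
  by (simp add: E0_def sum_distrib_left algebra_simps sum_negf)

end

context regular_harmonic_structure
begin

abbreviation rw :: "'s list \<Rightarrow> real" where "rw w \<equiv> prod_list (map r w)"

lemma rw_pos: "set w \<subseteq> S \<Longrightarrow> 0 < rw w"
  by (induction w) (auto simp: r_pos)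

lemma row_sum: "q \<in> V0 \<Longrightarrow> (\<Sum>q'\<in>V0. D q q') = 0"
  using D_kernel[of "\<lambda>_. 1"] by (auto simp: Dop_def constant_on_def)

lemma col_sum: "q \<in> V0 \<Longrightarrow> (\<Sum>q'\<in>V0. D q' q) = 0"
  using row_sum[of q] D_symmetric by (metis (no_types, lifting) sum.cong)

text \<open>Since rows and columns of \<open>D\<close> sum to zero, the form sees increments only:
  it is a resistor network with conductances \<open>D q q'\<close>, and the double sum counts each
  edge twice.\<close>

lemma E0_eq_sum_diff:
  "E0 D u v = (\<Sum>q\<in>V0. \<Sum>q'\<in>V0. D q q' * ((u q - u q') * (v q - v q'))) / 2"
proof -
  have 1: "(\<Sum>q\<in>V0. \<Sum>q'\<in>V0. D q q' * (u q * v q)) = 0"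
    using row_sum by (simp flip: sum_distrib_right)
  have 2: "(\<Sum>q\<in>V0. \<Sum>q'\<in>V0. D q q' * (u q' * v q')) = 0"
    using col_sum by (subst sum.swap) (simp flip: sum_distrib_right)
  have 3: "(\<Sum>q\<in>V0. \<Sum>q'\<in>V0. D q q' * (u q' * v q)) = - E0 D u v"
    by (simp add: E0_def Dop_def sum_distrib_left sum_negf mult_ac)
  have 4: "(\<Sum>q\<in>V0. \<Sum>q'\<in>V0. D q q' * (u q * v q')) = - E0 D u v"
    unfolding 3[symmetric] by (subst sum.swap) (auto intro!: sum.cong simp: D_symmetric)
  have "(\<Sum>q\<in>V0. \<Sum>q'\<in>V0. D q q' * ((u q - u q') * (v q - v q'))) =
    (\<Sum>q\<in>V0. \<Sum>q'\<in>V0. D q q' * (u q * v q)) + (\<Sum>q\<in>V0. \<Sum>q'\<in>V0. D q q' * (u q' * v q'))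
    - (\<Sum>q\<in>V0. \<Sum>q'\<in>V0. D q q' * (u q' * v q)) - (\<Sum>q\<in>V0. \<Sum>q'\<in>V0. D q q' * (u q * v q'))"
    by (simp add: algebra_simps sum.distrib sum_subtractf)
  then show ?thesis unfolding 1 2 3 4 by simp
qed

lemma E0_sym: "E0 D u v = E0 D v u"
  by (simp add: E0_eq_sum_diff mult.commute[of "u _ - u _"])

lemma E0_nonneg: "0 \<le> E0 D u u"
  using D_nonpositive[of u] by (simp add: E0_def sum_negf)

lemma sum_E0_eq:
  "(\<Sum>i\<in>I. E0 D (f i) (f i)) = (\<Sum>q\<in>V0. \<Sum>q'\<in>V0. D q q' * (\<Sum>i\<in>I. (f i q - f i q')\<^sup>2)) / 2"
proof -
  have "(\<Sum>i\<in>I. E0 D (f i) (f i)) = (\<Sum>i\<in>I. (\<Sum>q\<in>V0. \<Sum>q'\<in>V0. D q q' * (f i q - f i q')\<^sup>2)) / 2"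
    by (simp add: E0_eq_sum_diff power2_eq_square sum_divide_distrib)
  also have "(\<Sum>i\<in>I. (\<Sum>q\<in>V0. \<Sum>q'\<in>V0. D q q' * (f i q - f i q')\<^sup>2)) =
      (\<Sum>q\<in>V0. \<Sum>i\<in>I. \<Sum>q'\<in>V0. D q q' * (f i q - f i q')\<^sup>2)"
    by (rule sum.swap)
  also have "\<dots> = (\<Sum>q\<in>V0. \<Sum>q'\<in>V0. D q q' * (\<Sum>i\<in>I. (f i q - f i q')\<^sup>2))"
    by (rule sum.cong[OF refl]) (subst sum.swap, simp add: sum_distrib_left)
  finally show ?thesis .
qed

text \<open>The weights off the diagonal are nonnegative and the diagonal terms vanish. Families on
  both sides cover the Markov property, vector-valued comparison functions and the lattice
  inequality at once.\<close>

lemma E0_sum_mono: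
  assumes "\<And>q q'. q \<in> V0 \<Longrightarrow> q' \<in> V0 \<Longrightarrow> (\<Sum>i\<in>I. (f i q - f i q')\<^sup>2) \<le> (\<Sum>j\<in>J. (g j q - g j q')\<^sup>2)"
  shows "(\<Sum>i\<in>I. E0 D (f i) (f i)) \<le> (\<Sum>j\<in>J. E0 D (g j) (g j))"
proof -
  have "D q q' * (\<Sum>i\<in>I. (f i q - f i q')\<^sup>2) \<le> D q q' * (\<Sum>j\<in>J. (g j q - g j q')\<^sup>2)"
    if "q \<in> V0" "q' \<in> V0" for q q'
    using that assms[of q q'] D_off_diagonal[of q q'] by (cases "q = q'") (auto intro: mult_left_mono)
  then show ?thesis
    unfolding sum_E0_eq by (auto intro!: sum_mono divide_right_mono)
qed

lemma E0_mono:
  assumes "\<And>q q'. q \<in> V0 \<Longrightarrow> q' \<in> V0 \<Longrightarrow> \<bar>f q - f q'\<bar> \<le> \<bar>g q - g q'\<bar>"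
  shows "E0 D f f \<le> E0 D g g"
  using E0_sum_mono[where I = "{()}" and J = "{()}" and f = "\<lambda>_. f" and g = "\<lambda>_. g"] assms by (simp add: abs_le_square_iff)

text \<open>Strong subadditivity, edge by edge: if the order of \<open>u\<close> and
  \<open>v\<close> differs at the two ends, the term left over is a product of two factors of the
  same sign.\<close>

lemma E0_max_min:
  "E0 D (\<lambda>x. max (u x) (v x)) (\<lambda>x. max (u x) (v x)) + E0 D (\<lambda>x. min (u x) (v x)) (\<lambda>x. min (u x) (v x))
    \<le> E0 D u u + E0 D v v"
proof -
  have lat: "(max a b - max a' b')\<^sup>2 + (min a b - min a' b')\<^sup>2 \<le> (a - a')\<^sup>2 + (b - b')\<^sup>2" for a b a' b' :: real
  proof -
    have *: "0 \<le> (a - b) * (b' - a')" if "a \<ge> b" "a' \<le> b'" using that by simp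
    have **: "0 \<le> (b - a) * (a' - b')" if "a \<le> b" "a' \<ge> b'" using that by simp
    show ?thesis
      using * ** by (auto simp: max_def min_def power2_eq_square algebra_simps)
  qed
  show ?thesis
    using E0_sum_mono[where I = "{True, False}" and J = "{True, False}" and
        f = "\<lambda>i x. if i then max (u x) (v x) else min (u x) (v x)" and g = "\<lambda>i x. if i then u x else v x"] lat
    by simp
qed

lemma Em_cong:
  assumes "\<And>w q. w \<in> words m \<Longrightarrow> q \<in> V0 \<Longrightarrow> u (psi_word w q) = u' (psi_word w q)"
    "\<And>w q. w \<in> words m \<Longrightarrow> q \<in> V0 \<Longrightarrow> v (psi_word w q) = v' (psi_word w q)"
  shows "Em D r m u v = Em D r m u' v'"
  unfolding Em_def using assms by (auto intro!: sum.cong E0_cong)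

lemma Em_cong_K: "(\<And>x. x \<in> K \<Longrightarrow> u x = u' x) \<Longrightarrow> (\<And>x. x \<in> K \<Longrightarrow> v x = v' x) \<Longrightarrow> Em D r m u v = Em D r m u' v'"
  by (rule Em_cong) (use V0_subset in \<open>auto simp: psi_word_in_K words_imp\<close>)

lemma Em_0: "Em D r 0 u v = E0 D u v"
  by (simp add: Em_def)

lemma Em_sym: "Em D r m u v = Em D r m v u"
  unfolding Em_def by (simp add: E0_sym[of "u \<circ> _"])

lemma Em_add_left: "Em D r m (\<lambda>x. u x + u' x) v = Em D r m u v + Em D r m u' v"
  by (simp add: Em_def o_def E0_add_left algebra_simps sum.distrib)

lemma Em_add_right: "Em D r m u (\<lambda>x. v x + v' x) = Em D r m u v + Em D r m u v'"
  by (simp add: Em_def o_def E0_add_right algebra_simps sum.distrib)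

lemma Em_scale_left: "Em D r m (\<lambda>x. c * u x) v = c * Em D r m u v"
  by (simp add: Em_def o_def E0_scale_left sum_distrib_left algebra_simps)

lemma Em_scale_right: "Em D r m u (\<lambda>x. c * v x) = c * Em D r m u v"
  by (simp add: Em_def o_def E0_scale_right sum_distrib_left algebra_simps)

lemma Em_nonneg: "0 \<le> Em D r m u u"
  unfolding Em_def using rw_pos
  by (intro sum_nonneg mult_nonneg_nonneg E0_nonneg) (auto simp: less_imp_le words_imp)

lemma Em_lin_comb:
  "Em D r m (\<lambda>x. a * u x + b * v x) (\<lambda>x. a * u x + b * v x) =
    a\<^sup>2 * Em D r m u u + 2 * a * b * Em D r m u v + b\<^sup>2 * Em D r m v v"
  by (simp add: Em_add_left Em_add_right Em_scale_left Em_scale_right Em_sym[of m v u] power2_eq_square algebra_simps)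

lemma E0_lin_comb:
  "E0 D (\<lambda>x. a * u x + b * v x) (\<lambda>x. a * u x + b * v x) =
    a\<^sup>2 * E0 D u u + 2 * a * b * E0 D u v + b\<^sup>2 * E0 D v v"
  using Em_lin_comb[of 0] by (simp add: Em_0)

lemma Em_add_level:
  "Em D r (m + n) u v = (\<Sum>w\<in>words m. inverse (rw w) * Em D r n (u \<circ> psi_word w) (v \<circ> psi_word w))"
proof -
  have inj: "inj_on (\<lambda>(u, w). u @ w) (words m \<times> words n)"
    by (auto simp: inj_on_def words_def)
  have "Em D r (m + n) u v = (\<Sum>(w, w')\<in>words m \<times> words n. inverse (rw (w @ w')) *
      E0 D (u \<circ> psi_word (w @ w')) (v \<circ> psi_word (w @ w')))"
    unfolding Em_def words_add by (subst sum.reindex[OF inj]) (simp add: case_prod_beta o_def)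
  also have "\<dots> = (\<Sum>w\<in>words m. \<Sum>w'\<in>words n. inverse (rw (w @ w')) *
      E0 D (u \<circ> psi_word (w @ w')) (v \<circ> psi_word (w @ w')))"
    by (simp add: sum.cartesian_product)
  finally show ?thesis
    unfolding Em_def by (simp add: psi_word_append o_assoc sum_distrib_left mult_ac)
qed

lemma E0_le_Em1:
  assumes "\<And>q. q \<in> V0 \<Longrightarrow> u q = v q"
  shows "E0 D v v \<le> Em D r 1 u u"
  unfolding E0_eq_Inf_E1[of v]
  by (rule cINF_lower) (use assms Em_nonneg in \<open>auto intro!: bdd_belowI[of _ 0]\<close>)

lemma Em_mono_Suc: "Em D r m u u \<le> Em D r (Suc m) u u"
proof -
  have "E0 D (u \<circ> psi_word w) (u \<circ> psi_word w) \<le> Em D r 1 (u \<circ> psi_word w) (u \<circ> psi_word w)" for w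
    by (rule E0_le_Em1) auto
  then have "Em D r m u u \<le> Em D r (m + 1) u u"
    unfolding Em_add_level using rw_pos
    by (subst Em_def, intro sum_mono mult_left_mono) (auto simp: less_imp_le words_imp)
  then show ?thesis by simp
qed

lemma Em_mono: "m \<le> n \<Longrightarrow> Em D r m u u \<le> Em D r n u u"
  by (rule lift_Suc_mono_le[of "\<lambda>m. Em D r m u u"]) (auto intro: Em_mono_Suc)

lemma Em_sub_cell:
  assumes "w \<in> words m"
  shows "inverse (rw w) * Em D r n (u \<circ> psi_word w) (u \<circ> psi_word w) \<le> Em D r (m + n) u u"
  unfolding Em_add_level using assms rw_pos
  by (intro member_le_sum[where f = "\<lambda>w. inverse (rw w) * Em D r n (u \<circ> psi_word w) (u \<circ> psi_word w)"])
    (auto intro!: mult_nonneg_nonneg Em_nonneg simp: less_imp_le words_imp)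

text \<open>The indicator of the set of points reachable from \<open>a\<close> along positive
  conductances is in the kernel of \<open>D\<close>, hence constant.\<close>

lemma D_connected:
  assumes "a \<in> V0" "b \<in> V0"
  shows "(a, b) \<in> {(q, q'). q \<in> V0 \<and> q' \<in> V0 \<and> 0 < D q q'}\<^sup>*"
proof -
  let ?T = "{(q, q'). q \<in> V0 \<and> q' \<in> V0 \<and> 0 < D q q'}"
  define R where "R = {b. (a, b) \<in> ?T\<^sup>*}"
  have aR: "a \<in> R" by (simp add: R_def)
  have RV: "R \<subseteq> V0"
    using assms(1) by (auto simp: R_def elim: rtrancl.cases)
  have sep: "D q q' = 0" if "q \<in> R" "q' \<in> V0 - R" for q q'
  proof -
    have "\<not> 0 < D q q'"
      using that RV rtrancl_into_rtrancl[of a q ?T q'] by (auto simp: R_def)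
    moreover have "0 \<le> D q q'"
      using that RV by (intro D_off_diagonal) auto
    ultimately show ?thesis by simp
  qed
  have "Dop D (indicat_real R) q = 0" if "q \<in> V0" for q
  proof -
    have 1: "Dop D (indicat_real R) q = (\<Sum>q'\<in>R. D q q')"
      using RV by (auto simp: Dop_def indicator_def if_distrib Int_absorb1 cong: if_cong
          simp flip: sum.inter_restrict)
    show ?thesis
    proof (cases "q \<in> R")
      case True
      have "(\<Sum>q'\<in>R. D q q') = (\<Sum>q'\<in>V0. D q q')"
        using RV sep[OF True] by (intro sum.mono_neutral_left) auto
      then show ?thesis using 1 row_sum that by simp
    next
      case False
      have "D q q' = 0" if "q' \<in> R" for q'
        using sep[of q' q] D_symmetric[of q q'] that \<open>q \<in> V0\<close> False RV by auto
      then show ?thesis using 1 by simp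
    qed
  qed
  then have "indicat_real R constant_on V0"
    using D_kernel by blast
  then have "indicat_real R b = indicat_real R a"
    using assms unfolding constant_on_def by metis
  with aR have "b \<in> R" by (auto simp: indicator_def split: if_splits)
  then show ?thesis by (simp add: R_def)
qed

lemma E0_edge:
  assumes "q \<in> V0" "q' \<in> V0" "q \<noteq> q'"
  shows "D q q' * (u q - u q')\<^sup>2 \<le> E0 D u u"
proof -
  define F where "F = (\<lambda>(q, q'). D q q' * (u q - u q')\<^sup>2)"
  have nn: "0 \<le> F p" if "p \<in> V0 \<times> V0" for p
    using that D_off_diagonal by (cases "fst p = snd p") (auto simp: F_def case_prod_beta)
  have "sum F {(q, q'), (q', q)} \<le> sum F (V0 \<times> V0)"
    using assms nn by (intro sum_mono2) auto
  also have "\<dots> = 2 * E0 D u u"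
    by (simp add: E0_eq_sum_diff F_def sum.cartesian_product power2_eq_square)
  finally show ?thesis
    using assms D_symmetric[of q' q] by (simp add: F_def power2_commute)
qed

text \<open>Telescoping along a path of positive conductances; the maximum over the finitely many
  pairs of vertices gives one constant.\<close>

lemma E0_Poincare_ex: "\<exists>C>0. \<forall>u. \<forall>a\<in>V0. \<forall>b\<in>V0. (u a - u b)\<^sup>2 \<le> C * E0 D u u"
proof -
  let ?T = "{(q, q'). q \<in> V0 \<and> q' \<in> V0 \<and> 0 < D q q'}"
  have ex: "\<exists>C>0. \<forall>u. (u a - u b)\<^sup>2 \<le> C * E0 D u u" if "(a, b) \<in> ?T\<^sup>*" for a b
    using that
  proof (induction rule: rtrancl_induct)
    case base
    show ?case by (rule exI[of _ 1]) (auto simp: E0_nonneg)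
  next
    case (step y z)
    then obtain C where C: "C > 0" "\<And>u. (u a - u y)\<^sup>2 \<le> C * E0 D u u" by blast
    have yz: "y \<in> V0" "z \<in> V0" "0 < D y z" using step by auto
    show ?case
    proof (cases "y = z")
      case True
      then show ?thesis using C by blast
    next
      case False
      have "(u a - u z)\<^sup>2 \<le> (2 * C + 2 / D y z) * E0 D u u" for u
      proof -
        have "(u a - u z)\<^sup>2 \<le> 2 * (u a - u y)\<^sup>2 + 2 * (u y - u z)\<^sup>2"
          using sum_squares_ge_zero[of "(u a - u y) - (u y - u z)" 0] by (simp add: power2_eq_square algebra_simps)
        also have "(u y - u z)\<^sup>2 \<le> E0 D u u / D y z"
          using E0_edge[of y z u] yz False by (simp add: field_simps)
        finally show ?thesis
          using C(2)[of u] by (simp add: algebra_simps)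
      qed
      moreover have "0 < 2 * C + 2 / D y z" using C yz by (auto intro!: add_pos_pos)
      ultimately show ?thesis by blast
    qed
  qed
  then have "\<forall>p\<in>V0 \<times> V0. \<exists>C>0. \<forall>u. (u (fst p) - u (snd p))\<^sup>2 \<le> C * E0 D u u"
    using D_connected by auto
  then obtain C where C: "\<And>p. p \<in> V0 \<times> V0 \<Longrightarrow> C p > 0 \<and> (\<forall>u. (u (fst p) - u (snd p))\<^sup>2 \<le> C p * E0 D u u)"
    by metis
  define M where "M = Max (insert 1 (C ` (V0 \<times> V0)))"
  have "M \<ge> 1" by (simp add: M_def)
  moreover have "(u a - u b)\<^sup>2 \<le> M * E0 D u u" if "a \<in> V0" "b \<in> V0" for u a b
  proof -
    have "(u a - u b)\<^sup>2 \<le> C (a, b) * E0 D u u" using C[of "(a, b)"] that by auto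
    also have "C (a, b) \<le> M" using that by (auto simp: M_def)
    then have "C (a, b) * E0 D u u \<le> M * E0 D u u" by (intro mult_right_mono E0_nonneg)
    finally show ?thesis .
  qed
  ultimately show ?thesis by (intro exI[of _ M]) auto
qed

definition CP :: real where
  "CP = (SOME C. C > 0 \<and> (\<forall>u. \<forall>a\<in>V0. \<forall>b\<in>V0. (u a - u b)\<^sup>2 \<le> C * E0 D u u))"

lemma CP: "CP > 0" "a \<in> V0 \<Longrightarrow> b \<in> V0 \<Longrightarrow> (u a - u b)\<^sup>2 \<le> CP * E0 D u u"
  using someI_ex[OF E0_Poincare_ex] unfolding CP_def by blast+

lemma E0_eq_0: "E0 D u u = 0 \<Longrightarrow> a \<in> V0 \<Longrightarrow> b \<in> V0 \<Longrightarrow> u a = u b"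
  using CP(2)[of a b u] by simp

lemma Em1_eq_0:
  assumes "Em D r 1 u u = 0" "i \<in> S" "c \<in> V0" "j \<in> S" "d \<in> V0"
  shows "u (\<psi> i c) = u (\<psi> j d)"
proof -
  have E: "u (\<psi> i c) = u (\<psi> i d)" if "i \<in> S" "c \<in> V0" "d \<in> V0" for i c d
  proof -
    have "inverse (rw [i]) * Em D r 0 (u \<circ> psi_word [i]) (u \<circ> psi_word [i]) \<le> 0"
      using Em_sub_cell[of "[i]" 1 0 u] assms that by (simp add: words_1)
    then have "E0 D (u \<circ> psi_word [i]) (u \<circ> psi_word [i]) \<le> 0"
      using r_pos[OF that(1)] by (simp add: Em_0 field_simps zero_less_divide_iff mult_le_0_iff)
    with E0_nonneg[of "u \<circ> psi_word [i]"] have "E0 D (u \<circ> psi_word [i]) (u \<circ> psi_word [i]) = 0"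
      by linarith
    from E0_eq_0[OF this that(2,3)] show ?thesis by (simp add: psi_word_Cons)
  qed
  have "(\<psi> i c, \<psi> j d) \<in> (link (\<lambda>_. V0))\<^sup>*"
    using assms by (intro link_connected) auto
  then show ?thesis
    by (induction rule: rtrancl_induct) (auto simp: link_def dest: E)
qed

text \<open>Cutting a minimizing sequence off at the extreme values of \<open>v\<close> keeps the
  boundary values and does not raise the energy, and a bounded sequence converges along a
  subsequence at the finitely many points of level 1. So the infimum in \<open>E0_eq_Inf_E1\<close>
  is attained, and the cut-off yields the maximum principle as well.\<close>

lemma ex_minimizer:
  "\<exists>u. (\<forall>q\<in>V0. u q = v q) \<and> Em D r 1 u u = E0 D v v \<and> (\<forall>x. Min (v ` V0) \<le> u x \<and> u x \<le> Max (v ` V0))"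
proof -
  define a b where "a = Min (v ` V0)" and "b = Max (v ` V0)"
  have ab: "a \<le> v q" "v q \<le> b" if "q \<in> V0" for q
    using that by (auto simp: a_def b_def)
  have "a \<le> b" using V0_nonempty ab by (meson all_not_in_conv order_trans)
  define V1 where "V1 = (\<lambda>(i, q). \<psi> i q) ` (S \<times> V0)"
  have fin: "finite V1" by (simp add: V1_def finite_S)
  have V0V1: "V0 \<subseteq> V1"
    by (force simp: V1_def elim: V0_subset_V1)
  have inV1: "psi_word w q \<in> V1" if "w \<in> words 1" "q \<in> V0" for w q
    using that by (force simp: V1_def words_1 psi_word_Cons)
  have "\<exists>u. (\<forall>q\<in>V0. u q = v q) \<and> Em D r 1 u u < E0 D v v + 1 / Suc k" for k
  proof -
    have "(INF u\<in>{u. \<forall>q\<in>V0. u q = v q}. Em D r 1 u u) < E0 D v v + 1 / Suc k"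
      unfolding E0_eq_Inf_E1[of v] by simp
    then show ?thesis
      by (subst (asm) cINF_less_iff) (auto intro!: bdd_belowI[of _ 0] Em_nonneg)
  qed
  then obtain u where u: "\<And>k q. q \<in> V0 \<Longrightarrow> u k q = v q" "\<And>k. Em D r 1 (u k) (u k) < E0 D v v + 1 / Suc k"
    by metis
  define c where "c k x = max a (min b (u k x))" for k x
  have c0: "c k q = v q" if "q \<in> V0" for k q
    using u(1)[OF that] ab[OF that] by (simp add: c_def)
  have cE: "Em D r 1 (c k) (c k) \<le> Em D r 1 (u k) (u k)" for k
    unfolding Em_def using rw_pos
    by (intro sum_mono mult_left_mono E0_mono) (auto simp: c_def less_imp_le words_imp)
  have "\<bar>c k x\<bar> \<le> \<bar>a\<bar> + \<bar>b\<bar>" for k x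
    using \<open>a \<le> b\<close> by (auto simp: c_def)
  then obtain s l where s: "strict_mono s" "\<And>x. x \<in> V1 \<Longrightarrow> (\<lambda>k. c (s k) x) \<longlonglongrightarrow> l x"
    using bounded_seq_finite_set[OF fin, of c "\<bar>a\<bar> + \<bar>b\<bar>"] by blast
  define U where "U x = (if x \<in> V1 then l x else a)" for x
  have lim: "(\<lambda>k. c (s k) x) \<longlonglongrightarrow> U x" if "x \<in> V1" for x
    using s(2) that by (simp add: U_def)
  have U0: "U q = v q" if "q \<in> V0" for q
    using LIMSEQ_unique[OF lim[of q], of "v q"] that c0 V0V1 by auto
  have "(\<lambda>k. Em D r 1 (c (s k)) (c (s k))) \<longlonglongrightarrow> Em D r 1 U U"
    unfolding Em_def E0_def Dop_def o_def
    by (intro tendsto_intros lim inV1) auto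
  moreover have "(\<lambda>k. E0 D v v + 1 / Suc k) \<longlonglongrightarrow> E0 D v v + 0"
    by (intro tendsto_intros LIMSEQ_Suc[OF lim_1_over_n])
  moreover have "Em D r 1 (c (s k)) (c (s k)) \<le> E0 D v v + 1 / Suc k" for k
  proof -
    have "k \<le> s k" using s(1) by (rule seq_suble)
    then have "1 / real (Suc (s k)) \<le> 1 / real (Suc k)" by (simp add: field_simps)
    then show ?thesis using cE[of "s k"] u(2)[of "s k"] by linarith
  qed
  ultimately have "Em D r 1 U U \<le> E0 D v v"
    using LIMSEQ_le[of _ _ _ "E0 D v v + 0"] by auto
  moreover have "E0 D v v \<le> Em D r 1 U U"
    using U0 by (rule E0_le_Em1)
  moreover have "a \<le> U x \<and> U x \<le> b" for x
  proof (cases "x \<in> V1")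
    case True
    have "a \<le> c (s k) x" "c (s k) x \<le> b" for k using \<open>a \<le> b\<close> by (auto simp: c_def)
    then show ?thesis
      using lim[OF True] by (auto intro: LIMSEQ_le_const LIMSEQ_le_const2)
  qed (use \<open>a \<le> b\<close> in \<open>auto simp: U_def\<close>)
  ultimately show ?thesis
    using U0 unfolding a_def b_def by (intro exI[of _ U]) auto
qed

definition ext1 :: "('a \<Rightarrow> real) \<Rightarrow> 'a \<Rightarrow> real" where
  "ext1 v = (SOME u. (\<forall>q\<in>V0. u q = v q) \<and> Em D r 1 u u = E0 D v v \<and>
     (\<forall>x. Min (v ` V0) \<le> u x \<and> u x \<le> Max (v ` V0)))"

lemma ext1:
  shows ext1_V0: "q \<in> V0 \<Longrightarrow> ext1 v q = v q"
    and Em_ext1: "Em D r 1 (ext1 v) (ext1 v) = E0 D v v"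
    and ext1_ge: "Min (v ` V0) \<le> ext1 v x"
    and ext1_le: "ext1 v x \<le> Max (v ` V0)"
  using someI_ex[OF ex_minimizer[of v]] unfolding ext1_def by blast+

text \<open>The inequality \<open>E0_le_Em1\<close>, applied to \<open>v\<close> plus
  \<open>t\<close> times \<open>\<phi>\<close>, is an equality at \<open>t = 0\<close>, so the terms
  linear in \<open>t\<close> agree. As \<open>\<phi>\<close> need not vanish on \<open>V0\<close>,
  this is a Gauss-Green formula, with the boundary term on the right.\<close>

lemma Em_ext1_left: "Em D r 1 (ext1 v) \<phi> = E0 D v \<phi>"
proof -
  have "Em D r 1 (ext1 v) \<phi> - E0 D v \<phi> = 0"
  proof (rule linear_nonneg_imp_zero)
    fix t
    have "E0 D (\<lambda>x. 1 * v x + t * \<phi> x) (\<lambda>x. 1 * v x + t * \<phi> x) \<le>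
        Em D r 1 (\<lambda>x. 1 * ext1 v x + t * \<phi> x) (\<lambda>x. 1 * ext1 v x + t * \<phi> x)"
      by (rule E0_le_Em1) (simp add: ext1_V0)
    then show "0 \<le> 2 * (Em D r 1 (ext1 v) \<phi> - E0 D v \<phi>) * t + (Em D r 1 \<phi> \<phi> - E0 D \<phi> \<phi>) * t\<^sup>2"
      unfolding Em_lin_comb E0_lin_comb by (simp add: Em_ext1 algebra_simps del: One_nat_def)
  qed
  then show ?thesis by simp
qed

text \<open>By Gauss-Green the difference has zero energy, so it is constant on the points of level
  1; these include \<open>V0\<close>, where it vanishes.\<close>

lemma ext1_unique:
  assumes "\<And>q. q \<in> V0 \<Longrightarrow> u q = v q" "Em D r 1 u u = E0 D v v" "i \<in> S" "c \<in> V0"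
  shows "u (\<psi> i c) = ext1 v (\<psi> i c)"
proof -
  let ?d = "\<lambda>x. 1 * u x + (-1) * ext1 v x"
  have "Em D r 1 u (ext1 v) = E0 D v v"
    using Em_ext1_left[of v u] assms(1) by (metis Em_sym E0_cong)
  then have "Em D r 1 ?d ?d = 0"
    unfolding Em_lin_comb by (simp add: assms Em_ext1 del: One_nat_def)
  obtain q where q: "q \<in> V0" using V0_nonempty by auto
  obtain j d where "j \<in> S" "d \<in> V0" "q = \<psi> j d" using q by (rule V0_subset_V1)
  then have "?d (\<psi> i c) = ?d q"
    using Em1_eq_0[OF \<open>Em D r 1 ?d ?d = 0\<close> assms(3,4), of j d] by auto
  then show ?thesis using assms(1)[OF q] ext1_V0[OF q, of v] by simp
qed

lemma ext1_cong:
  assumes "\<And>q. q \<in> V0 \<Longrightarrow> u q = v q" "i \<in> S" "c \<in> V0"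
  shows "ext1 u (\<psi> i c) = ext1 v (\<psi> i c)"
proof (rule ext1_unique)
  show "Em D r 1 (ext1 u) (ext1 u) = E0 D v v"
    unfolding Em_ext1 using assms by (intro E0_cong) auto
qed (use assms in \<open>auto simp: ext1_V0\<close>)

end

section \<open>The form domain and harmonic functions\<close>

context self_similar_structure
begin

lemma V0_in_K [simp]: "q \<in> V0 \<Longrightarrow> q \<in> K"
  using V0_subset by blast

lemma psi_word_in_K' [simp]: "w \<in> words n \<Longrightarrow> x \<in> K \<Longrightarrow> psi_word w x \<in> K"
  using psi_word_in_K words_imp by blast

text \<open>The union of the cells of level \<open>n\<close> that avoid \<open>x\<close> is closed,
  so all points near \<open>x\<close> share a cell with \<open>x\<close>.\<close>

lemma continuous_on_cellwise:
  fixes f :: "'a \<Rightarrow> 'b::metric_space"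
  assumes "\<And>\<epsilon>. \<epsilon> > 0 \<Longrightarrow> \<exists>n. \<forall>w\<in>words n. \<forall>x\<in>K. \<forall>y\<in>K. dist (f (psi_word w x)) (f (psi_word w y)) < \<epsilon>"
  shows "continuous_on K f"
  unfolding continuous_on_iff
proof (intro ballI allI impI)
  fix x and \<epsilon> :: real assume x: "x \<in> K" and "0 < \<epsilon>"
  from assms[OF this(2)] obtain n where
    n: "\<And>w x y. w \<in> words n \<Longrightarrow> x \<in> K \<Longrightarrow> y \<in> K \<Longrightarrow> dist (f (psi_word w x)) (f (psi_word w y)) < \<epsilon>"
    by blast
  define C where "C = (\<Union>w\<in>{w \<in> words n. x \<notin> psi_word w ` K}. psi_word w ` K)"
  have "closed C"
    unfolding C_def by (auto intro!: closed_UN closed_cell dest: words_imp)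
  moreover have "x \<notin> C" by (auto simp: C_def)
  ultimately obtain d where d: "d > 0" "\<And>y. dist y x < d \<Longrightarrow> y \<notin> C"
    using open_dist[of "- C"] by (auto simp: open_closed)
  show "\<exists>d>0. \<forall>x'\<in>K. dist x' x < d \<longrightarrow> dist (f x') (f x) < \<epsilon>"
  proof (intro exI[of _ d] conjI ballI impI d(1))
    fix y assume y: "y \<in> K" "dist y x < d"
    obtain w z where w: "w \<in> words n" "z \<in> K" "y = psi_word w z"
      using y(1) by (rule ex_cell)
    have "y \<notin> C" using d y by blast
    then have "x \<in> psi_word w ` K" using w by (auto simp: C_def)
    then show "dist (f y) (f x) < \<epsilon>" using w n by auto
  qed
qed

end

context regular_harmonic_structure
begin

lemma form_domainI:
  assumes "continuous_on K u" "\<And>m. Em D r m u u \<le> M"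
  shows "u \<in> form_domain"
proof -
  have "Bseq (\<lambda>m. Em D r m u u)"
    using assms(2) by (intro BseqI'[of _ M]) (auto simp: Em_nonneg)
  moreover have "incseq (\<lambda>m. Em D r m u u)"
    by (auto simp: incseq_def intro: Em_mono)
  ultimately show ?thesis
    using assms(1) by (auto simp: form_domain_def intro: Bseq_monoseq_convergent incseq_imp_monoseq)
qed

lemma form_domain_continuous: "u \<in> form_domain \<Longrightarrow> continuous_on K u"
  by (simp add: form_domain_def)

lemma energy_tendsto_self: "u \<in> form_domain \<Longrightarrow> (\<lambda>m. Em D r m u u) \<longlonglongrightarrow> energy u u"
  by (simp add: form_domain_def energy_def convergent_LIMSEQ_iff)

lemma Em_le_energy: "u \<in> form_domain \<Longrightarrow> Em D r m u u \<le> energy u u"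
  using energy_tendsto_self by (rule incseq_le[rotated]) (auto simp: incseq_def intro: Em_mono)

lemma E0_le_energy: "u \<in> form_domain \<Longrightarrow> E0 D u u \<le> energy u u"
  using Em_le_energy[of u 0] by (simp add: Em_0)

lemma energy_nonneg: "u \<in> form_domain \<Longrightarrow> 0 \<le> energy u u"
  using E0_le_energy E0_nonneg by (rule order_trans[rotated])

lemma energy_leI:
  assumes "u \<in> form_domain" "\<And>m. Em D r m u u \<le> M"
  shows "energy u u \<le> M"
  using energy_tendsto_self[OF assms(1)] assms(2) by (intro LIMSEQ_le_const2) auto

lemma energy_cong: "(\<And>x. x \<in> K \<Longrightarrow> u x = u' x) \<Longrightarrow> (\<And>x. x \<in> K \<Longrightarrow> v x = v' x) \<Longrightarrow> energy u v = energy u' v'"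
  unfolding energy_def by (intro arg_cong[where f = lim] ext Em_cong_K)

lemma Em_sum_mono:
  assumes "\<And>x y. x \<in> K \<Longrightarrow> y \<in> K \<Longrightarrow> (u x - u y)\<^sup>2 \<le> (\<Sum>j\<in>J. (g j x - g j y)\<^sup>2)"
  shows "Em D r m u u \<le> (\<Sum>j\<in>J. Em D r m (g j) (g j))"
proof -
  have "E0 D (u \<circ> psi_word w) (u \<circ> psi_word w) \<le> (\<Sum>j\<in>J. E0 D (g j \<circ> psi_word w) (g j \<circ> psi_word w))"
    if "w \<in> words m" for w
    using E0_sum_mono[where I = "{()}" and J = J and f = "\<lambda>_. u \<circ> psi_word w" and g = "\<lambda>j. g j \<circ> psi_word w"]
      assms that by simp
  then have "Em D r m u u \<le> (\<Sum>w\<in>words m. inverse (rw w) * (\<Sum>j\<in>J. E0 D (g j \<circ> psi_word w) (g j \<circ> psi_word w)))"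
    unfolding Em_def using rw_pos by (intro sum_mono mult_left_mono) (auto simp: less_imp_le words_imp)
  also have "\<dots> = (\<Sum>j\<in>J. Em D r m (g j) (g j))"
    unfolding Em_def sum_distrib_left by (rule sum.swap)
  finally show ?thesis .
qed

lemma form_domain_const: "(\<lambda>_. c) \<in> form_domain"
  by (rule form_domainI[of _ 0]) (simp_all add: Em_def o_def E0_eq_sum_diff)

lemma energy_const: "energy (\<lambda>_. c) v = 0" "energy v (\<lambda>_. c) = 0"
  unfolding energy_def by (simp_all add: Em_def o_def E0_eq_sum_diff lim_const)

lemma form_domain_lin_comb:
  assumes "u \<in> form_domain" "v \<in> form_domain"
  shows "(\<lambda>x. a * u x + b * v x) \<in> form_domain"
proof (rule form_domainI)
  show "continuous_on K (\<lambda>x. a * u x + b * v x)"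
    using assms by (intro continuous_intros form_domain_continuous)
  fix m
  have "0 \<le> Em D r m (\<lambda>x. a * u x + (- b) * v x) (\<lambda>x. a * u x + (- b) * v x)"
    by (rule Em_nonneg)
  then have "Em D r m (\<lambda>x. a * u x + b * v x) (\<lambda>x. a * u x + b * v x)
     \<le> 2 * (a\<^sup>2 * Em D r m u u + b\<^sup>2 * Em D r m v v)"
    unfolding Em_lin_comb by simp
  also have "\<dots> \<le> 2 * (a\<^sup>2 * energy u u + b\<^sup>2 * energy v v)"
    using assms by (intro mult_left_mono add_mono Em_le_energy) auto
  finally show "Em D r m (\<lambda>x. a * u x + b * v x) (\<lambda>x. a * u x + b * v x) \<le>
    2 * (a\<^sup>2 * energy u u + b\<^sup>2 * energy v v)" .
qed

lemma form_domain_add: "u \<in> form_domain \<Longrightarrow> v \<in> form_domain \<Longrightarrow> (\<lambda>x. u x + v x) \<in> form_domain"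
  using form_domain_lin_comb[of u v 1 1] by simp

lemma form_domain_diff: "u \<in> form_domain \<Longrightarrow> v \<in> form_domain \<Longrightarrow> (\<lambda>x. u x - v x) \<in> form_domain"
  using form_domain_lin_comb[of u v 1 "-1"] by simp

lemma form_domain_scale: "u \<in> form_domain \<Longrightarrow> (\<lambda>x. c * u x) \<in> form_domain"
  using form_domain_lin_comb[of u u c 0] by simp

lemma energy_tendsto:
  assumes "u \<in> form_domain" "v \<in> form_domain"
  shows "(\<lambda>m. Em D r m u v) \<longlonglongrightarrow> energy u v"
proof -
  have eq: "(\<lambda>m. Em D r m u v) =
      (\<lambda>m. (Em D r m (\<lambda>x. u x + v x) (\<lambda>x. u x + v x) - Em D r m u u - Em D r m v v) / 2)"
    by (rule ext) (simp add: Em_add_left Em_add_right Em_sym[of _ v u])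
  have "(\<lambda>m. (Em D r m (\<lambda>x. u x + v x) (\<lambda>x. u x + v x) - Em D r m u u - Em D r m v v) / 2)
      \<longlonglongrightarrow> (energy (\<lambda>x. u x + v x) (\<lambda>x. u x + v x) - energy u u - energy v v) / 2"
    by (intro tendsto_intros energy_tendsto_self form_domain_add assms) simp
  then have lim: "(\<lambda>m. Em D r m u v) \<longlonglongrightarrow> (energy (\<lambda>x. u x + v x) (\<lambda>x. u x + v x) - energy u u - energy v v) / 2"
    unfolding eq .
  have "energy u v = (energy (\<lambda>x. u x + v x) (\<lambda>x. u x + v x) - energy u u - energy v v) / 2"
    unfolding energy_def[of u v] using lim by (rule limI)
  with lim show ?thesis by (simp only:)
qed

lemma energy_sym: "energy u v = energy v u"
  unfolding energy_def by (simp add: Em_sym)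

lemma energy_lin_comb:
  assumes "u \<in> form_domain" "v \<in> form_domain"
  shows "energy (\<lambda>x. a * u x + b * v x) (\<lambda>x. a * u x + b * v x) =
    a\<^sup>2 * energy u u + 2 * a * b * energy u v + b\<^sup>2 * energy v v"
proof (rule LIMSEQ_unique[OF energy_tendsto_self[OF form_domain_lin_comb[OF assms]]])
  show "(\<lambda>m. Em D r m (\<lambda>x. a * u x + b * v x) (\<lambda>x. a * u x + b * v x)) \<longlonglongrightarrow>
    a\<^sup>2 * energy u u + 2 * a * b * energy u v + b\<^sup>2 * energy v v"
    unfolding Em_lin_comb by (intro tendsto_intros energy_tendsto assms)
qed

lemma energy_scale: "u \<in> form_domain \<Longrightarrow> energy (\<lambda>x. c * u x) (\<lambda>x. c * u x) = c\<^sup>2 * energy u u"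
  using energy_lin_comb[of u u c 0] by simp

lemma form_domain_contraction:
  assumes "u \<in> form_domain" "\<And>x y. x \<in> K \<Longrightarrow> y \<in> K \<Longrightarrow> \<bar>f x - f y\<bar> \<le> \<bar>u x - u y\<bar>"
  shows "f \<in> form_domain" "energy f f \<le> energy u u"
proof -
  have "Em D r m f f \<le> Em D r m u u" for m
    using Em_sum_mono[where u = f and J = "{()}" and g = "\<lambda>_. u" and m = m] assms by (simp add: abs_le_square_iff)
  then have le: "Em D r m f f \<le> energy u u" for m
    using Em_le_energy[OF assms(1)] order_trans by blast
  have "continuous_on K f"
    unfolding continuous_on_iff
  proof (intro ballI allI impI)
    fix x and e :: real assume a: "x \<in> K" "0 < e"
    with form_domain_continuous[OF assms(1)] obtain d where
      "d > 0" "\<forall>x'\<in>K. dist x' x < d \<longrightarrow> dist (u x') (u x) < e"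
      unfolding continuous_on_iff by blast
    then show "\<exists>d>0. \<forall>x'\<in>K. dist x' x < d \<longrightarrow> dist (f x') (f x) < e"
      using assms(2) a(1) by (intro exI[of _ d]) (force simp: dist_real_def)
  qed
  then show "f \<in> form_domain" using le by (rule form_domainI)
  then show "energy f f \<le> energy u u" using le by (rule energy_leI)
qed

lemma form_domain_abs: "u \<in> form_domain \<Longrightarrow> (\<lambda>x. \<bar>u x\<bar>) \<in> form_domain"
  by (rule form_domain_contraction(1)) auto

lemma energy_abs: "u \<in> form_domain \<Longrightarrow> energy (\<lambda>x. \<bar>u x\<bar>) (\<lambda>x. \<bar>u x\<bar>) \<le> energy u u"
  by (rule form_domain_contraction(2)) auto

lemma form_domain_max:
  assumes "u \<in> form_domain" "v \<in> form_domain"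
  shows "(\<lambda>x. max (u x) (v x)) \<in> form_domain"
proof -
  have "(\<lambda>x. (1/2) * (u x + v x) + (1/2) * \<bar>u x - v x\<bar>) \<in> form_domain"
    by (intro form_domain_lin_comb form_domain_add form_domain_abs form_domain_diff assms)
  moreover have "(\<lambda>x. (1/2) * (u x + v x) + (1/2) * \<bar>u x - v x\<bar>) = (\<lambda>x. max (u x) (v x))"
    by (auto simp: max_def field_simps)
  ultimately show ?thesis by simp
qed

lemma energy_max_le:
  assumes "u \<in> form_domain" "v \<in> form_domain"
  shows "energy (\<lambda>x. max (u x) (v x)) (\<lambda>x. max (u x) (v x)) \<le> energy u u + energy v v"
proof (rule energy_leI[OF form_domain_max[OF assms]])
  fix m
  have "E0 D (\<lambda>x. max (u (psi_word w x)) (v (psi_word w x))) (\<lambda>x. max (u (psi_word w x)) (v (psi_word w x)))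
     \<le> E0 D (u \<circ> psi_word w) (u \<circ> psi_word w) + E0 D (v \<circ> psi_word w) (v \<circ> psi_word w)" for w
    using E0_max_min[of "u \<circ> psi_word w" "v \<circ> psi_word w"]
      E0_nonneg[of "\<lambda>x. min ((u \<circ> psi_word w) x) ((v \<circ> psi_word w) x)"] by simp
  then have "Em D r m (\<lambda>x. max (u x) (v x)) (\<lambda>x. max (u x) (v x)) \<le> (\<Sum>w\<in>words m. inverse (rw w) *
      (E0 D (u \<circ> psi_word w) (u \<circ> psi_word w) + E0 D (v \<circ> psi_word w) (v \<circ> psi_word w)))"
    unfolding Em_def o_def using rw_pos by (intro sum_mono mult_left_mono) (auto simp: less_imp_le words_imp)
  also have "\<dots> = Em D r m u u + Em D r m v v"
    by (simp add: Em_def algebra_simps sum.distrib)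
  also have "\<dots> \<le> energy u u + energy v v"
    using assms by (intro add_mono Em_le_energy)
  finally show "Em D r m (\<lambda>x. max (u x) (v x)) (\<lambda>x. max (u x) (v x)) \<le> energy u u + energy v v" .
qed

lemma form_domain_bounded:
  assumes "u \<in> form_domain" shows "\<exists>M\<ge>0. \<forall>x\<in>K. \<bar>u x\<bar> \<le> M"
proof -
  have "bounded (u ` K)"
    using compact_continuous_image[OF form_domain_continuous[OF assms] compact_K] by (rule compact_imp_bounded)
  then obtain M where M: "\<And>x. x \<in> K \<Longrightarrow> \<bar>u x\<bar> \<le> M" by (auto simp: bounded_iff)
  then have "\<bar>u x\<bar> \<le> \<bar>M\<bar>" if "x \<in> K" for x using that order_trans[OF _ abs_ge_self] by blast
  then show ?thesis by (intro exI[of _ "\<bar>M\<bar>"]) simp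
qed

lemma form_domain_mult:
  assumes "u \<in> form_domain" "v \<in> form_domain"
  shows "(\<lambda>x. u x * v x) \<in> form_domain"
proof -
  obtain M where M: "M \<ge> 0" "\<And>x. x \<in> K \<Longrightarrow> \<bar>u x\<bar> \<le> M" using form_domain_bounded[OF assms(1)] by blast
  obtain N where N: "N \<ge> 0" "\<And>x. x \<in> K \<Longrightarrow> \<bar>v x\<bar> \<le> N" using form_domain_bounded[OF assms(2)] by blast
  \<comment> \<open>The factors 2 come from
    \<open>(s + t)\<^sup>2 \<le> 2 * s\<^sup>2 + 2 * t\<^sup>2\<close>, applied to the product rule
    for increments; the product is thus dominated by a pair of functions of finite energy.\<close>
  define g where "g b x = (if b then 2 * M * v x else 2 * N * u x)" for b :: bool and x
  have "(u x * v x - u y * v y)\<^sup>2 \<le> (\<Sum>b\<in>{True, False}. (g b x - g b y)\<^sup>2)" if "x \<in> K" "y \<in> K" for x y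
  proof -
    have "u x * v x - u y * v y = u x * (v x - v y) + v y * (u x - u y)"
      by (simp add: algebra_simps)
    then have "\<bar>u x * v x - u y * v y\<bar> \<le> \<bar>u x\<bar> * \<bar>v x - v y\<bar> + \<bar>v y\<bar> * \<bar>u x - u y\<bar>"
      by (metis abs_mult abs_triangle_ineq)
    also have "\<dots> \<le> M * \<bar>v x - v y\<bar> + N * \<bar>u x - u y\<bar>"
      using M N that by (intro add_mono mult_right_mono) auto
    finally have "(u x * v x - u y * v y)\<^sup>2 \<le> (M * \<bar>v x - v y\<bar> + N * \<bar>u x - u y\<bar>)\<^sup>2"
      using M(1) N(1) by (simp flip: abs_le_square_iff)
    also have "\<dots> \<le> 2 * (M * \<bar>v x - v y\<bar>)\<^sup>2 + 2 * (N * \<bar>u x - u y\<bar>)\<^sup>2"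
      using sum_squares_ge_zero[of "M * \<bar>v x - v y\<bar> - N * \<bar>u x - u y\<bar>" 0]
      by (simp add: power2_eq_square algebra_simps)
    also have "\<dots> \<le> (2 * (M * \<bar>v x - v y\<bar>))\<^sup>2 + (2 * (N * \<bar>u x - u y\<bar>))\<^sup>2"
      by (simp add: power_mult_distrib)
    also have "\<dots> = (\<Sum>b\<in>{True, False}. (g b x - g b y)\<^sup>2)"
      by (simp add: g_def power_mult_distrib flip: right_diff_distrib)
    finally show ?thesis .
  qed
  then have le: "Em D r m (\<lambda>x. u x * v x) (\<lambda>x. u x * v x) \<le> (\<Sum>b\<in>{True, False}. Em D r m (g b) (g b))" for m
    by (rule Em_sum_mono)
  have g: "g b \<in> form_domain" for b
    unfolding g_def using form_domain_scale assms by (cases b) auto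
  have "(\<Sum>b\<in>{True, False}. Em D r m (g b) (g b)) \<le> (\<Sum>b\<in>{True, False}. energy (g b) (g b))" for m
    by (intro sum_mono Em_le_energy g)
  with le show ?thesis
    using assms by (intro form_domainI[where M = "\<Sum>b\<in>{True, False}. energy (g b) (g b)"])
      (auto intro: continuous_intros form_domain_continuous order_trans)
qed

section \<open>Energy carried by cells\<close>

lemma form_domain_psi_word:
  assumes "u \<in> form_domain" "w \<in> words m"
  shows "u \<circ> psi_word w \<in> form_domain"
proof (rule form_domainI)
  show "continuous_on K (u \<circ> psi_word w)"
    using assms psi_word_continuous[of w] psi_word_image[of w]
    by (intro continuous_on_compose) (auto simp: words_imp intro: continuous_on_subset[OF form_domain_continuous])
  fix n
  have "inverse (rw w) * Em D r n (u \<circ> psi_word w) (u \<circ> psi_word w) \<le> energy u u"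
    using Em_sub_cell[OF assms(2), of n u] Em_le_energy[OF assms(1), of "m + n"] by linarith
  then show "Em D r n (u \<circ> psi_word w) (u \<circ> psi_word w) \<le> rw w * energy u u"
    using rw_pos[of w] assms(2) by (simp add: words_imp field_simps)
qed

text \<open>The share of the cell \<open>w\<close> in \<open>energy u u\<close>; the factor
  \<open>inverse (rw w)\<close> undoes the scaling of the form under
  \<open>psi_word w\<close>.\<close>

definition cell_energy :: "'s list \<Rightarrow> ('a \<Rightarrow> real) \<Rightarrow> real" where
  "cell_energy w u = inverse (rw w) * energy (u \<circ> psi_word w) (u \<circ> psi_word w)"

lemma cell_energy_Nil [simp]: "cell_energy [] u = energy u u"
  by (simp add: cell_energy_def)

lemma cell_energy_nonneg: "u \<in> form_domain \<Longrightarrow> w \<in> words m \<Longrightarrow> 0 \<le> cell_energy w u"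
  unfolding cell_energy_def using rw_pos[of w]
  by (intro mult_nonneg_nonneg energy_nonneg) (auto intro: form_domain_psi_word simp: less_imp_le words_imp)

lemma energy_eq_sum_cells:
  assumes "u \<in> form_domain"
  shows "energy u u = (\<Sum>w\<in>words m. cell_energy w u)"
proof (rule LIMSEQ_unique)
  show "(\<lambda>n. Em D r (n + m) u u) \<longlonglongrightarrow> energy u u"
    by (intro LIMSEQ_ignore_initial_segment energy_tendsto_self assms)
  have "(\<lambda>n. \<Sum>w\<in>words m. inverse (rw w) * Em D r n (u \<circ> psi_word w) (u \<circ> psi_word w)) \<longlonglongrightarrow> (\<Sum>w\<in>words m. cell_energy w u)"
    unfolding cell_energy_def
    by (intro tendsto_intros energy_tendsto_self form_domain_psi_word[OF assms])
  then show "(\<lambda>n. Em D r (n + m) u u) \<longlonglongrightarrow> (\<Sum>w\<in>words m. cell_energy w u)"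
    by (simp add: add.commute[of _ m] Em_add_level)
qed

lemma cell_energy_append:
  "cell_energy (w @ w') u = inverse (rw w) * cell_energy w' (u \<circ> psi_word w)"
  by (simp add: cell_energy_def psi_word_append o_assoc)

lemma cell_energy_eq_sum:
  assumes "u \<in> form_domain" "w \<in> words n"
  shows "cell_energy w u = (\<Sum>w'\<in>words m. cell_energy (w @ w') u)"
  unfolding cell_energy_append unfolding cell_energy_def[of w]
  by (subst energy_eq_sum_cells[OF form_domain_psi_word[OF assms], of m]) (simp add: sum_distrib_left)

lemma cell_energy_le:
  assumes "u \<in> form_domain" "w \<in> words m"
  shows "cell_energy w u \<le> energy u u"
  unfolding energy_eq_sum_cells[OF assms(1), of m] using assms
  by (intro member_le_sum[where f = "\<lambda>w. cell_energy w u"]) (auto intro: cell_energy_nonneg)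

lemma energy_psi_word:
  assumes "w \<in> words m"
  shows "energy (u \<circ> psi_word w) (u \<circ> psi_word w) = rw w * cell_energy w u"
  using rw_pos[of w] assms by (simp add: cell_energy_def words_imp)

definition rmax :: real where "rmax = Max (r ` S)"

lemma rmax: "0 < rmax" "rmax < 1" "i \<in> S \<Longrightarrow> r i \<le> rmax"
proof -
  have "rmax \<in> r ` S" unfolding rmax_def using finite_S S_nonempty by (intro Max_in) auto
  then show "0 < rmax" "rmax < 1" using r_pos r_less_1 by auto
  show "i \<in> S \<Longrightarrow> r i \<le> rmax" unfolding rmax_def using finite_S by auto
qed

lemma rw_le: "w \<in> words m \<Longrightarrow> rw w \<le> rmax ^ m"
proof (induction m arbitrary: w)
  case (Suc m)
  then obtain i w' where "w = i # w'" "i \<in> S" "w' \<in> words m" by (auto simp: words_Suc)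
  then show ?case
    using Suc.IH[of w'] rmax rw_pos[of w'] by (auto intro!: mult_mono simp: less_imp_le words_imp)
qed (auto simp: words_def)

lemma energy_psi_word_le:
  assumes "u \<in> form_domain" "w \<in> words m"
  shows "energy (u \<circ> psi_word w) (u \<circ> psi_word w) \<le> rmax ^ m * energy u u"
  unfolding energy_psi_word[OF assms(2)]
  using rw_le[OF assms(2)] cell_energy_le[OF assms] cell_energy_nonneg[OF assms] rmax
  by (intro mult_mono) auto

text \<open>Inside a cell this is the Poincare inequality of \<open>V0\<close>; cells are joined
  through common vertices.\<close>

lemma Em1_Poincare_ex:
  "\<exists>C>0. \<forall>u. \<forall>i\<in>S. \<forall>c\<in>V0. \<forall>j\<in>S. \<forall>d\<in>V0. (u (\<psi> i c) - u (\<psi> j d))\<^sup>2 \<le> C * Em D r 1 u u"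
proof -
  have E: "(u (\<psi> i c) - u (\<psi> i d))\<^sup>2 \<le> CP * Em D r 1 u u" if "i \<in> S" "c \<in> V0" "d \<in> V0" for u i c d
  proof -
    have "inverse (rw [i]) * E0 D (u \<circ> psi_word [i]) (u \<circ> psi_word [i]) \<le> Em D r 1 u u"
      using Em_sub_cell[of "[i]" 1 0 u] that by (simp add: words_1 Em_0)
    then have "E0 D (u \<circ> \<psi> i) (u \<circ> \<psi> i) \<le> r i * Em D r 1 u u"
      using r_pos[OF that(1)] by (simp add: psi_word_Cons field_simps)
    also have "\<dots> \<le> 1 * Em D r 1 u u"
      using r_less_1[OF that(1)] by (intro mult_right_mono Em_nonneg) auto
    finally have "CP * E0 D (u \<circ> \<psi> i) (u \<circ> \<psi> i) \<le> CP * Em D r 1 u u"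
      using CP(1) by simp
    then show ?thesis using CP(2)[OF that(2,3), of "u \<circ> \<psi> i"] by simp
  qed
  have ex: "\<exists>C>0. \<forall>u. (u x - u y)\<^sup>2 \<le> C * Em D r 1 u u" if "(x, y) \<in> (link (\<lambda>_. V0))\<^sup>*" for x y
    using that
  proof (induction rule: rtrancl_induct)
    case base
    show ?case by (rule exI[of _ 1]) (auto simp: Em_nonneg)
  next
    case (step y z)
    then obtain C where C: "C > 0" "\<And>u. (u x - u y)\<^sup>2 \<le> C * Em D r 1 u u" by blast
    have "(u x - u z)\<^sup>2 \<le> (2 * C + 2 * CP) * Em D r 1 u u" for u
    proof -
      have "(u x - u z)\<^sup>2 \<le> 2 * (u x - u y)\<^sup>2 + 2 * (u y - u z)\<^sup>2"
        using sum_squares_ge_zero[of "(u x - u y) - (u y - u z)" 0] by (simp add: power2_eq_square algebra_simps)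
      also have "(u y - u z)\<^sup>2 \<le> CP * Em D r 1 u u"
        using step(2) E by (auto simp: link_def)
      finally show ?thesis
        using C(2)[of u] by (simp add: algebra_simps)
    qed
    then show ?case using C(1) CP(1) by (intro exI[of _ "2 * C + 2 * CP"]) auto
  qed
  define X where "X = (\<lambda>(i, c). \<psi> i c) ` (S \<times> V0)"
  have "\<forall>p\<in>X \<times> X. \<exists>C>0. \<forall>u. (u (fst p) - u (snd p))\<^sup>2 \<le> C * Em D r 1 u u"
  proof
    fix p assume "p \<in> X \<times> X"
    then obtain i c j d where "p = (\<psi> i c, \<psi> j d)" "i \<in> S" "c \<in> V0" "j \<in> S" "d \<in> V0"
      by (auto simp: X_def)
    then show "\<exists>C>0. \<forall>u. (u (fst p) - u (snd p))\<^sup>2 \<le> C * Em D r 1 u u"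
      using ex[OF link_connected[of "\<lambda>_. V0" i c j d]] by auto
  qed
  then obtain C where C: "\<And>p. p \<in> X \<times> X \<Longrightarrow> C p > 0 \<and> (\<forall>u. (u (fst p) - u (snd p))\<^sup>2 \<le> C p * Em D r 1 u u)"
    by metis
  have "finite X" by (simp add: X_def finite_S)
  define M where "M = Max (insert 1 (C ` (X \<times> X)))"
  have "M \<ge> 1" using \<open>finite X\<close> by (simp add: M_def)
  moreover have "(u x - u y)\<^sup>2 \<le> M * Em D r 1 u u" if "x \<in> X" "y \<in> X" for u x y
  proof -
    have "(u x - u y)\<^sup>2 \<le> C (x, y) * Em D r 1 u u" using C[of "(x, y)"] that by auto
    also have "C (x, y) \<le> M" using that \<open>finite X\<close> by (auto simp: M_def)
    then have "C (x, y) * Em D r 1 u u \<le> M * Em D r 1 u u" by (intro mult_right_mono Em_nonneg)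
    finally show ?thesis .
  qed
  then have "\<forall>u. \<forall>i\<in>S. \<forall>c\<in>V0. \<forall>j\<in>S. \<forall>d\<in>V0. (u (\<psi> i c) - u (\<psi> j d))\<^sup>2 \<le> M * Em D r 1 u u"
    by (auto simp: X_def)
  ultimately show ?thesis by (intro exI[of _ M]) auto
qed

text \<open>The points \<open>psi_word (prefix \<omega> n) q\<close> along an address of
  \<open>x\<close> tend to \<open>x\<close>. Consecutive ones lie in a common cell of level
  \<open>n\<close>, whose rescaled energy is at most \<open>rmax ^ n * energy u u\<close>, so the
  increments of \<open>u\<close> form a convergent geometric series. This is where all
  \<open>r i\<close> are below 1.\<close>

lemma Sobolev_ex: "\<exists>C>0. \<forall>u\<in>form_domain. \<forall>x\<in>K. \<forall>y\<in>K. \<bar>u x - u y\<bar> \<le> C * sqrt (energy u u)"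
proof -
  obtain C where C: "C > 0" "\<And>u i c j d. i \<in> S \<Longrightarrow> c \<in> V0 \<Longrightarrow> j \<in> S \<Longrightarrow> d \<in> V0 \<Longrightarrow>
      (u (\<psi> i c) - u (\<psi> j d))\<^sup>2 \<le> C * Em D r 1 u u"
    using Em1_Poincare_ex by blast
  obtain q where q: "q \<in> V0" using V0_nonempty by auto
  obtain j d where jd: "j \<in> S" "d \<in> V0" "q = \<psi> j d" using q by (rule V0_subset_V1)
  have qK: "q \<in> K" using q V0_subset by auto
  define \<rho> where "\<rho> = sqrt rmax"
  have \<rho>: "0 < \<rho>" "\<rho> < 1" using rmax by (auto simp: \<rho>_def)
  define C' where "C' = sqrt C / (1 - \<rho>)"
  have C': "C' > 0" using C(1) \<rho> by (simp add: C'_def)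
  have main: "\<bar>u q - u x\<bar> \<le> C' * sqrt (energy u u)" if u: "u \<in> form_domain" and x: "x \<in> K" for u x
  proof -
    obtain \<omega> where \<omega>: "\<omega> \<in> UNIV \<rightarrow> S" "x = \<pi> \<omega>" using x by (rule pi_obtain)
    define a where "a n = psi_word (prefix \<omega> n) q" for n
    have step: "\<bar>u (a n) - u (a (Suc n))\<bar> \<le> sqrt C * sqrt (energy u u) * \<rho> ^ n" for n
    proof -
      let ?g = "u \<circ> psi_word (prefix \<omega> n)"
      have g: "?g \<in> form_domain" using u prefix_words[OF \<omega>(1)] by (rule form_domain_psi_word)
      have "(?g (\<psi> j d) - ?g (\<psi> (\<omega> n) q))\<^sup>2 \<le> C * Em D r 1 ?g ?g"
        using jd q \<omega> by (intro C(2)) auto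
      also have "\<dots> \<le> C * energy ?g ?g"
        using C(1) Em_le_energy[OF g] by (intro mult_left_mono) auto
      also have "\<dots> \<le> C * (rmax ^ n * energy u u)"
        using C(1) energy_psi_word_le[OF u prefix_words[OF \<omega>(1)]] by (intro mult_left_mono) auto
      finally have "sqrt ((?g (\<psi> j d) - ?g (\<psi> (\<omega> n) q))\<^sup>2) \<le> sqrt (C * (rmax ^ n * energy u u))"
        by (rule real_sqrt_le_mono)
      then have "\<bar>u (a n) - u (a (Suc n))\<bar> \<le> sqrt (C * (rmax ^ n * energy u u))"
        by (simp add: a_def jd(3) prefix_Suc psi_word_snoc)
      then show ?thesis
        by (simp add: real_sqrt_mult real_sqrt_power \<rho>_def mult_ac)
    qed
    have part: "\<bar>u q - u (a n)\<bar> \<le> C' * sqrt (energy u u)" for n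
    proof -
      have "\<bar>u q - u (a n)\<bar> \<le> (\<Sum>k<n. sqrt C * sqrt (energy u u) * \<rho> ^ k)"
      proof (induction n)
        case (Suc n)
        then show ?case using step[of n] by simp
      qed (simp add: a_def)
      also have "\<dots> = sqrt C * sqrt (energy u u) * (\<Sum>k<n. \<rho> ^ k)"
        by (simp add: sum_distrib_left)
      also have "(\<Sum>k<n. \<rho> ^ k) \<le> 1 / (1 - \<rho>)"
        using \<rho> by (simp add: sum_gp_strict divide_right_mono)
      then have "sqrt C * sqrt (energy u u) * (\<Sum>k<n. \<rho> ^ k) \<le> sqrt C * sqrt (energy u u) * (1 / (1 - \<rho>))"
        using C(1) energy_nonneg[OF u] by (intro mult_left_mono) auto
      finally show ?thesis by (simp add: C'_def mult_ac)
    qed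
    show ?thesis
    proof (rule field_le_epsilon)
      fix \<epsilon> :: real assume "\<epsilon> > 0"
      from uniform_on_cells[OF form_domain_continuous[OF u] this] obtain n where
        n: "\<forall>w\<in>words n. \<forall>x\<in>K. \<forall>y\<in>K. dist (u (psi_word w x)) (u (psi_word w y)) < \<epsilon>" by blast
      have "(\<lambda>k. \<omega> (k + n)) \<in> UNIV \<rightarrow> S" using \<omega>(1) by auto
      then have "\<pi> (\<lambda>k. \<omega> (k + n)) \<in> K" by (rule pi_in_K)
      then have "dist (u (a n)) (u x) < \<epsilon>"
        using n prefix_words[OF \<omega>(1), of n] qK pi_prefix[OF \<omega>(1), of n] by (simp add: a_def \<omega>(2))
      then show "\<bar>u q - u x\<bar> \<le> C' * sqrt (energy u u) + \<epsilon>"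
        using part[of n] by (simp add: dist_real_def)
    qed
  qed
  have "\<bar>u x - u y\<bar> \<le> 2 * C' * sqrt (energy u u)" if "u \<in> form_domain" "x \<in> K" "y \<in> K" for u x y
    using main[OF that(1,2)] main[OF that(1,3)] by simp
  then show ?thesis using C' by (intro exI[of _ "2 * C'"]) auto
qed

definition CS :: real where
  "CS = (SOME C. C > 0 \<and> (\<forall>u\<in>form_domain. \<forall>x\<in>K. \<forall>y\<in>K. \<bar>u x - u y\<bar> \<le> C * sqrt (energy u u)))"

lemma CS: "CS > 0" "u \<in> form_domain \<Longrightarrow> x \<in> K \<Longrightarrow> y \<in> K \<Longrightarrow> \<bar>u x - u y\<bar> \<le> CS * sqrt (energy u u)"
  using someI_ex[OF Sobolev_ex] unfolding CS_def by blast+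

lemma energy_eq_0: "u \<in> form_domain \<Longrightarrow> energy u u = 0 \<Longrightarrow> x \<in> K \<Longrightarrow> y \<in> K \<Longrightarrow> u x = u y"
  using CS(2)[of u x y] by simp

text \<open>A point of \<open>K\<close> has several representations only at common vertices of
  cells, where the pieces agree. Continuity is read off on small cells, and the energies of the
  pieces add up with weights \<open>inverse (r i)\<close>.\<close>

lemma glue:
  fixes u :: "'s \<Rightarrow> 'a \<Rightarrow> real"
  assumes u: "\<And>i. i \<in> S \<Longrightarrow> u i \<in> form_domain"
    and compat: "\<And>i j c d. i \<in> S \<Longrightarrow> j \<in> S \<Longrightarrow> c \<in> V0 \<Longrightarrow> d \<in> V0 \<Longrightarrow> \<psi> i c = \<psi> j d \<Longrightarrow> u i c = u j d"
  obtains U where "U \<in> form_domain" "\<And>i x. i \<in> S \<Longrightarrow> x \<in> K \<Longrightarrow> U (\<psi> i x) = u i x"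
proof -
  define sel where "sel x = (SOME p. fst p \<in> S \<and> snd p \<in> K \<and> x = \<psi> (fst p) (snd p))" for x
  define U where "U x = u (fst (sel x)) (snd (sel x))" for x
  have U: "U (\<psi> i x) = u i x" if "i \<in> S" "x \<in> K" for i x
  proof -
    have "\<exists>p. fst p \<in> S \<and> snd p \<in> K \<and> \<psi> i x = \<psi> (fst p) (snd p)"
      using that by (intro exI[of _ "(i, x)"]) auto
    from someI_ex[OF this] have s: "fst (sel (\<psi> i x)) \<in> S" "snd (sel (\<psi> i x)) \<in> K"
      "\<psi> i x = \<psi> (fst (sel (\<psi> i x))) (snd (sel (\<psi> i x)))"
      unfolding sel_def by blast+
    show ?thesis
    proof (cases "i = fst (sel (\<psi> i x))")
      case True
      then have "x = snd (sel (\<psi> i x))"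
        using s(3) psi_eq_iff[OF that(1,2) s(2)] by metis
      then show ?thesis using True by (simp add: U_def)
    next
      case False
      then have "x \<in> V0" "snd (sel (\<psi> i x)) \<in> V0"
        using cell_meet[of i "fst (sel (\<psi> i x))" x "snd (sel (\<psi> i x))"]
          cell_meet[of "fst (sel (\<psi> i x))" i "snd (sel (\<psi> i x))" x] s that by auto
      then show ?thesis
        using compat[OF that(1) s(1) _ _ s(3)] by (simp add: U_def)
    qed
  qed
  have "U \<in> form_domain"
  proof (rule form_domainI)
    show "continuous_on K U"
    proof (rule continuous_on_cellwise)
      fix \<epsilon> :: real assume e: "\<epsilon> > 0"
      have "\<forall>i\<in>S. \<exists>n0. \<forall>n\<ge>n0. \<forall>w\<in>words n. \<forall>x\<in>K. \<forall>y\<in>K. dist (u i (psi_word w x)) (u i (psi_word w y)) < \<epsilon>"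
        using u e by (intro ballI uniform_on_cells_ge form_domain_continuous)
      then obtain n0 where n0: "\<And>i n w x y. i \<in> S \<Longrightarrow> n \<ge> n0 i \<Longrightarrow> w \<in> words n \<Longrightarrow> x \<in> K \<Longrightarrow> y \<in> K \<Longrightarrow>
          dist (u i (psi_word w x)) (u i (psi_word w y)) < \<epsilon>" by metis
      define n where "n = Max (n0 ` S)"
      have n: "n0 i \<le> n" if "i \<in> S" for i using that finite_S by (auto simp: n_def)
      have "dist (U (psi_word w x)) (U (psi_word w y)) < \<epsilon>" if w: "w \<in> words (Suc n)" "x \<in> K" "y \<in> K" for w x y
      proof -
        obtain i w' where "w = i # w'" "i \<in> S" "w' \<in> words n" using w(1) by (auto simp: words_Suc)
        then show ?thesis using n0[OF _ n, of i w' x y] U w by (simp add: psi_word_Cons psi_word_in_K words_imp)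
      qed
      then show "\<exists>n. \<forall>w\<in>words n. \<forall>x\<in>K. \<forall>y\<in>K. dist (U (psi_word w x)) (U (psi_word w y)) < \<epsilon>" by blast
    qed
    fix m
    have "Em D r m U U \<le> Em D r (1 + m) U U" by (rule Em_mono) simp
    also have "\<dots> = (\<Sum>w\<in>words 1. inverse (rw w) * Em D r m (U \<circ> psi_word w) (U \<circ> psi_word w))"
      by (rule Em_add_level)
    also have "\<dots> = (\<Sum>i\<in>S. inverse (r i) * Em D r m (U \<circ> \<psi> i) (U \<circ> \<psi> i))"
      by (simp add: words_1 sum.reindex inj_on_def psi_word_Cons)
    also have "\<dots> = (\<Sum>i\<in>S. inverse (r i) * Em D r m (u i) (u i))"
      using U by (intro sum.cong refl arg_cong2[where f = "(*)"] Em_cong_K) auto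
    also have "\<dots> \<le> (\<Sum>i\<in>S. inverse (r i) * energy (u i) (u i))"
      using u r_pos by (intro sum_mono mult_left_mono Em_le_energy) (auto simp: less_imp_le)
    finally show "Em D r m U U \<le> (\<Sum>i\<in>S. inverse (r i) * energy (u i) (u i))" .
  qed
  then show ?thesis using U that by blast
qed

end

section \<open>Harmonic extension when all boundary vertices are fixed points\<close>

locale fixed_vertex_structure = regular_harmonic_structure K S \<psi> \<pi> D r
  for K :: "'a::metric_space set" and S :: "'s set" and \<psi> \<pi> D r +
  assumes V0_fixpt: "\<And>p. p \<in> V0 \<Longrightarrow> \<exists>i\<in>S. p = fixpt i"
begin

text \<open>A point of \<open>V0\<close> is some \<open>fixpt i\<close> and has the constant word
  \<open>i\<close> as its only address, which determines both the letter \<open>j\<close> and the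
  address of \<open>x\<close>.\<close>

lemma psi_in_V0:
  assumes "\<psi> j x \<in> V0" "j \<in> S" "x \<in> K"
  shows "x = \<psi> j x \<and> fixpt j = x"
proof -
  obtain i where i: "i \<in> S" "\<psi> j x = fixpt i" using V0_fixpt assms by metis
  obtain \<omega> where \<omega>: "\<omega> \<in> UNIV \<rightarrow> S" "x = \<pi> \<omega>" using assms(3) by (rule pi_obtain)
  then have "\<pi> (case_nat j \<omega>) = fixpt i" using pi_conj assms i by metis
  moreover have "case_nat j \<omega> \<in> UNIV \<rightarrow> S" using assms \<omega> by (auto simp: Pi_iff split: nat.split)
  ultimately have eq: "case_nat j \<omega> = (\<lambda>_. i)" using pi_eq_fixpt i by blast
  from fun_cong[OF this, of 0] have "j = i" by simp
  moreover have "\<omega> n = i" for n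
    using fun_cong[OF eq, of "Suc n"] by simp
  then have "\<omega> = (\<lambda>_. i)" by blast
  ultimately show ?thesis using \<omega> i by (simp add: fixpt_eq)
qed

text \<open>The restriction of the discrete harmonic extension to the cell \<open>i\<close>. It is
  the operator \<open>A i\<close> in a form available before harmonic functions on \<open>K\<close>
  are constructed; \<open>A_eq_B\<close> identifies the two.\<close>

definition B :: "'s \<Rightarrow> ('a \<Rightarrow> real) \<Rightarrow> 'a \<Rightarrow> real" where
  "B i u = ext1 u \<circ> \<psi> i"

fun Bw :: "'s list \<Rightarrow> ('a \<Rightarrow> real) \<Rightarrow> 'a \<Rightarrow> real" where
  "Bw [] u = u"
| "Bw (i # w) u = Bw w (B i u)"

lemma Bw_append: "Bw (w @ w') u = Bw w' (Bw w u)"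
  by (induction w arbitrary: u) auto

lemma B_cong: "(\<And>q. q \<in> V0 \<Longrightarrow> u q = v q) \<Longrightarrow> i \<in> S \<Longrightarrow> q \<in> V0 \<Longrightarrow> B i u q = B i v q"
  unfolding B_def o_def by (rule ext1_cong)

lemma Bw_cong: "(\<And>q. q \<in> V0 \<Longrightarrow> u q = v q) \<Longrightarrow> set w \<subseteq> S \<Longrightarrow> q \<in> V0 \<Longrightarrow> Bw w u q = Bw w v q"
proof (induction w arbitrary: u v)
  case (Cons i w)
  have "B i u q = B i v q" if "q \<in> V0" for q
    using Cons.prems(2) that by (intro B_cong[OF Cons.prems(1)]) auto
  then show ?case using Cons.IH[of "B i u" "B i v"] Cons.prems by simp
qed simp

text \<open>The Gauss-Green formula for \<open>ext1\<close>, split over the cells of level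
  1.\<close>

lemma E0_B_sum: "(\<Sum>i\<in>S. inverse (r i) * E0 D (B i u) (\<phi> \<circ> \<psi> i)) = E0 D u \<phi>"
  unfolding Em_ext1_left[of u \<phi>, symmetric]
  by (simp add: Em_def words_1 sum.reindex inj_on_def psi_word_Cons B_def)

lemma E0_B_le:
  assumes "i \<in> S" shows "E0 D (B i u) (B i u) \<le> r i * E0 D u u"
proof -
  have "inverse (r i) * E0 D (B i u) (B i u) \<le> (\<Sum>i\<in>S. inverse (r i) * E0 D (B i u) (B i u))"
    using assms finite_S r_pos
    by (intro member_le_sum[where f = "\<lambda>i. inverse (r i) * E0 D (B i u) (B i u)"])
      (auto intro!: mult_nonneg_nonneg E0_nonneg simp: less_imp_le)
  also have "\<dots> = E0 D u u"
    using E0_B_sum[of u "ext1 u"] E0_cong[of u u "ext1 u" u D] by (simp add: B_def ext1_V0)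
  finally show ?thesis using r_pos[OF assms] by (simp add: field_simps)
qed

lemma E0_Bw_le: "set w \<subseteq> S \<Longrightarrow> E0 D (Bw w u) (Bw w u) \<le> rw w * E0 D u u"
proof (induction w arbitrary: u)
  case (Cons i w)
  then have "E0 D (Bw w (B i u)) (Bw w (B i u)) \<le> rw w * E0 D (B i u) (B i u)" by auto
  also have "\<dots> \<le> rw w * (r i * E0 D u u)"
    using Cons.prems rw_pos[of w] by (intro mult_left_mono E0_B_le) (auto simp: less_imp_le)
  finally show ?case by (simp add: mult_ac)
qed simp

lemma Bw_osc:
  assumes "w \<in> words n" "a \<in> V0" "b \<in> V0"
  shows "\<bar>Bw w u a - Bw w u b\<bar> \<le> sqrt (CP * E0 D u u) * sqrt rmax ^ n"
proof -
  have "(Bw w u a - Bw w u b)\<^sup>2 \<le> CP * E0 D (Bw w u) (Bw w u)" using assms by (intro CP) auto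
  also have "\<dots> \<le> CP * (rw w * E0 D u u)"
    using assms CP(1) by (intro mult_left_mono E0_Bw_le) (auto simp: words_imp)
  also have "\<dots> \<le> CP * (rmax ^ n * E0 D u u)"
    using assms CP(1) rw_le by (intro mult_left_mono mult_right_mono E0_nonneg) auto
  finally have "sqrt ((Bw w u a - Bw w u b)\<^sup>2) \<le> sqrt (CP * (rmax ^ n * E0 D u u))"
    by (rule real_sqrt_le_mono)
  then have "\<bar>Bw w u a - Bw w u b\<bar> \<le> sqrt (CP * (rmax ^ n * E0 D u u))" by simp
  then show ?thesis by (simp add: real_sqrt_mult real_sqrt_power mult_ac)
qed

lemma B_bounds:
  assumes "\<And>q. q \<in> V0 \<Longrightarrow> a \<le> u q" "\<And>q. q \<in> V0 \<Longrightarrow> u q \<le> b"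
  shows "a \<le> B i u x" "B i u x \<le> b"
proof -
  have "a \<le> Min (u ` V0)" "Max (u ` V0) \<le> b" using assms V0_nonempty by auto
  then show "a \<le> B i u x" "B i u x \<le> b"
    using ext1_ge[of u "\<psi> i x"] ext1_le[of u "\<psi> i x"] by (auto simp: B_def)
qed

lemma Bw_bounds:
  assumes "\<And>q. q \<in> V0 \<Longrightarrow> a \<le> u q" "\<And>q. q \<in> V0 \<Longrightarrow> u q \<le> b" "q \<in> V0"
  shows "a \<le> Bw w u q \<and> Bw w u q \<le> b"
  using assms
proof (induction w arbitrary: u)
  case (Cons i w)
  then show ?case using B_bounds[of a u b] by auto
qed auto

text \<open>The harmonic extension is built on addresses, as the limit of vertex values over
  shrinking cells; by \<open>L_tendsto\<close> the choice of the vertex is immaterial.\<close>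

definition L :: "('a \<Rightarrow> real) \<Rightarrow> (nat \<Rightarrow> 's) \<Rightarrow> real" where
  "L u \<omega> = lim (\<lambda>n. Bw (prefix \<omega> n) u (SOME q. q \<in> V0))"

lemma prefix_add: "prefix \<omega> (m + n) = prefix \<omega> m @ prefix (\<lambda>k. \<omega> (k + m)) n"
  by (induction n) (simp_all add: prefix_Suc add.commute[of _ m])

text \<open>By the maximum principle all later values stay between the extreme vertex values in the
  cell \<open>prefix \<omega> n\<close>, whose spread is bounded by \<open>Bw_osc\<close>.\<close>

lemma Bw_prefix_between:
  assumes "\<omega> \<in> UNIV \<rightarrow> S" "m \<ge> n" "a \<in> V0" "b \<in> V0"
  shows "\<bar>Bw (prefix \<omega> m) u a - Bw (prefix \<omega> n) u b\<bar> \<le> sqrt (CP * E0 D u u) * sqrt rmax ^ n"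
proof -
  let ?e = "sqrt (CP * E0 D u u) * sqrt rmax ^ n" and ?g = "Bw (prefix \<omega> n) u"
  have "?g b - ?e \<le> ?g q" "?g q \<le> ?g b + ?e" if "q \<in> V0" for q
    using Bw_osc[OF prefix_words[OF assms(1), of n] that assms(4), of u] by auto
  then have "?g b - ?e \<le> Bw (prefix (\<lambda>k. \<omega> (k + n)) (m - n)) ?g a \<and>
      Bw (prefix (\<lambda>k. \<omega> (k + n)) (m - n)) ?g a \<le> ?g b + ?e"
    using assms by (intro Bw_bounds) auto
  then show ?thesis using assms(2) prefix_add[of \<omega> n "m - n"] by (simp add: Bw_append abs_le_iff)
qed

lemma osc_tendsto_0: "(\<lambda>n. sqrt (CP * E0 D u u) * sqrt rmax ^ n) \<longlonglongrightarrow> 0"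
  using rmax by (intro tendsto_mult_right_zero LIMSEQ_realpow_zero) auto

lemma L_tendsto:
  assumes "\<omega> \<in> UNIV \<rightarrow> S" "q \<in> V0"
  shows "(\<lambda>n. Bw (prefix \<omega> n) u q) \<longlonglongrightarrow> L u \<omega>"
proof -
  let ?q0 = "SOME q. q \<in> V0"
  have q0: "?q0 \<in> V0" using V0_nonempty some_in_eq by blast
  have "Cauchy (\<lambda>n. Bw (prefix \<omega> n) u ?q0)"
  proof (rule CauchyI')
    fix e :: real assume "e > 0"
    then obtain N where N: "\<And>n. n \<ge> N \<Longrightarrow> sqrt (CP * E0 D u u) * sqrt rmax ^ n < e"
      using order_tendstoD(2)[OF osc_tendsto_0[of u], of e] by (auto simp: eventually_sequentially)
    have "dist (Bw (prefix \<omega> m) u ?q0) (Bw (prefix \<omega> n) u ?q0) < e" if "m \<ge> N" "n > m" for m n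
      using Bw_prefix_between[OF assms(1), of m n ?q0 ?q0 u] q0 N[of m] that
      by (simp add: dist_real_def abs_minus_commute)
    then show "\<exists>M. \<forall>m\<ge>M. \<forall>n>m. dist (Bw (prefix \<omega> m) u ?q0) (Bw (prefix \<omega> n) u ?q0) < e" by blast
  qed
  then have 1: "(\<lambda>n. Bw (prefix \<omega> n) u ?q0) \<longlonglongrightarrow> L u \<omega>"
    unfolding L_def by (simp add: Cauchy_convergent_iff convergent_LIMSEQ_iff)
  have "(\<lambda>n. Bw (prefix \<omega> n) u q - Bw (prefix \<omega> n) u ?q0) \<longlonglongrightarrow> 0"
    using Bw_osc[OF prefix_words[OF assms(1)] assms(2) q0]
    by (intro Lim_null_comparison[OF _ osc_tendsto_0[of u]]) auto
  from tendsto_add[OF this 1] show ?thesis by simp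
qed

lemma L_bounds:
  assumes "\<And>q. q \<in> V0 \<Longrightarrow> a \<le> u q" "\<And>q. q \<in> V0 \<Longrightarrow> u q \<le> b" "\<omega> \<in> UNIV \<rightarrow> S"
  shows "a \<le> L u \<omega>" "L u \<omega> \<le> b"
proof -
  obtain q where q: "q \<in> V0" using V0_nonempty by auto
  have "a \<le> Bw (prefix \<omega> n) u q \<and> Bw (prefix \<omega> n) u q \<le> b" for n
    using assms q by (intro Bw_bounds) auto
  then show "a \<le> L u \<omega>" "L u \<omega> \<le> b"
    using L_tendsto[OF assms(3) q, of u] by (auto intro: LIMSEQ_le_const LIMSEQ_le_const2)
qed

lemma L_prefix:
  assumes "\<omega> \<in> UNIV \<rightarrow> S"
  shows "L u \<omega> = L (Bw (prefix \<omega> n) u) (\<lambda>k. \<omega> (k + n))"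
proof -
  obtain q where q: "q \<in> V0" using V0_nonempty by auto
  have "(\<lambda>k. \<omega> (k + n)) \<in> UNIV \<rightarrow> S" using assms by auto
  from L_tendsto[OF this q, of "Bw (prefix \<omega> n) u"]
  have "(\<lambda>m. Bw (prefix \<omega> (m + n)) u q) \<longlonglongrightarrow> L (Bw (prefix \<omega> n) u) (\<lambda>k. \<omega> (k + n))"
    by (simp add: add.commute[of _ n] prefix_add Bw_append)
  moreover have "(\<lambda>m. Bw (prefix \<omega> (m + n)) u q) \<longlonglongrightarrow> L u \<omega>"
    by (intro LIMSEQ_ignore_initial_segment L_tendsto assms q)
  ultimately show ?thesis by (rule LIMSEQ_unique[symmetric])
qed

lemma B_fixpt: "i \<in> S \<Longrightarrow> fixpt i \<in> V0 \<Longrightarrow> B i u (fixpt i) = u (fixpt i)"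
  by (simp add: B_def psi_fixpt ext1_V0)

lemma Bw_fixpt: "i \<in> S \<Longrightarrow> fixpt i \<in> V0 \<Longrightarrow> Bw (replicate n i) u (fixpt i) = u (fixpt i)"
  by (induction n arbitrary: u) (auto simp: B_fixpt)

lemma L_vertex:
  assumes "\<omega> \<in> UNIV \<rightarrow> S" "\<pi> \<omega> \<in> V0"
  shows "L u \<omega> = u (\<pi> \<omega>)"
proof -
  obtain i where i: "i \<in> S" "\<pi> \<omega> = fixpt i" using V0_fixpt assms by metis
  then have "\<omega> = (\<lambda>_. i)" using pi_eq_fixpt assms by blast
  then have "(\<lambda>n. u (\<pi> \<omega>)) \<longlonglongrightarrow> L u \<omega>"
    using L_tendsto[OF assms, of u] Bw_fixpt[of i _ u] i assms by simp
  then show ?thesis by (simp add: LIMSEQ_const_iff)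
qed

text \<open>At the first position \<open>n\<close> where the addresses differ, the tails after it
  are points of \<open>V0\<close> by \<open>cell_meet\<close>, and both limits are the value of the
  one function \<open>ext1 (Bw (prefix \<omega> n) u)\<close> at the same point.\<close>

lemma L_eq:
  assumes "\<omega> \<in> UNIV \<rightarrow> S" "\<omega>' \<in> UNIV \<rightarrow> S" "\<pi> \<omega> = \<pi> \<omega>'"
  shows "L u \<omega> = L u \<omega>'"
proof (cases "\<omega> = \<omega>'")
  case False
  then obtain k where "\<omega> k \<noteq> \<omega>' k" by auto
  define n where "n = (LEAST k. \<omega> k \<noteq> \<omega>' k)"
  have n: "\<omega> n \<noteq> \<omega>' n" unfolding n_def using \<open>\<omega> k \<noteq> \<omega>' k\<close> by (rule LeastI)
  have "\<omega> k = \<omega>' k" if "k < n" for k using that not_less_Least n_def by blast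
  then have pre: "prefix \<omega> n = prefix \<omega>' n" by (auto simp: prefix_def)
  have sh: "(\<lambda>k. \<eta> (k + m)) \<in> UNIV \<rightarrow> S" if "\<eta> \<in> UNIV \<rightarrow> S" for \<eta> m using that by auto
  define y where "y = \<pi> (\<lambda>k. \<omega> (k + Suc n))"
  define y' where "y' = \<pi> (\<lambda>k. \<omega>' (k + Suc n))"
  have yK: "y \<in> K" "y' \<in> K" unfolding y_def y'_def by (intro pi_in_K sh assms)+
  have xK: "\<pi> (\<lambda>k. \<omega> (k + n)) \<in> K" "\<pi> (\<lambda>k. \<omega>' (k + n)) \<in> K" by (intro pi_in_K sh assms)+
  have "\<pi> (\<lambda>k. \<omega> (k + n)) = \<pi> (\<lambda>k. \<omega>' (k + n))"
    using pi_prefix[OF assms(1), of n] pi_prefix[OF assms(2), of n] assms(3) pre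
      psi_word_eq_iff[OF words_imp[OF prefix_words[OF assms(1), of n]] xK] by simp
  moreover have "\<pi> (\<lambda>k. \<eta> (k + n)) = \<psi> (\<eta> n) (\<pi> (\<lambda>k. \<eta> (k + Suc n)))" if "\<eta> \<in> UNIV \<rightarrow> S" for \<eta>
    using pi_decomp[OF sh[OF that, of n]] by simp
  ultimately have eq: "\<psi> (\<omega> n) y = \<psi> (\<omega>' n) y'"
    using assms by (simp add: y_def y'_def)
  have S: "\<omega> n \<in> S" "\<omega>' n \<in> S" using assms by auto
  have V: "y \<in> V0" "y' \<in> V0"
    using cell_meet[OF S n yK eq] cell_meet[OF S(2,1) n[symmetric] yK(2,1) eq[symmetric]] by auto
  have "L u \<eta> = ext1 (Bw (prefix \<eta> n) u) (\<psi> (\<eta> n) (\<pi> (\<lambda>k. \<eta> (k + Suc n))))"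
    if "\<eta> \<in> UNIV \<rightarrow> S" "\<pi> (\<lambda>k. \<eta> (k + Suc n)) \<in> V0" for \<eta>
    using L_prefix[OF that(1), of u "Suc n"] L_vertex[OF sh[OF that(1), of "Suc n"] that(2)]
    by (simp add: prefix_Suc Bw_append B_def)
  then show ?thesis using assms V pre eq by (simp add: y_def y'_def)
qed simp

definition H :: "('a \<Rightarrow> real) \<Rightarrow> 'a \<Rightarrow> real" where
  "H u x = L u (SOME \<omega>. \<omega> \<in> UNIV \<rightarrow> S \<and> \<pi> \<omega> = x)"

lemma H_pi:
  assumes "\<omega> \<in> UNIV \<rightarrow> S" shows "H u (\<pi> \<omega>) = L u \<omega>"
proof -
  have "\<exists>\<omega>'. \<omega>' \<in> UNIV \<rightarrow> S \<and> \<pi> \<omega>' = \<pi> \<omega>" using assms by blast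
  from someI_ex[OF this] show ?thesis unfolding H_def using L_eq assms by blast
qed

lemma H_V0 [simp]: "q \<in> V0 \<Longrightarrow> H u q = u q"
proof -
  assume q: "q \<in> V0"
  then obtain \<omega> where "\<omega> \<in> UNIV \<rightarrow> S" "q = \<pi> \<omega>" using V0_subset pi_obtain by blast
  then show "H u q = u q" using H_pi L_vertex q by auto
qed

lemma H_bounds:
  assumes "\<And>q. q \<in> V0 \<Longrightarrow> a \<le> u q" "\<And>q. q \<in> V0 \<Longrightarrow> u q \<le> b" "x \<in> K"
  shows "a \<le> H u x" "H u x \<le> b"
proof -
  obtain \<omega> where \<omega>: "\<omega> \<in> UNIV \<rightarrow> S" "x = \<pi> \<omega>" using assms(3) by (rule pi_obtain)
  show "a \<le> H u x" "H u x \<le> b" using L_bounds[OF assms(1,2) \<omega>(1)] H_pi[OF \<omega>(1)] \<omega>(2) by auto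
qed

lemma H_psi:
  assumes "i \<in> S" "x \<in> K" shows "H u (\<psi> i x) = H (B i u) x"
proof -
  obtain \<omega> where \<omega>: "\<omega> \<in> UNIV \<rightarrow> S" "x = \<pi> \<omega>" using assms(2) by (rule pi_obtain)
  have c: "case_nat i \<omega> \<in> UNIV \<rightarrow> S" using assms \<omega> by (auto simp: Pi_iff split: nat.split)
  show ?thesis
    using H_pi[OF c, of u] H_pi[OF \<omega>(1), of "B i u"] L_prefix[OF c, of u 1] pi_conj[OF assms(1) \<omega>(1)] \<omega>(2)
    by (simp add: prefix_Suc)
qed

lemma H_psi_word: "set w \<subseteq> S \<Longrightarrow> x \<in> K \<Longrightarrow> H u (psi_word w x) = H (Bw w u) x"
  by (induction w arbitrary: u) (auto simp: psi_word_Cons H_psi psi_word_in_K)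

lemma B_eq_H: "i \<in> S \<Longrightarrow> q \<in> V0 \<Longrightarrow> B i u q = H u (\<psi> i q)"
  using V0_subset by (subst H_psi) auto

lemma H_cong:
  assumes "\<And>q. q \<in> V0 \<Longrightarrow> u q = v q" "x \<in> K" shows "H u x = H v x"
proof -
  obtain \<omega> where \<omega>: "\<omega> \<in> UNIV \<rightarrow> S" "x = \<pi> \<omega>" using assms(2) by (rule pi_obtain)
  obtain q where q: "q \<in> V0" using V0_nonempty by auto
  have "Bw (prefix \<omega> n) u q = Bw (prefix \<omega> n) v q" for n
    using assms q prefix_words[OF \<omega>(1), of n] by (intro Bw_cong) (auto dest: words_imp)
  then have "L u \<omega> = L v \<omega>"
    using L_tendsto[OF \<omega>(1) q, of u] L_tendsto[OF \<omega>(1) q, of v] LIMSEQ_unique by auto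
  then show ?thesis using H_pi[OF \<omega>(1)] \<omega>(2) by simp
qed

lemma H_psi_word': "set w \<subseteq> S \<Longrightarrow> x \<in> K \<Longrightarrow> H u (psi_word w x) = H (H u \<circ> psi_word w) x"
  unfolding H_psi_word using V0_subset by (intro H_cong) (auto simp: H_psi_word)

lemma H_continuous: "continuous_on K (H u)"
proof (rule continuous_on_cellwise)
  fix \<epsilon> :: real assume "\<epsilon> > 0"
  then have "eventually (\<lambda>n. sqrt (CP * E0 D u u) * sqrt rmax ^ n < \<epsilon> / 2) sequentially"
    by (intro order_tendstoD(2)[OF osc_tendsto_0[of u]]) simp
  then obtain n where n: "sqrt (CP * E0 D u u) * sqrt rmax ^ n < \<epsilon> / 2"
    by (auto simp: eventually_sequentially)
  have "dist (H u (psi_word w x)) (H u (psi_word w y)) < \<epsilon>" if w: "w \<in> words n" "x \<in> K" "y \<in> K" for w x y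
  proof -
    obtain q where q: "q \<in> V0" using V0_nonempty by auto
    let ?e = "sqrt (CP * E0 D u u) * sqrt rmax ^ n"
    have "Bw w u q - ?e \<le> Bw w u a" "Bw w u a \<le> Bw w u q + ?e" if "a \<in> V0" for a
      using Bw_osc[OF w(1) that q, of u] by auto
    then have "Bw w u q - ?e \<le> H (Bw w u) x \<and> H (Bw w u) x \<le> Bw w u q + ?e" if "x \<in> K" for x
      using H_bounds that by blast
    from this[OF w(2)] this[OF w(3)] n show ?thesis
      using w by (simp add: dist_real_def H_psi_word words_imp abs_if)
  qed
  then show "\<exists>n. \<forall>w\<in>words n. \<forall>x\<in>K. \<forall>y\<in>K. dist (H u (psi_word w x)) (H u (psi_word w y)) < \<epsilon>" by blast
qed

text \<open>Passing to the next level is \<open>E0_B_sum\<close>, so the energy paired with an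
  arbitrary \<open>\<phi>\<close> does not depend on the level.\<close>

lemma Em_H: "Em D r m (H u) \<phi> = E0 D u \<phi>"
proof (induction m arbitrary: u \<phi>)
  case 0
  then show ?case by (auto simp: Em_0 intro!: E0_cong)
next
  case (Suc m)
  have "Em D r (1 + m) (H u) \<phi> = (\<Sum>i\<in>S. inverse (r i) * Em D r m (H u \<circ> \<psi> i) (\<phi> \<circ> \<psi> i))"
    by (simp only: Em_add_level) (simp add: words_1 sum.reindex inj_on_def psi_word_Cons)
  also have "\<dots> = (\<Sum>i\<in>S. inverse (r i) * Em D r m (H (B i u)) (\<phi> \<circ> \<psi> i))"
    by (intro sum.cong refl arg_cong2[where f = "(*)"] Em_cong_K) (auto simp: H_psi)
  also have "\<dots> = E0 D u \<phi>" by (simp only: Suc E0_B_sum)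
  finally show ?case by simp
qed

lemma H_form_domain: "H u \<in> form_domain"
  by (rule form_domainI[OF H_continuous, of u "E0 D u u"])
    (auto simp: Em_H intro!: order_eq_refl E0_cong)

lemma energy_H: "energy (H u) \<phi> = E0 D u \<phi>"
  unfolding energy_def by (simp add: Em_H lim_const)

lemma energy_H_self: "energy (H u) (H u) = E0 D u u"
  unfolding energy_H by (rule E0_cong) auto

text \<open>The mixed energy of \<open>f\<close> and \<open>H u\<close> depends on the boundary
  values of \<open>f\<close> only, which makes the energy of the difference nonpositive.\<close>

lemma H_unique:
  assumes f: "f \<in> form_domain" and "energy f f \<le> E0 D u u" "\<And>q. q \<in> V0 \<Longrightarrow> f q = u q" "x \<in> K"
  shows "f x = H u x"
proof -
  let ?d = "\<lambda>x. 1 * f x + (-1) * H u x"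
  have d: "?d \<in> form_domain" using f H_form_domain by (rule form_domain_lin_comb)
  have "energy f (H u) = E0 D u u"
    unfolding energy_sym[of f] energy_H using assms by (intro E0_cong) auto
  then have "energy ?d ?d \<le> 0"
    unfolding energy_lin_comb[OF f H_form_domain] using assms(2) by (simp add: energy_H_self)
  then have "energy ?d ?d = 0" using energy_nonneg[OF d] by simp
  obtain q where q: "q \<in> V0" using V0_nonempty by auto
  have "?d x = ?d q" by (rule energy_eq_0[OF d \<open>energy ?d ?d = 0\<close> assms(4) V0_in_K[OF q]])
  then show ?thesis using assms(3)[OF q] q by simp
qed

lemma H_lin_comb:
  assumes "x \<in> K" shows "H (\<lambda>x. a * u x + b * v x) x = a * H u x + b * H v x"
proof (rule H_unique[symmetric])
  show "(\<lambda>x. a * H u x + b * H v x) \<in> form_domain" by (intro form_domain_lin_comb H_form_domain)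
  have "energy (H u) (H v) = E0 D u v" unfolding energy_H by (rule E0_cong) auto
  then show "energy (\<lambda>x. a * H u x + b * H v x) (\<lambda>x. a * H u x + b * H v x) \<le>
      E0 D (\<lambda>x. a * u x + b * v x) (\<lambda>x. a * u x + b * v x)"
    by (simp add: energy_lin_comb[OF H_form_domain H_form_domain] E0_lin_comb energy_H_self)
qed (use assms in auto)

lemma H_const: "x \<in> K \<Longrightarrow> H (\<lambda>_. c) x = c"
  using H_bounds[of c "\<lambda>_. c" c x] by auto

text \<open>The infimum in the definition is \<open>E0 D u u\<close>, attained by
  \<open>H u\<close>; the abstract minimizer is thereby replaced by an explicit function.\<close>

lemma harmonic_extension_eq_H:
  "harmonic_extension u h \<longleftrightarrow> h \<in> form_domain \<and> (\<forall>x\<in>K. h x = H u x)"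
proof -
  have Inf: "(INF g\<in>{g \<in> form_domain. \<forall>q\<in>V0. g q = u q}. energy g g) = E0 D u u"
  proof (rule cInf_eq_minimum)
    show "E0 D u u \<in> (\<lambda>g. energy g g) ` {g \<in> form_domain. \<forall>q\<in>V0. g q = u q}"
      using H_form_domain energy_H_self by (intro image_eqI[of _ _ "H u"]) auto
    fix x assume "x \<in> (\<lambda>g. energy g g) ` {g \<in> form_domain. \<forall>q\<in>V0. g q = u q}"
    then obtain g where g: "g \<in> form_domain" "\<forall>q\<in>V0. g q = u q" "x = energy g g" by auto
    have "E0 D u u = E0 D g g" using g by (intro E0_cong) auto
    then show "E0 D u u \<le> x" using E0_le_energy g by simp
  qed
  show ?thesis
  proof
    assume h: "harmonic_extension u h"
    then show "h \<in> form_domain \<and> (\<forall>x\<in>K. h x = H u x)"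
      unfolding harmonic_extension_def Inf using H_unique by auto
  next
    assume h: "h \<in> form_domain \<and> (\<forall>x\<in>K. h x = H u x)"
    then have "energy h h = energy (H u) (H u)" by (intro energy_cong) auto
    then show "harmonic_extension u h"
      unfolding harmonic_extension_def Inf using h V0_subset by (auto simp: energy_H_self)
  qed
qed

lemma iota_eq_H: "x \<in> K \<Longrightarrow> iota u x = H u x"
proof -
  assume x: "x \<in> K"
  have "\<exists>h. harmonic_extension u h" unfolding harmonic_extension_eq_H using H_form_domain by blast
  from someI_ex[OF this] have "harmonic_extension u (iota u)" by (simp add: iota_def)
  then show ?thesis using x by (simp add: harmonic_extension_eq_H)
qed

lemma A_eq_B: "i \<in> S \<Longrightarrow> q \<in> V0 \<Longrightarrow> A i u q = B i u q"
  using V0_subset by (auto simp: A_def iota_eq_H B_eq_H psi_in_K)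

lemma harmonic_eq_H: "harmonic h \<Longrightarrow> x \<in> K \<Longrightarrow> h x = H h x"
proof -
  assume "harmonic h" and x: "x \<in> K"
  then obtain u where u: "h \<in> form_domain" "\<forall>x\<in>K. h x = H u x"
    unfolding harmonic_def harmonic_extension_eq_H by auto
  then have "H h x = H u x" using V0_subset x by (intro H_cong) auto
  then show "h x = H h x" using u x by simp
qed

lemma harmonic_form_domain: "harmonic h \<Longrightarrow> h \<in> form_domain"
  by (auto simp: harmonic_def harmonic_extension_def)

end

section \<open>Measures with prescribed cell masses\<close>

text \<open>The half-open subintervals partition the interval; those of length zero contain no
  point, so the index stays unique.\<close>

lemma partial_sum_interval:
  fixes a :: "nat \<Rightarrow> real"
  assumes "\<And>k. k < N \<Longrightarrow> 0 \<le> a k" "0 \<le> t" "t < (\<Sum>k<N. a k)"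
  shows "\<exists>!k. k < N \<and> (\<Sum>j<k. a j) \<le> t \<and> t < (\<Sum>j<k. a j) + a k"
proof -
  define k where "k = (LEAST k. t < (\<Sum>j<k. a j))"
  have k: "t < (\<Sum>j<k. a j)" unfolding k_def using assms(3) by (rule LeastI)
  have kN: "k \<le> N" unfolding k_def using assms(3) by (rule Least_le)
  have "k \<noteq> 0" using k assms(2) by (intro notI) simp
  then obtain k' where k': "k = Suc k'" by (cases k) auto
  then have "\<not> t < (\<Sum>j<k'. a j)" using not_less_Least[of k' "\<lambda>k. t < (\<Sum>j<k. a j)"] k_def by auto
  then have ex: "k' < N \<and> (\<Sum>j<k'. a j) \<le> t \<and> t < (\<Sum>j<k'. a j) + a k'"
    using k k' kN by simp
  have mono: "(\<Sum>j<m. a j) + a m \<le> (\<Sum>j<n. a j)" if "m < n" "n \<le> N" for m n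
  proof -
    have "(\<Sum>j<Suc m. a j) \<le> (\<Sum>j<n. a j)"
      using that assms(1) by (intro sum_mono2) auto
    then show ?thesis by simp
  qed
  have "l = k'" if "l < N \<and> (\<Sum>j<l. a j) \<le> t \<and> t < (\<Sum>j<l. a j) + a l" for l
    using that ex mono[of l k'] mono[of k' l] by (cases l k' rule: linorder_cases) auto
  with ex show ?thesis by blast
qed

lemma continuous_imp_measurable_restrict:
  "continuous_on K f \<Longrightarrow> sets M = sets (restrict_space borel K) \<Longrightarrow>
    (f :: 'a::topological_space \<Rightarrow> real) \<in> borel_measurable M"
  by (metis borel_measurable_continuous_on_restrict measurable_cong_sets)

lemma continuous_imp_integrable:
  fixes K :: "'a::metric_space set" and f :: "'a \<Rightarrow> real"
  assumes "compact K" "continuous_on K f" "sets M = sets (restrict_space borel K)" "finite_measure M"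
  shows "integrable M f"
proof -
  interpret finite_measure M by fact
  have "bounded (f ` K)" using assms compact_continuous_image compact_imp_bounded by blast
  then obtain B where "\<And>x. x \<in> K \<Longrightarrow> norm (f x) \<le> B" by (auto simp: bounded_iff)
  moreover have "space M = K" using sets_eq_imp_space_eq[OF assms(3)] by (simp add: space_restrict_space)
  ultimately show ?thesis
    using continuous_imp_measurable_restrict[OF assms(2,3)]
    by (intro integrable_const_bound[of _ B]) auto
qed

text \<open>The cutoffs decrease to the indicator of \<open>C\<close>, because points outside a
  closed set have positive distance from it.\<close>

lemma integral_approx_closed:
  fixes K :: "'a::metric_space set"
  assumes "sets M = sets (restrict_space borel K)" "finite_measure M" "closed C" "C \<noteq> {}"
  shows "(\<lambda>n. \<integral>x. max 0 (1 - real n * infdist x C) \<partial>M) \<longlonglongrightarrow> measure M (C \<inter> K)"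
proof -
  interpret finite_measure M by fact
  have sp: "space M = K" using sets_eq_imp_space_eq[OF assms(1)] by (simp add: space_restrict_space)
  have CK: "C \<inter> K \<in> sets M" unfolding assms(1) sets_restrict_space using assms(3) by auto
  have "(\<lambda>n. \<integral>x. max 0 (1 - real n * infdist x C) \<partial>M) \<longlonglongrightarrow> (\<integral>x. indicat_real (C \<inter> K) x \<partial>M)"
  proof (rule integral_dominated_convergence[where w = "\<lambda>_. 1"])
    show "AE x in M. (\<lambda>n. max 0 (1 - real n * infdist x C)) \<longlonglongrightarrow> indicat_real (C \<inter> K) x"
    proof (rule AE_I2)
      fix x assume x: "x \<in> space M"
      show "(\<lambda>n. max 0 (1 - real n * infdist x C)) \<longlonglongrightarrow> indicat_real (C \<inter> K) x"
      proof (cases "x \<in> C")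
        case True
        then have "infdist x C = 0" by simp
        then show ?thesis using True x sp by simp
      next
        case False
        then have d: "infdist x C > 0"
          using assms(3,4) in_closed_iff_infdist_zero[of C x] infdist_nonneg[of x C] by auto
        obtain N where N: "1 < real N * infdist x C" using d reals_Archimedean3 by blast
        have "max 0 (1 - real n * infdist x C) = 0" if "n \<ge> N" for n
        proof -
          have "real N * infdist x C \<le> real n * infdist x C" using that d by (intro mult_right_mono) auto
          then show ?thesis using N by simp
        qed
        then have "eventually (\<lambda>n. max 0 (1 - real n * infdist x C) = 0) sequentially"
          by (auto simp: eventually_sequentially)
        then have "(\<lambda>n. max 0 (1 - real n * infdist x C)) \<longlonglongrightarrow> 0" by (rule tendsto_eventually)
        then show ?thesis using False by simp
      qed
    qed
    show "(\<lambda>x. max 0 (1 - real n * infdist x C)) \<in> borel_measurable M" for n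
      by (rule continuous_imp_measurable_restrict[OF _ assms(1)]) (intro continuous_intros)
    show "AE x in M. norm (max 0 (1 - real n * infdist x C)) \<le> 1" for n
      by (rule AE_I2) (simp add: infdist_nonneg)
  qed (use CK in auto)
  then show ?thesis using CK by simp
qed

text \<open>Closed sets are stable under intersection and generate the Borel sets, so cutoffs at
  closed sets suffice. Signed combinations are treated in order to serve both for the uniqueness of
  energy measures and for an additive identity between several measures.\<close>

lemma signed_measure_zero:
  fixes K :: "'a::metric_space set" and c :: "'i \<Rightarrow> real"
  assumes "finite I" "\<And>a. a \<in> I \<Longrightarrow> sets (M a) = sets (restrict_space borel K)"
    "\<And>a. a \<in> I \<Longrightarrow> finite_measure (M a)"
    and zero: "\<And>\<phi>. continuous_on UNIV \<phi> \<Longrightarrow> (\<Sum>a\<in>I. c a * integral\<^sup>L (M a) \<phi>) = 0"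
    and B: "B \<in> sets (restrict_space borel K)"
  shows "(\<Sum>a\<in>I. c a * measure (M a) B) = 0"
proof -
  define T where "T A = (\<Sum>a\<in>I. c a * measure (M a) (A \<inter> K))" for A
  have cl: "T C = 0" if "closed C" for C
  proof (cases "C = {}")
    case False
    have "(\<lambda>n. \<Sum>a\<in>I. c a * (\<integral>x. max 0 (1 - real n * infdist x C) \<partial>M a)) \<longlonglongrightarrow> T C"
      unfolding T_def by (intro tendsto_intros integral_approx_closed assms that False)
    moreover have "(\<Sum>a\<in>I. c a * (\<integral>x. max 0 (1 - real n * infdist x C) \<partial>M a)) = 0" for n
      by (rule zero) (intro continuous_intros)
    ultimately show ?thesis by (simp add: LIMSEQ_const_iff)
  qed (simp add: T_def)
  have inM: "A \<inter> K \<in> sets (M a)" if "A \<in> sets borel" "a \<in> I" for A a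
    using that assms(2) by (auto simp: sets_restrict_space)
  have "T A = 0" if "A \<in> sets borel" for A
  proof -
    have s: "A \<in> sigma_sets UNIV (Collect closed)"
      using that by (simp add: borel_eq_closed)
    have g: "Int_stable (Collect closed :: 'a set set)" "Collect closed \<subseteq> Pow (UNIV :: 'a set)"
      by (auto simp: Int_stable_def)
    show ?thesis
      using g s
    proof (induction rule: sigma_sets_induct_disjoint)
      case (basic A) then show ?case using cl by simp
    next
      case empty then show ?case using cl by simp
    next
      case (compl A)
      have A: "A \<in> sets borel" using compl.hyps by (simp add: borel_eq_closed)
      have "measure (M a) ((UNIV - A) \<inter> K) = measure (M a) (UNIV \<inter> K) - measure (M a) (A \<inter> K)" if "a \<in> I" for a
      proof -
        interpret finite_measure "M a" using assms that by simp
        have e: "(UNIV - A) \<inter> K = UNIV \<inter> K - A \<inter> K" by auto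
        have U: "UNIV \<inter> K \<in> sets (M a)" by (rule inM[OF _ that]) simp
        show ?thesis unfolding e by (rule finite_measure_Diff[OF U inM[OF A that]]) auto
      qed
      then have "T (UNIV - A) = T UNIV - T A"
        by (simp add: T_def right_diff_distrib sum_subtractf)
      then show ?case using cl[of UNIV] compl by simp
    next
      case (union A)
      have A: "A i \<in> sets borel" for i using union.hyps by (auto simp: borel_eq_closed)
      have "(\<lambda>i. measure (M a) (A i \<inter> K)) sums measure (M a) (\<Union> (range A) \<inter> K)" if "a \<in> I" for a
      proof -
        interpret finite_measure "M a" using assms that by simp
        have "(\<lambda>i. measure (M a) (A i \<inter> K)) sums measure (M a) (\<Union>i. A i \<inter> K)"
          using union.hyps(1) inM[OF A that] by (intro finite_measure_UNION) (auto simp: disjoint_family_on_def)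
        then show ?thesis by (simp add: Int_UN_distrib2)
      qed
      then have "(\<lambda>i. T (A i)) sums T (\<Union> (range A))"
        unfolding T_def by (intro sums_sum sums_mult)
      then show ?case using union.IH sums_unique2[OF sums_zero] by simp
    qed
  qed
  moreover obtain A where "A \<in> sets borel" "B = K \<inter> A" using B by (auto simp: sets_restrict_space)
  moreover have "B \<inter> K = B" using \<open>B = K \<inter> A\<close> by auto
  ultimately show ?thesis unfolding T_def by (metis inf_commute)
qed

context self_similar_structure
begin

text \<open>The measure is the image of Lebesgue measure on \<open>[0, mass [])\<close> under the map that reads off an
  infinite word from a nested subdivision of the interval with lengths \<open>mass w\<close>.\<close>

lemma ex_measure_with_cell_masses:
  fixes mass :: "'s list \<Rightarrow> real"
  assumes nonneg: "\<And>n w. w \<in> words n \<Longrightarrow> 0 \<le> mass w"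
    and add: "\<And>n w. w \<in> words n \<Longrightarrow> mass w = (\<Sum>i\<in>S. mass (w @ [i]))"
    and x0: "x0 \<in> K"
  shows "\<exists>M. sets M = sets (restrict_space borel K) \<and> finite_measure M \<and>
    (\<forall>\<phi>. continuous_on K \<phi> \<longrightarrow> (\<lambda>n. \<Sum>w\<in>words n. mass w * \<phi> (psi_word w x0)) \<longlonglongrightarrow> integral\<^sup>L M \<phi>)"
proof -
  define N where "N = card S"
  obtain e where e: "bij_betw e {..<N} S"
    using ex_bij_betw_nat_finite[OF finite_S] by (auto simp: N_def lessThan_atLeast0)
  have eS: "e k \<in> S" if "k < N" for k using e that by (auto simp: bij_betw_def)
  have add': "mass w = (\<Sum>k<N. mass (w @ [e k]))" if "w \<in> words n" for n w
    unfolding add[OF that] using e by (intro sum.reindex_bij_betw[symmetric])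
  have app: "w @ [e k] \<in> words (Suc n)" if "w \<in> words n" "k < N" for n w k
    using that eS by (auto simp: words_def)
  \<comment> \<open>The index of the child whose subinterval contains the offset \<open>s\<close>,
    children being laid out in the order given by \<open>e\<close>.\<close>
  define ch where "ch w s = (THE k. k < N \<and> (\<Sum>j<k. mass (w @ [e j])) \<le> s \<and>
      s < (\<Sum>j<k. mass (w @ [e j])) + mass (w @ [e k]))" for w s
  \<comment> \<open>After \<open>n\<close> steps \<open>st n t\<close> holds the word read so far
    and the offset of \<open>t\<close> inside the interval of that word.\<close>
  define st where "st = rec_nat (\<lambda>t. ([], t)) (\<lambda>_ f t. case f t of (w, s) \<Rightarrow>
      (w @ [e (ch w s)], s - (\<Sum>j<ch w s. mass (w @ [e j]))))"
  have st0: "st 0 t = ([], t)" for t by (simp add: st_def)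
  have stS: "st (Suc n) t = (let (w, s) = st n t in (w @ [e (ch w s)], s - (\<Sum>j<ch w s. mass (w @ [e j]))))" for n t
    by (simp add: st_def Let_def case_prod_beta)
  have ch: "ch w s < N \<and> (\<Sum>j<ch w s. mass (w @ [e j])) \<le> s \<and> s < (\<Sum>j<ch w s. mass (w @ [e j])) + mass (w @ [e (ch w s)])"
    and ch_eq: "k < N \<Longrightarrow> (\<Sum>j<k. mass (w @ [e j])) \<le> s \<Longrightarrow> s < (\<Sum>j<k. mass (w @ [e j])) + mass (w @ [e k]) \<Longrightarrow> ch w s = k"
    if "w \<in> words n" "0 \<le> s" "s < mass w" for w s n k
  proof -
    have u: "\<exists>!k. k < N \<and> (\<Sum>j<k. mass (w @ [e j])) \<le> s \<and> s < (\<Sum>j<k. mass (w @ [e j])) + mass (w @ [e k])"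
      using that add'[OF that(1)] nonneg[OF app[OF that(1)]] by (intro partial_sum_interval) auto
    show "ch w s < N \<and> (\<Sum>j<ch w s. mass (w @ [e j])) \<le> s \<and> s < (\<Sum>j<ch w s. mass (w @ [e j])) + mass (w @ [e (ch w s)])"
      unfolding ch_def using u by (rule theI')
    show "k < N \<Longrightarrow> (\<Sum>j<k. mass (w @ [e j])) \<le> s \<Longrightarrow> s < (\<Sum>j<k. mass (w @ [e j])) + mass (w @ [e k]) \<Longrightarrow> ch w s = k"
      unfolding ch_def using u by (intro the1_equality) auto
  qed
  define J where "J = {0..<mass []}"
  have inv: "fst (st n t) \<in> words n \<and> 0 \<le> snd (st n t) \<and> snd (st n t) < mass (fst (st n t))" if "t \<in> J" for n t
  proof (induction n)
    case 0 then show ?case using that by (auto simp: st0 J_def)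
  next
    case (Suc n)
    then show ?case
      using ch[of "fst (st n t)" n "snd (st n t)"] app[of "fst (st n t)" n]
      by (auto simp: stS Let_def case_prod_beta)
  qed
  \<comment> \<open>The points whose word of length \<open>n\<close> is \<open>w\<close> form an
    interval of length \<open>mass w\<close>; the formula for the offset is carried along for the
    induction.\<close>
  have interval: "\<exists>l. {t \<in> J. fst (st n t) = w} = {l..<l + mass w} \<and> (\<forall>t\<in>J. fst (st n t) = w \<longrightarrow> snd (st n t) = t - l)"
    if "w \<in> words n" for n w
    using that
  proof (induction n arbitrary: w)
    case 0 then show ?case by (auto simp: st0 J_def intro!: exI[of _ 0])
  next
    case (Suc n)
    then have "w \<in> (\<lambda>(u, w). u @ w) ` (words n \<times> words 1)" by (metis words_add Suc_eq_plus1)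
    then obtain u i where u: "w = u @ [i]" "u \<in> words n" "i \<in> S" by (auto simp: words_1)
    then obtain k where k: "k < N" "i = e k" using e by (auto simp: bij_betw_def)
    obtain l where l: "{t \<in> J. fst (st n t) = u} = {l..<l + mass u}"
        "\<And>t. t \<in> J \<Longrightarrow> fst (st n t) = u \<Longrightarrow> snd (st n t) = t - l"
      using Suc.IH[OF u(2)] by blast
    define l' where "l' = l + (\<Sum>j<k. mass (u @ [e j]))"
    have le: "(\<Sum>j<k. mass (u @ [e j])) + mass (u @ [e k]) \<le> mass u"
    proof -
      have "(\<Sum>j<Suc k. mass (u @ [e j])) \<le> (\<Sum>j<N. mass (u @ [e j]))"
        using k(1) nonneg[OF app[OF u(2)]] by (intro sum_mono2) auto
      then show ?thesis using add'[OF u(2)] by simp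
    qed
    have ge: "0 \<le> (\<Sum>j<k. mass (u @ [e j]))"
      using k(1) nonneg[OF app[OF u(2)]] by (intro sum_nonneg) auto
    have inje: "e j = e k \<longleftrightarrow> j = k" if "j < N" for j
      using e that k(1) by (auto simp: bij_betw_def inj_on_def)
    have iff: "t \<in> J \<and> fst (st (Suc n) t) = w \<longleftrightarrow> l' \<le> t \<and> t < l' + mass w" for t
    proof
      assume t: "t \<in> J \<and> fst (st (Suc n) t) = w"
      then have a: "fst (st n t) = u" "e (ch u (snd (st n t))) = e k"
        by (auto simp: stS Let_def case_prod_beta u(1) k(2))
      have b: "0 \<le> snd (st n t)" "snd (st n t) < mass u" using inv[of t n] t a by auto
      have "ch u (snd (st n t)) = k" using ch[OF u(2) b] inje a(2) by auto
      then show "l' \<le> t \<and> t < l' + mass w"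
        using ch[OF u(2) b] l(2)[of t] t a(1) by (auto simp: l'_def u(1) k(2))
    next
      assume t: "l' \<le> t \<and> t < l' + mass w"
      then have "t \<in> {l..<l + mass u}" using le ge by (auto simp: l'_def u(1) k(2))
      then have "t \<in> {t \<in> J. fst (st n t) = u}" by (simp only: l(1))
      then have a: "t \<in> J" "fst (st n t) = u" by auto
      have s: "snd (st n t) = t - l" using l(2) a by auto
      have "ch u (t - l) = k"
        using t inv[OF a(1), of n] a(2) s k(1) u by (intro ch_eq[of u n]) (auto simp: l'_def k(2))
      then show "t \<in> J \<and> fst (st (Suc n) t) = w"
        using a s by (auto simp: stS Let_def case_prod_beta u(1) k(2))
    qed
    have "snd (st (Suc n) t) = t - l'" if t: "t \<in> J" "fst (st (Suc n) t) = w" for t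
    proof -
      have a: "fst (st n t) = u" "e (ch u (snd (st n t))) = e k"
        using t by (auto simp: stS Let_def case_prod_beta u(1) k(2))
      have b: "0 \<le> snd (st n t)" "snd (st n t) < mass u" using inv[of t n] t a by auto
      have "ch u (snd (st n t)) = k" using ch[OF u(2) b] inje a(2) by auto
      then show ?thesis using l(2)[OF t(1) a(1)] a by (simp add: stS Let_def case_prod_beta l'_def)
    qed
    with iff show ?case by (intro exI[of _ l']) auto
  qed
  define \<omega> where "\<omega> t n = e (ch (fst (st n t)) (snd (st n t)))" for t n
  have \<omega>S: "\<omega> t \<in> UNIV \<rightarrow> S" if "t \<in> J" for t
    using inv[OF that] ch eS by (fastforce simp: \<omega>_def)
  have pre: "prefix (\<omega> t) n = fst (st n t)" for t n
    by (induction n) (auto simp: prefix_Suc st0 stS Let_def case_prod_beta \<omega>_def)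
  define \<Phi> where "\<Phi> t = \<pi> (\<omega> t)" for t
  define \<Phi>n where "\<Phi>n n t = psi_word (fst (st n t)) x0" for n t
  define NN where "NN = restrict_space lborel J"
  have spN: "space NN = J" by (simp add: NN_def space_restrict_space)
  have finN: "finite_measure NN"
  proof (rule finite_measureI)
    have "emeasure NN J = emeasure lborel J"
      unfolding NN_def by (rule emeasure_restrict_space) (auto simp: J_def)
    then show "emeasure NN (space NN) \<noteq> \<infinity>" unfolding spN using nonneg[of "[]" 0] by (simp add: J_def)
  qed
  interpret NN: finite_measure NN by (rule finN)
  have setN: "{t \<in> J. fst (st n t) = w} \<in> sets NN" "measure NN {t \<in> J. fst (st n t) = w} = mass w" if w: "w \<in> words n" for n w
  proof -
    obtain l where l: "{t \<in> J. fst (st n t) = w} = {l..<l + mass w}" using interval[OF w] by blast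
    then have sub: "{l..<l + mass w} \<subseteq> J" by auto
    then show "{t \<in> J. fst (st n t) = w} \<in> sets NN"
      unfolding l NN_def sets_restrict_space by (intro image_eqI[of _ _ "{l..<l + mass w}"]) auto
    have "measure NN {l..<l + mass w} = measure lborel {l..<l + mass w}"
      unfolding NN_def using sub by (intro measure_restrict_space) (auto simp: J_def)
    then show "measure NN {t \<in> J. fst (st n t) = w} = mass w"
      unfolding l using nonneg[OF w] by simp
  qed
  have close: "\<exists>n0. \<forall>n\<ge>n0. \<forall>t\<in>J. dist (f (\<Phi>n n t)) (f (\<Phi> t)) < \<epsilon>"
    if f: "continuous_on K f" "\<epsilon> > 0" for f :: "'a \<Rightarrow> 'b::metric_space" and \<epsilon>
  proof -
    obtain n0 where n0: "\<forall>n\<ge>n0. \<forall>w\<in>words n. \<forall>x\<in>K. \<forall>y\<in>K. dist (f (psi_word w x)) (f (psi_word w y)) < \<epsilon>"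
      using uniform_on_cells_ge[OF f] by blast
    have "dist (f (\<Phi>n n t)) (f (\<Phi> t)) < \<epsilon>" if "n \<ge> n0" "t \<in> J" for n t
    proof -
      have "(\<lambda>k. \<omega> t (k + n)) \<in> UNIV \<rightarrow> S" using \<omega>S[OF that(2)] by auto
      then have "\<pi> (\<lambda>k. \<omega> t (k + n)) \<in> K" by (rule pi_in_K)
      then show ?thesis
        using n0 that inv[OF that(2), of n] x0 pi_prefix[OF \<omega>S[OF that(2)], of n] by (simp add: \<Phi>n_def \<Phi>_def pre)
    qed
    then show ?thesis by blast
  qed
  have \<Phi>_lim: "(\<lambda>n. f (\<Phi>n n t)) \<longlonglongrightarrow> f (\<Phi> t)" if "continuous_on K f" "t \<in> J" for f :: "'a \<Rightarrow> 'b::metric_space" and t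
    unfolding lim_sequentially using close[OF that(1)] that(2) by blast
  have \<Phi>K: "\<Phi> t \<in> K" if "t \<in> J" for t unfolding \<Phi>_def using \<omega>S[OF that] by (rule pi_in_K)
  have words_meas: "(\<lambda>t. fst (st n t)) \<in> measurable NN (count_space (words n))" for n
  proof -
    have "(\<lambda>t. fst (st n t)) -` {w} \<inter> space NN = {t \<in> J. fst (st n t) = w}" for w
      by (auto simp: spN)
    then show ?thesis using inv setN(1) by (subst measurable_count_space_eq2) (auto simp: spN)
  qed
  have \<Phi>n_meas: "(\<lambda>t. g (fst (st n t))) \<in> borel_measurable NN" for g :: "'s list \<Rightarrow> 'b::topological_space" and n
    by (rule measurable_compose[OF words_meas]) simp
  have \<Phi>_meas: "\<Phi> \<in> borel_measurable NN"
  proof (rule borel_measurable_LIMSEQ_metric[where f = \<Phi>n])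
    show "\<Phi>n n \<in> borel_measurable NN" for n
      using \<Phi>n_meas[of "\<lambda>w. psi_word w x0" n] unfolding \<Phi>n_def .
    show "(\<lambda>n. \<Phi>n n t) \<longlonglongrightarrow> \<Phi> t" if "t \<in> space NN" for t
      using \<Phi>_lim[of "\<lambda>x. x" t] that unfolding spN by (simp add: continuous_on_id)
  qed
  have \<Phi>_meas': "\<Phi> \<in> measurable NN (restrict_space borel K)"
    using \<Phi>_meas \<Phi>K by (intro measurable_restrict_space2) (auto simp: spN)
  define M where "M = distr NN (restrict_space borel K) \<Phi>"
  have "finite_measure M" unfolding M_def using \<Phi>_meas' by (rule NN.finite_measure_distr)
  moreover have "(\<lambda>n. \<Sum>w\<in>words n. mass w * \<phi> (psi_word w x0)) \<longlonglongrightarrow> integral\<^sup>L M \<phi>"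
    if \<phi>: "continuous_on K \<phi>" for \<phi>
  proof -
    have m\<phi>: "\<phi> \<in> borel_measurable (restrict_space borel K)"
      using \<phi> by (rule borel_measurable_continuous_on_restrict)
    have int: "integral\<^sup>L M \<phi> = (\<integral>t. \<phi> (\<Phi> t) \<partial>NN)"
      unfolding M_def by (rule integral_distr[OF \<Phi>_meas' m\<phi>])
    have "bounded (\<phi> ` K)" using \<phi> compact_K compact_continuous_image compact_imp_bounded by blast
    then obtain b where b: "\<And>x. x \<in> K \<Longrightarrow> norm (\<phi> x) \<le> b" by (auto simp: bounded_iff)
    have "(\<lambda>n. \<integral>t. \<phi> (\<Phi>n n t) \<partial>NN) \<longlonglongrightarrow> (\<integral>t. \<phi> (\<Phi> t) \<partial>NN)"
    proof (rule integral_dominated_convergence[where w = "\<lambda>_. b"])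
      show "(\<lambda>t. \<phi> (\<Phi> t)) \<in> borel_measurable NN" using measurable_compose[OF \<Phi>_meas' m\<phi>] .
      show "(\<lambda>t. \<phi> (\<Phi>n n t)) \<in> borel_measurable NN" for n
        using \<Phi>n_meas[of "\<lambda>w. \<phi> (psi_word w x0)" n] by (simp add: \<Phi>n_def)
      show "AE t in NN. (\<lambda>n. \<phi> (\<Phi>n n t)) \<longlonglongrightarrow> \<phi> (\<Phi> t)"
        using \<Phi>_lim[OF \<phi>] by (intro AE_I2) (simp add: spN)
      show "AE t in NN. norm (\<phi> (\<Phi>n n t)) \<le> b" for n
      proof (rule AE_I2)
        fix t assume "t \<in> space NN"
        then have "fst (st n t) \<in> words n" using inv by (simp add: spN)
        then show "norm (\<phi> (\<Phi>n n t)) \<le> b" using x0 words_imp by (intro b) (simp add: \<Phi>n_def psi_word_in_K words_imp)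
      qed
    qed simp
    moreover have "(\<integral>t. \<phi> (\<Phi>n n t) \<partial>NN) = (\<Sum>w\<in>words n. mass w * \<phi> (psi_word w x0))" for n
    proof -
      have "(\<integral>t. \<phi> (\<Phi>n n t) \<partial>NN) = (\<integral>t. (\<Sum>w\<in>words n. \<phi> (psi_word w x0) * indicat_real {t \<in> J. fst (st n t) = w} t) \<partial>NN)"
      proof (rule Bochner_Integration.integral_cong[OF refl])
        fix t assume t: "t \<in> space NN"
        then have w: "fst (st n t) \<in> words n" using inv by (simp add: spN)
        have "(\<Sum>w\<in>words n. \<phi> (psi_word w x0) * indicat_real {t \<in> J. fst (st n t) = w} t) =
            (\<Sum>w\<in>words n. if fst (st n t) = w then \<phi> (psi_word w x0) else 0)"
          using t by (intro sum.cong) (auto simp: spN)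
        then show "\<phi> (\<Phi>n n t) = (\<Sum>w\<in>words n. \<phi> (psi_word w x0) * indicat_real {t \<in> J. fst (st n t) = w} t)"
          using w by (simp add: \<Phi>n_def)
      qed
      also have "\<dots> = (\<Sum>w\<in>words n. \<phi> (psi_word w x0) * measure NN {t \<in> J. fst (st n t) = w})"
        using setN(1)
        by (subst Bochner_Integration.integral_sum)
          (auto intro!: integrable_mult_right integrable_real_indicator simp: NN.emeasure_finite less_top[symmetric])
      also have "\<dots> = (\<Sum>w\<in>words n. mass w * \<phi> (psi_word w x0))"
        using setN(2) by (intro sum.cong) auto
      finally show ?thesis .
    qed
    ultimately show ?thesis by (simp add: int)
  qed
  ultimately show ?thesis by (intro exI[of _ M]) (simp add: M_def)
qed

end

section \<open>Energy measures\<close>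

context fixed_vertex_structure
begin

text \<open>Common letters cancel by injectivity. At the first different letter the tails are in
  \<open>V0\<close> by \<open>cell_meet\<close>, and \<open>psi_in_V0\<close> strips the remaining
  letters, since only a vertex is mapped to a vertex.\<close>

lemma psi_word_meet:
  assumes "w \<in> words n" "w' \<in> words n" "w \<noteq> w'" "x \<in> K" "y \<in> K" "psi_word w x = psi_word w' y"
  shows "x \<in> V0"
  using assms
proof (induction n arbitrary: w w')
  case (Suc n)
  then obtain i u j u' where u: "w = i # u" "i \<in> S" "u \<in> words n" "w' = j # u'" "j \<in> S" "u' \<in> words n"
    by (auto simp: words_Suc)
  have K: "psi_word u x \<in> K" "psi_word u' y \<in> K" using u Suc.prems by auto
  have eq: "\<psi> i (psi_word u x) = \<psi> j (psi_word u' y)" using Suc.prems(6) by (simp add: u psi_word_Cons)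
  show ?case
  proof (cases "i = j")
    case True
    then have "psi_word u x = psi_word u' y" using eq psi_eq_iff[OF u(2) K] by simp
    then show ?thesis using Suc.IH[OF u(3,6)] Suc.prems True u by auto
  next
    case False
    then have V: "psi_word u x \<in> V0" using cell_meet[OF u(2,5) False K eq] by simp
    have "x \<in> V0" if "psi_word u x \<in> V0" "u \<in> words m" for u m
      using that
    proof (induction u arbitrary: m)
      case (Cons a u)
      then have au: "a \<in> S" "u \<in> words (m - 1)" by (auto simp: words_def)
      then have "psi_word u x \<in> V0"
        using psi_in_V0[of a "psi_word u x"] Cons.prems Suc.prems(4) by (auto simp: psi_word_Cons)
      then show ?case using Cons.IH au by blast
    qed simp
    then show ?thesis using V u by blast
  qed
qed auto

text \<open>By \<open>psi_in_V0\<close> each letter fixes the point it is applied to, and different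
  letters have different fixed points.\<close>

lemma psi_word_in_V0:
  assumes "psi_word w x \<in> V0" "w \<in> words n" "x \<in> K"
  shows "x \<in> V0 \<and> (\<exists>i\<in>S. w = replicate n i \<and> x = fixpt i)"
  using assms
proof (induction n arbitrary: w)
  case 0
  then show ?case using V0_fixpt by auto
next
  case (Suc n)
  then obtain j u where u: "w = j # u" "j \<in> S" "u \<in> words n" by (auto simp: words_Suc)
  have 1: "psi_word u x = \<psi> j (psi_word u x)" "fixpt j = psi_word u x"
    using psi_in_V0[of j "psi_word u x"] Suc.prems u by (auto simp: psi_word_Cons)
  then have "psi_word u x \<in> V0" using Suc.prems u by (simp add: psi_word_Cons)
  then obtain i where i: "x \<in> V0" "i \<in> S" "u = replicate n i" "x = fixpt i" using Suc.IH u Suc.prems by blast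
  then have "fixpt j = fixpt i" using 1(2) psi_replicate_fixpt by simp
  then have "(\<lambda>_. j) = (\<lambda>_::nat. i)"
    using pi_eq_fixpt[OF i(2), of "\<lambda>_. j"] fixpt_eq[OF u(2)] u(2) by auto
  then have "j = i" by meson
  then show ?case using i u by auto
qed

text \<open>Piecewise harmonic interpolation at the vertices of level \<open>n\<close>, glued over
  the cells; the bounds in each cell are the maximum principle. It serves to approximate continuous
  functions uniformly within \<open>form_domain\<close>.\<close>

lemma ex_interpolation:
  fixes \<phi> :: "'a \<Rightarrow> real"
  shows "\<exists>g\<in>form_domain. (\<forall>q\<in>V0. g q = \<phi> q) \<and>
    (\<forall>w\<in>words n. \<forall>a b. (\<forall>q\<in>V0. a \<le> \<phi> (psi_word w q) \<and> \<phi> (psi_word w q) \<le> b) \<longrightarrow>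
       (\<forall>x\<in>K. a \<le> g (psi_word w x) \<and> g (psi_word w x) \<le> b))"
proof (induction n arbitrary: \<phi>)
  case 0
  have "a \<le> H \<phi> x \<and> H \<phi> x \<le> b" if "\<forall>q\<in>V0. a \<le> \<phi> q \<and> \<phi> q \<le> b" "x \<in> K" for a b x
    using H_bounds[of a \<phi> b x] that by auto
  then show ?case using H_form_domain[of \<phi>] by (intro bexI[of _ "H \<phi>"]) auto
next
  case (Suc n)
  have "\<forall>i. \<exists>g\<in>form_domain. (\<forall>q\<in>V0. g q = (\<phi> \<circ> \<psi> i) q) \<and>
    (\<forall>w\<in>words n. \<forall>a b. (\<forall>q\<in>V0. a \<le> (\<phi> \<circ> \<psi> i) (psi_word w q) \<and> (\<phi> \<circ> \<psi> i) (psi_word w q) \<le> b) \<longrightarrow>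
       (\<forall>x\<in>K. a \<le> g (psi_word w x) \<and> g (psi_word w x) \<le> b))"
    using Suc by blast
  then obtain g where g: "\<And>i. g i \<in> form_domain" "\<And>i q. q \<in> V0 \<Longrightarrow> g i q = \<phi> (\<psi> i q)"
    "\<And>i w a b x. w \<in> words n \<Longrightarrow> (\<forall>q\<in>V0. a \<le> \<phi> (\<psi> i (psi_word w q)) \<and> \<phi> (\<psi> i (psi_word w q)) \<le> b) \<Longrightarrow>
       x \<in> K \<Longrightarrow> a \<le> g i (psi_word w x) \<and> g i (psi_word w x) \<le> b"
    unfolding o_def by metis
  obtain G where G: "G \<in> form_domain" "\<And>i x. i \<in> S \<Longrightarrow> x \<in> K \<Longrightarrow> G (\<psi> i x) = g i x"
    by (rule glue[of g]) (use g in auto)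
  have "G q = \<phi> q" if q: "q \<in> V0" for q
  proof -
    obtain i c where "i \<in> S" "c \<in> V0" "q = \<psi> i c" using q by (rule V0_subset_V1)
    then show ?thesis using G g by auto
  qed
  moreover have "a \<le> G (psi_word w x) \<and> G (psi_word w x) \<le> b"
    if w: "w \<in> words (Suc n)" "\<forall>q\<in>V0. a \<le> \<phi> (psi_word w q) \<and> \<phi> (psi_word w q) \<le> b" "x \<in> K" for w a b x
  proof -
    obtain i u where u: "w = i # u" "i \<in> S" "u \<in> words n" using w(1) by (auto simp: words_Suc)
    then show ?thesis
      using g(3)[of u a i b x] w G(2)[of i "psi_word u x"] by (simp add: psi_word_Cons)
  qed
  ultimately show ?case using G(1) by blast
qed

lemma form_domain_dense:
  assumes "continuous_on K \<phi>" "\<epsilon> > 0"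
  shows "\<exists>g\<in>form_domain. \<forall>x\<in>K. \<bar>g x - \<phi> x\<bar> \<le> \<epsilon>"
proof -
  obtain n where n: "\<forall>w\<in>words n. \<forall>x\<in>K. \<forall>y\<in>K. dist (\<phi> (psi_word w x)) (\<phi> (psi_word w y)) < \<epsilon>"
    using uniform_on_cells[OF assms] by blast
  obtain g where g: "g \<in> form_domain" "\<And>w a b x. w \<in> words n \<Longrightarrow>
      (\<forall>q\<in>V0. a \<le> \<phi> (psi_word w q) \<and> \<phi> (psi_word w q) \<le> b) \<Longrightarrow> x \<in> K \<Longrightarrow>
       a \<le> g (psi_word w x) \<and> g (psi_word w x) \<le> b"
    using ex_interpolation[of \<phi> n] by blast
  have "\<bar>g x - \<phi> x\<bar> \<le> \<epsilon>" if x: "x \<in> K" for x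
  proof -
    obtain w y where w: "w \<in> words n" "y \<in> K" "x = psi_word w y" using x by (rule ex_cell)
    have "\<phi> x - \<epsilon> \<le> \<phi> (psi_word w q) \<and> \<phi> (psi_word w q) \<le> \<phi> x + \<epsilon>" if "q \<in> V0" for q
    proof -
      have "dist (\<phi> (psi_word w q)) (\<phi> (psi_word w y)) < \<epsilon>" using n w that by simp
      then show ?thesis by (simp add: dist_real_def w(3) abs_less_iff)
    qed
    then have "\<phi> x - \<epsilon> \<le> g x \<and> g x \<le> \<phi> x + \<epsilon>" using g(2)[of w "\<phi> x - \<epsilon>" "\<phi> x + \<epsilon>" y] w by simp
    then show ?thesis by (simp add: abs_le_iff)
  qed
  then show ?thesis using g(1) by blast
qed

text \<open>The carre du champ identity on a finite network: the functional of the energy measure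
  puts the squared increment of \<open>g\<close> on each edge and weighs it by the values of
  \<open>\<phi>\<close> at both ends.\<close>

lemma E0_energy_functional:
  "2 * E0 D g (\<lambda>x. g x * \<phi> x) - E0 D (\<lambda>x. (g x)\<^sup>2) \<phi> =
    (\<Sum>q\<in>V0. \<Sum>q'\<in>V0. D q q' * ((g q - g q')\<^sup>2 * (\<phi> q + \<phi> q'))) / 2"
  unfolding E0_eq_sum_diff
  by (simp add: sum_distrib_left flip: sum_subtractf diff_divide_distrib)
    (intro sum.cong refl, simp add: power2_eq_square algebra_simps)

lemma E0_energy_functional_approx:
  assumes "\<And>q. q \<in> V0 \<Longrightarrow> \<bar>\<phi> q - c\<bar> \<le> \<epsilon>"
  shows "\<bar>2 * E0 D g (\<lambda>x. g x * \<phi> x) - E0 D (\<lambda>x. (g x)\<^sup>2) \<phi> - 2 * E0 D g g * c\<bar> \<le> 2 * \<epsilon> * E0 D g g"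
proof -
  let ?X = "\<Sum>q\<in>V0. \<Sum>q'\<in>V0. D q q' * ((g q - g q')\<^sup>2 * ((\<phi> q - c) + (\<phi> q' - c)))"
  let ?Y = "\<Sum>q\<in>V0. \<Sum>q'\<in>V0. D q q' * ((g q - g q')\<^sup>2 * (2 * \<epsilon>))"
  have X: "2 * E0 D g (\<lambda>x. g x * \<phi> x) - E0 D (\<lambda>x. (g x)\<^sup>2) \<phi> - 2 * E0 D g g * c = ?X / 2"
    unfolding E0_energy_functional unfolding E0_eq_sum_diff
    by (simp add: sum_distrib_left sum_distrib_right sum_divide_distrib flip: sum_subtractf)
      (intro sum.cong refl, simp add: power2_eq_square field_simps)
  have le: "\<bar>D q q' * ((g q - g q')\<^sup>2 * ((\<phi> q - c) + (\<phi> q' - c)))\<bar> \<le> D q q' * ((g q - g q')\<^sup>2 * (2 * \<epsilon>))"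
    if "q \<in> V0" "q' \<in> V0" for q q'
  proof (cases "q = q'")
    case False
    have "\<bar>(\<phi> q - c) + (\<phi> q' - c)\<bar> \<le> 2 * \<epsilon>" using assms[OF that(1)] assms[OF that(2)] by linarith
    then show ?thesis
      using D_off_diagonal[OF that False] by (simp add: abs_mult mult_left_mono)
  qed simp
  have XY: "\<bar>?X\<bar> \<le> ?Y"
    by (rule order_trans[OF sum_abs], rule sum_mono, rule order_trans[OF sum_abs], rule sum_mono, rule le)
  have Y: "?Y / 2 = 2 * \<epsilon> * E0 D g g"
    unfolding E0_eq_sum_diff
    by (simp add: sum_distrib_left sum_divide_distrib) (intro sum.cong refl, simp add: power2_eq_square)
  show ?thesis unfolding X Y[symmetric] using XY by simp
qed

text \<open>Two errors are controlled: the oscillation of \<open>\<phi>\<close> on small cells, and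
  the deficit \<open>energy f f - Em D r n f f\<close> from replacing cell energies by discrete
  ones. The result identifies \<open>2 * cell_energy w f\<close> as the cell masses to be realised
  by a measure.\<close>

lemma energy_functional_tendsto:
  assumes f: "f \<in> form_domain" and \<phi>: "\<phi> \<in> form_domain" and x0: "x0 \<in> K"
  shows "(\<lambda>n. \<Sum>w\<in>words n. 2 * cell_energy w f * \<phi> (psi_word w x0)) \<longlonglongrightarrow>
    2 * energy f (\<lambda>x. f x * \<phi> x) - energy (\<lambda>x. (f x)\<^sup>2) \<phi>"
proof -
  define I where "I n = 2 * Em D r n f (\<lambda>x. f x * \<phi> x) - Em D r n (\<lambda>x. (f x)\<^sup>2) \<phi>" for n
  define S' where "S' n = (\<Sum>w\<in>words n. 2 * cell_energy w f * \<phi> (psi_word w x0))" for n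
  have ff: "(\<lambda>x. (f x)\<^sup>2) \<in> form_domain"
    using form_domain_mult[OF f f] by (simp add: power2_eq_square)
  have lim: "I \<longlonglongrightarrow> 2 * energy f (\<lambda>x. f x * \<phi> x) - energy (\<lambda>x. (f x)\<^sup>2) \<phi>"
    unfolding I_def by (intro tendsto_intros energy_tendsto f \<phi> ff form_domain_mult)
  obtain M where M: "M \<ge> 0" "\<And>x. x \<in> K \<Longrightarrow> \<bar>\<phi> x\<bar> \<le> M" using form_domain_bounded[OF \<phi>] by blast
  have diff: "\<bar>I n - S' n\<bar> \<le> 2 * \<epsilon> * energy f f + 2 * M * (energy f f - Em D r n f f)"
    if e: "\<epsilon> > 0" "\<forall>w\<in>words n. \<forall>x\<in>K. \<forall>y\<in>K. dist (\<phi> (psi_word w x)) (\<phi> (psi_word w y)) < \<epsilon>" for \<epsilon> n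
  proof -
    let ?g = "\<lambda>w. f \<circ> psi_word w" and ?p = "\<lambda>w. \<phi> \<circ> psi_word w"
    have In: "I n = (\<Sum>w\<in>words n. inverse (rw w) * (2 * E0 D (?g w) (\<lambda>x. ?g w x * ?p w x) - E0 D (\<lambda>x. (?g w x)\<^sup>2) (?p w)))"
      by (simp add: I_def Em_def o_def sum_distrib_left right_diff_distrib sum_subtractf mult_ac)
    have "\<bar>I n - (\<Sum>w\<in>words n. inverse (rw w) * (2 * E0 D (?g w) (?g w) * \<phi> (psi_word w x0)))\<bar>
        \<le> (\<Sum>w\<in>words n. inverse (rw w) * (2 * \<epsilon> * E0 D (?g w) (?g w)))"
      unfolding In sum_subtractf[symmetric] right_diff_distrib[symmetric]
    proof (rule order_trans[OF sum_abs], rule sum_mono)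
      fix w assume w: "w \<in> words n"
      have osc: "\<bar>?p w q - \<phi> (psi_word w x0)\<bar> \<le> \<epsilon>" if "q \<in> V0" for q
      proof -
        have "dist (\<phi> (psi_word w q)) (\<phi> (psi_word w x0)) < \<epsilon>" using e(2) w that x0 by simp
        then show ?thesis by (simp add: dist_real_def)
      qed
      have "\<bar>2 * E0 D (?g w) (\<lambda>x. ?g w x * ?p w x) - E0 D (\<lambda>x. (?g w x)\<^sup>2) (?p w) -
          2 * E0 D (?g w) (?g w) * \<phi> (psi_word w x0)\<bar> \<le> 2 * \<epsilon> * E0 D (?g w) (?g w)"
        by (rule E0_energy_functional_approx) (rule osc)
      then show "\<bar>inverse (rw w) * (2 * E0 D (?g w) (\<lambda>x. ?g w x * ?p w x) - E0 D (\<lambda>x. (?g w x)\<^sup>2) (?p w) -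
          2 * E0 D (?g w) (?g w) * \<phi> (psi_word w x0))\<bar> \<le> inverse (rw w) * (2 * \<epsilon> * E0 D (?g w) (?g w))"
        using rw_pos[OF words_imp[OF w]] by (simp add: abs_mult divide_right_mono mult_left_mono)
    qed
    also have "\<dots> = 2 * \<epsilon> * Em D r n f f"
      by (simp add: Em_def sum_distrib_left mult_ac)
    also have "\<dots> \<le> 2 * \<epsilon> * energy f f"
      using e(1) Em_le_energy[OF f] by (intro mult_left_mono) auto
    finally have 1: "\<bar>I n - (\<Sum>w\<in>words n. inverse (rw w) * (2 * E0 D (?g w) (?g w) * \<phi> (psi_word w x0)))\<bar> \<le> 2 * \<epsilon> * energy f f" .
    have "\<bar>S' n - (\<Sum>w\<in>words n. inverse (rw w) * (2 * E0 D (?g w) (?g w) * \<phi> (psi_word w x0)))\<bar> \<le>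
       (\<Sum>w\<in>words n. 2 * M * (cell_energy w f - inverse (rw w) * E0 D (?g w) (?g w)))"
      unfolding S'_def sum_subtractf[symmetric]
    proof (rule order_trans[OF sum_abs], rule sum_mono)
      fix w assume w: "w \<in> words n"
      have "0 \<le> inverse (rw w)" using rw_pos[OF words_imp[OF w]] by simp
      moreover have "E0 D (?g w) (?g w) \<le> energy (?g w) (?g w)"
        using f w by (intro E0_le_energy form_domain_psi_word)
      ultimately have "0 \<le> cell_energy w f - inverse (rw w) * E0 D (?g w) (?g w)"
        unfolding cell_energy_def by (simp add: mult_left_mono)
      moreover have "2 * cell_energy w f * \<phi> (psi_word w x0) - inverse (rw w) * (2 * E0 D (?g w) (?g w) * \<phi> (psi_word w x0)) =
         2 * (cell_energy w f - inverse (rw w) * E0 D (?g w) (?g w)) * \<phi> (psi_word w x0)"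
        by (simp add: algebra_simps)
      ultimately show "\<bar>2 * cell_energy w f * \<phi> (psi_word w x0) - inverse (rw w) * (2 * E0 D (?g w) (?g w) * \<phi> (psi_word w x0))\<bar>
         \<le> 2 * M * (cell_energy w f - inverse (rw w) * E0 D (?g w) (?g w))"
        using M(2)[of "psi_word w x0"] w x0 mult_left_mono[of "\<bar>\<phi> (psi_word w x0)\<bar>" M "2 * (cell_energy w f - inverse (rw w) * E0 D (?g w) (?g w))"]
        by (simp add: abs_mult mult_ac)
    qed
    also have "\<dots> = 2 * M * (energy f f - Em D r n f f)"
      unfolding energy_eq_sum_cells[OF f, of n] by (simp add: Em_def sum_distrib_left sum_subtractf right_diff_distrib)
    finally show ?thesis using 1 by linarith
  qed
  have "(\<lambda>n. S' n - I n) \<longlonglongrightarrow> 0"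
    unfolding lim_sequentially
  proof (intro allI impI)
    fix \<delta> :: real assume d: "\<delta> > 0"
    define \<epsilon> where "\<epsilon> = \<delta> / (4 * (energy f f + 1))"
    have E: "energy f f \<ge> 0" using f by (rule energy_nonneg)
    have e: "\<epsilon> > 0" using d E by (simp add: \<epsilon>_def)
    have e2: "2 * \<epsilon> * energy f f \<le> \<delta> / 2"
      using d E by (simp add: \<epsilon>_def field_simps)
    obtain n0 where n0: "\<forall>n\<ge>n0. \<forall>w\<in>words n. \<forall>x\<in>K. \<forall>y\<in>K. dist (\<phi> (psi_word w x)) (\<phi> (psi_word w y)) < \<epsilon>"
      using uniform_on_cells_ge[OF form_domain_continuous[OF \<phi>] e] by blast
    have "(\<lambda>n. 2 * M * (energy f f - Em D r n f f)) \<longlonglongrightarrow> 2 * M * (energy f f - energy f f)"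
      by (intro tendsto_intros energy_tendsto_self f)
    then have "eventually (\<lambda>n. 2 * M * (energy f f - Em D r n f f) < \<delta> / 2) sequentially"
      using d by (intro order_tendstoD(2)) auto
    then obtain n1 where n1: "\<And>n. n \<ge> n1 \<Longrightarrow> 2 * M * (energy f f - Em D r n f f) < \<delta> / 2"
      by (auto simp: eventually_sequentially)
    have "dist (S' n - I n) 0 < \<delta>" if "n \<ge> max n0 n1" for n
    proof -
      have "\<bar>I n - S' n\<bar> \<le> 2 * \<epsilon> * energy f f + 2 * M * (energy f f - Em D r n f f)"
        using that n0 by (intro diff[OF e]) auto
      then show ?thesis using e2 n1[of n] that by (simp add: dist_real_def abs_minus_commute)
    qed
    then show "\<exists>no. \<forall>n\<ge>no. dist (S' n - I n) 0 < \<delta>" by blast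
  qed
  from tendsto_add[OF this lim] show ?thesis by (simp add: S'_def)
qed

lemma cell_energy_children:
  assumes "u \<in> form_domain" "w \<in> words n"
  shows "cell_energy w u = (\<Sum>i\<in>S. cell_energy (w @ [i]) u)"
  using cell_energy_eq_sum[OF assms, of "Suc 0"] by (simp add: words_1 sum.reindex inj_on_def)

definition is_energy_measure :: "('a \<Rightarrow> real) \<Rightarrow> 'a measure \<Rightarrow> bool" where
  "is_energy_measure f M \<longleftrightarrow> sets M = sets (restrict_space borel K) \<and> finite_measure M \<and>
    (\<forall>\<phi>. continuous_on K \<phi> \<longrightarrow> (\<forall>x0\<in>K. (\<lambda>n. \<Sum>w\<in>words n. 2 * cell_energy w f * \<phi> (psi_word w x0)) \<longlonglongrightarrow> integral\<^sup>L M \<phi>))"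

text \<open>Uniform density of \<open>form_domain\<close> extends the equality to continuous
  integrands, which determine a finite measure.\<close>

lemma measure_eqI_form_domain:
  assumes M: "sets M = sets (restrict_space borel K)" "finite_measure M"
    and M': "sets M' = sets (restrict_space borel K)" "finite_measure M'"
    and eq: "\<And>\<phi>. \<phi> \<in> form_domain \<Longrightarrow> integral\<^sup>L M \<phi> = integral\<^sup>L M' \<phi>"
  shows "M = M'"
proof (rule measure_eqI)
  show "sets M = sets M'" using M M' by simp
  interpret M: finite_measure M by fact
  interpret M': finite_measure M' by fact
  have sp: "space M = K" "space M' = K"
    using sets_eq_imp_space_eq[OF M(1)] sets_eq_imp_space_eq[OF M'(1)] by (simp_all add: space_restrict_space)
  have int: "integral\<^sup>L M \<phi> = integral\<^sup>L M' \<phi>" if \<phi>: "continuous_on K \<phi>" for \<phi> :: "'a \<Rightarrow> real"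
  proof -
    let ?m = "measure M K + measure M' K"
    have close: "\<bar>integral\<^sup>L N \<phi> - integral\<^sup>L N g\<bar> \<le> \<epsilon> * measure N K"
      if N: "sets N = sets (restrict_space borel K)" "finite_measure N" and g: "g \<in> form_domain" "\<forall>x\<in>K. \<bar>g x - \<phi> x\<bar> \<le> \<epsilon>"
      for N g \<epsilon>
    proof -
      interpret N: finite_measure N by fact
      have spN: "space N = K" using sets_eq_imp_space_eq[OF N(1)] by (simp add: space_restrict_space)
      note ig = continuous_imp_integrable[OF compact_K form_domain_continuous[OF g(1)] N]
      note ip = continuous_imp_integrable[OF compact_K \<phi> N]
      have "integral\<^sup>L N \<phi> - integral\<^sup>L N g = (\<integral>x. \<phi> x - g x \<partial>N)" using ig ip by simp
      moreover have "\<bar>\<integral>x. \<phi> x - g x \<partial>N\<bar> \<le> (\<integral>x. \<bar>\<phi> x - g x\<bar> \<partial>N)"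
        by (rule integral_abs_bound)
      moreover have "(\<integral>x. \<bar>\<phi> x - g x\<bar> \<partial>N) \<le> (\<integral>x. \<epsilon> \<partial>N)"
        using ig ip g(2) by (intro integral_mono) (auto simp: spN abs_minus_commute)
      moreover have "(\<integral>x. \<epsilon> \<partial>N) = \<epsilon> * measure N K" by (simp add: spN mult.commute)
      ultimately show ?thesis by linarith
    qed
    have "\<bar>integral\<^sup>L M \<phi> - integral\<^sup>L M' \<phi>\<bar> \<le> 0"
    proof (rule field_le_epsilon)
      fix e :: real assume e: "e > 0"
      define \<epsilon> where "\<epsilon> = e / (?m + 1)"
      have m: "?m \<ge> 0" by simp
      then have "?m + 1 > 0" by linarith
      then have "\<epsilon> > 0" unfolding \<epsilon>_def using e by (intro divide_pos_pos)
      then obtain g where g: "g \<in> form_domain" "\<forall>x\<in>K. \<bar>g x - \<phi> x\<bar> \<le> \<epsilon>"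
        using form_domain_dense[OF \<phi>] by blast
      have "\<bar>integral\<^sup>L M \<phi> - integral\<^sup>L M' \<phi>\<bar> \<le> \<epsilon> * ?m"
        using close[OF M g] close[OF M' g] eq[OF g(1)] by (simp add: algebra_simps)
      also have "\<dots> = e * (?m / (?m + 1))" by (simp add: \<epsilon>_def)
      also have "\<dots> \<le> e * 1"
      proof (rule mult_left_mono)
        show "?m / (?m + 1) \<le> 1" using \<open>?m + 1 > 0\<close> by (subst pos_divide_le_eq) auto
      qed (use e in simp)
      finally show "\<bar>integral\<^sup>L M \<phi> - integral\<^sup>L M' \<phi>\<bar> \<le> 0 + e" by simp
    qed
    then show ?thesis by simp
  qed
  fix B assume B: "B \<in> sets M"
  have "(\<Sum>a\<in>{True, False}. (if a then 1 else -1) * measure (if a then M else M') B) = 0"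
  proof (rule signed_measure_zero[where K = K])
    fix \<phi> :: "'a \<Rightarrow> real" assume "continuous_on UNIV \<phi>"
    then have "continuous_on K \<phi>" by (rule continuous_on_subset) simp
    then show "(\<Sum>a\<in>{True, False}. (if a then 1 else -1) * integral\<^sup>L (if a then M else M') \<phi>) = 0"
      using int by simp
  qed (use M M' B in auto)
  then show "emeasure M B = emeasure M' B"
    using B M M' by (simp add: M.emeasure_eq_measure M'.emeasure_eq_measure)
qed

lemma ex_measure_cell_energy:
  assumes f: "f \<in> form_domain" and x0: "x0 \<in> K"
  shows "\<exists>M. sets M = sets (restrict_space borel K) \<and> finite_measure M \<and>
    (\<forall>\<phi>. continuous_on K \<phi> \<longrightarrow> (\<lambda>n. \<Sum>w\<in>words n. 2 * cell_energy w f * \<phi> (psi_word w x0)) \<longlonglongrightarrow> integral\<^sup>L M \<phi>)"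
proof (rule ex_measure_with_cell_masses)
  show "0 \<le> 2 * cell_energy w f" if "w \<in> words n" for n w
    using cell_energy_nonneg[OF f that] by simp
  show "2 * cell_energy w f = (\<Sum>i\<in>S. 2 * cell_energy (w @ [i]) f)" if "w \<in> words n" for n w
    unfolding sum_distrib_left[symmetric] using cell_energy_children[OF f that] by simp
qed (rule x0)

text \<open>Existence comes from the construction by cell masses and uniqueness from density, so the
  definite description denotes the constructed measure. Uniqueness also makes the limit independent
  of the sample point.\<close>

lemma energy_measure:
  assumes f: "f \<in> form_domain" shows "is_energy_measure f (energy_measure f)"
proof -
  obtain x1 where x1: "x1 \<in> K" using K_nonempty by auto
  define P where "P M \<longleftrightarrow> sets M = sets (restrict_space borel K) \<and> finite_measure M \<and>
     (\<forall>\<phi>\<in>form_domain. integral\<^sup>L M \<phi> = 2 * energy f (\<lambda>x. f x * \<phi> x) - energy (\<lambda>x. (f x)\<^sup>2) \<phi>)" for M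
  obtain M where M: "sets M = sets (restrict_space borel K)" "finite_measure M"
    "\<And>\<phi>. continuous_on K \<phi> \<Longrightarrow> (\<lambda>n. \<Sum>w\<in>words n. 2 * cell_energy w f * \<phi> (psi_word w x1)) \<longlonglongrightarrow> integral\<^sup>L M \<phi>"
    using ex_measure_cell_energy[OF f x1] by blast
  have PM: "P M"
    unfolding P_def
  proof (intro conjI ballI M(1,2))
    fix \<phi> assume \<phi>: "\<phi> \<in> form_domain"
    show "integral\<^sup>L M \<phi> = 2 * energy f (\<lambda>x. f x * \<phi> x) - energy (\<lambda>x. (f x)\<^sup>2) \<phi>"
      by (rule LIMSEQ_unique[OF M(3)[OF form_domain_continuous[OF \<phi>]] energy_functional_tendsto[OF f \<phi> x1]])
  qed
  have "M' = M" if "P M'" for M'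
    using that PM by (intro measure_eqI_form_domain) (auto simp: P_def)
  then have EM: "energy_measure f = M"
    using PM unfolding energy_measure_def P_def[symmetric] by (intro the_equality)
  have "(\<lambda>n. \<Sum>w\<in>words n. 2 * cell_energy w f * \<phi> (psi_word w x0)) \<longlonglongrightarrow> integral\<^sup>L M \<phi>"
    if \<phi>: "continuous_on K \<phi>" and x0: "x0 \<in> K" for \<phi> x0
  proof -
    obtain M' where M': "sets M' = sets (restrict_space borel K)" "finite_measure M'"
      "\<And>\<phi>. continuous_on K \<phi> \<Longrightarrow> (\<lambda>n. \<Sum>w\<in>words n. 2 * cell_energy w f * \<phi> (psi_word w x0)) \<longlonglongrightarrow> integral\<^sup>L M' \<phi>"
      using ex_measure_cell_energy[OF f x0] by blast
    have "P M'"
      unfolding P_def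
    proof (intro conjI ballI M'(1,2))
      fix \<phi> assume \<phi>: "\<phi> \<in> form_domain"
      show "integral\<^sup>L M' \<phi> = 2 * energy f (\<lambda>x. f x * \<phi> x) - energy (\<lambda>x. (f x)\<^sup>2) \<phi>"
        by (rule LIMSEQ_unique[OF M'(3)[OF form_domain_continuous[OF \<phi>]] energy_functional_tendsto[OF f \<phi> x0]])
    qed
    then have "M' = M" using PM by (intro measure_eqI_form_domain) (auto simp: P_def)
    then show ?thesis using M'(3)[OF \<phi>] by simp
  qed
  then show ?thesis using M(1,2) by (simp add: is_energy_measure_def EM)
qed

text \<open>The excess of the cell masses of the \<open>h j\<close> over those of \<open>f\<close>
  is nonnegative and additive, hence realised by a measure \<open>N\<close>. The measures of
  \<open>f\<close> and \<open>N\<close> add up to those of the \<open>h j\<close> on all Borel sets,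
  not only on cells.\<close>

lemma energy_measure_dominated:
  fixes J :: "'j set"
  assumes f: "f \<in> form_domain" and J: "finite J" and h: "\<And>j. j \<in> J \<Longrightarrow> h j \<in> form_domain"
    and dom: "\<And>n w. w \<in> words n \<Longrightarrow> cell_energy w f \<le> (\<Sum>j\<in>J. cell_energy w (h j))"
    and Y: "Y \<in> sets (restrict_space borel K)"
  shows "emeasure (energy_measure f) Y \<le> (\<Sum>j\<in>J. emeasure (energy_measure (h j)) Y)"
proof -
  obtain x0 where x0: "x0 \<in> K" using K_nonempty by auto
  define mass where "mass w = (\<Sum>j\<in>J. 2 * cell_energy w (h j)) - 2 * cell_energy w f" for w
  have madd: "mass w = (\<Sum>i\<in>S. mass (w @ [i]))" if "w \<in> words n" for w n
  proof -
    have "(\<Sum>j\<in>J. 2 * cell_energy w (h j)) = (\<Sum>j\<in>J. \<Sum>i\<in>S. 2 * cell_energy (w @ [i]) (h j))"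
      using cell_energy_children[OF h that] by (simp add: sum_distrib_left)
    also have "\<dots> = (\<Sum>i\<in>S. \<Sum>j\<in>J. 2 * cell_energy (w @ [i]) (h j))" by (rule sum.swap)
    finally show ?thesis
      using cell_energy_children[OF f that] by (simp add: mass_def sum_subtractf sum_distrib_left)
  qed
  have "\<exists>M. sets M = sets (restrict_space borel K) \<and> finite_measure M \<and>
    (\<forall>\<phi>. continuous_on K \<phi> \<longrightarrow> (\<lambda>n. \<Sum>w\<in>words n. mass w * \<phi> (psi_word w x0)) \<longlonglongrightarrow> integral\<^sup>L M \<phi>)"
  proof (rule ex_measure_with_cell_masses)
    show "0 \<le> mass w" if "w \<in> words n" for w n
      using dom[OF that] by (simp add: mass_def flip: sum_distrib_left)
  qed (rule madd x0, assumption?)+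
  then obtain N where N: "sets N = sets (restrict_space borel K)" "finite_measure N"
    "\<And>\<phi>. continuous_on K \<phi> \<Longrightarrow> (\<lambda>n. \<Sum>w\<in>words n. mass w * \<phi> (psi_word w x0)) \<longlonglongrightarrow> integral\<^sup>L N \<phi>"
    by blast
  \<comment> \<open>Indices of the signed combination: \<open>None\<close> stands for
    \<open>f\<close>, \<open>Some None\<close> for \<open>N\<close>, and
    \<open>Some (Some j)\<close>, with coefficient -1, for \<open>h j\<close>.\<close>
  define I where "I = insert None (insert (Some None) ((Some \<circ> Some) ` J))"
  define M where "M a = (case a of None \<Rightarrow> energy_measure f | Some None \<Rightarrow> N | Some (Some j) \<Rightarrow> energy_measure (h j))" for a
  define c where "c a = (case a of None \<Rightarrow> 1 | Some None \<Rightarrow> 1 | Some (Some j) \<Rightarrow> - (1 :: real))" for a :: "'j option option"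
  have sumI: "(\<Sum>a\<in>I. g a) = g None + g (Some None) + (\<Sum>j\<in>J. g (Some (Some j)))" for g :: "'j option option \<Rightarrow> real"
  proof -
    have "inj_on (Some \<circ> Some) J" by (auto simp: inj_on_def)
    then have "sum g ((Some \<circ> Some) ` J) = (\<Sum>j\<in>J. g (Some (Some j)))" by (subst sum.reindex) auto
    then show ?thesis unfolding I_def using J by (subst sum.insert, force, force)+ simp
  qed
  have em: "sets (energy_measure f) = sets (restrict_space borel K)" "finite_measure (energy_measure f)"
    "\<And>j. j \<in> J \<Longrightarrow> sets (energy_measure (h j)) = sets (restrict_space borel K)"
    "\<And>j. j \<in> J \<Longrightarrow> finite_measure (energy_measure (h j))"
    using energy_measure[OF f] energy_measure[OF h] by (auto simp: is_energy_measure_def)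
  have "(\<Sum>a\<in>I. c a * measure (M a) Y) = 0"
  proof (rule signed_measure_zero[where K = K])
    fix \<phi> :: "'a \<Rightarrow> real" assume "continuous_on UNIV \<phi>"
    then have \<phi>: "continuous_on K \<phi>" by (rule continuous_on_subset) simp
    have "(\<lambda>n. (\<Sum>w\<in>words n. 2 * cell_energy w f * \<phi> (psi_word w x0)) + (\<Sum>w\<in>words n. mass w * \<phi> (psi_word w x0)))
      \<longlonglongrightarrow> integral\<^sup>L (energy_measure f) \<phi> + integral\<^sup>L N \<phi>"
      using energy_measure[OF f] N(3) \<phi> x0 by (intro tendsto_intros) (auto simp: is_energy_measure_def)
    moreover have "(\<lambda>n. \<Sum>j\<in>J. \<Sum>w\<in>words n. 2 * cell_energy w (h j) * \<phi> (psi_word w x0)) \<longlonglongrightarrow> (\<Sum>j\<in>J. integral\<^sup>L (energy_measure (h j)) \<phi>)"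
      using energy_measure[OF h] \<phi> x0 by (intro tendsto_intros) (auto simp: is_energy_measure_def)
    moreover have "(\<Sum>j\<in>J. \<Sum>w\<in>words n. 2 * cell_energy w (h j) * \<phi> (psi_word w x0)) =
        (\<Sum>w\<in>words n. 2 * cell_energy w f * \<phi> (psi_word w x0)) + (\<Sum>w\<in>words n. mass w * \<phi> (psi_word w x0))" for n
      by (subst sum.swap) (simp add: mass_def algebra_simps sum_distrib_left flip: sum.distrib)
    ultimately have "integral\<^sup>L (energy_measure f) \<phi> + integral\<^sup>L N \<phi> = (\<Sum>j\<in>J. integral\<^sup>L (energy_measure (h j)) \<phi>)"
      by (auto dest: LIMSEQ_unique)
    then show "(\<Sum>a\<in>I. c a * integral\<^sup>L (M a) \<phi>) = 0"
      unfolding sumI by (simp add: M_def c_def sum_negf)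
  qed (use em N J Y in \<open>auto simp: M_def I_def\<close>)
  then have "measure (energy_measure f) Y + measure N Y = (\<Sum>j\<in>J. measure (energy_measure (h j)) Y)"
    unfolding sumI by (simp add: M_def c_def sum_negf)
  then have "measure (energy_measure f) Y \<le> (\<Sum>j\<in>J. measure (energy_measure (h j)) Y)"
    using measure_nonneg[of N Y] by linarith
  then have "ennreal (measure (energy_measure f) Y) \<le> (\<Sum>j\<in>J. ennreal (measure (energy_measure (h j)) Y))"
    by (subst sum_ennreal) (auto intro: ennreal_leI)
  then show ?thesis
    using em by (simp add: finite_measure.emeasure_eq_measure)
qed

text \<open>All sample points below a word of \<open>W\<close> lie in the closed union, where the
  cutoffs are 1. Only an inequality results, since mass accumulating at boundary vertices of the
  union from adjacent cells is counted as well.\<close>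

lemma energy_measure_lower:
  assumes f: "f \<in> form_domain" and W: "W \<subseteq> words n"
  shows "(\<Sum>w\<in>W. 2 * cell_energy w f) \<le> measure (energy_measure f) (\<Union>w\<in>W. psi_word w ` K)"
proof (cases "W = {}")
  case False
  define C where "C = (\<Union>w\<in>W. psi_word w ` K)"
  have fin: "finite W" using W by (rule finite_subset) simp
  have clo: "closed C" unfolding C_def using W fin by (auto intro!: closed_UN closed_cell dest: words_imp)
  have ne: "C \<noteq> {}" using False K_nonempty by (auto simp: C_def)
  have CK: "C \<subseteq> K" using W by (auto simp: C_def)
  obtain x0 where x0: "x0 \<in> K" using K_nonempty by auto
  have em: "sets (energy_measure f) = sets (restrict_space borel K)" "finite_measure (energy_measure f)"
    "\<And>\<phi>. continuous_on K \<phi> \<Longrightarrow> (\<lambda>n. \<Sum>w\<in>words n. 2 * cell_energy w f * \<phi> (psi_word w x0)) \<longlonglongrightarrow> integral\<^sup>L (energy_measure f) \<phi>"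
    using energy_measure[OF f] x0 by (auto simp: is_energy_measure_def)
  have "(\<Sum>w\<in>W. 2 * cell_energy w f) \<le> (\<integral>x. max 0 (1 - real k * infdist x C) \<partial>(energy_measure f))" for k
  proof -
    define \<phi> where "\<phi> x = max 0 (1 - real k * infdist x C)" for x
    have \<phi>: "continuous_on K \<phi>" unfolding \<phi>_def by (intro continuous_intros)
    have \<phi>1: "\<phi> x = 1" if "x \<in> C" for x using that by (simp add: \<phi>_def)
    have \<phi>0: "0 \<le> \<phi> x" for x by (simp add: \<phi>_def)
    have "(\<Sum>w\<in>W. 2 * cell_energy w f) \<le> (\<Sum>w\<in>words (n + m). 2 * cell_energy w f * \<phi> (psi_word w x0))" for m
    proof -
      have inj: "inj_on (\<lambda>(u, w). u @ w) (W \<times> words m)"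
        using W by (auto simp: inj_on_def words_def)
      have "(\<Sum>w\<in>W. 2 * cell_energy w f) = (\<Sum>w\<in>W. \<Sum>w'\<in>words m. 2 * cell_energy (w @ w') f)"
        using cell_energy_eq_sum[OF f, of _ n m] W by (intro sum.cong) (auto simp: sum_distrib_left)
      also have "\<dots> = (\<Sum>w\<in>W. \<Sum>w'\<in>words m. 2 * cell_energy (w @ w') f * \<phi> (psi_word (w @ w') x0))"
      proof (intro sum.cong refl)
        fix w w' assume w: "w \<in> W" "w' \<in> words m"
        then have "psi_word (w @ w') x0 \<in> C"
          unfolding C_def psi_word_append o_def using x0 by (intro UN_I[of w] imageI) auto
        then show "2 * cell_energy (w @ w') f = 2 * cell_energy (w @ w') f * \<phi> (psi_word (w @ w') x0)"
          by (simp add: \<phi>1)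
      qed
      also have "\<dots> = (\<Sum>w\<in>(\<lambda>(u, w). u @ w) ` (W \<times> words m). 2 * cell_energy w f * \<phi> (psi_word w x0))"
        unfolding sum.reindex[OF inj] by (simp add: sum.cartesian_product case_prod_beta o_def)
      also have "\<dots> \<le> (\<Sum>w\<in>words (n + m). 2 * cell_energy w f * \<phi> (psi_word w x0))"
        unfolding words_add using W \<phi>0 f
        by (intro sum_mono2) (auto intro!: mult_nonneg_nonneg cell_energy_nonneg words_append)
      finally show ?thesis .
    qed
    then have "(\<Sum>w\<in>W. 2 * cell_energy w f) \<le> (\<Sum>w\<in>words (m + n). 2 * cell_energy w f * \<phi> (psi_word w x0))" for m
      by (simp add: add.commute)
    then show ?thesis
      using LIMSEQ_ignore_initial_segment[OF em(3)[OF \<phi>], of n] unfolding \<phi>_def[symmetric]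
      by (intro LIMSEQ_le_const) auto
  qed
  moreover have "(\<lambda>k. \<integral>x. max 0 (1 - real k * infdist x C) \<partial>(energy_measure f)) \<longlonglongrightarrow> measure (energy_measure f) C"
    using integral_approx_closed[OF em(1,2) clo ne] CK by (simp add: Int_absorb2)
  ultimately show ?thesis unfolding C_def[symmetric] by (intro LIMSEQ_le_const) auto
qed simp

lemma energy_measure_total:
  assumes f: "f \<in> form_domain" shows "measure (energy_measure f) K = 2 * energy f f"
proof -
  obtain x0 where x0: "x0 \<in> K" using K_nonempty by auto
  have em: "sets (energy_measure f) = sets (restrict_space borel K)"
    "(\<lambda>n. \<Sum>w\<in>words n. 2 * cell_energy w f * 1) \<longlonglongrightarrow> integral\<^sup>L (energy_measure f) (\<lambda>_. 1)"
    using energy_measure[OF f] x0 unfolding is_energy_measure_def by (blast intro: continuous_on_const)+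
  have sp: "space (energy_measure f) = K" using sets_eq_imp_space_eq[OF em(1)] by (simp add: space_restrict_space)
  have "(\<lambda>n::nat. 2 * energy f f) \<longlonglongrightarrow> integral\<^sup>L (energy_measure f) (\<lambda>_. 1)"
    using em(2) energy_eq_sum_cells[OF f] by (simp flip: sum_distrib_left)
  then show ?thesis by (simp add: LIMSEQ_const_iff sp)
qed

end

section \<open>Three boundary vertices\<close>

locale three_vertex_structure = regular_harmonic_structure K S \<psi> \<pi> D r
  for K :: "'a::metric_space set" and S :: "'s set" and \<psi> \<pi> D r +
  fixes v :: "'s \<Rightarrow> 'a \<Rightarrow> real"
  assumes v: "\<And>i. i \<in> S0 \<Longrightarrow> nonneg_eigenvector i (v i)"
    and card_V0: "card V0 = 3"
    and connected_minus_vertex: "\<And>p. p \<in> V0 \<Longrightarrow> connected (K - {p})"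
    and vertex_fixpt: "\<And>p. p \<in> V0 \<Longrightarrow> \<exists>i\<in>S0. p = fixpt i"
    and Dop_v_neg: "\<And>i q. i \<in> S0 \<Longrightarrow> q \<in> V0 - {fixpt i} \<Longrightarrow> Dop D (v i) q < 0"

sublocale three_vertex_structure \<subseteq> fixed_vertex_structure
  by unfold_locales (use vertex_fixpt in \<open>auto simp: S0_def\<close>)

context fixed_vertex_structure
begin

lemma fixpt_inj: "i \<in> S \<Longrightarrow> j \<in> S \<Longrightarrow> fixpt i = fixpt j \<Longrightarrow> i = j"
proof -
  assume a: "i \<in> S" "j \<in> S" "fixpt i = fixpt j"
  have "(\<lambda>_::nat. i) = (\<lambda>_. j)"
    by (rule pi_eq_fixpt) (use a fixpt_eq[of i] in auto)
  then show "i = j" by meson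
qed

lemma psi_eq_fixpt:
  assumes "i \<in> S" "fixpt i \<in> V0" "j \<in> S" "x \<in> K" "\<psi> j x = fixpt i"
  shows "j = i \<and> x = fixpt i"
proof -
  have "fixpt j = x" "x = \<psi> j x" using psi_in_V0[of j x] assms by simp_all
  then have "fixpt j = fixpt i" using assms(5) by (simp only:)
  then have "j = i" by (rule fixpt_inj[OF assms(3,1)])
  then show ?thesis using \<open>fixpt j = x\<close> by simp
qed

section \<open>Normal derivatives and the minimum principle\<close>

lemma E0_indicator: "p \<in> V0 \<Longrightarrow> E0 D u (indicat_real {p}) = - Dop D u p"
proof -
  assume p: "p \<in> V0"
  have "E0 D u (indicat_real {p}) = (\<Sum>q\<in>V0. if q = p then - Dop D u q else 0)"
    unfolding E0_def by (intro sum.cong) auto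
  then show ?thesis using p by simp
qed

lemma Dop_indicator: "p \<in> V0 \<Longrightarrow> Dop D (indicat_real {p}) q = D q p"
proof -
  assume p: "p \<in> V0"
  have "Dop D (indicat_real {p}) q = (\<Sum>q'\<in>V0. if q' = p then D q q' else 0)"
    unfolding Dop_def by (intro sum.cong) auto
  then show ?thesis using p by simp
qed

text \<open>Testing the Gauss-Green formula with the indicator of the vertex leaves only the cell
  \<open>i\<close>, because no other first-level cell contains \<open>fixpt i\<close>. So
  \<open>r i\<close> is the scaling factor of normal derivatives.\<close>

lemma Dop_B:
  assumes "i \<in> S" "fixpt i \<in> V0"
  shows "Dop D (B i u) (fixpt i) = r i * Dop D u (fixpt i)"
proof -
  let ?\<phi> = "indicat_real {fixpt i}"
  have "E0 D (B j u) (?\<phi> \<circ> \<psi> j) = (if j = i then E0 D (B i u) ?\<phi> else 0)" if j: "j \<in> S" for j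
  proof (cases "j = i")
    case True
    then show ?thesis
      using psi_eq_fixpt[OF assms, of i] psi_fixpt[OF assms(1)] assms by (auto intro!: E0_cong simp: indicator_def)
  next
    case False
    have "E0 D (B j u) (?\<phi> \<circ> \<psi> j) = E0 D (B j u) (\<lambda>_. 0 * 0)"
    proof (rule E0_cong)
      fix q assume "q \<in> V0"
      then show "(?\<phi> \<circ> \<psi> j) q = 0 * 0" using psi_eq_fixpt[OF assms j, of q] False by (auto simp: indicator_def)
    qed simp
    then show ?thesis using False unfolding E0_scale_right by simp
  qed
  then have "(\<Sum>j\<in>S. inverse (r j) * E0 D (B j u) (?\<phi> \<circ> \<psi> j)) =
      (\<Sum>j\<in>S. if j = i then inverse (r i) * E0 D (B i u) ?\<phi> else 0)"
    by (intro sum.cong) auto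
  then have "E0 D u ?\<phi> = inverse (r i) * E0 D (B i u) ?\<phi>"
    using assms(1) finite_S by (simp add: E0_B_sum)
  then show ?thesis
    using r_pos[OF assms(1)] assms(2) by (simp add: E0_indicator field_simps)
qed

lemma H_mono:
  assumes "\<And>q. q \<in> V0 \<Longrightarrow> u q \<le> u' q" "x \<in> K" shows "H u x \<le> H u' x"
proof -
  have "u' q - u q \<le> Max ((\<lambda>q. u' q - u q) ` V0)" if "q \<in> V0" for q
    using that by (intro Max_ge) auto
  then have "0 \<le> H (\<lambda>x. 1 * u' x + (-1) * u x) x"
    using assms by (intro H_bounds(1)[where b = "Max ((\<lambda>q. u' q - u q) ` V0)"]) auto
  then show ?thesis unfolding H_lin_comb[OF assms(2), of 1 u' "-1" u] by simp
qed

lemma H_nonneg: "(\<And>q. q \<in> V0 \<Longrightarrow> 0 \<le> u q) \<Longrightarrow> x \<in> K \<Longrightarrow> 0 \<le> H u x"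
  using H_mono[of "\<lambda>_. 0" u x] H_const[of x 0] by simp

lemma H_scale: "x \<in> K \<Longrightarrow> H (\<lambda>x. c * u x) x = c * H u x"
  using H_lin_comb[of x c u 0 u] by simp

lemma B_lin_comb: "i \<in> S \<Longrightarrow> q \<in> V0 \<Longrightarrow> B i (\<lambda>x. a * u x + b * w x) q = a * B i u q + b * B i w q"
  by (simp only: B_eq_H H_lin_comb[OF psi_in_K, of i q a u b w] V0_in_K)

lemma B_scale: "i \<in> S \<Longrightarrow> q \<in> V0 \<Longrightarrow> B i (\<lambda>x. c * u x) q = c * B i u q"
  by (simp add: B_eq_H H_scale psi_in_K)

lemma B_mono: "(\<And>q. q \<in> V0 \<Longrightarrow> u q \<le> u' q) \<Longrightarrow> i \<in> S \<Longrightarrow> q \<in> V0 \<Longrightarrow> B i u q \<le> B i u' q"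
  by (simp add: B_eq_H H_mono psi_in_K)

lemma B_nonneg: "(\<And>q. q \<in> V0 \<Longrightarrow> 0 \<le> u q) \<Longrightarrow> i \<in> S \<Longrightarrow> q \<in> V0 \<Longrightarrow> 0 \<le> B i u q"
  by (simp add: B_eq_H H_nonneg psi_in_K)

lemma B_const: "i \<in> S \<Longrightarrow> q \<in> V0 \<Longrightarrow> B i (\<lambda>_. c) q = c"
  by (simp add: B_eq_H H_const psi_in_K)

text \<open>Strong minimum principle. At an interior zero of a nonnegative harmonic function the
  contributions \<open>Dop D (B i u)\<close> of all adjacent cells are nonnegative and sum to zero.
  Hence each vanishes, and so does the function at every neighbour with positive
  conductance.\<close>

lemma minimum_spreads:
  assumes u: "\<And>q. q \<in> V0 \<Longrightarrow> 0 \<le> u q" and j: "j \<in> S" "c \<in> V0" "\<psi> j c \<notin> V0" "B j u c = 0"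
    and d: "d \<in> V0" "0 < D c d"
  shows "B j u d = 0"
proof -
  let ?z = "\<psi> j c"
  let ?\<phi> = "indicat_real {?z}"
  have nn: "0 \<le> B i u q" if "i \<in> S" "q \<in> V0" for i q using B_nonneg[OF u] that by auto
  have B0: "B i u c' = 0" if "i \<in> S" "c' \<in> V0" "\<psi> i c' = ?z" for i c'
    using j that B_eq_H[of j c u] B_eq_H[of i c' u] by simp
  have Dn: "0 \<le> Dop D (B i u) c'" if "i \<in> S" "c' \<in> V0" "\<psi> i c' = ?z" for i c'
    unfolding Dop_def
  proof (rule sum_nonneg)
    fix q assume "q \<in> V0"
    then show "0 \<le> D c' q * B i u q"
      using B0[OF that] nn[OF that(1)] D_off_diagonal[OF that(2)] by (cases "q = c'") auto
  qed
  have neg: "E0 D (B i u) (?\<phi> \<circ> \<psi> i) \<le> 0" if "i \<in> S" for i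
    unfolding E0_def using Dn[OF that] by (intro sum_nonpos) (auto simp: indicator_def)
  have "(\<Sum>i\<in>S. inverse (r i) * E0 D (B i u) (?\<phi> \<circ> \<psi> i)) = E0 D u ?\<phi>" by (rule E0_B_sum)
  also have "\<dots> = 0" unfolding E0_def using j(3) by (intro sum.neutral) (auto simp: indicator_def)
  finally have "(\<Sum>i\<in>S. - (inverse (r i) * E0 D (B i u) (?\<phi> \<circ> \<psi> i))) = 0" by (simp add: sum_negf)
  then have "- (inverse (r j) * E0 D (B j u) (?\<phi> \<circ> \<psi> j)) = 0"
    using neg r_pos finite_S j(1)
    by (subst (asm) sum_nonneg_eq_0_iff) (auto simp: mult_le_0_iff less_imp_le)
  then have "E0 D (B j u) (?\<phi> \<circ> \<psi> j) = 0" using r_pos[OF j(1)] by simp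
  then have "(\<Sum>q\<in>V0. Dop D (B j u) q * (?\<phi> \<circ> \<psi> j) q) = 0" by (simp add: E0_def sum_negf)
  then have "Dop D (B j u) c * (?\<phi> \<circ> \<psi> j) c = 0"
    using Dn[OF j(1)] j(2) by (subst (asm) sum_nonneg_eq_0_iff) (auto simp: indicator_def)
  then have "(\<Sum>q\<in>V0. D c q * B j u q) = 0" by (simp add: Dop_def)
  moreover have "0 \<le> D c q * B j u q" if "q \<in> V0" for q
    using that j nn[OF j(1)] D_off_diagonal[OF j(2)] by (cases "q = c") auto
  ultimately have "D c d * B j u d = 0"
    using d(1) by (subst (asm) sum_nonneg_eq_0_iff) auto
  then show ?thesis using d(2) by simp
qed

end

section \<open>Strict positivity off the diagonal\<close>

context three_vertex_structure
begin

lemma S0_imp: "i \<in> S0 \<Longrightarrow> i \<in> S" "i \<in> S0 \<Longrightarrow> fixpt i \<in> V0"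
  by (auto simp: S0_def)

lemma third_vertex:
  assumes "p \<in> V0" "q \<in> V0" "p \<noteq> q"
  obtains t where "V0 = {p, q, t}" "t \<noteq> p" "t \<noteq> q" "t \<in> V0"
proof -
  have "card (V0 - {p, q}) = 1"
    using assms card_V0 by (simp add: card_Diff_subset)
  then obtain t where t: "V0 - {p, q} = {t}" by (auto simp: card_1_singleton_iff)
  then have "V0 = {p, q, t}" using assms by blast
  then show ?thesis using that t by blast
qed

lemma vertices:
  assumes "p \<in> V0"
  obtains a b where "V0 = {p, a, b}" "a \<noteq> p" "b \<noteq> p" "a \<noteq> b" "a \<in> V0" "b \<in> V0"
proof -
  have "V0 \<noteq> {p}" using card_V0 by auto
  then obtain a where a: "a \<in> V0" "a \<noteq> p" using assms by auto
  obtain b where "V0 = {p, a, b}" "b \<noteq> p" "b \<noteq> a" "b \<in> V0"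
    by (rule third_vertex[OF assms a(1) a(2)[symmetric]])
  then show ?thesis using that a by metis
qed

lemma B_v: "i \<in> S0 \<Longrightarrow> q \<in> V0 \<Longrightarrow> B i (v i) q = r i * v i q"
  using v[of i] A_eq_B[of i q "v i"] S0_imp(1)[of i] by (auto simp: nonneg_eigenvector_def)

lemma v_nonneg: "i \<in> S0 \<Longrightarrow> q \<in> V0 \<Longrightarrow> 0 \<le> v i q"
  using v[of i] by (auto simp: nonneg_eigenvector_def)

lemma v_fixpt: "i \<in> S0 \<Longrightarrow> v i (fixpt i) = 0"
  using B_v[of i "fixpt i"] B_fixpt[of i "v i"] S0_imp[of i] r_less_1[of i] by auto

text \<open>At a zero of the nonnegative \<open>v i\<close> all terms of \<open>Dop D (v i)\<close>
  are nonnegative, against \<open>Dop_v_neg\<close>.\<close>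

lemma v_pos:
  assumes "i \<in> S0" "q \<in> V0" "q \<noteq> fixpt i" shows "0 < v i q"
proof (rule ccontr)
  assume "\<not> 0 < v i q"
  then have "v i q = 0" using v_nonneg[OF assms(1,2)] by simp
  then have "0 \<le> Dop D (v i) q"
    unfolding Dop_def using D_off_diagonal[OF assms(2)] v_nonneg[OF assms(1)]
    by (intro sum_nonneg) (metis mult_nonneg_nonneg mult_zero_right order_refl)
  then show False using Dop_v_neg[of i q] assms by auto
qed

text \<open>This is where connectedness of \<open>K\<close> minus a vertex enters. If
  \<open>D p q = 0\<close>, the harmonic functions with value 1 at \<open>p\<close>, respectively at
  \<open>q\<close>, and 0 at the other vertices have product zero, since the absolute value of their
  difference has no more energy than their sum. Their zero sets then separate \<open>p\<close> from
  \<open>q\<close> in \<open>K - {t}\<close>, where \<open>t\<close> is the third vertex.\<close>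

lemma D_pos:
  assumes pq: "p \<in> V0" "q \<in> V0" "p \<noteq> q" shows "0 < D p q"
proof (rule ccontr)
  assume "\<not> 0 < D p q"
  then have D0: "D p q = 0" "D q p = 0"
    using D_off_diagonal[OF pq] D_symmetric[OF pq(1,2)] by auto
  obtain t where t: "V0 = {p, q, t}" "t \<noteq> p" "t \<noteq> q" "t \<in> V0" using pq by (rule third_vertex)
  have iso: "0 < D a t" if a: "a \<in> {p, q}" for a
  proof (rule ccontr)
    assume "\<not> 0 < D a t"
    then have "D a t = 0" using D_off_diagonal[of a t] a t pq by auto
    then have "D a x = 0" if "x \<in> V0" for x
      using row_sum[of a] a that D0 pq t by auto
    then have "Dop D (indicat_real {a}) x = 0" if "x \<in> V0" for x
      using D_symmetric[of x a] that a pq by (auto simp: Dop_indicator)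
    then have "indicat_real {a} constant_on V0" using D_kernel by blast
    then have "indicat_real {a} p = indicat_real {a} q" using pq unfolding constant_on_def by metis
    then show False using a pq by (auto simp: indicator_def)
  qed
  obtain k where k: "k \<in> S0" "t = fixpt k" using vertex_fixpt t(4) by blast
  have kS: "k \<in> S" using S0_imp k by auto
  define hp where "hp = indicat_real {p}"
  define hq where "hq = indicat_real {q}"
  define z where "z x = 1 * hp x + 1 * hq x" for x
  have H0: "0 \<le> H hp x" "0 \<le> H hq x" if "x \<in> K" for x
    using that by (auto intro!: H_nonneg simp: hp_def hq_def)
  have Hz: "H z x = H hp x + H hq x" if "x \<in> K" for x
    unfolding z_def H_lin_comb[OF that, of 1 hp 1 hq] by simp
  \<comment> \<open>As the mixed energy vanishes, \<open>\<bar>H hp - H hq\<bar>\<close> has at most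
    the energy of the harmonic function \<open>H z\<close> with the same boundary values, so it
    equals \<open>H z\<close> by uniqueness.\<close>
  have disj: "H hp x = 0 \<or> H hq x = 0" if x: "x \<in> K" for x
  proof -
    let ?d = "\<lambda>x. 1 * H hp x + (-1) * H hq x"
    have d: "?d \<in> form_domain" by (intro form_domain_lin_comb H_form_domain)
    have E: "E0 D hp hq = 0"
      using E0_indicator[OF pq(2), of hp] Dop_indicator[OF pq(1), of q] D0 by (simp add: hq_def hp_def)
    have "energy (H hp) (H hq) = E0 D hp hq" unfolding energy_H by (intro E0_cong) auto
    then have "energy ?d ?d = E0 D z z"
      unfolding z_def energy_lin_comb[OF H_form_domain H_form_domain, of 1 hp "-1" hq] E0_lin_comb[of 1 hp 1 hq] E
      by (simp add: energy_H_self)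
    then have "energy (\<lambda>x. \<bar>?d x\<bar>) (\<lambda>x. \<bar>?d x\<bar>) \<le> E0 D z z"
      using energy_abs[OF d] by simp
    then have "\<bar>?d x\<bar> = H z x"
      by (rule H_unique[OF form_domain_abs[OF d]]) (use x pq in \<open>auto simp: z_def hp_def hq_def indicator_def\<close>)
    then show ?thesis using Hz[OF x] H0[OF x] by auto
  qed
  have z0: "0 \<le> z x" for x by (simp add: z_def hp_def hq_def)
  have zt: "z t = 0" using t by (simp add: z_def hp_def hq_def)
  have z1: "z x = 1" if "x \<in> V0" "x \<noteq> t" for x
  proof -
    have "x = p \<or> x = q" using that t(1) by auto
    then show ?thesis using pq(3) by (auto simp: z_def hp_def hq_def)
  qed
  \<comment> \<open>On \<open>V0\<close> both \<open>z\<close> and \<open>v k\<close> vanish exactly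
    at \<open>t\<close>, so they are comparable up to a constant. This turns the eigenvalue equation
    of \<open>v k\<close> into a lower bound for \<open>B k z\<close>.\<close>
  obtain c where c: "c > 0" "\<And>x. x \<in> V0 \<Longrightarrow> c * v k x \<le> z x" "\<And>x. x \<in> V0 \<Longrightarrow> c * z x \<le> v k x"
  proof -
    have vp: "v k p > 0" "v k q > 0" "v k t = 0" using v_pos[OF k(1)] v_fixpt[OF k(1)] pq t k by auto
    define c where "c = min (min (v k p) (v k q)) (min (1 / v k p) (1 / v k q))"
    have "c > 0" using vp by (simp add: c_def)
    moreover have "c * v k p \<le> 1" "c * v k q \<le> 1"
    proof -
      have "c \<le> 1 / v k p" "c \<le> 1 / v k q" by (auto simp: c_def)
      then show "c * v k p \<le> 1" "c * v k q \<le> 1" using vp by (simp_all add: field_simps)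
    qed
    moreover have "c \<le> v k p" "c \<le> v k q" by (auto simp: c_def)
    ultimately have "c > 0 \<and> (\<forall>x\<in>V0. c * v k x \<le> z x \<and> c * z x \<le> v k x)"
      using vp zt z1[of p] z1[of q] pq t(1-3) by auto
    then show ?thesis using that[of c] by blast
  qed
  have Bkz: "c * (r k * v k x) \<le> B k z x" if "x \<in> V0" for x
    using B_mono[of "\<lambda>x. c * v k x" z k x] c(2) kS that B_scale[OF kS that, of c "v k"] B_v[OF k(1) that] by simp
  \<comment> \<open>A zero of \<open>H z\<close> in a cell other than \<open>k\<close> spreads to
    all vertices of that cell and on to adjacent cells. It never enters the cell \<open>k\<close>,
    where \<open>B k z\<close> is positive at all vertices except \<open>t\<close>, and this
    contradicts the connectedness of the cells.\<close>
  have outside: False if x: "x \<in> K" "x \<notin> \<psi> k ` K" "H z x = 0" for x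
  proof -
    obtain j y where j: "j \<in> S" "y \<in> K" "x = \<psi> j y" using x(1) by (rule ex_cell1)
    then have jk: "j \<noteq> k" using x(2) by auto
    have Hy: "H (B j z) y = 0" using x(3) j by (simp add: H_psi)
    define T where "T = {i \<in> S - {k}. \<forall>a\<in>V0. B i z a = 0}"
    have T: "i \<in> T" if i: "i \<in> S" "i \<noteq> k" "a \<in> V0" "B i z a = 0" for i a
    proof -
      have nV: "\<psi> i b \<notin> V0" if "b \<in> V0" "B i z b = 0" for b
      proof
        assume V: "\<psi> i b \<in> V0"
        then have "\<psi> i b = fixpt i" using psi_in_V0[OF V] i that by auto
        moreover have "z (\<psi> i b) = 0" using that V B_eq_H[of i b z] i by simp
        then have "\<psi> i b = t" using z1[OF V] by (metis zero_neq_one)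
        ultimately show False using k i fixpt_inj[of i k] kS by auto
      qed
      have "B i z t = 0"
      proof (cases "a = t")
        case False
        then have "0 < D a t" using iso i t by auto
        then show ?thesis using minimum_spreads[OF _ i(1,3) nV[OF i(3,4)] i(4) t(4)] z0 by auto
      qed (use i in simp)
      then have "B i z b = 0" if "b \<in> {p, q}" for b
        using minimum_spreads[OF _ i(1) t(4) nV[OF t(4)], of z b] z0 that pq iso[of b] D_symmetric[of t b] t(4) by auto
      then show ?thesis using \<open>B i z t = 0\<close> i t(1) by (auto simp: T_def)
    qed
    have "\<exists>a\<in>V0. B j z a = 0"
    proof (rule ccontr)
      assume "\<not> ?thesis"
      then have pos: "0 < B j z a" if "a \<in> V0" for a
        using B_nonneg[of z j a] z0 j that by force
      define m where "m = Min (B j z ` V0)"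
      have "m \<in> B j z ` V0" unfolding m_def using V0_nonempty by (intro Min_in) auto
      then have "0 < m" using pos by auto
      moreover have "m \<le> B j z a" if "a \<in> V0" for a unfolding m_def using that by auto
      ultimately show False
        using H_mono[of "\<lambda>_. m" "B j z" y] H_const[of y m] j Hy by auto
    qed
    then have "j \<in> T" using T j jk by blast
    have "T = S"
    proof (rule cells_connected)
      fix i j' a b assume a: "i \<in> T" "j' \<in> S" "a \<in> V0" "b \<in> V0" "\<psi> i a = \<psi> j' b"
      then have i: "i \<in> S" "i \<noteq> k" "B i z a = 0" by (auto simp: T_def)
      then have b0: "B j' z b = 0" using a B_eq_H[of i a z] B_eq_H[of j' b z] by simp
      have "j' \<noteq> k"
      proof
        assume [simp]: "j' = k"
        have "c * (r k * v k b) \<le> 0" using Bkz[OF a(4)] b0 by simp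
        then have "\<not> 0 < v k b" using c(1) r_pos[OF kS] by (auto simp: mult_le_0_iff)
        then have "b = t" using v_pos[OF k(1) a(4)] k by auto
        then have "\<psi> i a = fixpt k" using a k psi_fixpt[OF kS] by simp
        then show False using psi_eq_fixpt[OF kS _ i(1), of a] a i t k by auto
      qed
      then show "j' \<in> T" using T a b0 by blast
    qed (use \<open>j \<in> T\<close> in \<open>auto simp: T_def\<close>)
    then show False using kS by (auto simp: T_def)
  qed
  have zero: "x = t" if x: "x \<in> K" "H z x = 0" for x
  proof (rule ccontr)
    assume "x \<noteq> t"
    \<comment> \<open>By the lower bound for \<open>B k z\<close>, a zero in the cell
      \<open>k\<close> pulls back to a zero of \<open>H z\<close>. Iterating, zeros lie in the cells
      of all words \<open>replicate n k\<close>, which shrink to \<open>t\<close>.\<close>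
    have *: "y \<notin> K \<or> y \<in> psi_word (replicate n k) ` K \<or> H z y \<noteq> 0" for n y
    proof (induction n arbitrary: y)
      case (Suc n)
      show ?case
      proof (rule ccontr)
        assume "\<not> ?case"
        then have y: "y \<in> K" "y \<notin> psi_word (replicate (Suc n) k) ` K" "H z y = 0" by auto
        then have "y \<in> \<psi> k ` K" using outside by blast
        then obtain y' where y': "y' \<in> K" "y = \<psi> k y'" by auto
        have "H (B k z) y' = 0" using y y' kS by (simp add: H_psi)
        moreover have "c * (r k * (c * z q)) \<le> B k z q" if "q \<in> V0" for q
        proof -
          have "c * (r k * (c * z q)) \<le> c * (r k * v k q)"
            using c(3)[OF that] c(1) r_pos[OF kS] by (intro mult_left_mono) auto
          then show ?thesis using Bkz[OF that] by simp
        qed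
        then have "H (\<lambda>q. (c * r k * c) * z q) y' \<le> H (B k z) y'"
          using y' by (intro H_mono) (auto simp: mult_ac)
        ultimately have "(c * r k * c) * H z y' \<le> 0"
          using H_scale[OF y'(1)] by simp
        then have "H z y' = 0"
          using H_nonneg[of z y'] z0 y' c(1) r_pos[OF kS] by (auto simp: mult_le_0_iff)
        then have "y' \<in> psi_word (replicate n k) ` K" using Suc y' by blast
        then show False using y y' by (auto simp: psi_word_Cons)
      qed
    qed (auto)
    have "0 < dist x t" using \<open>x \<noteq> t\<close> by simp
    from cells_small[OF this] obtain n where
      n: "\<forall>w\<in>words n. \<forall>y\<in>K. \<forall>y'\<in>K. dist (psi_word w y) (psi_word w y') < dist x t" by blast
    have w: "replicate n k \<in> words n" using kS by (auto simp: words_def)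
    obtain y where y: "y \<in> K" "x = psi_word (replicate n k) y" using *[of x n] x by auto
    have "dist (psi_word (replicate n k) y) (psi_word (replicate n k) t) < dist x t"
      using n w y t(4) by simp
    then show False using psi_replicate_fixpt[OF kS] k y by simp
  qed
  define X where "X = {x \<in> K. H hp x = 0}"
  define Y where "Y = {x \<in> K. H hq x = 0}"
  have "closed X" "closed Y"
    unfolding X_def Y_def using continuous_closed_preimage_constant[OF H_continuous closed_K] by auto
  moreover have "X \<inter> Y \<inter> (K - {t}) = {}" using zero Hz by (auto simp: X_def Y_def)
  moreover have "K - {t} \<subseteq> X \<union> Y" using disj by (auto simp: X_def Y_def)
  moreover have "q \<in> X \<inter> (K - {t})" "p \<in> Y \<inter> (K - {t})"
    using pq t by (auto simp: X_def Y_def hp_def hq_def)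
  ultimately show False
    using connected_closedD[OF connected_minus_vertex[OF t(4)], of X Y] by blast
qed

text \<open>A zero at \<open>q\<close> would spread over the vertices of the cell by the minimum
  principle and \<open>D_pos\<close>, so the normal derivative at \<open>fixpt i\<close> would
  vanish; but it is \<open>r i * D (fixpt i) c\<close>.\<close>

lemma B_pos:
  assumes "i \<in> S0" "c \<in> V0" "q \<in> V0" "c \<noteq> fixpt i" "q \<noteq> fixpt i"
  shows "0 < B i (indicat_real {c}) q"
proof (rule ccontr)
  let ?u = "indicat_real {c}"
  have iS: "i \<in> S" "fixpt i \<in> V0" using S0_imp assms(1) by auto
  assume "\<not> 0 < B i ?u q"
  then have q0: "B i ?u q = 0" using B_nonneg[of ?u i q] iS assms by force
  have "\<psi> i q \<notin> V0" using psi_in_V0[of i q] iS assms by auto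
  then have "B i ?u d = 0" if "d \<in> V0" for d
    using minimum_spreads[of ?u i q d] iS assms q0 D_pos[of q d] that by (cases "d = q") auto
  then have "Dop D (B i ?u) (fixpt i) = 0" by (simp add: Dop_def)
  then have "Dop D ?u (fixpt i) = 0" using Dop_B[OF iS] r_pos[OF iS(1)] by simp
  then have "D (fixpt i) c = 0" using Dop_indicator[OF assms(2)] by simp
  then show False using D_pos[OF iS(2) assms(2)] assms by auto
qed

section \<open>Behaviour of harmonic functions at a vertex\<close>

lemma Dop_v_fixpt_pos:
  assumes i: "i \<in> S0" shows "0 < Dop D (v i) (fixpt i)"
proof -
  let ?p = "fixpt i"
  have p: "?p \<in> V0" using S0_imp i by auto
  obtain a b where ab: "V0 = {?p, a, b}" "a \<noteq> ?p" "b \<noteq> ?p" "a \<noteq> b" "a \<in> V0" "b \<in> V0" using p by (rule vertices)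
  have "Dop D (v i) ?p = D ?p a * v i a + D ?p b * v i b"
    using ab v_fixpt[OF i] by (simp add: Dop_def)
  also have "\<dots> > 0"
    using ab p by (intro add_pos_pos mult_pos_pos D_pos v_pos i) auto
  finally show ?thesis .
qed

text \<open>In the norm weighted by \<open>D (fixpt i)\<close>, a nonnegative function vanishing at
  \<open>fixpt i\<close> is scaled by exactly \<open>r i\<close>, because its norm is its normal
  derivative. A vanishing normal derivative forces opposite signs at the other two vertices, and as
  the entries of \<open>B i\<close> there are positive, part of the two contributions
  cancels.\<close>

lemma B_contraction:
  assumes i: "i \<in> S0"
  shows "\<exists>\<theta>. 0 \<le> \<theta> \<and> \<theta> < 1 \<and> (\<forall>u. u (fixpt i) = 0 \<longrightarrow> Dop D u (fixpt i) = 0 \<longrightarrow>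
    (\<Sum>q\<in>V0 - {fixpt i}. D (fixpt i) q * \<bar>B i u q\<bar>) \<le> \<theta> * r i * (\<Sum>q\<in>V0 - {fixpt i}. D (fixpt i) q * \<bar>u q\<bar>))"
proof -
  define p where "p = fixpt i"
  have iS: "i \<in> S" and p: "p \<in> V0" using S0_imp i by (auto simp: p_def)
  have ri: "r i > 0" using r_pos iS by simp
  obtain a b where ab: "V0 = {p, a, b}" "a \<noteq> p" "b \<noteq> p" "a \<noteq> b" "a \<in> V0" "b \<in> V0" using p by (rule vertices)
  define \<alpha> where "\<alpha> = D p a"
  define \<beta> where "\<beta> = D p b"
  have pos: "\<alpha> > 0" "\<beta> > 0" using D_pos[OF p] ab by (auto simp: \<alpha>_def \<beta>_def)
  define N where "N u = \<alpha> * \<bar>u a\<bar> + \<beta> * \<bar>u b\<bar>" for u :: "'a \<Rightarrow> real"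
  have Vp: "V0 - {p} = {a, b}" using ab by auto
  have N: "(\<Sum>q\<in>V0 - {fixpt i}. D (fixpt i) q * \<bar>u q\<bar>) = N u" for u
    unfolding p_def[symmetric] Vp using ab(4) by (simp add: N_def \<alpha>_def \<beta>_def)
  define X where "X = B i (indicat_real {a})"
  define Y where "Y = B i (indicat_real {b})"
  have XY: "X a > 0" "X b > 0" "Y a > 0" "Y b > 0"
    unfolding X_def Y_def using ab by (auto intro!: B_pos i simp: p_def)
  have Np: "\<alpha> * X a + \<beta> * X b = r i * \<alpha>" "\<alpha> * Y a + \<beta> * Y b = r i * \<beta>"
  proof -
    have "B i (indicat_real {c}) p = 0" if "c \<in> {a, b}" for c
      using B_fixpt[OF iS, of "indicat_real {c}"] p that ab by (auto simp: p_def)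
    then have "Dop D X p = \<alpha> * X a + \<beta> * X b" "Dop D Y p = \<alpha> * Y a + \<beta> * Y b"
      unfolding Dop_def using ab(2-4) by (simp_all add: ab(1) X_def Y_def \<alpha>_def \<beta>_def)
    then show "\<alpha> * X a + \<beta> * X b = r i * \<alpha>" "\<alpha> * Y a + \<beta> * Y b = r i * \<beta>"
      using Dop_B[OF iS, of "indicat_real {a}"] Dop_B[OF iS, of "indicat_real {b}"] p ab
      by (simp_all add: X_def Y_def \<alpha>_def \<beta>_def p_def Dop_indicator)
  qed
  \<comment> \<open>The cancellation for the function with values \<open>\<beta>\<close> at
    \<open>a\<close> and \<open>- \<alpha>\<close> at \<open>b\<close>, whose norm is
    \<open>2 * (\<alpha> * \<beta>)\<close>: after one step
    \<open>2 * (r i * (\<alpha> * \<beta>) - m)\<close> remains.\<close>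
  define m where "m = \<alpha> * min (\<beta> * X a) (\<alpha> * Y a) + \<beta> * min (\<beta> * X b) (\<alpha> * Y b)"
  have "m > 0" using pos XY by (auto simp: m_def intro!: add_pos_pos mult_pos_pos)
  define \<theta> where "\<theta> = max 0 (1 - m / (r i * (\<alpha> * \<beta>)))"
  have \<theta>: "0 \<le> \<theta>" "\<theta> < 1" using \<open>m > 0\<close> pos ri by (auto simp: \<theta>_def)
  have "N (B i u) \<le> \<theta> * r i * N u" if u: "u p = 0" "Dop D u p = 0" for u
  proof -
    have rel: "\<alpha> * u a + \<beta> * u b = 0"
      using u ab by (simp add: Dop_def \<alpha>_def \<beta>_def)
    define l where "l = u a / \<beta>"
    have ua: "u a = l * \<beta>" using pos by (simp add: l_def)
    have "\<beta> * (u b + l * \<alpha>) = 0" using rel by (simp add: ua algebra_simps)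
    then have ub: "u b = - (l * \<alpha>)" using pos by (simp add: add_eq_0_iff2)
    have ueq: "u q = (l * \<beta>) * indicat_real {a} q + (- (l * \<alpha>)) * indicat_real {b} q" if "q \<in> V0" for q
      using that ab u ua ub by (auto simp: indicator_def)
    have Bu: "B i u q = l * (\<beta> * X q - \<alpha> * Y q)" if "q \<in> V0" for q
      using B_cong[OF ueq iS that] B_lin_comb[OF iS that, of "l * \<beta>" "indicat_real {a}" "- (l * \<alpha>)" "indicat_real {b}"]
      by (simp add: X_def Y_def algebra_simps)
    have absd: "\<bar>x - y\<bar> = x + y - 2 * min x y" for x y :: real by (auto simp: min_def)
    have "N (B i u) = \<bar>l\<bar> * (\<alpha> * \<bar>\<beta> * X a - \<alpha> * Y a\<bar> + \<beta> * \<bar>\<beta> * X b - \<alpha> * Y b\<bar>)"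
    proof -
      have "\<alpha> * (L * x) + \<beta> * (L * y) = L * (\<alpha> * x + \<beta> * y)" for x y L :: real by (simp add: algebra_simps)
      then show ?thesis unfolding N_def Bu[OF ab(5)] Bu[OF ab(6)] abs_mult .
    qed
    also have "\<alpha> * \<bar>\<beta> * X a - \<alpha> * Y a\<bar> + \<beta> * \<bar>\<beta> * X b - \<alpha> * Y b\<bar> =
        \<beta> * (\<alpha> * X a + \<beta> * X b) + \<alpha> * (\<alpha> * Y a + \<beta> * Y b) - 2 * m"
      unfolding absd m_def by (simp add: algebra_simps)
    also have "\<dots> = 2 * (r i * (\<alpha> * \<beta>) - m)" unfolding Np by (simp add: algebra_simps)
    also have "\<bar>l\<bar> * \<dots> \<le> \<bar>l\<bar> * (2 * (\<theta> * (r i * (\<alpha> * \<beta>))))"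
    proof (intro mult_left_mono)
      have "(1 - m / (r i * (\<alpha> * \<beta>))) * (r i * (\<alpha> * \<beta>)) \<le> \<theta> * (r i * (\<alpha> * \<beta>))"
        using pos ri by (intro mult_right_mono) (auto simp: \<theta>_def)
      then show "r i * (\<alpha> * \<beta>) - m \<le> \<theta> * (r i * (\<alpha> * \<beta>))"
        using pos ri by (simp add: left_diff_distrib)
    qed auto
    also have "\<dots> = \<theta> * r i * N u"
      using pos by (simp add: N_def ua ub abs_mult algebra_simps)
    finally show ?thesis .
  qed
  then show ?thesis unfolding N unfolding p_def[symmetric] using \<theta>
    by (intro exI[of _ \<theta>] conjI allI impI)
qed

lemma E0_le_sup: "\<exists>C>0. \<forall>u M. (\<forall>q\<in>V0. \<bar>u q\<bar> \<le> M) \<longrightarrow> E0 D u u \<le> C * M\<^sup>2"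
proof -
  define C where "C = 1 + (\<Sum>q\<in>V0. \<Sum>q'\<in>V0. \<bar>D q q'\<bar>)"
  have "E0 D u u \<le> C * M\<^sup>2" if M: "\<forall>q\<in>V0. \<bar>u q\<bar> \<le> M" for u M
  proof -
    have eq: "E0 D u u = (\<Sum>q\<in>V0. \<Sum>q'\<in>V0. - (D q q' * u q' * u q))"
      by (simp add: E0_def Dop_def sum_distrib_right sum_negf)
    have "E0 D u u \<le> \<bar>\<Sum>q\<in>V0. \<Sum>q'\<in>V0. - (D q q' * u q' * u q)\<bar>" unfolding eq by simp
    also have "\<dots> \<le> (\<Sum>q\<in>V0. \<Sum>q'\<in>V0. \<bar>D q q'\<bar> * M\<^sup>2)"
    proof (rule order_trans[OF sum_abs], rule sum_mono, rule order_trans[OF sum_abs], rule sum_mono)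
      fix q q' assume q: "q \<in> V0" "q' \<in> V0"
      have "\<bar>u q'\<bar> * \<bar>u q\<bar> \<le> M * M" using M q by (intro mult_mono) auto
      then show "\<bar>- (D q q' * u q' * u q)\<bar> \<le> \<bar>D q q'\<bar> * M\<^sup>2"
        by (simp add: abs_mult power2_eq_square mult.assoc mult_left_mono)
    qed
    also have "\<dots> = (\<Sum>q\<in>V0. \<Sum>q'\<in>V0. \<bar>D q q'\<bar>) * M\<^sup>2" by (simp add: sum_distrib_right)
    also have "\<dots> \<le> C * M\<^sup>2" by (intro mult_right_mono) (auto simp: C_def)
    finally show ?thesis .
  qed
  moreover have "C > 0" unfolding C_def by (intro add_pos_nonneg sum_nonneg) auto
  ultimately show ?thesis by blast
qed

text \<open>Under \<open>B i\<close> normal derivatives at \<open>fixpt i\<close> scale by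
  \<open>r i\<close>, as \<open>v i\<close> itself does, so this quotient is the coefficient of
  \<open>v i\<close> in the rescaled limit.\<close>

definition ncoeff :: "'s \<Rightarrow> ('a \<Rightarrow> real) \<Rightarrow> real" where
  "ncoeff i u = Dop D u (fixpt i) / Dop D (v i) (fixpt i)"

lemma Bw_replicate_Suc: "Bw (replicate (Suc n) i) u = B i (Bw (replicate n i) u)"
proof -
  have "replicate (Suc n) i = replicate n i @ [i]" by (simp add: replicate_append_same)
  then show ?thesis by (simp only: Bw_append) simp
qed

text \<open>Blowing up a harmonic function at the vertex fixed by \<open>\<psi>\<^sub>i\<close> leaves a multiple of \<open>v i\<close>, namely
  the normal derivative there; the rest decays faster.\<close>

lemma B_decay:
  assumes i: "i \<in> S0"
  shows "\<exists>C \<theta>. 0 < C \<and> 0 \<le> \<theta> \<and> \<theta> < 1 \<and> (\<forall>u n. \<forall>q\<in>V0.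
    \<bar>Bw (replicate n i) u q - u (fixpt i) - ncoeff i u * r i ^ n * v i q\<bar> \<le> C * (\<theta> * r i) ^ n * sqrt (E0 D u u))"
proof -
  define p where "p = fixpt i"
  have iS: "i \<in> S" and p: "p \<in> V0" using S0_imp i by (auto simp: p_def)
  have ri: "r i > 0" using r_pos iS by simp
  obtain \<theta> where \<theta>: "0 \<le> \<theta>" "\<theta> < 1" "\<And>u. u p = 0 \<Longrightarrow> Dop D u p = 0 \<Longrightarrow>
    (\<Sum>q\<in>V0 - {p}. D p q * \<bar>B i u q\<bar>) \<le> \<theta> * r i * (\<Sum>q\<in>V0 - {p}. D p q * \<bar>u q\<bar>)"
    using B_contraction[OF i] unfolding p_def by blast
  define N where "N u = (\<Sum>q\<in>V0 - {p}. D p q * \<bar>u q\<bar>)" for u :: "'a \<Rightarrow> real"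
  have Dp: "D p q > 0" if "q \<in> V0 - {p}" for q using D_pos[OF p, of q] that by auto
  have Dv: "Dop D (v i) p > 0" using Dop_v_fixpt_pos[OF i] by (simp add: p_def)
  have vp: "v i p = 0" using v_fixpt[OF i] by (simp add: p_def)
  have Dlin: "Dop D (\<lambda>x. u x - c - k * v i x) q = Dop D u q - k * Dop D (v i) q" if "q \<in> V0" for u c k q
  proof -
    have "Dop D (\<lambda>x. u x - c - k * v i x) q = Dop D u q - c * (\<Sum>q'\<in>V0. D q q') - k * Dop D (v i) q"
      by (simp add: Dop_def algebra_simps sum_subtractf sum_distrib_left sum.distrib)
    then show ?thesis using row_sum[OF that] by simp
  qed
  \<comment> \<open>The remainder after removing the value at \<open>p\<close> and the multiple of
    \<open>v i\<close>. It has zero value and zero normal derivative at \<open>p\<close> for every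
    \<open>n\<close> and is propagated by \<open>B i\<close>, so the contraction applies at each
    step.\<close>
  define Z where "Z u n q = Bw (replicate n i) u q - u p - ncoeff i u * r i ^ n * v i q" for u n q
  have Bw_p: "Bw (replicate n i) u p = u p" for n u using Bw_fixpt[OF iS] p by (simp add: p_def)
  have DBw: "Dop D (Bw (replicate n i) u) p = r i ^ n * Dop D u p" for n u
    by (induction n) (use Dop_B[OF iS] p in \<open>auto simp: Bw_replicate_Suc p_def simp del: replicate_Suc\<close>)
  have Zp: "Z u n p = 0" for u n by (simp add: Z_def Bw_p vp)
  have DZ: "Dop D (Z u n) p = 0" for u n
    unfolding Z_def Dlin[OF p] DBw using Dv by (simp add: ncoeff_def p_def)
  have ZS: "Z u (Suc n) q = B i (Z u n) q" if q: "q \<in> V0" for u n q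
  proof -
    have "B i (Z u n) q = B i (\<lambda>x. 1 * Bw (replicate n i) u x + (-1) * ((u p) * 1 + (ncoeff i u * r i ^ n) * v i x)) q"
      by (rule arg_cong[where f = "\<lambda>g. B i g q"]) (auto simp: Z_def)
    also have "\<dots> = B i (Bw (replicate n i) u) q - (u p * B i (\<lambda>_. 1) q + ncoeff i u * r i ^ n * B i (v i) q)"
      by (simp only: B_lin_comb[OF iS q, of 1 _ "-1" "\<lambda>x. (u p) * 1 + (ncoeff i u * r i ^ n) * v i x"]
          B_lin_comb[OF iS q, of "u p" "\<lambda>_. 1" "ncoeff i u * r i ^ n" "v i"]) simp
    also have "\<dots> = Z u (Suc n) q"
      unfolding B_const[OF iS q] B_v[OF i q] by (simp add: Z_def Bw_replicate_Suc del: replicate_Suc)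
    finally show ?thesis by simp
  qed
  have NZ: "N (Z u n) \<le> (\<theta> * r i) ^ n * N (Z u 0)" for u n
  proof (induction n)
    case (Suc n)
    have "N (Z u (Suc n)) = N (B i (Z u n))" unfolding N_def using ZS by (intro sum.cong) auto
    also have "\<dots> \<le> \<theta> * r i * N (Z u n)" unfolding N_def by (rule \<theta>(3)[OF Zp DZ])
    also have "\<dots> \<le> \<theta> * r i * ((\<theta> * r i) ^ n * N (Z u 0))"
      using Suc \<theta>(1) ri by (intro mult_left_mono) auto
    finally show ?case by simp
  qed simp
  \<comment> \<open>Bounds the initial remainder \<open>Z u 0\<close> by the energy: the increments
    of \<open>u\<close> and its normal derivative are both estimated by the Poincare
    inequality.\<close>
  define A where "A = (\<Sum>q\<in>V0 - {p}. D p q * (1 + (\<Sum>q'\<in>V0. \<bar>D p q'\<bar>) * v i q / Dop D (v i) p))"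
  have A0: "0 \<le> A"
    unfolding A_def using Dp Dv v_nonneg[OF i]
    by (intro sum_nonneg mult_nonneg_nonneg add_nonneg_nonneg divide_nonneg_pos) (auto simp: less_imp_le)
  have NZ0: "N (Z u 0) \<le> A * sqrt (CP * E0 D u u)" for u
  proof -
    let ?s = "sqrt (CP * E0 D u u)"
    have d: "\<bar>u q - u p\<bar> \<le> ?s" if "q \<in> V0" for q
    proof -
      have "sqrt ((u q - u p)\<^sup>2) \<le> ?s" using CP(2)[OF that p, of u] by (rule real_sqrt_le_mono)
      then show ?thesis by simp
    qed
    have "Dop D u p = (\<Sum>q\<in>V0. D p q * (u q - u p))"
      using row_sum[OF p] by (simp add: Dop_def right_diff_distrib sum_subtractf flip: sum_distrib_right)
    then have "\<bar>Dop D u p\<bar> \<le> (\<Sum>q\<in>V0. \<bar>D p q\<bar> * ?s)"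
      using d by (auto intro!: order_trans[OF sum_abs] sum_mono mult_left_mono simp: abs_mult)
    then have n: "\<bar>ncoeff i u\<bar> \<le> (\<Sum>q\<in>V0. \<bar>D p q\<bar>) * ?s / Dop D (v i) p"
      using Dv by (simp add: ncoeff_def p_def[symmetric] divide_right_mono sum_distrib_right)
    have "D p q * \<bar>Z u 0 q\<bar> \<le> D p q * (1 + (\<Sum>q'\<in>V0. \<bar>D p q'\<bar>) * v i q / Dop D (v i) p) * ?s" if "q \<in> V0 - {p}" for q
    proof -
      have "\<bar>Z u 0 q\<bar> \<le> \<bar>u q - u p\<bar> + \<bar>ncoeff i u\<bar> * v i q"
        using v_nonneg[OF i, of q] that by (simp add: Z_def abs_mult order_trans[OF abs_triangle_ineq4])
      also have "\<dots> \<le> ?s + ((\<Sum>q\<in>V0. \<bar>D p q\<bar>) * ?s / Dop D (v i) p) * v i q"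
        using d n v_nonneg[OF i, of q] that by (intro add_mono mult_right_mono) auto
      also have "\<dots> = (1 + (\<Sum>q'\<in>V0. \<bar>D p q'\<bar>) * v i q / Dop D (v i) p) * ?s" by (simp add: algebra_simps)
      finally show ?thesis using Dp[OF that] by (simp add: mult.assoc)
    qed
    then show ?thesis unfolding N_def A_def sum_distrib_right by (intro sum_mono)
  qed
  define dm where "dm = Min (D p ` (V0 - {p}))"
  obtain a where "a \<in> V0" "a \<noteq> p" using p by (rule vertices)
  then have ne: "V0 - {p} \<noteq> {}" by blast
  have dm: "dm > 0" "\<And>q. q \<in> V0 - {p} \<Longrightarrow> dm \<le> D p q"
    using ne Dp by (auto simp: dm_def)
  define C where "C = A * sqrt CP / dm + 1"
  have "\<bar>Z u n q\<bar> \<le> C * (\<theta> * r i) ^ n * sqrt (E0 D u u)" if q: "q \<in> V0" for u n q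
  proof (cases "q = p")
    case True
    then show ?thesis using Zp \<theta>(1) ri A0 CP(1) dm(1) by (auto simp: C_def E0_nonneg intro!: mult_nonneg_nonneg add_nonneg_nonneg)
  next
    case False
    have "dm * \<bar>Z u n q\<bar> \<le> D p q * \<bar>Z u n q\<bar>" using dm q False by (intro mult_right_mono) auto
    also have "\<dots> \<le> N (Z u n)"
      unfolding N_def using q False Dp
      by (intro member_le_sum[where f = "\<lambda>q. D p q * \<bar>Z u n q\<bar>"]) (auto simp: less_imp_le)
    also have "\<dots> \<le> (\<theta> * r i) ^ n * (A * sqrt (CP * E0 D u u))"
      using NZ[of u n] mult_left_mono[OF NZ0[of u], of "(\<theta> * r i) ^ n"] \<theta>(1) ri by simp
    finally have "\<bar>Z u n q\<bar> \<le> (\<theta> * r i) ^ n * (A * sqrt (CP * E0 D u u)) / dm"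
      using dm(1) by (simp add: field_simps)
    also have "\<dots> = (A * sqrt CP / dm) * ((\<theta> * r i) ^ n * sqrt (E0 D u u))"
      by (simp add: real_sqrt_mult)
    also have "\<dots> \<le> C * ((\<theta> * r i) ^ n * sqrt (E0 D u u))"
      using \<theta>(1) ri E0_nonneg[of u] by (intro mult_right_mono) (auto simp: C_def)
    finally show ?thesis by (simp add: mult.assoc)
  qed
  moreover have "C > 0" using A0 CP(1) dm(1) by (auto simp: C_def intro!: add_nonneg_pos)
  ultimately show ?thesis using \<theta>(1,2) unfolding Z_def p_def by blast
qed

text \<open>Near the vertex the deviation from \<open>u (fixpt i)\<close> is of order
  \<open>r i ^ n\<close>, so the energy is of order \<open>r i ^ (2 * n)\<close>, and one factor
  \<open>r i ^ n\<close> is left after the division.\<close>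

lemma energy_at_vertex_tendsto_0:
  assumes i: "i \<in> S0"
  shows "(\<lambda>n. inverse (r i ^ n) * E0 D (Bw (replicate n i) u) (Bw (replicate n i) u)) \<longlonglongrightarrow> 0"
proof -
  have iS: "i \<in> S" using S0_imp i by auto
  have ri: "r i > 0" "r i < 1" using r_pos r_less_1 iS by auto
  obtain C \<theta> where C: "0 < C" "0 \<le> \<theta>" "\<theta> < 1" "\<And>u n q. q \<in> V0 \<Longrightarrow>
    \<bar>Bw (replicate n i) u q - u (fixpt i) - ncoeff i u * r i ^ n * v i q\<bar> \<le> C * (\<theta> * r i) ^ n * sqrt (E0 D u u)"
    using B_decay[OF i] by blast
  obtain C' where C': "C' > 0" "\<And>u M. (\<forall>q\<in>V0. \<bar>u q\<bar> \<le> M) \<Longrightarrow> E0 D u u \<le> C' * M\<^sup>2"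
    using E0_le_sup by blast
  define V where "V = Max (v i ` V0)"
  have V: "v i q \<le> V" if "q \<in> V0" for q using that by (auto simp: V_def)
  define M where "M = \<bar>ncoeff i u\<bar> * V + C * sqrt (E0 D u u)"
  have le: "\<bar>Bw (replicate n i) u q - u (fixpt i)\<bar> \<le> M * r i ^ n" if q: "q \<in> V0" for n q
  proof -
    have "(\<theta> * r i) ^ n \<le> r i ^ n" using C ri by (intro power_mono) (auto simp: mult_le_cancel_right1)
    then have "C * (\<theta> * r i) ^ n * sqrt (E0 D u u) \<le> C * r i ^ n * sqrt (E0 D u u)"
      using C(1) E0_nonneg by (intro mult_right_mono mult_left_mono) auto
    moreover have "\<bar>ncoeff i u * r i ^ n * v i q\<bar> \<le> \<bar>ncoeff i u\<bar> * r i ^ n * V"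
      using V[OF q] v_nonneg[OF i q] ri by (auto simp: abs_mult intro!: mult_left_mono)
    moreover have "M * r i ^ n = \<bar>ncoeff i u\<bar> * r i ^ n * V + C * r i ^ n * sqrt (E0 D u u)"
      by (simp add: M_def algebra_simps)
    ultimately show ?thesis using C(4)[OF q, of n u] by linarith
  qed
  have E: "E0 D (Bw (replicate n i) u) (Bw (replicate n i) u) \<le> C' * (M * r i ^ n)\<^sup>2" for n
  proof -
    have "E0 D (Bw (replicate n i) u) (Bw (replicate n i) u) \<le>
       E0 D (\<lambda>q. Bw (replicate n i) u q - u (fixpt i)) (\<lambda>q. Bw (replicate n i) u q - u (fixpt i))"
      by (rule E0_mono) simp
    also have "\<dots> \<le> C' * (M * r i ^ n)\<^sup>2" using le by (intro C') auto
    finally show ?thesis .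
  qed
  have bnd: "\<bar>inverse (r i ^ n) * E0 D (Bw (replicate n i) u) (Bw (replicate n i) u)\<bar> \<le> C' * M\<^sup>2 * r i ^ n" for n
  proof -
    have "inverse (r i ^ n) * E0 D (Bw (replicate n i) u) (Bw (replicate n i) u) \<le> inverse (r i ^ n) * (C' * (M * r i ^ n)\<^sup>2)"
      using E ri by (intro mult_left_mono) auto
    also have "\<dots> = C' * M\<^sup>2 * r i ^ n" using ri by (simp add: field_simps power2_eq_square)
    finally show ?thesis using E0_nonneg ri by (simp add: abs_mult)
  qed
  have lim: "(\<lambda>n. C' * M\<^sup>2 * r i ^ n) \<longlonglongrightarrow> 0"
    using ri by (intro tendsto_mult_right_zero LIMSEQ_realpow_zero) auto
  show ?thesis
    by (rule Lim_null_comparison[OF _ lim], rule always_eventually, rule allI) (unfold real_norm_def, rule bnd)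
qed

section \<open>Energy measures of harmonic functions on cells\<close>

lemma rw_replicate: "rw (replicate n i) = r i ^ n"
  by (induction n) auto

lemma energy_H_psi_word:
  assumes "w \<in> words n" shows "energy (H u \<circ> psi_word w) (H u \<circ> psi_word w) = E0 D (Bw w u) (Bw w u)"
proof -
  have "energy (H u \<circ> psi_word w) (H u \<circ> psi_word w) = energy (H (Bw w u)) (H (Bw w u))"
    using assms by (intro energy_cong) (auto simp: H_psi_word words_imp)
  then show ?thesis by (simp add: energy_H_self)
qed

lemma cell_energy_at_vertex_tendsto_0:
  assumes i: "i \<in> S0" and w: "w \<in> words m"
  shows "(\<lambda>n. cell_energy (w @ replicate n i) (H u)) \<longlonglongrightarrow> 0"
proof -
  have "cell_energy (w @ replicate n i) (H u) =
     inverse (rw w) * (inverse (r i ^ n) * E0 D (Bw (replicate n i) (Bw w u)) (Bw (replicate n i) (Bw w u)))" for n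
  proof -
    have "replicate n i \<in> words n" using S0_imp i by (auto simp: words_def)
    then show ?thesis using energy_H_psi_word[OF words_append[OF w], of "replicate n i" n u]
      by (simp add: cell_energy_def Bw_append rw_replicate)
  qed
  then show ?thesis
    using tendsto_mult_right_zero[OF energy_at_vertex_tendsto_0[OF i, of "Bw w u"], of "inverse (rw w)"] by simp
qed

text \<open>The cells of level \<open>m + n\<close> containing the point all end in \<open>n\<close>
  equal letters of \<open>S0\<close>, so their total energy tends to zero. The remaining cells carry
  at least their share by \<open>energy_measure_lower\<close>, which leaves nothing for the point in
  the limit.\<close>

lemma no_atom_at_vertex:
  assumes w0: "w0 \<in> words m" and q0: "q0 \<in> V0"
  shows "measure (energy_measure (H u)) {psi_word w0 q0} = 0"
proof -
  define x where "x = psi_word w0 q0"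
  have xK: "x \<in> K" using w0 q0 by (simp add: x_def)
  define M where "M = energy_measure (H u)"
  have em: "sets M = sets (restrict_space borel K)" "finite_measure M"
    using energy_measure[OF H_form_domain, of u] by (auto simp: is_energy_measure_def M_def)
  interpret M: finite_measure M by (rule em)
  have sp: "space M = K" using sets_eq_imp_space_eq[OF em(1)] by (simp add: space_restrict_space)
  have inM: "C \<in> sets M" if "closed C" "C \<subseteq> K" for C
    unfolding em(1) sets_restrict_space using that by (intro image_eqI[of _ _ C]) auto
  define F where "F = (\<lambda>(w, i). \<lambda>n. cell_energy (w @ replicate n i) (H u))"
  have bound: "measure M {x} \<le> 2 * (\<Sum>p\<in>words m \<times> S0. F p n)" for n
  proof -
    define W where "W = {w \<in> words (m + n). x \<notin> psi_word w ` K}"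
    define C where "C = (\<Union>w\<in>W. psi_word w ` K)"
    have W: "W \<subseteq> words (m + n)" "finite W" by (auto simp: W_def)
    have C: "C \<in> sets M"
      unfolding C_def using W by (intro inM) (auto intro!: closed_UN closed_cell dest: words_imp)
    have xM: "{x} \<in> sets M" using xK by (intro inM) auto
    have CK: "C \<subseteq> K" using W by (auto simp: C_def)
    have "x \<notin> C" by (auto simp: C_def W_def)
    then have "measure M {x} + measure M C = measure M ({x} \<union> C)"
      using C xM by (intro M.finite_measure_Union[symmetric]) auto
    also have "\<dots> \<le> measure M K" using CK xK sets.top[of M] by (intro M.finite_measure_mono) (auto simp: sp)
    also have "\<dots> = (\<Sum>w\<in>words (m + n). 2 * cell_energy w (H u))"
      using energy_measure_total[OF H_form_domain, of u] energy_eq_sum_cells[OF H_form_domain, of u "m + n"]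
      by (simp add: M_def sum_distrib_left)
    finally have "measure M {x} \<le> (\<Sum>w\<in>words (m + n). 2 * cell_energy w (H u)) - (\<Sum>w\<in>W. 2 * cell_energy w (H u))"
      using energy_measure_lower[OF H_form_domain W(1), of u] by (simp add: M_def C_def)
    also have "\<dots> = (\<Sum>w\<in>words (m + n) - W. 2 * cell_energy w (H u))"
      using W by (subst sum_diff) auto
    also have "\<dots> \<le> (\<Sum>w\<in>(\<lambda>(w, i). w @ replicate n i) ` (words m \<times> S0). 2 * cell_energy w (H u))"
    proof (rule sum_mono2)
      show "finite ((\<lambda>(w, i). w @ replicate n i) ` (words m \<times> S0))"
        using finite_S by (auto simp: S0_def)
      show "words (m + n) - W \<subseteq> (\<lambda>(w, i). w @ replicate n i) ` (words m \<times> S0)"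
      proof
        fix w assume "w \<in> words (m + n) - W"
        then have w: "w \<in> words (m + n)" "x \<in> psi_word w ` K" by (auto simp: W_def)
        then obtain w1 w2 where w12: "w = w1 @ w2" "w1 \<in> words m" "w2 \<in> words n" by (auto simp: words_add)
        obtain y where y: "y \<in> K" "x = psi_word w1 (psi_word w2 y)" using w(2) w12 by (auto simp: psi_word_append)
        have "psi_word w2 y \<in> V0"
        proof (cases "w1 = w0")
          case True
          then have "psi_word w2 y = q0"
            using y psi_word_eq_iff[of w0 "psi_word w2 y" q0] w12 w0 q0 by (auto simp: x_def dest: words_imp)
          then show ?thesis using q0 by simp
        next
          case False
          then show ?thesis using psi_word_meet[OF w12(2) w0 False, of "psi_word w2 y" q0] y w12 q0 by (simp add: x_def)
        qed
        then obtain i where i: "i \<in> S" "w2 = replicate n i" "y = fixpt i" "y \<in> V0"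
          using psi_word_in_V0[OF _ w12(3) y(1)] by blast
        then have "i \<in> S0" by (auto simp: S0_def)
        then show "w \<in> (\<lambda>(w, i). w @ replicate n i) ` (words m \<times> S0)" using w12 i by auto
      qed
      show "0 \<le> 2 * cell_energy b (H u)" if "b \<in> (\<lambda>(w, i). w @ replicate n i) ` (words m \<times> S0) - (words (m + n) - W)" for b
        using that S0_imp cell_energy_nonneg[OF H_form_domain, of b "m + n" u]
        by (auto simp: words_def subset_iff)
    qed
    also have "\<dots> \<le> (\<Sum>p\<in>words m \<times> S0. 2 * F p n)"
    proof -
      have "finite (words m \<times> S0)" using finite_S by (auto simp: S0_def)
      moreover have "0 \<le> 2 * F p n" if "p \<in> words m \<times> S0" for p
        using that S0_imp cell_energy_nonneg[OF H_form_domain, of "fst p @ replicate n (snd p)" "m + n" u]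
        by (auto simp: F_def words_def subset_iff)
      ultimately have "(\<Sum>w\<in>(\<lambda>(w, i). w @ replicate n i) ` (words m \<times> S0). 2 * cell_energy w (H u)) \<le>
          (\<Sum>p\<in>words m \<times> S0. ((\<lambda>w. 2 * cell_energy w (H u)) \<circ> (\<lambda>(w, i). w @ replicate n i)) p)"
        by (intro sum_image_le) (auto simp: F_def case_prod_beta)
      then show ?thesis by (simp add: F_def case_prod_beta o_def)
    qed
    finally show ?thesis by (simp add: sum_distrib_left)
  qed
  have "(\<lambda>n. 2 * (\<Sum>p\<in>words m \<times> S0. F p n)) \<longlonglongrightarrow> 2 * (\<Sum>p\<in>words m \<times> S0. 0)"
    unfolding F_def using cell_energy_at_vertex_tendsto_0
    by (intro tendsto_intros tendsto_sum) (auto simp: case_prod_beta)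
  then have "measure M {x} \<le> 0"
    using bound by (intro LIMSEQ_le_const[where X = "\<lambda>n. 2 * (\<Sum>p\<in>words m \<times> S0. F p n)"]) auto
  then have "measure M {x} = 0" using measure_nonneg[of M "{x}"] by linarith
  then show ?thesis unfolding M_def x_def .
qed

text \<open>Off the vertices of level \<open>m\<close>, a set of measure zero, the cells are
  disjoint. So their masses sum to at most the total, and the lower bounds for the single cells must
  be equalities.\<close>

lemma energy_measure_H_cell:
  assumes w: "w \<in> words m"
  shows "measure (energy_measure (H u)) (psi_word w ` K) = 2 * cell_energy w (H u)"
proof -
  define M where "M = energy_measure (H u)"
  have em: "sets M = sets (restrict_space borel K)" "finite_measure M"
    using energy_measure[OF H_form_domain, of u] by (auto simp: is_energy_measure_def M_def)
  interpret M: finite_measure M by (rule em)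
  have sp: "space M = K" using sets_eq_imp_space_eq[OF em(1)] by (simp add: space_restrict_space)
  have inM: "C \<in> sets M" if "closed C" "C \<subseteq> K" for C
    unfolding em(1) sets_restrict_space using that by (intro image_eqI[of _ _ C]) auto
  define V where "V = (\<Union>w\<in>words m. psi_word w ` V0)"
  have Vfin: "finite V" by (simp add: V_def)
  have VK: "V \<subseteq> K" by (auto simp: V_def)
  have V0m: "measure M V = 0"
  proof -
    have "measure M V \<le> (\<Sum>x\<in>V. measure M {x})"
    proof -
      have "(\<lambda>x. {x}) ` V \<subseteq> sets M" using VK by (auto intro!: inM)
      from M.finite_measure_subadditive_finite[OF Vfin this] show ?thesis by simp
    qed
    also have "\<dots> = 0" by (rule sum.neutral) (auto simp: V_def M_def no_atom_at_vertex)
    finally show ?thesis using measure_nonneg[of M V] by simp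
  qed
  have cell: "psi_word w ` K \<in> sets M" if "w \<in> words m" for w
    using that by (intro inM closed_cell) (auto dest: words_imp)
  have VM: "V \<in> sets M" using Vfin VK by (intro inM finite_imp_closed)
  have eq: "measure M (psi_word w ` K - V) = measure M (psi_word w ` K)" if "w \<in> words m" for w
  proof -
    have "measure M (psi_word w ` K) \<le> measure M (psi_word w ` K - V) + measure M V"
    proof -
      have "measure M (psi_word w ` K) \<le> measure M ((psi_word w ` K - V) \<union> V)"
        using cell[OF that] VM by (intro M.finite_measure_mono) auto
      also have "\<dots> \<le> measure M (psi_word w ` K - V) + measure M V"
        using cell[OF that] VM by (intro measure_Un_le) auto
      finally show ?thesis .
    qed
    moreover have "measure M (psi_word w ` K - V) \<le> measure M (psi_word w ` K)"
      using cell[OF that] VM by (intro M.finite_measure_mono) auto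
    ultimately show ?thesis using V0m by simp
  qed
  have disj: "disjoint_family_on (\<lambda>w. psi_word w ` K - V) (words m)"
    unfolding disjoint_family_on_def
  proof (intro ballI impI)
    fix w w' assume a: "w \<in> words m" "w' \<in> words m" "w \<noteq> w'"
    show "(psi_word w ` K - V) \<inter> (psi_word w' ` K - V) = {}"
    proof (rule equals0I)
      fix z assume z: "z \<in> (psi_word w ` K - V) \<inter> (psi_word w' ` K - V)"
      then obtain x y where xy: "x \<in> K" "y \<in> K" "z = psi_word w x" "z = psi_word w' y" by blast
      then have "x \<in> V0" using psi_word_meet[OF a xy(1,2)] by simp
      then have "z \<in> V" using a xy unfolding V_def by blast
      then show False using z by blast
    qed
  qed
  have "(\<Sum>w\<in>words m. measure M (psi_word w ` K)) = (\<Sum>w\<in>words m. measure M (psi_word w ` K - V))"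
    using eq by simp
  also have "\<dots> = measure M (\<Union>w\<in>words m. psi_word w ` K - V)"
    using disj cell VM by (intro M.finite_measure_finite_Union[symmetric]) auto
  also have "\<dots> \<le> measure M K"
    using sets.top[of M] by (intro M.finite_measure_mono) (auto simp: sp)
  also have "\<dots> = (\<Sum>w\<in>words m. 2 * cell_energy w (H u))"
    using energy_measure_total[OF H_form_domain, of u] energy_eq_sum_cells[OF H_form_domain, of u m]
    by (simp add: M_def sum_distrib_left)
  finally have le: "(\<Sum>w\<in>words m. measure M (psi_word w ` K)) \<le> (\<Sum>w\<in>words m. 2 * cell_energy w (H u))" .
  have ge: "2 * cell_energy w (H u) \<le> measure M (psi_word w ` K)" if "w \<in> words m" for w
    using energy_measure_lower[OF H_form_domain, of "{w}" m u] that by (simp add: M_def)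
  have "(\<Sum>w\<in>words m. measure M (psi_word w ` K) - 2 * cell_energy w (H u)) = 0"
    using le sum_mono[of "words m" "\<lambda>w. 2 * cell_energy w (H u)" "\<lambda>w. measure M (psi_word w ` K)", OF ge]
    by (simp add: sum_subtractf)
  from sum_nonneg_0[OF finite_words _ this w]
  have "measure M (psi_word w ` K) - 2 * cell_energy w (H u) = 0" using ge by simp
  then show ?thesis by (simp add: M_def)
qed

text \<open>For \<open>f\<close> the lower bound on the mass of a cell suffices; on the dominating
  side the exact mass is available because the functions are harmonic.\<close>

lemma cell_energy_dominated:
  assumes f: "f \<in> form_domain" and J: "finite J"
    and dom: "\<And>Y. Y \<in> sets (restrict_space borel K) \<Longrightarrow>
      emeasure (energy_measure f) Y \<le> (\<Sum>j\<in>J. emeasure (energy_measure (H (u j))) Y)"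
    and w: "w \<in> words m"
  shows "cell_energy w f \<le> (\<Sum>j\<in>J. cell_energy w (H (u j)))"
proof -
  let ?Y = "psi_word w ` K"
  have Y: "?Y \<in> sets (restrict_space borel K)"
    unfolding sets_restrict_space using closed_cell[OF words_imp[OF w]] w by (intro image_eqI[of _ _ ?Y]) auto
  have fin: "finite_measure (energy_measure f)" "finite_measure (energy_measure (H (u j)))" for j
    using energy_measure[OF f] energy_measure[OF H_form_domain, of "u j"] by (auto simp: is_energy_measure_def)
  have "ennreal (measure (energy_measure f) ?Y) \<le> (\<Sum>j\<in>J. ennreal (measure (energy_measure (H (u j))) ?Y))"
    using dom[OF Y] fin by (simp add: finite_measure.emeasure_eq_measure)
  then have "measure (energy_measure f) ?Y \<le> (\<Sum>j\<in>J. measure (energy_measure (H (u j))) ?Y)"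
    by (subst (asm) sum_ennreal) (auto simp: ennreal_le_iff sum_nonneg)
  also have "\<dots> = 2 * (\<Sum>j\<in>J. cell_energy w (H (u j)))"
    by (simp add: energy_measure_H_cell[OF w] sum_distrib_left)
  finally show ?thesis using energy_measure_lower[OF f, of "{w}" m] w by simp
qed

end

section \<open>Comparison at a vertex\<close>

context regular_harmonic_structure
begin

lemma cell_energy_cong:
  assumes "w \<in> words m" "\<And>x. x \<in> K \<Longrightarrow> f (psi_word w x) = g (psi_word w x)"
  shows "cell_energy w f = cell_energy w g"
  unfolding cell_energy_def using assms by (intro arg_cong2[where f = "(*)"] refl energy_cong) auto

lemma energy_shift:
  assumes "f \<in> form_domain" shows "energy (\<lambda>x. f x + c) (\<lambda>x. f x + c) = energy f f"
  using energy_lin_comb[OF assms form_domain_const[of c], of 1 1] by (simp add: energy_const)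

lemma form_domain_shift: "f \<in> form_domain \<Longrightarrow> (\<lambda>x. f x + c) \<in> form_domain"
  by (rule form_domain_add[OF _ form_domain_const])

lemma cell_energy_shift:
  assumes "f \<in> form_domain" "w \<in> words m" shows "cell_energy w (\<lambda>x. f x + c) = cell_energy w f"
  unfolding cell_energy_def o_def
  using energy_shift[OF form_domain_psi_word[OF assms], of c] by (simp add: o_def)

lemma cell_energy_scale:
  assumes "f \<in> form_domain" "w \<in> words m" shows "cell_energy w (\<lambda>x. c * f x) = c\<^sup>2 * cell_energy w f"
  unfolding cell_energy_def o_def
  using energy_scale[OF form_domain_psi_word[OF assms], of c] by (simp add: o_def)

text \<open>Young's inequality with weight \<open>s\<close>, from the nonnegative energy of
  \<open>sqrt s * f - g / sqrt s\<close>.\<close>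

lemma energy_add_le:
  assumes "f \<in> form_domain" "g \<in> form_domain" "s > 0"
  shows "energy (\<lambda>x. f x + g x) (\<lambda>x. f x + g x) \<le> (1 + s) * energy f f + (1 + 1 / s) * energy g g"
proof -
  have "0 \<le> energy (\<lambda>x. sqrt s * f x + (- 1 / sqrt s) * g x) (\<lambda>x. sqrt s * f x + (- 1 / sqrt s) * g x)"
    by (intro energy_nonneg form_domain_lin_comb assms)
  also have "\<dots> = s * energy f f - 2 * energy f g + (1 / s) * energy g g"
    unfolding energy_lin_comb[OF assms(1,2)] using assms(3) by (simp add: power_divide field_simps)
  finally have "2 * energy f g \<le> s * energy f f + (1 / s) * energy g g" by simp
  moreover have "energy (\<lambda>x. f x + g x) (\<lambda>x. f x + g x) = energy f f + 2 * energy f g + energy g g"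
    using energy_lin_comb[OF assms(1,2), of 1 1] by simp
  ultimately show ?thesis by (simp add: algebra_simps)
qed

lemma cell_energy_add_le:
  assumes "f \<in> form_domain" "g \<in> form_domain" "s > 0" "w \<in> words m"
  shows "cell_energy w (\<lambda>x. f x + g x) \<le> (1 + s) * cell_energy w f + (1 + 1 / s) * cell_energy w g"
proof -
  have "0 < inverse (rw w)" using rw_pos[OF words_imp[OF assms(4)]] by simp
  then have "inverse (rw w) * energy (\<lambda>x. (f \<circ> psi_word w) x + (g \<circ> psi_word w) x) (\<lambda>x. (f \<circ> psi_word w) x + (g \<circ> psi_word w) x)
     \<le> inverse (rw w) * ((1 + s) * energy (f \<circ> psi_word w) (f \<circ> psi_word w) + (1 + 1 / s) * energy (g \<circ> psi_word w) (g \<circ> psi_word w))"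
    using assms by (intro mult_left_mono energy_add_le form_domain_psi_word) auto
  then show ?thesis by (simp add: cell_energy_def o_def algebra_simps)
qed

lemma cell_energy_max_le:
  assumes "f \<in> form_domain" "g \<in> form_domain" "w \<in> words m"
  shows "cell_energy w (\<lambda>x. max (f x) (g x)) \<le> cell_energy w f + cell_energy w g"
proof -
  have "0 < inverse (rw w)" using rw_pos[OF words_imp[OF assms(3)]] by simp
  then have "inverse (rw w) * energy (\<lambda>x. max ((f \<circ> psi_word w) x) ((g \<circ> psi_word w) x)) (\<lambda>x. max ((f \<circ> psi_word w) x) ((g \<circ> psi_word w) x))
     \<le> inverse (rw w) * (energy (f \<circ> psi_word w) (f \<circ> psi_word w) + energy (g \<circ> psi_word w) (g \<circ> psi_word w))"
    using assms by (intro mult_left_mono energy_max_le form_domain_psi_word) auto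
  then show ?thesis by (simp add: cell_energy_def o_def algebra_simps)
qed

text \<open>Away from the level set \<open>g = V - \<epsilon>\<close> the maximum agrees locally with one of the two functions;
  among many disjoint level sets one carries little energy.\<close>

lemma energy_max_level:
  assumes V: "V \<in> form_domain" and g: "g \<in> form_domain"
    and exc: "\<And>n. (\<Sum>w\<in>words n. max 0 (cell_energy w g - cell_energy w V)) \<le> \<tau>"
    and e0: "0 < \<epsilon>0" and m: "0 < m"
  shows "\<exists>\<epsilon>. 0 < \<epsilon> \<and> \<epsilon> < \<epsilon>0 \<and>
    energy (\<lambda>x. max (g x) (V x + (- \<epsilon>))) (\<lambda>x. max (g x) (V x + (- \<epsilon>))) \<le> energy V V + \<tau> + energy V V / real m"
proof -
  define d where "d x = g x - V x" for x
  \<comment> \<open>Equally spaced levels between 0 and \<open>\<epsilon>0\<close>, at distance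
    \<open>gap\<close>. A cell on which \<open>d\<close> varies by less than \<open>gap\<close> is
    crossed by at most one of them.\<close>
  define e where "e j = \<epsilon>0 * real (Suc j) / real (Suc m)" for j
  define gap where "gap = \<epsilon>0 / real (Suc m)"
  have gap: "gap > 0" using e0 by (simp add: gap_def)
  have e: "0 < e j" for j unfolding e_def using e0 by (intro divide_pos_pos mult_pos_pos) auto
  have e': "e j < \<epsilon>0" if "j < m" for j
    unfolding e_def using that e0 by (subst pos_divide_less_eq) (auto intro!: mult_strict_left_mono)
  have e_gap: "e j + gap \<le> e j'" if "j < j'" for j j'
  proof -
    have "\<epsilon>0 * real (Suc j) + \<epsilon>0 \<le> \<epsilon>0 * real (Suc j')"
      using that e0 mult_left_mono[of "real (Suc j) + 1" "real (Suc j')" \<epsilon>0] by (simp add: algebra_simps)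
    then show ?thesis unfolding e_def gap_def by (simp add: divide_right_mono flip: add_divide_distrib)
  qed
  have dc: "continuous_on K d" unfolding d_def using V g by (intro continuous_intros form_domain_continuous)
  obtain n where n: "\<forall>w\<in>words n. \<forall>x\<in>K. \<forall>y\<in>K. dist (d (psi_word w x)) (d (psi_word w y)) < gap"
    using uniform_on_cells[OF dc gap] by blast
  define M where "M j = {w \<in> words n. (\<exists>x\<in>K. - e j \<le> d (psi_word w x)) \<and> (\<exists>y\<in>K. d (psi_word w y) < - e j)}" for j
  have disj: "M j \<inter> M j' = {}" if "j < j'" for j j'
  proof (rule equals0I)
    fix w assume "w \<in> M j \<inter> M j'"
    then obtain x y where "w \<in> words n" "x \<in> K" "y \<in> K" "- e j \<le> d (psi_word w x)" "d (psi_word w y) < - e j'"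
      by (auto simp: M_def)
    moreover from this have "\<bar>d (psi_word w x) - d (psi_word w y)\<bar> < gap" using n by (simp add: dist_real_def)
    ultimately show False using e_gap[OF that] by linarith
  qed
  have Mfin: "finite (M j)" "M j \<subseteq> words n" for j by (auto simp: M_def)
  have nn: "0 \<le> cell_energy w V" if "w \<in> words n" for w using cell_energy_nonneg[OF V that] .
  have "(\<Sum>j<m. \<Sum>w\<in>M j. cell_energy w V) = (\<Sum>w\<in>(\<Union>j<m. M j). cell_energy w V)"
  proof (rule sum.UNION_disjoint[symmetric])
    show "\<forall>i\<in>{..<m}. \<forall>j\<in>{..<m}. i \<noteq> j \<longrightarrow> M i \<inter> M j = {}"
      using disj by (metis inf_commute nat_neq_iff)
  qed (use Mfin in auto)
  also have "\<dots> \<le> (\<Sum>w\<in>words n. cell_energy w V)"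
    using Mfin nn by (intro sum_mono2) auto
  also have "\<dots> = energy V V" by (rule energy_eq_sum_cells[OF V, symmetric])
  finally have tot: "(\<Sum>j<m. \<Sum>w\<in>M j. cell_energy w V) \<le> energy V V" .
  \<comment> \<open>Pigeonhole: the sets \<open>M j\<close> are disjoint, so one of them carries at
    most the \<open>m\<close>-th part of the energy of \<open>V\<close>.\<close>
  have "\<exists>j<m. (\<Sum>w\<in>M j. cell_energy w V) \<le> energy V V / real m"
  proof (rule ccontr)
    assume "\<not> ?thesis"
    then have "(\<Sum>j<m. energy V V / real m) < (\<Sum>j<m. \<Sum>w\<in>M j. cell_energy w V)"
      using m by (intro sum_strict_mono) (auto simp: not_le)
    then show False using tot m by simp
  qed
  then obtain j where j: "j < m" "(\<Sum>w\<in>M j. cell_energy w V) \<le> energy V V / real m" by blast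
  let ?V = "\<lambda>x. V x + (- e j)" and ?F = "\<lambda>x. max (g x) (V x + (- e j))"
  have V': "?V \<in> form_domain" using V by (rule form_domain_shift)
  have F: "?F \<in> form_domain" using g V' by (rule form_domain_max)
  have cell: "cell_energy w ?F \<le> (cell_energy w V + max 0 (cell_energy w g - cell_energy w V)) + (if w \<in> M j then cell_energy w V else 0)"
    if w: "w \<in> words n" for w
  proof (cases "w \<in> M j")
    case True
    have "cell_energy w ?F \<le> cell_energy w g + cell_energy w ?V" by (rule cell_energy_max_le[OF g V' w])
    then show ?thesis using True cell_energy_shift[OF V w, of "- e j"] by simp
  next
    case False
    then consider "\<forall>x\<in>K. d (psi_word w x) < - e j" | "\<forall>x\<in>K. - e j \<le> d (psi_word w x)"
      using w unfolding M_def by (auto simp: not_less not_le)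
    then show ?thesis
    proof cases
      case 1
      then have "cell_energy w ?F = cell_energy w ?V"
        by (intro cell_energy_cong[OF w]) (fastforce simp: d_def max_def)
      then show ?thesis using cell_energy_shift[OF V w, of "- e j"] False by simp
    next
      case 2
      then have "cell_energy w ?F = cell_energy w g"
        by (intro cell_energy_cong[OF w]) (fastforce simp: d_def max_def)
      then show ?thesis using False by simp
    qed
  qed
  have "energy ?F ?F = (\<Sum>w\<in>words n. cell_energy w ?F)" by (rule energy_eq_sum_cells[OF F])
  also have "\<dots> \<le> (\<Sum>w\<in>words n. (cell_energy w V + max 0 (cell_energy w g - cell_energy w V)) + (if w \<in> M j then cell_energy w V else 0))"
    using cell by (rule sum_mono)
  also have "\<dots> = energy V V + (\<Sum>w\<in>words n. max 0 (cell_energy w g - cell_energy w V)) + (\<Sum>w\<in>M j. cell_energy w V)"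
    using energy_eq_sum_cells[OF V, of n] Mfin[of j]
    by (simp add: sum.distrib Int_absorb1 flip: sum.inter_restrict)
  also have "\<dots> \<le> energy V V + \<tau> + energy V V / real m" using exc[of n] j(2) by simp
  finally show ?thesis using e[of j] e'[OF j(1)] by blast
qed

end

context three_vertex_structure
begin

text \<open>Testing \<open>V = H (v i)\<close> against \<open>max g (V - \<epsilon>)\<close>: since all normal derivatives of \<open>v i\<close> away from
  its zero are strictly negative, a function whose energy is dominated by that of \<open>V\<close> cannot exceed \<open>V\<close>.\<close>

lemma comparison_at_vertex:
  assumes i: "i \<in> S0"
  shows "\<exists>\<beta>>0. \<forall>g\<in>form_domain. \<forall>\<tau>. g (fixpt i) = 0 \<longrightarrow>
    (\<forall>n. (\<Sum>w\<in>words n. max 0 (cell_energy w g - cell_energy w (H (v i)))) \<le> \<tau>) \<longrightarrow>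
    (\<forall>q\<in>V0. g q \<le> v i q + \<beta> * \<tau>)"
proof -
  define p where "p = fixpt i"
  have p: "p \<in> V0" using S0_imp i by (auto simp: p_def)
  define V where "V = H (v i)"
  have V: "V \<in> form_domain" unfolding V_def by (rule H_form_domain)
  have vp: "v i p = 0" using v_fixpt[OF i] by (simp add: p_def)
  \<comment> \<open>Positive weights by \<open>Dop_v_neg\<close>: the mixed energy of
    \<open>V\<close> with a function vanishing at \<open>p\<close> is the weighted sum of its values
    at the other vertices.\<close>
  define k where "k x = - Dop D (v i) x" for x
  have k: "k x > 0" if "x \<in> V0 - {p}" for x using Dop_v_neg[OF i, of x] that by (simp add: k_def p_def)
  define b where "b = Min (k ` (V0 - {p}))"
  obtain a where "a \<in> V0" "a \<noteq> p" using p by (rule vertices)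
  then have "V0 - {p} \<noteq> {}" by blast
  then have b: "b > 0" "\<And>x. x \<in> V0 - {p} \<Longrightarrow> b \<le> k x" using k by (auto simp: b_def)
  define G where "G = (\<Sum>x\<in>V0 - {p}. k x)"
  have EV: "energy V V = (\<Sum>x\<in>V0 - {p}. k x * v i x)"
    unfolding V_def energy_H_self E0_def using p vp by (subst sum.remove[OF finite_V0 p]) (simp add: k_def)
  have EVn: "0 \<le> energy V V" using V by (rule energy_nonneg)
  have main: "g q \<le> v i q + (1 / (2 * b)) * \<tau>"
    if g: "g \<in> form_domain" "g p = 0" and exc: "\<And>n. (\<Sum>w\<in>words n. max 0 (cell_energy w g - cell_energy w V)) \<le> \<tau>"
      and q: "q \<in> V0" for g \<tau> q
  proof (cases "g q \<le> v i q")
    case True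
    have "0 \<le> \<tau>" using exc[of 0] by (simp add: max_def split: if_splits)
    then show ?thesis using True b(1) by (simp add: add_increasing2)
  next
    case False
    then have qp: "q \<in> V0 - {p}" using q g(2) vp by auto
    \<comment> \<open>The energy bound for \<open>F\<close> bounds \<open>2 * energy V F\<close>
      from above. In the weighted sum the excess of \<open>F\<close> over
      \<open>v i - \<epsilon>\<close> enters with nonnegative terms only, so the single term at
      \<open>q\<close> is bounded too.\<close>
    have step: "k q * (g q - v i q) \<le> \<tau> / 2 + (\<epsilon>0 * G + energy V V / real m / 2)"
      if e0: "0 < \<epsilon>0" and m: "0 < m" for \<epsilon>0 m
    proof -
      obtain \<epsilon> where e: "0 < \<epsilon>" "\<epsilon> < \<epsilon>0"
        and le: "energy (\<lambda>x. max (g x) (V x + (- \<epsilon>))) (\<lambda>x. max (g x) (V x + (- \<epsilon>))) \<le> energy V V + \<tau> + energy V V / real m"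
        using energy_max_level[OF V g(1) exc e0 m] by blast
      define F where "F x = max (g x) (V x + (- \<epsilon>))" for x
      have F: "F \<in> form_domain" unfolding F_def using g(1) form_domain_shift[OF V] by (rule form_domain_max)
      have Fp: "F p = 0" using g(2) vp p e by (simp add: F_def V_def)
      have FV: "v i x - \<epsilon> \<le> F x" "g x \<le> F x" if "x \<in> V0" for x using that by (auto simp: F_def V_def)
      have "energy V F = (\<Sum>x\<in>V0 - {p}. k x * F x)"
        unfolding V_def energy_H E0_def using p Fp by (subst sum.remove[OF finite_V0 p]) (simp add: k_def)
      also have "\<dots> = (\<Sum>x\<in>V0 - {p}. k x * (v i x - \<epsilon>)) + (\<Sum>x\<in>V0 - {p}. k x * (F x - (v i x - \<epsilon>)))"
        by (simp add: sum.distrib[symmetric] algebra_simps)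
      also have "(\<Sum>x\<in>V0 - {p}. k x * (v i x - \<epsilon>)) = energy V V - \<epsilon> * G"
        unfolding EV G_def by (simp add: algebra_simps sum_subtractf sum_distrib_left)
      finally have 1: "energy V F = energy V V - \<epsilon> * G + (\<Sum>x\<in>V0 - {p}. k x * (F x - (v i x - \<epsilon>)))" .
      have "k q * (F q - (v i q - \<epsilon>)) \<le> (\<Sum>x\<in>V0 - {p}. k x * (F x - (v i x - \<epsilon>)))"
        using qp k FV by (intro member_le_sum[where f = "\<lambda>x. k x * (F x - (v i x - \<epsilon>))"])
          (auto intro!: mult_nonneg_nonneg simp: less_imp_le)
      moreover have "k q * (g q - v i q) \<le> k q * (F q - (v i q - \<epsilon>))"
        using k[OF qp] FV(2)[OF q] e by (intro mult_left_mono) auto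
      moreover have "2 * energy V F \<le> energy V V + energy F F"
        using energy_nonneg[OF form_domain_lin_comb[OF V F, of 1 "-1"]] unfolding energy_lin_comb[OF V F] by simp
      moreover have "energy F F \<le> energy V V + \<tau> + energy V V / real m" using le unfolding F_def .
      moreover have "\<epsilon> * G \<le> \<epsilon>0 * G"
        unfolding G_def using e k by (intro mult_right_mono sum_nonneg) (auto simp: less_imp_le)
      ultimately show ?thesis using 1 by (simp add: field_simps)
    qed
    \<comment> \<open>Letting \<open>\<epsilon>0\<close> and the energy share of the level set tend
      to zero leaves \<open>\<tau> / 2\<close>, whence the constant
      \<open>1 / (2 * b)\<close>.\<close>
    have "(\<lambda>m. \<tau> / 2 + (1 / real (Suc m) * G + energy V V / real (Suc m) / 2)) \<longlonglongrightarrow> \<tau> / 2 + (0 * G + 0 / 2)"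
    proof -
      have a: "(\<lambda>m. 1 / real (Suc m)) \<longlonglongrightarrow> 0" by (rule LIMSEQ_Suc[OF lim_1_over_n])
      have "(\<lambda>m. energy V V * (1 / real (Suc m))) \<longlonglongrightarrow> energy V V * 0" by (intro tendsto_intros a)
      then have "(\<lambda>m. energy V V / real (Suc m)) \<longlonglongrightarrow> 0" by simp
      then show ?thesis by (intro tendsto_intros a) auto
    qed
    then have "k q * (g q - v i q) \<le> \<tau> / 2 + (0 * G + 0 / 2)"
      by (rule LIMSEQ_le_const) (use step[of "1 / real (Suc _)" "Suc _"] in auto)
    moreover have "b * (g q - v i q) \<le> k q * (g q - v i q)" using b(2)[OF qp] False by (intro mult_right_mono) auto
    ultimately have "b * (g q - v i q) \<le> \<tau> / 2" by simp
    then show ?thesis using b(1) by (simp add: field_simps)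
  qed
  show ?thesis
    using main b(1) unfolding V_def p_def by (intro exI[of _ "1 / (2 * b)"]) auto
qed

section \<open>Dominated functions near a vertex\<close>

text \<open>Harmonicity on \<open>K\<close> in terms of the function's own boundary values, a form
  that passes to \<open>h \<circ> psi_word w\<close>.\<close>

definition harm :: "('a \<Rightarrow> real ^ 'n) \<Rightarrow> bool" where
  "harm h \<longleftrightarrow> (\<forall>j. \<forall>x\<in>K. h x $ j = H (\<lambda>z. h z $ j) x)"

definition dominated :: "('a \<Rightarrow> real) \<Rightarrow> ('a \<Rightarrow> real ^ 'n) \<Rightarrow> bool" where
  "dominated f h \<longleftrightarrow> f \<in> form_domain \<and>
    (\<forall>m. \<forall>w\<in>words m. cell_energy w f \<le> (\<Sum>j\<in>UNIV. cell_energy w (\<lambda>z. h z $ j)))"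

definition total_energy :: "('a \<Rightarrow> real ^ 'n) \<Rightarrow> real" where
  "total_energy h = (\<Sum>j\<in>UNIV. E0 D (\<lambda>z. h z $ j) (\<lambda>z. h z $ j))"

lemma harm_psi_word:
  assumes "harm h" "w \<in> words m" shows "harm (h \<circ> psi_word w)"
  unfolding harm_def
proof (intro allI ballI)
  fix j x assume x: "x \<in> K"
  let ?u = "\<lambda>z. h z $ j"
  have "(h \<circ> psi_word w) x $ j = H ?u (psi_word w x)" using assms x by (auto simp: harm_def)
  also have "\<dots> = H (H ?u \<circ> psi_word w) x" using H_psi_word'[OF words_imp[OF assms(2)] x] .
  also have "\<dots> = H (\<lambda>z. (h \<circ> psi_word w) z $ j) x"
    using assms by (intro H_cong x) (auto simp: harm_def)
  finally show "(h \<circ> psi_word w) x $ j = H (\<lambda>z. (h \<circ> psi_word w) z $ j) x" .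
qed

lemma dominated_psi_word:
  assumes "dominated f h" "w \<in> words m" shows "dominated (f \<circ> psi_word w) (h \<circ> psi_word w)"
  unfolding dominated_def
proof (intro conjI allI ballI)
  show "f \<circ> psi_word w \<in> form_domain" using assms form_domain_psi_word by (auto simp: dominated_def)
  fix n w' assume w': "w' \<in> words n"
  have pos: "rw w > 0" using rw_pos[OF words_imp[OF assms(2)]] .
  have c: "cell_energy w' (g \<circ> psi_word w) = rw w * cell_energy (w @ w') g" for g
    using pos by (simp add: cell_energy_append)
  have ch: "cell_energy w' (\<lambda>z. (h \<circ> psi_word w) z $ j) = rw w * cell_energy (w @ w') (\<lambda>z. h z $ j)" for j
    using c[of "\<lambda>z. h z $ j"] by (simp add: o_def)
  have "cell_energy (w @ w') f \<le> (\<Sum>j\<in>UNIV. cell_energy (w @ w') (\<lambda>z. h z $ j))"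
    using assms(1) words_append[OF assms(2) w'] by (auto simp: dominated_def)
  then have "rw w * cell_energy (w @ w') f \<le> (\<Sum>j\<in>UNIV. rw w * cell_energy (w @ w') (\<lambda>z. h z $ j))"
    using pos by (simp flip: sum_distrib_left)
  then show "cell_energy w' (f \<circ> psi_word w) \<le> (\<Sum>j\<in>UNIV. cell_energy w' (\<lambda>z. (h \<circ> psi_word w) z $ j))"
    using c[of f] ch by simp
qed

lemma total_energy_nonneg: "0 \<le> total_energy h"
  unfolding total_energy_def by (intro sum_nonneg E0_nonneg)

lemma harm_energy:
  assumes "harm h"
  shows "energy (\<lambda>z. h z $ j) (\<lambda>z. h z $ j) = E0 D (\<lambda>z. h z $ j) (\<lambda>z. h z $ j)"
  using assms energy_H_self[of "\<lambda>z. h z $ j"]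
    energy_cong[of "\<lambda>z. h z $ j" "H (\<lambda>z. h z $ j)" "\<lambda>z. h z $ j" "H (\<lambda>z. h z $ j)"] by (simp add: harm_def)

lemma dominated_energy: "harm h \<Longrightarrow> dominated f h \<Longrightarrow> energy f f \<le> total_energy h"
  unfolding dominated_def total_energy_def using harm_energy[of h] by (force dest: spec[of _ 0])

lemma dominated_osc:
  assumes "harm h" "dominated f h" "x \<in> K" "y \<in> K"
  shows "\<bar>f x - f y\<bar> \<le> CS * sqrt (total_energy h)"
proof -
  have "\<bar>f x - f y\<bar> \<le> CS * sqrt (energy f f)" using assms by (intro CS) (auto simp: dominated_def)
  also have "\<dots> \<le> CS * sqrt (total_energy h)"
    using dominated_energy[OF assms(1,2)] CS(1) by (intro mult_left_mono real_sqrt_le_mono) auto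
  finally show ?thesis .
qed

text \<open>The blow-up argument: near a vertex at which the normal derivative of \<open>h\<close> is not small,
  increments of a dominated function are controlled by those of \<open>h\<close>, uniformly in both functions.\<close>

lemma good_end:
  fixes dummy :: "'n::finite itself"
  assumes i: "i \<in> S0" and \<delta>: "0 < \<delta>" and \<epsilon>: "0 < \<epsilon>"
  shows "\<exists>n\<ge>1. \<exists>\<eta>>0. \<forall>(h :: 'a \<Rightarrow> real ^ 'n) f. harm h \<longrightarrow> dominated f h \<longrightarrow>
    \<delta> * sqrt (total_energy h) \<le> norm (\<chi> j. Dop D (\<lambda>z. h z $ j) (fixpt i)) \<longrightarrow>
    (\<forall>q\<in>V0 - {fixpt i}.
      \<bar>f (psi_word (replicate n i) q) - f (fixpt i)\<bar> \<le> (1 + \<epsilon>) * norm (h (psi_word (replicate n i) q) - h (fixpt i)) \<and>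
      \<eta> * sqrt (total_energy h) \<le> norm (h (psi_word (replicate n i) q) - h (fixpt i)))"
proof -
  define p where "p = fixpt i"
  have iS: "i \<in> S" and p: "p \<in> V0" using S0_imp i by (auto simp: p_def)
  have ri: "r i > 0" using r_pos iS by simp
  have Dv: "Dop D (v i) p > 0" using Dop_v_fixpt_pos[OF i] by (simp add: p_def)
  define V where "V = H (v i)"
  have VF: "V \<in> form_domain" unfolding V_def by (rule H_form_domain)
  define EV where "EV = energy V V"
  have EV: "EV \<ge> 0" unfolding EV_def using VF by (rule energy_nonneg)
  obtain \<beta> where \<beta>: "\<beta> > 0" "\<And>g \<tau> q. g \<in> form_domain \<Longrightarrow> g p = 0 \<Longrightarrow>
      (\<And>n. (\<Sum>w\<in>words n. max 0 (cell_energy w g - cell_energy w V)) \<le> \<tau>) \<Longrightarrow> q \<in> V0 \<Longrightarrow> g q \<le> v i q + \<beta> * \<tau>"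
    using comparison_at_vertex[OF i] unfolding V_def p_def by blast
  obtain C \<theta> where C: "0 < C" "0 \<le> \<theta>" "\<theta> < 1" "\<And>u n q. q \<in> V0 \<Longrightarrow>
    \<bar>Bw (replicate n i) u q - u p - ncoeff i u * r i ^ n * v i q\<bar> \<le> C * (\<theta> * r i) ^ n * sqrt (E0 D u u)"
    using B_decay[OF i] unfolding p_def by blast
  obtain C' where C': "C' > 0" "\<And>u M. (\<forall>q\<in>V0. \<bar>u q\<bar> \<le> M) \<Longrightarrow> E0 D u u \<le> C' * M\<^sup>2"
    using E0_le_sup by blast
  obtain a where "a \<in> V0" "a \<noteq> p" using p by (rule vertices)
  then have ne: "V0 - {p} \<noteq> {}" by blast
  define vm where "vm = Min (v i ` (V0 - {p}))"
  have vm: "vm > 0" "\<And>q. q \<in> V0 - {p} \<Longrightarrow> vm \<le> v i q"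
    using ne v_pos[OF i] by (auto simp: vm_def p_def)
  define \<delta>' where "\<delta>' = \<delta> / Dop D (v i) p"
  have \<delta>': "\<delta>' > 0" using \<delta> Dv by (simp add: \<delta>'_def)
  define N where "N = real CARD('n)"
  have N: "N \<ge> 1" unfolding N_def using zero_less_card_finite[where 'a = 'n] by linarith
  \<comment> \<open>Makes the comparison error \<open>\<beta> * \<tau>\<close> equal to
    \<open>\<epsilon> * vm / 4\<close>, a small fraction of the least increment \<open>vm\<close> of
    \<open>v i\<close>.\<close>
  define \<tau> where "\<tau> = \<epsilon> * vm / (4 * \<beta>)"
  have \<tau>: "\<tau> > 0" using \<epsilon> vm \<beta> by (simp add: \<tau>_def)
  \<comment> \<open>The weight in Young's inequality: enlarging the coefficient of \<open>V\<close>
    costs \<open>s * EV\<close>, at most half of \<open>\<tau>\<close>, and the other half is left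
    for \<open>y n\<close>.\<close>
  define s where "s = \<tau> / (2 * (EV + 1))"
  have s: "s > 0" "s * EV \<le> \<tau> / 2"
  proof -
    show "s > 0" using \<tau> EV by (simp add: s_def)
    have "s * EV = (\<tau> / 2) * (EV / (EV + 1))" by (simp add: s_def)
    also have "\<dots> \<le> (\<tau> / 2) * 1" using \<tau> EV by (intro mult_left_mono) auto
    finally show "s * EV \<le> \<tau> / 2" by simp
  qed
  \<comment> \<open>\<open>x n\<close> and \<open>y n\<close> bound the values and the energy
    contribution of the blow-up remainder relative to \<open>norm \<kappa>\<close> and its square.
    They do not depend on \<open>h\<close> and \<open>f\<close>, since \<open>norm \<kappa>\<close>
    is at least \<open>\<delta>' * sqrt E\<close>.\<close>
  define x where "x n = N * C * \<theta> ^ n / \<delta>'" for n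
  define y where "y n = (1 + 1 / s) * (N * C' * (C * \<theta> ^ n / \<delta>')\<^sup>2)" for n
  have th: "(\<lambda>n. \<theta> ^ n) \<longlonglongrightarrow> 0" using C by (intro LIMSEQ_realpow_zero) auto
  have "x \<longlonglongrightarrow> N * C * 0 / \<delta>'" unfolding x_def using \<delta>' by (intro tendsto_intros th) auto
  then have "eventually (\<lambda>n. x n < min (vm / 2) (\<epsilon> * vm / (2 * (1 + \<epsilon>)))) sequentially"
    using vm \<epsilon> by (intro order_tendstoD(2)) auto
  moreover have "y \<longlonglongrightarrow> (1 + 1 / s) * (N * C' * (C * 0 / \<delta>')\<^sup>2)"
    unfolding y_def using \<delta>' by (intro tendsto_intros th) auto
  then have "eventually (\<lambda>n. y n < \<tau> / 2) sequentially"
    using \<tau> by (intro order_tendstoD(2)) auto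
  moreover have "eventually (\<lambda>n. n \<ge> (1::nat)) sequentially" by (rule eventually_ge_at_top)
  ultimately have "eventually (\<lambda>n. x n < min (vm / 2) (\<epsilon> * vm / (2 * (1 + \<epsilon>))) \<and> y n < \<tau> / 2 \<and> n \<ge> 1) sequentially"
    by eventually_elim auto
  then obtain n where n: "x n < vm / 2" "x n < \<epsilon> * vm / (2 * (1 + \<epsilon>))" "y n < \<tau> / 2" "n \<ge> 1"
    by (auto simp: eventually_sequentially)
  define W where "W = replicate n i"
  have W: "W \<in> words n" using iS by (auto simp: W_def words_def)
  have rwW: "rw W = r i ^ n" by (simp add: W_def rw_replicate)
  define \<eta> where "\<eta> = r i ^ n * \<delta>' * (vm / 2)"
  have \<eta>: "\<eta> > 0" using ri \<delta>' vm by (simp add: \<eta>_def)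
  have main: "\<bar>f (psi_word W q) - f p\<bar> \<le> (1 + \<epsilon>) * norm (h (psi_word W q) - h p) \<and>
      \<eta> * sqrt (total_energy h) \<le> norm (h (psi_word W q) - h p)"
    if h: "harm h" and f: "dominated f h" and q: "q \<in> V0 - {p}"
      and big: "\<delta> * sqrt (total_energy h) \<le> norm (\<chi> j. Dop D (\<lambda>z. h z $ j) p)"
    for h :: "'a \<Rightarrow> real ^ 'n" and f q
  proof (cases "total_energy h = 0")
    case True
    then have "\<bar>f (psi_word W q) - f p\<bar> \<le> 0"
      using dominated_osc[OF h f, of "psi_word W q" p] W q p by simp
    moreover have "0 \<le> (1 + \<epsilon>) * norm (h (psi_word W q) - h p)" using \<epsilon> by simp
    ultimately show ?thesis using True by (auto intro: order_trans)
  next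
    case False
    define E where "E = total_energy h"
    have E: "E > 0" using False total_energy_nonneg[of h] by (simp add: E_def)
    define u where "u j = (\<lambda>z. h z $ j)" for j
    have Eu: "E0 D (u j) (u j) \<le> E" for j
      unfolding E_def total_energy_def u_def
      by (rule member_le_sum[where f = "\<lambda>j. E0 D (\<lambda>z. h z $ j) (\<lambda>z. h z $ j)"]) (auto simp: E0_nonneg)
    define \<kappa> where "\<kappa> = (\<chi> j. ncoeff i (u j))"
    have "\<kappa> = (1 / Dop D (v i) p) *\<^sub>R (\<chi> j. Dop D (\<lambda>z. h z $ j) p)"
      by (simp add: \<kappa>_def vec_eq_iff ncoeff_def u_def p_def)
    then have "norm \<kappa> = norm (\<chi> j. Dop D (\<lambda>z. h z $ j) p) / Dop D (v i) p"
      using Dv by simp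
    then have \<kappa>ge: "\<delta>' * sqrt E \<le> norm \<kappa>"
      using big Dv by (simp add: \<delta>'_def E_def divide_right_mono)
    have sE: "sqrt E > 0" using E by simp
    have \<kappa>pos: "norm \<kappa> > 0" using \<kappa>ge \<delta>' sE by (smt (verit) mult_pos_pos)
    define R where "R = r i ^ n"
    have R: "R > 0" using ri by (simp add: R_def)
    \<comment> \<open>The rescaled remainder: at the vertices, \<open>h \<circ> psi_word W\<close>
      minus \<open>h p\<close>, divided by \<open>R\<close>, is \<open>v i\<close> times the vector
      \<open>\<kappa>\<close> plus \<open>\<zeta>\<close>.\<close>
    define \<zeta> where "\<zeta> j z = (Bw W (u j) z - u j p) / R - \<kappa> $ j * v i z" for j z
    have \<zeta>: "\<bar>\<zeta> j z\<bar> \<le> C * \<theta> ^ n * sqrt E" if z: "z \<in> V0" for j z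
    proof -
      have "\<zeta> j z = (Bw W (u j) z - u j p - ncoeff i (u j) * R * v i z) / R"
        using R by (simp add: \<zeta>_def \<kappa>_def field_simps)
      then have "\<bar>\<zeta> j z\<bar> = \<bar>Bw W (u j) z - u j p - ncoeff i (u j) * R * v i z\<bar> / R"
        using R by simp
      also have "\<dots> \<le> C * (\<theta> * r i) ^ n * sqrt (E0 D (u j) (u j)) / R"
        using C(4)[OF z, of n "u j"] R by (intro divide_right_mono) (auto simp: W_def R_def)
      also have "\<dots> = C * \<theta> ^ n * sqrt (E0 D (u j) (u j))" using ri by (simp add: power_mult_distrib R_def)
      also have "\<dots> \<le> C * \<theta> ^ n * sqrt E" using Eu[of j] C by (intro mult_left_mono real_sqrt_le_mono) auto
      finally show ?thesis .
    qed
    have hW: "h (psi_word W z) $ j = Bw W (u j) z" if z: "z \<in> V0" for z j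
    proof -
      have "h (psi_word W z) $ j = H (u j) (psi_word W z)" using h W z by (auto simp: harm_def u_def)
      then show ?thesis using H_psi_word[OF words_imp[OF W], of z "u j"] z by simp
    qed
    have hp: "h p $ j = u j p" for j by (simp add: u_def)
    have hdiff: "h (psi_word W q) - h p = R *\<^sub>R (v i q *\<^sub>R \<kappa> + (\<chi> j. \<zeta> j q))"
      using R q by (simp add: vec_eq_iff hW hp \<zeta>_def field_simps)
    have "norm (\<chi> j. \<zeta> j q) \<le> (\<Sum>j\<in>UNIV. \<bar>\<zeta> j q\<bar>)" using norm_le_l1_cart[of "\<chi> j. \<zeta> j q"] by simp
    also have "\<dots> \<le> (\<Sum>j\<in>(UNIV::'n set). C * \<theta> ^ n * sqrt E)" using \<zeta> q by (intro sum_mono) auto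
    also have "\<dots> = N * C * \<theta> ^ n * sqrt E" by (simp add: N_def)
    also have "\<dots> = x n * (\<delta>' * sqrt E)" using \<delta>' by (simp add: x_def)
    also have "\<dots> \<le> x n * norm \<kappa>" using \<kappa>ge N C \<delta>' by (intro mult_left_mono) (auto simp: x_def)
    finally have nz: "norm (\<chi> j. \<zeta> j q) \<le> x n * norm \<kappa>" .
    have "v i q * norm \<kappa> - x n * norm \<kappa> \<le> norm (v i q *\<^sub>R \<kappa> + (\<chi> j. \<zeta> j q))"
      using norm_diff_ineq[of "v i q *\<^sub>R \<kappa>" "\<chi> j. \<zeta> j q"] nz v_nonneg[OF i, of q] q by simp
    then have lower: "R * ((v i q - x n) * norm \<kappa>) \<le> norm (h (psi_word W q) - h p)"
      unfolding hdiff using R by (simp add: left_diff_distrib)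
    have vq: "vm \<le> v i q" using vm q by simp
    have "\<eta> * sqrt E = R * (vm / 2 * (\<delta>' * sqrt E))" by (simp add: \<eta>_def R_def)
    also have "\<dots> \<le> R * ((v i q - x n) * norm \<kappa>)"
      using R vq n(1) \<kappa>ge vm \<delta>' sE by (intro mult_left_mono mult_mono) auto
    finally have conj2: "\<eta> * sqrt E \<le> norm (h (psi_word W q) - h p)" using lower by simp
    have fF: "f \<in> form_domain" using f by (simp add: dominated_def)
    \<comment> \<open>Normalised so that the main part of the dominating energy is that of
      \<open>V\<close>, because the squared components of \<open>\<kappa>\<close> sum to
      \<open>(norm \<kappa>)\<^sup>2\<close>.\<close>
    define g where "g z = (f (psi_word W z) - f p) / (R * norm \<kappa>)" for z
    have gf: "g = (\<lambda>z. (1 / (R * norm \<kappa>)) * ((f \<circ> psi_word W) z + (- f p)))" by (auto simp: g_def)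
    have gF: "g \<in> form_domain"
      unfolding gf by (intro form_domain_scale form_domain_shift form_domain_psi_word[OF fF W])
    have psp: "psi_word W p = p" using psi_replicate_fixpt[OF iS] by (simp add: W_def p_def)
    have gp: "g p = 0" by (simp add: g_def psp)
    have \<zeta>F: "H (\<zeta> j) \<in> form_domain" for j by (rule H_form_domain)
    have cell: "cell_energy w g \<le> (1 + s) * cell_energy w V + (1 + 1 / s) * ((\<Sum>j\<in>UNIV. cell_energy w (H (\<zeta> j))) / (norm \<kappa>)\<^sup>2)"
      if w: "w \<in> words m" for w m
    proof -
      have eqj: "cell_energy w (\<lambda>z. (h \<circ> psi_word W) z $ j) \<le>
         R\<^sup>2 * ((1 + s) * ((\<kappa> $ j)\<^sup>2 * cell_energy w V) + (1 + 1 / s) * cell_energy w (H (\<zeta> j)))" for j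
      proof -
        have "(h \<circ> psi_word W) z $ j = R * (\<kappa> $ j * V z + H (\<zeta> j) z) + u j p" if z: "z \<in> K" for z
        proof -
          have "(h \<circ> psi_word W) z $ j = H (u j) (psi_word W z)" using h W z by (auto simp: harm_def u_def)
          also have "\<dots> = H (Bw W (u j)) z" by (rule H_psi_word[OF words_imp[OF W] z])
          also have "\<dots> = H (\<lambda>z. R * (\<kappa> $ j * v i z + 1 * \<zeta> j z) + u j p * 1) z"
            using R z by (intro H_cong) (auto simp: \<zeta>_def field_simps)
          also have "\<dots> = R * (\<kappa> $ j * H (v i) z + 1 * H (\<zeta> j) z) + u j p * 1"
            using H_lin_comb[OF z, of R "\<lambda>z. \<kappa> $ j * v i z + 1 * \<zeta> j z" "u j p" "\<lambda>_. 1"]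
              H_lin_comb[OF z, of "\<kappa> $ j" "v i" 1 "\<zeta> j"] H_const[OF z, of 1] by simp
          finally show ?thesis by (simp add: V_def)
        qed
        then have "cell_energy w (\<lambda>z. (h \<circ> psi_word W) z $ j) =
            cell_energy w (\<lambda>z. R * (\<kappa> $ j * V z + H (\<zeta> j) z) + u j p)"
          using w by (intro cell_energy_cong) auto
        also have "\<dots> = R\<^sup>2 * cell_energy w (\<lambda>z. \<kappa> $ j * V z + H (\<zeta> j) z)"
        proof -
          have a: "(\<lambda>z. \<kappa> $ j * V z + H (\<zeta> j) z) \<in> form_domain"
            by (intro form_domain_add form_domain_scale VF \<zeta>F)
          show ?thesis by (simp only: cell_energy_shift[OF form_domain_scale[OF a] w] cell_energy_scale[OF a w])
        qed
        also have "\<dots> \<le> R\<^sup>2 * ((1 + s) * cell_energy w (\<lambda>z. \<kappa> $ j * V z) + (1 + 1 / s) * cell_energy w (H (\<zeta> j)))"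
          using w VF \<zeta>F s by (intro mult_left_mono cell_energy_add_le) (auto intro: form_domain_scale)
        finally show ?thesis by (simp add: cell_energy_scale[OF VF w])
      qed
      have "cell_energy w g = (1 / (R * norm \<kappa>))\<^sup>2 * cell_energy w (f \<circ> psi_word W)"
      proof -
        note b = form_domain_psi_word[OF fF W]
        show ?thesis unfolding gf
          by (simp only: cell_energy_scale[OF form_domain_shift[OF b] w] cell_energy_shift[OF b w])
      qed
      also have "\<dots> \<le> (1 / (R * norm \<kappa>))\<^sup>2 * (\<Sum>j\<in>UNIV. cell_energy w (\<lambda>z. (h \<circ> psi_word W) z $ j))"
        using dominated_psi_word[OF f W] w by (intro mult_left_mono) (auto simp: dominated_def)
      also have "\<dots> \<le> (1 / (R * norm \<kappa>))\<^sup>2 * (\<Sum>j\<in>UNIV. R\<^sup>2 * ((1 + s) * ((\<kappa> $ j)\<^sup>2 * cell_energy w V) + (1 + 1 / s) * cell_energy w (H (\<zeta> j))))"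
        using eqj by (intro mult_left_mono sum_mono) auto
      also have "\<dots> = (1 + s) * ((\<Sum>j\<in>UNIV. (\<kappa> $ j)\<^sup>2) * cell_energy w V) / (norm \<kappa>)\<^sup>2 + (1 + 1 / s) * ((\<Sum>j\<in>UNIV. cell_energy w (H (\<zeta> j))) / (norm \<kappa>)\<^sup>2)"
        using R by (simp add: sum.distrib power_divide power_mult_distrib add_divide_distrib flip: sum_distrib_left sum_distrib_right)
      also have "(\<Sum>j\<in>UNIV. (\<kappa> $ j)\<^sup>2) = (norm \<kappa>)\<^sup>2"
        by (simp add: norm_vec_def L2_set_def sum_nonneg)
      finally show ?thesis using \<kappa>pos by simp
    qed
    have exc: "(\<Sum>w\<in>words m. max 0 (cell_energy w g - cell_energy w V)) \<le> \<tau>" for m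
    proof -
      have "max 0 (cell_energy w g - cell_energy w V) \<le> s * cell_energy w V + (1 + 1 / s) * ((\<Sum>j\<in>UNIV. cell_energy w (H (\<zeta> j))) / (norm \<kappa>)\<^sup>2)"
        if w: "w \<in> words m" for w
      proof -
        have "0 \<le> s * cell_energy w V" using s cell_energy_nonneg[OF VF w] by simp
        moreover have "0 \<le> (1 + 1 / s) * ((\<Sum>j\<in>UNIV. cell_energy w (H (\<zeta> j))) / (norm \<kappa>)\<^sup>2)"
          using s cell_energy_nonneg[OF \<zeta>F w] by (intro mult_nonneg_nonneg divide_nonneg_nonneg sum_nonneg) auto
        ultimately show ?thesis using cell[OF w] by (simp add: algebra_simps)
      qed
      then have "(\<Sum>w\<in>words m. max 0 (cell_energy w g - cell_energy w V)) \<le>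
         (\<Sum>w\<in>words m. s * cell_energy w V + (1 + 1 / s) * ((\<Sum>j\<in>UNIV. cell_energy w (H (\<zeta> j))) / (norm \<kappa>)\<^sup>2))"
        by (rule sum_mono)
      also have "\<dots> = s * EV + (1 + 1 / s) * ((\<Sum>w\<in>words m. \<Sum>j\<in>UNIV. cell_energy w (H (\<zeta> j))) / (norm \<kappa>)\<^sup>2)"
        unfolding EV_def energy_eq_sum_cells[OF VF, of m]
        by (simp add: sum.distrib flip: sum_distrib_left sum_divide_distrib)
      also have "(\<Sum>w\<in>words m. \<Sum>j\<in>UNIV. cell_energy w (H (\<zeta> j))) = (\<Sum>j\<in>UNIV. E0 D (\<zeta> j) (\<zeta> j))"
        by (subst sum.swap) (simp add: energy_H_self flip: energy_eq_sum_cells[OF \<zeta>F])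
      also have "s * EV + (1 + 1 / s) * ((\<Sum>j\<in>UNIV. E0 D (\<zeta> j) (\<zeta> j)) / (norm \<kappa>)\<^sup>2) \<le> s * EV + y n"
      proof -
        have "(\<Sum>j\<in>UNIV. E0 D (\<zeta> j) (\<zeta> j)) \<le> (\<Sum>j\<in>(UNIV::'n set). C' * (C * \<theta> ^ n * sqrt E)\<^sup>2)"
          using \<zeta> by (intro sum_mono C') auto
        also have "\<dots> = N * C' * (C * \<theta> ^ n / \<delta>')\<^sup>2 * (\<delta>' * sqrt E)\<^sup>2"
          using \<delta>' by (simp add: N_def power_mult_distrib power_divide)
        also have "\<dots> \<le> N * C' * (C * \<theta> ^ n / \<delta>')\<^sup>2 * (norm \<kappa>)\<^sup>2"
          using \<kappa>ge N C' \<delta>' sE by (intro mult_left_mono power_mono) auto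
        finally have "(\<Sum>j\<in>UNIV. E0 D (\<zeta> j) (\<zeta> j)) / (norm \<kappa>)\<^sup>2 \<le> N * C' * (C * \<theta> ^ n / \<delta>')\<^sup>2"
          using \<kappa>pos by (simp add: pos_divide_le_eq)
        then show ?thesis unfolding y_def using s by (intro add_left_mono mult_left_mono) auto
      qed
      finally show ?thesis using s(2) n(3) by simp
    qed
    have up: "g q \<le> v i q + \<beta> * \<tau>" using \<beta>(2)[OF gF gp exc] q by simp
    \<comment> \<open>The comparison is one-sided; applied to the negative of \<open>g\<close> as
      well, it bounds the absolute value.\<close>
    have gF': "(\<lambda>z. (-1) * g z) \<in> form_domain" using gF by (rule form_domain_scale)
    have "cell_energy w (\<lambda>z. (-1) * g z) = cell_energy w g" if "w \<in> words m" for w m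
      using cell_energy_scale[OF gF that, of "-1"] by simp
    then have exc': "(\<Sum>w\<in>words m. max 0 (cell_energy w (\<lambda>z. (-1) * g z) - cell_energy w V)) \<le> \<tau>" for m
      using exc[of m] by (simp cong: sum.cong)
    have "(-1) * g q \<le> v i q + \<beta> * \<tau>" by (rule \<beta>(2)[OF gF' _ exc']) (use gp q in auto)
    then have "\<bar>g q\<bar> \<le> v i q + \<beta> * \<tau>" using up by simp
    also have "\<beta> * \<tau> = \<epsilon> * vm / 4" using \<beta> by (simp add: \<tau>_def)
    also have "v i q + \<epsilon> * vm / 4 \<le> (1 + \<epsilon>) * (v i q - x n)"
    proof -
      have "(1 + \<epsilon>) * x n \<le> (1 + \<epsilon>) * (\<epsilon> * vm / (2 * (1 + \<epsilon>)))" using n(2) \<epsilon> by (intro mult_left_mono) auto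
      also have "\<dots> = \<epsilon> * vm / 2" using \<epsilon> by (simp add: field_simps)
      finally have "(1 + \<epsilon>) * x n \<le> \<epsilon> * vm / 2" .
      moreover have "\<epsilon> * vm \<le> \<epsilon> * v i q" using vq \<epsilon> by (intro mult_left_mono) auto
      moreover have "0 < \<epsilon> * vm" using \<epsilon> vm by simp
      ultimately show ?thesis by (simp add: algebra_simps)
    qed
    finally have gq: "\<bar>g q\<bar> \<le> (1 + \<epsilon>) * (v i q - x n)" .
    have "\<bar>f (psi_word W q) - f p\<bar> = \<bar>g q\<bar> * (R * norm \<kappa>)"
      using R \<kappa>pos by (simp add: g_def abs_mult)
    also have "\<dots> \<le> (1 + \<epsilon>) * (v i q - x n) * (R * norm \<kappa>)"
      using gq R \<kappa>pos by (intro mult_right_mono) auto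
    also have "\<dots> = (1 + \<epsilon>) * (R * ((v i q - x n) * norm \<kappa>))" by simp
    also have "\<dots> \<le> (1 + \<epsilon>) * norm (h (psi_word W q) - h p)"
      using lower \<epsilon> by (intro mult_left_mono) auto
    finally show ?thesis using conj2 by (simp add: E_def)
  qed
  show ?thesis
    using main n(4) \<eta> unfolding W_def p_def by (intro exI[of _ n] conjI exI[of _ \<eta>]) auto
qed

end

section \<open>Curves\<close>

text \<open>Partition sums over \<open>[a, b]\<close>, built from the left so that joining,
  splitting and limits become inductions without indices; \<open>psum_partition\<close> and
  \<open>partition_psum\<close> convert to indexed partitions and back.\<close>

inductive psum :: "(real \<Rightarrow> 'b::real_normed_vector) \<Rightarrow> real \<Rightarrow> real \<Rightarrow> real \<Rightarrow> bool" for g where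
  single: "a < b \<Longrightarrow> psum g a b (norm (g b - g a))"
| step: "a < c \<Longrightarrow> psum g c b s \<Longrightarrow> psum g a b (norm (g c - g a) + s)"

lemma psum_less: "psum g a b s \<Longrightarrow> a < b"
  by (induction rule: psum.induct) auto

lemma psum_join: "psum g a b s \<Longrightarrow> psum g b c s' \<Longrightarrow> psum g a c (s + s')"
proof (induction rule: psum.induct)
  case (step a d b s)
  then show ?case using psum.step[of a d g c "s + s'"] by (simp add: add.assoc)
qed (rule psum.step)

lemma psum_cong: "psum g a b s \<Longrightarrow> (\<And>t. a \<le> t \<Longrightarrow> t \<le> b \<Longrightarrow> g t = g' t) \<Longrightarrow> psum g' a b s"
proof (induction rule: psum.induct)
  case (single a b)
  then show ?case using psum.single[of a b g'] by simp
next
  case (step a c b s)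
  then have "c \<le> b" using psum_less by fastforce
  then show ?case using step psum.step[of a c g' b s] by simp
qed

lemma psum_reverse: "psum g a b s \<Longrightarrow> psum (\<lambda>t. g (k - t)) (k - b) (k - a) s"
proof (induction rule: psum.induct)
  case (single a b)
  then show ?case using psum.single[of "k - b" "k - a" "\<lambda>t. g (k - t)"] by (simp add: norm_minus_commute)
next
  case (step a c b s)
  have "psum (\<lambda>t. g (k - t)) (k - c) (k - a) (norm (g c - g a))"
    using psum.single[of "k - c" "k - a" "\<lambda>t. g (k - t)"] step(1) by (simp add: norm_minus_commute)
  from psum_join[OF step.IH this] show ?case by (simp add: add.commute)
qed

lemma psum_partition:
  "psum g a b s \<Longrightarrow> \<exists>n t. 1 \<le> n \<and> t 0 = a \<and> t n = b \<and> (\<forall>i<n. t i < t (Suc i)) \<and>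
    s = (\<Sum>i = 1..n. norm (g (t i) - g (t (i - 1))))"
proof (induction rule: psum.induct)
  case (single a b)
  then show ?case by (intro exI[of _ "1::nat"] exI[of _ "\<lambda>i. if i = 0 then a else b"]) auto
next
  case (step a c b s)
  then obtain n t where t: "1 \<le> n" "t 0 = c" "t n = b" "\<forall>i<n. t i < t (Suc i)"
    "s = (\<Sum>i = 1..n. norm (g (t i) - g (t (i - 1))))" by blast
  define t' where "t' = case_nat a t"
  have "\<forall>i<Suc n. t' i < t' (Suc i)" using t step(1) by (auto simp: t'_def split: nat.split)
  moreover have "(\<Sum>i = 1..Suc n. norm (g (t' i) - g (t' (i - 1)))) = norm (g c - g a) + s"
  proof -
    have "(\<Sum>i = 1..Suc n. norm (g (t' i) - g (t' (i - 1)))) =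
        norm (g (t' 1) - g (t' 0)) + (\<Sum>i = Suc 1..Suc n. norm (g (t' i) - g (t' (i - 1))))"
      by (subst sum.atLeast_Suc_atMost) auto
    also have "(\<Sum>i = Suc 1..Suc n. norm (g (t' i) - g (t' (i - 1)))) = (\<Sum>i = 1..n. norm (g (t' (Suc i)) - g (t' i)))"
      by (simp only: sum.atLeast_Suc_atMost_Suc_shift o_def diff_Suc_1)
    also have "\<dots> = s" unfolding t(5) by (intro sum.cong) (auto simp: t'_def split: nat.split)
    finally show ?thesis using t(2) by (simp add: t'_def)
  qed
  ultimately show ?case using t by (intro exI[of _ "Suc n"] exI[of _ t']) (auto simp: t'_def)
qed

lemma partition_psum:
  assumes "\<forall>i<n. t i < t (Suc i)" "1 \<le> n"
  shows "psum g (t 0) (t n) (\<Sum>i = 1..n. norm (g (t i) - g (t (i - 1))))"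
  using assms(2,1)
proof (induction n rule: nat_induct_at_least)
  case base
  then show ?case using psum.single[of "t 0" "t 1" g] by simp
next
  case (Suc n)
  then have "psum g (t 0) (t n) (\<Sum>i = 1..n. norm (g (t i) - g (t (i - 1))))" by auto
  from psum_join[OF this psum.single[of "t n" "t (Suc n)"]] show ?case using Suc by simp
qed

text \<open>A real upper bound takes the place of the length itself, so infinite lengths need no
  separate treatment and lengths of subarcs can be subtracted.\<close>

definition length_le :: "(real \<Rightarrow> 'b::real_normed_vector) \<Rightarrow> real \<Rightarrow> real \<Rightarrow> real \<Rightarrow> bool" where
  "length_le g a b L \<longleftrightarrow> (\<forall>s. psum g a b s \<longrightarrow> s \<le> L)"

lemma curve_length_le_iff: "curve_length h a b \<gamma> \<le> ereal L \<longleftrightarrow> length_le (\<lambda>t. h (\<gamma> t)) a b L"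
proof
  assume le: "curve_length h a b \<gamma> \<le> ereal L"
  show "length_le (\<lambda>t. h (\<gamma> t)) a b L"
    unfolding length_le_def
  proof (intro allI impI)
    fix s assume "psum (\<lambda>t. h (\<gamma> t)) a b s"
    from psum_partition[OF this] obtain n t where t: "1 \<le> n" "t 0 = a" "t n = b" "\<forall>i<n. t i < t (Suc i)"
      "s = (\<Sum>i = 1..n. norm (h (\<gamma> (t i)) - h (\<gamma> (t (i - 1)))))" by blast
    have "ereal s \<le> curve_length h a b \<gamma>"
      unfolding curve_length_def using t by (intro SUP_upper2[of "(n, t)"]) auto
    then have "ereal s \<le> ereal L" using le by (rule order_trans)
    then show "s \<le> L" by simp
  qed
next
  assume len: "length_le (\<lambda>t. h (\<gamma> t)) a b L"
  show "curve_length h a b \<gamma> \<le> ereal L"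
    unfolding curve_length_def
  proof (rule SUP_least, clarify)
    fix n :: nat and t :: "nat \<Rightarrow> real" assume t: "1 \<le> n" "a = t 0" "b = t n" "\<forall>i<n. t i < t (Suc i)"
    from partition_psum[OF t(4,1), of "\<lambda>t. h (\<gamma> t)"]
    show "ereal (\<Sum>i = 1..n. norm (h (\<gamma> (t i)) - h (\<gamma> (t (i - 1))))) \<le> ereal L"
      using len t by (simp add: length_le_def)
  qed
qed

lemma length_le_ge: "length_le g a b L \<Longrightarrow> a < b \<Longrightarrow> norm (g b - g a) \<le> L"
  using psum.single[of a b g] by (auto simp: length_le_def)

lemma length_le_nonneg: "length_le g a b L \<Longrightarrow> a < b \<Longrightarrow> 0 \<le> L"
  using length_le_ge[of g a b L] norm_ge_zero order_trans by blast

lemma length_le_cong: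
  "length_le g a b L \<Longrightarrow> (\<And>t. a \<le> t \<Longrightarrow> t \<le> b \<Longrightarrow> g t = g' t) \<Longrightarrow> length_le g' a b L"
  using psum_cong[of g' a b _ g] by (simp add: length_le_def)

lemma length_le_tail:
  assumes "length_le g a b L" "a < c" "c < b" shows "length_le g c b (L - norm (g c - g a))"
  unfolding length_le_def
proof (intro allI impI)
  fix s assume "psum g c b s"
  from psum.step[OF assms(2) this] show "s \<le> L - norm (g c - g a)" using assms(1) by (auto simp: length_le_def)
qed

lemma length_le_split:
  assumes "length_le g a b L" "a < c" "c < b"
  shows "\<exists>L1 L2. length_le g a c L1 \<and> length_le g c b L2 \<and> L1 + L2 = L"
proof -
  \<comment> \<open>The exact length of the left part; \<open>L\<close> minus it bounds every
    partition sum over the right part.\<close>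
  define L1 where "L1 = Sup {s. psum g a c s}"
  have sum: "s1 + s2 \<le> L" if "psum g a c s1" "psum g c b s2" for s1 s2
    using psum_join[OF that] assms(1) by (auto simp: length_le_def)
  have bdd: "bdd_above {s. psum g a c s}"
    using sum[OF _ psum.single[OF assms(3)]] by (intro bdd_aboveI[of _ "L - norm (g b - g c)"]) (auto simp: le_diff_eq)
  have ne: "{s. psum g a c s} \<noteq> {}" using psum.single[OF assms(2)] by blast
  have "s \<le> L1" if "psum g a c s" for s unfolding L1_def using that bdd by (intro cSup_upper) auto
  moreover have "s2 \<le> L - L1" if "psum g c b s2" for s2
  proof -
    have "L1 \<le> L - s2" unfolding L1_def using sum[OF _ that] ne by (intro cSup_least) (auto simp: le_diff_eq)
    then show ?thesis by simp
  qed
  ultimately show ?thesis unfolding length_le_def by (intro exI[of _ L1] exI[of _ "L - L1"]) auto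
qed

lemma length_le_mono: "length_le g a b L \<Longrightarrow> L \<le> L' \<Longrightarrow> length_le g a b L'"
  by (auto simp: length_le_def)

lemma length_le_sub:
  assumes "length_le g a b L" "a \<le> s" "s < t" "t \<le> b"
  shows "\<exists>L1 L2. length_le g s t L1 \<and> (t < b \<longrightarrow> length_le g t b L2) \<and> 0 \<le> L1 \<and> 0 \<le> L2 \<and> L1 + L2 \<le> L"
proof -
  have "length_le g s b L"
  proof (cases "a = s")
    case False
    then show ?thesis
      using assms length_le_tail[OF assms(1), of s] by (auto intro: length_le_mono)
  qed (use assms in simp)
  show ?thesis
  proof (cases "t = b")
    case True
    then show ?thesis using \<open>length_le g s b L\<close> assms length_le_nonneg by (intro exI[of _ L] exI[of _ 0]) auto
  next
    case False
    then obtain L1 L2 where "length_le g s t L1" "length_le g t b L2" "L1 + L2 = L"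
      using length_le_split[OF \<open>length_le g s b L\<close>, of t] assms by auto
    then show ?thesis using assms False length_le_nonneg by (intro exI[of _ L1] exI[of _ L2]) auto
  qed
qed

lemma length_le_reverse:
  assumes "length_le g a b L" shows "length_le (\<lambda>t. g (k - t)) (k - b) (k - a) L"
  unfolding length_le_def
proof (intro allI impI)
  fix s assume "psum (\<lambda>t. g (k - t)) (k - b) (k - a) s"
  from psum_reverse[OF this, of k] have "psum g a b s" by simp
  then show "s \<le> L" using assms by (auto simp: length_le_def)
qed

section \<open>Curves and cells\<close>

context fixed_vertex_structure
begin

definition Vn :: "nat \<Rightarrow> 'a set" where "Vn n = (\<Union>w\<in>words n. psi_word w ` V0)"

lemma finite_Vn: "finite (Vn n)"
  by (simp add: Vn_def)

lemma Vn_cell: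
  assumes "w \<in> words n" "y \<in> K" "psi_word w y \<in> Vn n" shows "y \<in> V0"
proof -
  obtain w' q where "w' \<in> words n" "q \<in> V0" "psi_word w y = psi_word w' q" using assms(3) by (auto simp: Vn_def)
  then show ?thesis
    using psi_word_meet[OF assms(1), of w' y q] psi_word_eq_iff[OF words_imp[OF assms(1)], of y q] assms by (cases "w = w'") auto
qed

lemma V0_subset_Vn: "V0 \<subseteq> Vn n"
proof
  fix q assume q: "q \<in> V0"
  then obtain i where i: "i \<in> S" "q = fixpt i" using V0_fixpt by blast
  then have "q = psi_word (replicate n i) q" by (simp add: psi_replicate_fixpt)
  moreover have "replicate n i \<in> words n" using i by (auto simp: words_def)
  ultimately show "q \<in> Vn n" unfolding Vn_def using q by blast
qed

text \<open>The cell \<open>w\<close> and the union of the other cells of its level are closed and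
  meet only in vertices of \<open>w\<close>. As \<open>C\<close> contains none of the shared ones,
  connectedness keeps it on one side.\<close>

lemma connected_in_cell:
  assumes C: "connected C" "C \<subseteq> K" "C \<noteq> {}" and w: "w \<in> words n"
    and meet: "\<And>q. q \<in> V0 \<Longrightarrow> psi_word w q \<in> C \<Longrightarrow>
       (\<forall>w'\<in>words n. w' \<noteq> w \<longrightarrow> psi_word w q \<notin> psi_word w' ` K)"
    and c: "C \<inter> psi_word w ` K \<noteq> {}"
  shows "C \<subseteq> psi_word w ` K"
proof -
  define X where "X = psi_word w ` K"
  define Y where "Y = (\<Union>w'\<in>words n - {w}. psi_word w' ` K)"
  have "closed X" "closed Y"
    unfolding X_def Y_def using w by (auto intro!: closed_UN closed_cell dest: words_imp)
  moreover have "C \<subseteq> X \<union> Y"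
  proof
    fix x assume "x \<in> C"
    then obtain w' where "w' \<in> words n" "x \<in> psi_word w' ` K" using C(2) cells_cover[of n] by blast
    then show "x \<in> X \<union> Y" by (cases "w' = w") (auto simp: X_def Y_def)
  qed
  moreover have "X \<inter> Y \<inter> C = {}"
  proof (rule equals0I)
    fix z assume z: "z \<in> X \<inter> Y \<inter> C"
    then obtain x where x: "x \<in> K" "z = psi_word w x" by (auto simp: X_def)
    obtain w' y where y: "w' \<in> words n" "w' \<noteq> w" "y \<in> K" "z = psi_word w' y" using z by (auto simp: Y_def)
    note a = x y
    then have "x \<in> V0" using psi_word_meet[OF w, of w' x y] by auto
    then have "z \<notin> psi_word w' ` K" using meet[of x] a z by auto
    then show False using a by blast
  qed
  ultimately have "X \<inter> C = {} \<or> Y \<inter> C = {}" using connected_closedD[OF C(1), of X Y] by blast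
  then show ?thesis using c \<open>C \<subseteq> X \<union> Y\<close> unfolding X_def by blast
qed

text \<open>The open segment is connected and avoids the vertices of level \<open>n\<close>;
  closedness of the cell adds the end points.\<close>

lemma path_segment_in_cell:
  fixes \<gamma> :: "real \<Rightarrow> 'a"
  assumes \<gamma>: "continuous_on {s..t} \<gamma>" "\<gamma> ` {s..t} \<subseteq> K" "s < t"
    and avoid: "\<And>x. s < x \<Longrightarrow> x < t \<Longrightarrow> \<gamma> x \<notin> Vn n"
  obtains w where "w \<in> words n" "\<gamma> ` {s..t} \<subseteq> psi_word w ` K"
proof -
  define C where "C = \<gamma> ` {s<..<t}"
  have C: "connected C" "C \<subseteq> K"
  proof -
    have sub: "{s<..<t} \<subseteq> {s..t}" by auto
    show "connected C" unfolding C_def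
      by (intro connected_continuous_image continuous_on_subset[OF \<gamma>(1) sub] connected_Ioo)
    show "C \<subseteq> K" unfolding C_def using \<gamma>(2) sub by blast
  qed
  have mid: "\<gamma> ((s + t) / 2) \<in> C" unfolding C_def using \<gamma>(3) by auto
  then obtain w y where w: "w \<in> words n" "y \<in> K" "\<gamma> ((s + t) / 2) = psi_word w y"
    using C(2) ex_cell[of "\<gamma> ((s + t) / 2)" n] by blast
  have CK: "C \<subseteq> psi_word w ` K"
  proof (rule connected_in_cell[OF C _ w(1)])
    show "C \<inter> psi_word w ` K \<noteq> {}" using mid w by auto
    fix q assume "q \<in> V0" "psi_word w q \<in> C"
    moreover have "psi_word w q \<in> Vn n" using w(1) \<open>q \<in> V0\<close> by (auto simp: Vn_def)
    ultimately show "\<forall>w'\<in>words n. w' \<noteq> w \<longrightarrow> psi_word w q \<notin> psi_word w' ` K"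
      using avoid unfolding C_def by auto
  qed (use mid in auto)
  have "closed ({s..t} \<inter> \<gamma> -` (psi_word w ` K))"
    using \<gamma>(1) w(1) by (intro continuous_closed_preimage closed_cell) (auto dest: words_imp)
  moreover have "{s<..<t} \<subseteq> {s..t} \<inter> \<gamma> -` (psi_word w ` K)" using CK by (auto simp: C_def)
  ultimately have "closure {s<..<t} \<subseteq> {s..t} \<inter> \<gamma> -` (psi_word w ` K)" by (rule closure_minimal[rotated])
  then have "\<gamma> ` {s..t} \<subseteq> psi_word w ` K" using \<gamma>(3) by auto
  then show ?thesis using that w by blast
qed

end

section \<open>Lipschitz constants along curves between vertices\<close>

context three_vertex_structure
begin

text \<open>Quantifying over all \<open>h\<close>, \<open>f\<close> and curves makes every cell
  inherit the bound with the same \<open>Q\<close>. The type argument fixes the dimension of the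
  target.\<close>

definition path_bound :: "'n::finite itself \<Rightarrow> real \<Rightarrow> bool" where
  "path_bound _ Q \<longleftrightarrow> (\<forall>(h :: 'a \<Rightarrow> real ^ 'n) f \<gamma> a b M. harm h \<longrightarrow> dominated f h \<longrightarrow> a < b \<longrightarrow>
     continuous_on {a..b} \<gamma> \<longrightarrow> \<gamma> ` {a..b} \<subseteq> K \<longrightarrow> \<gamma> a \<in> V0 \<longrightarrow> \<gamma> b \<in> V0 \<longrightarrow>
     length_le (\<lambda>t. h (\<gamma> t)) a b M \<longrightarrow> \<bar>f (\<gamma> b) - f (\<gamma> a)\<bar> \<le> Q * M)"

text \<open>Induction on the number of points of \<open>Vn n\<close> on the curve. From its last
  visit to the starting point up to the next point of \<open>Vn n\<close>, the curve lies in one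
  cell, where the bound applies after pulling back; the loops left out only use up length.\<close>

lemma path_bound_Vn:
  fixes h :: "'a \<Rightarrow> real ^ 'n::finite"
  assumes pb: "path_bound TYPE('n) Q" and Q: "0 \<le> Q" and h: "harm h" and f: "dominated f h"
    and "a \<le> b" "continuous_on {a..b} \<gamma>" "\<gamma> ` {a..b} \<subseteq> K" "\<gamma> a \<in> Vn n" "\<gamma> b \<in> Vn n"
    and "a < b \<Longrightarrow> length_le (\<lambda>t. h (\<gamma> t)) a b M" "0 \<le> M"
  shows "\<bar>f (\<gamma> b) - f (\<gamma> a)\<bar> \<le> Q * M"
proof -
  define k where "k = card (Vn n \<inter> \<gamma> ` {a..b})"
  from k_def assms(5-) show ?thesis
  proof (induction k arbitrary: a M rule: less_induct)
    case (less k)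
    show ?case
    proof (cases "\<gamma> b = \<gamma> a")
      case True
      then show ?thesis using Q less.prems by simp
    next
      case False
      then have ab: "a < b" using less.prems by (cases "a = b") auto
      note len = less.prems(7)[OF ab]
      have cl1: "closed {t \<in> {a..b}. \<gamma> t = \<gamma> a}"
        using less.prems(3) by (rule continuous_closed_preimage_constant) simp
      have "compact {t \<in> {a..b}. \<gamma> t = \<gamma> a}"
      proof -
        have "{t \<in> {a..b}. \<gamma> t = \<gamma> a} = {a..b} \<inter> {t \<in> {a..b}. \<gamma> t = \<gamma> a}" by blast
        then show ?thesis using compact_Int_closed[OF compact_Icc[of a b] cl1] by (simp only:)
      qed
      moreover have "a \<in> {t \<in> {a..b}. \<gamma> t = \<gamma> a}" using ab by simp
      then have "{t \<in> {a..b}. \<gamma> t = \<gamma> a} \<noteq> {}" by blast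
      \<comment> \<open>The last visit to \<open>\<gamma> a\<close>: afterwards this point no longer
        occurs, so the number of points of \<open>Vn n\<close> drops.\<close>
      ultimately obtain s where s0: "s \<in> {t \<in> {a..b}. \<gamma> t = \<gamma> a}" "\<forall>t\<in>{t \<in> {a..b}. \<gamma> t = \<gamma> a}. t \<le> s"
        using compact_attains_sup by blast
      have s: "a \<le> s" "s \<le> b" "\<gamma> s = \<gamma> a" "\<And>t. a \<le> t \<Longrightarrow> t \<le> b \<Longrightarrow> \<gamma> t = \<gamma> a \<Longrightarrow> t \<le> s"
      proof -
        show "a \<le> s" "s \<le> b" "\<gamma> s = \<gamma> a" using s0(1) by auto
        show "t \<le> s" if "a \<le> t" "t \<le> b" "\<gamma> t = \<gamma> a" for t using bspec[OF s0(2), of t] that by simp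
      qed
      have "s \<noteq> b" using s(3) False by metis
      then have sb: "s < b" using s(2) by simp
      have c2: "continuous_on {s..b} \<gamma>" using less.prems(3) s by (auto intro: continuous_on_subset)
      define T where "T = {s..b} \<inter> \<gamma> -` (Vn n - {\<gamma> a})"
      have "closed T" unfolding T_def
        using finite_Vn[of n]
        by (intro continuous_closed_preimage[OF c2 closed_atLeastAtMost finite_imp_closed]) simp
      then have "compact T"
        using compact_Int_closed[OF compact_Icc[of s b], of T] by (simp add: T_def Int_assoc[symmetric])
      moreover have "b \<in> T" using s sb False less.prems by (auto simp: T_def)
      ultimately obtain t where t: "t \<in> T" "\<And>x. x \<in> T \<Longrightarrow> t \<le> x" using compact_attains_inf[of T] by blast
      have tt: "s < t" "t \<le> b" "\<gamma> t \<in> Vn n" "\<gamma> t \<noteq> \<gamma> a" using t(1) s by (auto simp: T_def less_le)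
      have c3: "continuous_on {s..t} \<gamma>" using c2 tt by (auto intro: continuous_on_subset)
      have K3: "\<gamma> ` {s..t} \<subseteq> K" using less.prems(4) s tt by fastforce
      have avoid: "\<gamma> x \<notin> Vn n" if x: "s < x" "x < t" for x
      proof
        assume "\<gamma> x \<in> Vn n"
        moreover have "\<gamma> x \<noteq> \<gamma> a" using s(1) s(4)[of x] x tt by auto
        ultimately have "x \<in> T" using x s tt by (auto simp: T_def)
        then show False using t(2)[of x] x by simp
      qed
      obtain w where w: "w \<in> words n" "\<gamma> ` {s..t} \<subseteq> psi_word w ` K"
        by (rule path_segment_in_cell[OF c3 K3 tt(1) avoid])
      define \<gamma>' where "\<gamma>' x = the_inv_into K (psi_word w) (\<gamma> x)" for x
      note inj = psi_word_inj[OF words_imp[OF w(1)]]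
      have \<gamma>': "psi_word w (\<gamma>' x) = \<gamma> x" "\<gamma>' x \<in> K" if "x \<in> {s..t}" for x
      proof -
        have "\<gamma> x \<in> psi_word w ` K" using w(2) that by blast
        then show "psi_word w (\<gamma>' x) = \<gamma> x" "\<gamma>' x \<in> K"
          unfolding \<gamma>'_def using f_the_inv_into_f[OF inj, of "\<gamma> x"] the_inv_into_into[OF inj, of "\<gamma> x" K] by auto
      qed
      have c4: "continuous_on {s..t} \<gamma>'"
        unfolding \<gamma>'_def
        by (rule continuous_on_compose2[OF continuous_on_inv_into[OF psi_word_continuous[OF words_imp[OF w(1)]] compact_K inj] c3 w(2)])
      have ends: "\<gamma>' s \<in> V0" "\<gamma>' t \<in> V0"
        using Vn_cell[OF w(1), of "\<gamma>' s"] Vn_cell[OF w(1), of "\<gamma>' t"] \<gamma>'[of s] \<gamma>'[of t] tt less.prems(5) s(3) by auto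
      obtain L1 L2 where M: "length_le (\<lambda>x. h (\<gamma> x)) s t L1" "t < b \<longrightarrow> length_le (\<lambda>x. h (\<gamma> x)) t b L2"
          "0 \<le> L1" "0 \<le> L2" "L1 + L2 \<le> M"
        using length_le_sub[OF len s(1) tt(1,2)] by blast
      have "length_le (\<lambda>x. (h \<circ> psi_word w) (\<gamma>' x)) s t L1"
        using M(1) by (rule length_le_cong) (simp add: \<gamma>')
      then have "\<bar>(f \<circ> psi_word w) (\<gamma>' t) - (f \<circ> psi_word w) (\<gamma>' s)\<bar> \<le> Q * L1"
        using pb[unfolded path_bound_def, rule_format, OF harm_psi_word[OF h w(1)] dominated_psi_word[OF f w(1)] tt(1) c4 _ ends]
          \<gamma>'(2) by blast
      then have 1: "\<bar>f (\<gamma> t) - f (\<gamma> a)\<bar> \<le> Q * L1" using \<gamma>' tt s(3) by simp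
      have "\<bar>f (\<gamma> b) - f (\<gamma> t)\<bar> \<le> Q * L2"
      proof (rule less.IH[OF _ refl])
        have "\<gamma> a \<in> Vn n \<inter> \<gamma> ` {a..b}" using ab less.prems by auto
        moreover have "\<gamma> a \<notin> \<gamma> ` {t..b}"
        proof
          assume "\<gamma> a \<in> \<gamma> ` {t..b}"
          then obtain x where "t \<le> x" "x \<le> b" "\<gamma> x = \<gamma> a" by auto
          then show False using s(1) s(4)[of x] tt(1) by linarith
        qed
        moreover have "\<gamma> ` {t..b} \<subseteq> \<gamma> ` {a..b}" using s tt by auto
        ultimately have "Vn n \<inter> \<gamma> ` {t..b} \<subset> Vn n \<inter> \<gamma> ` {a..b}" by blast
        then show "card (Vn n \<inter> \<gamma> ` {t..b}) < k"
          unfolding less.prems(1) using finite_Vn by (intro psubset_card_mono) auto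
        show "continuous_on {t..b} \<gamma>" using less.prems(3) s tt by (auto intro: continuous_on_subset)
        show "\<gamma> ` {t..b} \<subseteq> K" using less.prems(4) s tt by fastforce
      qed (use tt M less.prems in auto)
      with 1 have "\<bar>f (\<gamma> b) - f (\<gamma> a)\<bar> \<le> Q * L1 + Q * L2" by linarith
      also have "\<dots> \<le> Q * M" using M(5) Q by (simp flip: distrib_left add: mult_left_mono)
      finally show ?thesis .
    qed
  qed
qed

text \<open>The cell of \<open>replicate n i\<close> shares only vertices other than
  \<open>fixpt i\<close> with the rest of its level, and for \<open>n \<ge> 1\<close> it contains no
  point of \<open>V0\<close> besides \<open>fixpt i\<close>. A curve leaving for another vertex must
  pass through one of the shared points.\<close>

lemma path_exits_corner:
  fixes \<gamma> :: "real \<Rightarrow> 'a"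
  assumes i: "i \<in> S0" and \<gamma>: "continuous_on {a..b} \<gamma>" "\<gamma> ` {a..b} \<subseteq> K" "a < b"
    and ends: "\<gamma> a = fixpt i" "\<gamma> b \<in> V0" "\<gamma> b \<noteq> \<gamma> a" and n: "1 \<le> n"
  obtains t q where "a < t" "t < b" "q \<in> V0 - {fixpt i}" "\<gamma> t = psi_word (replicate n i) q"
proof (rule ccontr)
  assume no: "\<not> thesis"
  define W where "W = replicate n i"
  have iS: "i \<in> S" "fixpt i \<in> V0" using S0_imp i by auto
  have W: "W \<in> words n" using iS by (auto simp: W_def words_def)
  have Wp: "psi_word W (fixpt i) = fixpt i" unfolding W_def using iS by (simp add: psi_replicate_fixpt)
  have bW: "\<gamma> b \<notin> psi_word W ` K"
  proof
    assume "\<gamma> b \<in> psi_word W ` K"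
    then obtain y where y: "y \<in> K" "\<gamma> b = psi_word W y" by auto
    then obtain j where j: "j \<in> S" "W = replicate n j" "y = fixpt j"
      using psi_word_in_V0[OF _ W y(1)] ends(2) by auto
    then have "j = i" using n unfolding W_def by (cases n) auto
    then show False using y j Wp ends by simp
  qed
  have "\<gamma> ` {a..b} \<subseteq> psi_word W ` K"
  proof (rule connected_in_cell[OF _ \<gamma>(2) _ W])
    show "connected (\<gamma> ` {a..b})" using \<gamma>(1) by (intro connected_continuous_image connected_Icc)
    show "\<gamma> ` {a..b} \<inter> psi_word W ` K \<noteq> {}" using ends(1) Wp iS \<gamma>(3) by (metis IntI V0_in_K atLeastAtMost_iff emptyE imageI less_imp_le order_refl)
    fix q assume q: "q \<in> V0" "psi_word W q \<in> \<gamma> ` {a..b}"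
    show "\<forall>w'\<in>words n. w' \<noteq> W \<longrightarrow> psi_word W q \<notin> psi_word w' ` K"
    proof (cases "q = fixpt i")
      case True
      show ?thesis
      proof (intro ballI impI notI)
        fix w' assume w': "w' \<in> words n" "w' \<noteq> W" "psi_word W q \<in> psi_word w' ` K"
        then obtain y where y: "y \<in> K" "psi_word w' y = fixpt i" using True Wp by auto
        then obtain j where j: "j \<in> S" "w' = replicate n j" "y = fixpt j"
          using psi_word_in_V0[OF _ w'(1) y(1)] iS by auto
        then have "fixpt j = fixpt i" using y psi_replicate_fixpt by simp
        then have "j = i" by (rule fixpt_inj[OF j(1) iS(1)])
        then show False using j w' by (simp add: W_def)
      qed
    next
      case False
      obtain t where t: "a \<le> t" "t \<le> b" "\<gamma> t = psi_word W q" using q by auto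
      have "t \<noteq> a" using t ends(1) Wp False psi_word_eq_iff[OF words_imp[OF W], of q "fixpt i"] q iS by auto
      moreover have "t \<noteq> b" using t bW q by auto
      ultimately show ?thesis using no that[of t q] t q False by (auto simp: W_def)
    qed
  qed (use \<gamma>(3) in auto)
  moreover have "\<gamma> b \<in> \<gamma> ` {a..b}" using \<gamma>(3) by (intro imageI) simp
  ultimately show False using bW by blast
qed

text \<open>As the normal derivatives sum to zero, summation by parts writes the energy through the
  two given ones and increments of the function. The Poincare inequality bounds the increments by
  the square root of the energy, which then cancels.\<close>

lemma normal_derivatives_control_energy:
  fixes h :: "'a \<Rightarrow> real ^ 'n::finite"
  assumes "p \<in> V0" "q \<in> V0" "p \<noteq> q"
  shows "total_energy h \<le> 2 * CP * ((norm (\<chi> j. Dop D (\<lambda>z. h z $ j) p))\<^sup>2 + (norm (\<chi> j. Dop D (\<lambda>z. h z $ j) q))\<^sup>2)"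
proof -
  obtain t where t: "V0 = {p, q, t}" "t \<noteq> p" "t \<noteq> q" "t \<in> V0" using assms by (rule third_vertex)
  have one: "E0 D u u \<le> 2 * CP * ((Dop D u p)\<^sup>2 + (Dop D u q)\<^sup>2)" for u
  proof -
    have "Dop D u p + Dop D u q + Dop D u t = (\<Sum>x\<in>V0. Dop D u x)" using t assms by simp
    also have "\<dots> = (\<Sum>y\<in>V0. \<Sum>x\<in>V0. D x y * u y)" unfolding Dop_def by (rule sum.swap)
    also have "\<dots> = 0" by (rule sum.neutral) (simp add: col_sum flip: sum_distrib_right)
    finally have dt: "Dop D u t = - Dop D u p - Dop D u q" by simp
    have "E0 D u u = - Dop D u p * u p - Dop D u q * u q - Dop D u t * u t" using t assms by (simp add: E0_def)
    also have "\<dots> = Dop D u p * (u t - u p) + Dop D u q * (u t - u q)" unfolding dt by (simp add: algebra_simps)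
    also have "\<dots> \<le> \<bar>Dop D u p\<bar> * sqrt (CP * E0 D u u) + \<bar>Dop D u q\<bar> * sqrt (CP * E0 D u u)"
    proof -
      have d: "\<bar>u t - u x\<bar> \<le> sqrt (CP * E0 D u u)" if "x \<in> V0" for x
        using real_sqrt_le_mono[OF CP(2)[OF t(4) that, of u]] by simp
      have "Dop D u x * (u t - u x) \<le> \<bar>Dop D u x\<bar> * sqrt (CP * E0 D u u)" if "x \<in> V0" for x
        using mult_left_mono[OF d[OF that], of "\<bar>Dop D u x\<bar>"] abs_ge_self[of "Dop D u x * (u t - u x)"] by (simp add: abs_mult)
      from this[OF assms(1)] this[OF assms(2)] show ?thesis by simp
    qed
    finally have le: "E0 D u u \<le> (\<bar>Dop D u p\<bar> + \<bar>Dop D u q\<bar>) * sqrt (CP * E0 D u u)" by (simp add: distrib_right)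
    have E: "0 \<le> E0 D u u" by (rule E0_nonneg)
    have "E0 D u u * E0 D u u \<le> ((\<bar>Dop D u p\<bar> + \<bar>Dop D u q\<bar>) * sqrt (CP * E0 D u u)) * ((\<bar>Dop D u p\<bar> + \<bar>Dop D u q\<bar>) * sqrt (CP * E0 D u u))"
      using le E CP(1) by (intro mult_mono) auto
    also have "\<dots> = (\<bar>Dop D u p\<bar> + \<bar>Dop D u q\<bar>)\<^sup>2 * CP * E0 D u u"
      using E CP(1) by (simp add: power2_eq_square mult_ac)
    finally have "E0 D u u \<le> (\<bar>Dop D u p\<bar> + \<bar>Dop D u q\<bar>)\<^sup>2 * CP"
      using E CP(1) by (cases "E0 D u u = 0") auto
    also have "\<dots> \<le> (2 * ((Dop D u p)\<^sup>2 + (Dop D u q)\<^sup>2)) * CP"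
      using CP(1) sum_squares_ge_zero[of "\<bar>Dop D u p\<bar> - \<bar>Dop D u q\<bar>" 0]
      by (intro mult_right_mono) (auto simp: power2_eq_square algebra_simps)
    finally show ?thesis by (simp add: algebra_simps)
  qed
  have n: "(norm (\<chi> j. X j))\<^sup>2 = (\<Sum>j\<in>UNIV. (X j)\<^sup>2)" for X :: "'n \<Rightarrow> real"
    by (simp add: norm_vec_def L2_set_def sum_nonneg)
  have "total_energy h \<le> (\<Sum>j\<in>UNIV. 2 * CP * ((Dop D (\<lambda>z. h z $ j) p)\<^sup>2 + (Dop D (\<lambda>z. h z $ j) q)\<^sup>2))"
    unfolding total_energy_def by (intro sum_mono one)
  then show ?thesis unfolding n by (simp add: sum.distrib flip: sum_distrib_left)
qed

text \<open>One of the two ends of a path between vertices is good, so that a fixed proportion of the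
  length is spent on a segment where the increment of \<open>f\<close> is controlled.\<close>

lemma path_good_segment:
  fixes dummy :: "'n::finite itself"
  assumes \<epsilon>: "0 < \<epsilon>"
  shows "\<exists>\<eta>>0. \<forall>(h :: 'a \<Rightarrow> real ^ 'n) f (\<gamma> :: real \<Rightarrow> 'a) a b. harm h \<longrightarrow> dominated f h \<longrightarrow> a < b \<longrightarrow>
    continuous_on {a..b} \<gamma> \<longrightarrow> \<gamma> ` {a..b} \<subseteq> K \<longrightarrow> \<gamma> a \<in> V0 \<longrightarrow> \<gamma> b \<in> V0 \<longrightarrow> \<gamma> a \<noteq> \<gamma> b \<longrightarrow>
    sqrt (total_energy h) \<le> sqrt (4 * CP) * norm (\<chi> j. Dop D (\<lambda>z. h z $ j) (\<gamma> a)) \<longrightarrow>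
    (\<exists>n t. a < t \<and> t < b \<and> \<gamma> t \<in> Vn n \<and> \<bar>f (\<gamma> t) - f (\<gamma> a)\<bar> \<le> (1 + \<epsilon>) * norm (h (\<gamma> t) - h (\<gamma> a)) \<and>
      \<eta> * sqrt (total_energy h) \<le> norm (h (\<gamma> t) - h (\<gamma> a)))"
proof -
  \<comment> \<open>With the larger of two normal derivatives in place of both, the constant
    \<open>2 * CP\<close> of \<open>normal_derivatives_control_energy\<close> becomes
    \<open>4 * CP\<close>.\<close>
  define \<delta> where "\<delta> = 1 / sqrt (4 * CP)"
  have \<delta>: "\<delta> > 0" using CP(1) by (simp add: \<delta>_def)
  have "\<forall>i\<in>S0. \<exists>n \<eta>. n \<ge> 1 \<and> \<eta> > 0 \<and> (\<forall>(h :: 'a \<Rightarrow> real ^ 'n) f. harm h \<longrightarrow> dominated f h \<longrightarrow>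
    \<delta> * sqrt (total_energy h) \<le> norm (\<chi> j. Dop D (\<lambda>z. h z $ j) (fixpt i)) \<longrightarrow>
    (\<forall>q\<in>V0 - {fixpt i}.
      \<bar>f (psi_word (replicate n i) q) - f (fixpt i)\<bar> \<le> (1 + \<epsilon>) * norm (h (psi_word (replicate n i) q) - h (fixpt i)) \<and>
      \<eta> * sqrt (total_energy h) \<le> norm (h (psi_word (replicate n i) q) - h (fixpt i))))"
    using good_end[OF _ \<delta> \<epsilon>, where 'n = 'n] by blast
  then obtain n \<eta> where ne: "\<And>i. i \<in> S0 \<Longrightarrow> n i \<ge> (1::nat) \<and> \<eta> i > (0::real) \<and> (\<forall>(h :: 'a \<Rightarrow> real ^ 'n) f. harm h \<longrightarrow> dominated f h \<longrightarrow>
    \<delta> * sqrt (total_energy h) \<le> norm (\<chi> j. Dop D (\<lambda>z. h z $ j) (fixpt i)) \<longrightarrow>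
    (\<forall>q\<in>V0 - {fixpt i}.
      \<bar>f (psi_word (replicate (n i) i) q) - f (fixpt i)\<bar> \<le> (1 + \<epsilon>) * norm (h (psi_word (replicate (n i) i) q) - h (fixpt i)) \<and>
      \<eta> i * sqrt (total_energy h) \<le> norm (h (psi_word (replicate (n i) i) q) - h (fixpt i))))"
    unfolding bchoice_iff by metis
  have fin: "finite S0" using finite_S by (simp add: S0_def)
  define \<eta>' where "\<eta>' = Min (insert 1 (\<eta> ` S0))"
  have \<eta>': "\<eta>' > 0" "\<And>i. i \<in> S0 \<Longrightarrow> \<eta>' \<le> \<eta> i" using fin ne by (auto simp: \<eta>'_def)
  have "\<exists>n t. a < t \<and> t < b \<and> \<gamma> t \<in> Vn n \<and> \<bar>f (\<gamma> t) - f (\<gamma> a)\<bar> \<le> (1 + \<epsilon>) * norm (h (\<gamma> t) - h (\<gamma> a)) \<and>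
      \<eta>' * sqrt (total_energy h) \<le> norm (h (\<gamma> t) - h (\<gamma> a))"
    if h: "harm h" "dominated f h" and \<gamma>: "a < b" "continuous_on {a..b} \<gamma>" "\<gamma> ` {a..b} \<subseteq> K" "\<gamma> a \<in> V0" "\<gamma> b \<in> V0" "\<gamma> a \<noteq> \<gamma> b"
      and big: "sqrt (total_energy h) \<le> sqrt (4 * CP) * norm (\<chi> j. Dop D (\<lambda>z. h z $ j) (\<gamma> a))"
    for h :: "'a \<Rightarrow> real ^ 'n" and f and \<gamma> :: "real \<Rightarrow> 'a" and a b
  proof -
    obtain i where i: "i \<in> S0" "\<gamma> a = fixpt i" using vertex_fixpt[OF \<gamma>(4)] by blast
    obtain t q where t: "a < t" "t < b" "q \<in> V0 - {fixpt i}" "\<gamma> t = psi_word (replicate (n i) i) q"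
      using path_exits_corner[OF i(1) \<gamma>(2,3,1) i(2) \<gamma>(5) \<gamma>(6)[symmetric], of "n i"] ne[OF i(1)] by metis
    have "\<delta> * sqrt (total_energy h) \<le> norm (\<chi> j. Dop D (\<lambda>z. h z $ j) (fixpt i))"
      using big i CP(1) by (simp add: \<delta>_def pos_divide_le_eq mult.commute)
    then have g: "\<bar>f (\<gamma> t) - f (\<gamma> a)\<bar> \<le> (1 + \<epsilon>) * norm (h (\<gamma> t) - h (\<gamma> a))"
      "\<eta> i * sqrt (total_energy h) \<le> norm (h (\<gamma> t) - h (\<gamma> a))"
      using ne[OF i(1)] h t i by auto
    have "\<eta>' * sqrt (total_energy h) \<le> \<eta> i * sqrt (total_energy h)"
      using \<eta>'(2)[OF i(1)] total_energy_nonneg[of h] by (intro mult_right_mono) auto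
    moreover have "replicate (n i) i \<in> words (n i)" using S0_imp i by (auto simp: words_def)
    then have "\<gamma> t \<in> Vn (n i)" using t by (auto simp: Vn_def)
    ultimately show ?thesis using g t by (intro exI[of _ "n i"] exI[of _ t]) auto
  qed
  then show ?thesis using \<eta>'(1) by (intro exI[of _ \<eta>']) blast
qed

section \<open>Dominated functions along curves\<close>

text \<open>The end with the larger normal derivative is the good one; if it is the terminal point,
  the curve is reversed. The good segment stops in some \<open>Vn n\<close>, so any bound
  \<open>Q\<close> already known applies to the rest.\<close>

lemma path_split_good:
  fixes dummy :: "'n::finite itself"
  assumes \<epsilon>: "0 < \<epsilon>"
  shows "\<exists>\<eta>>0. \<forall>(h :: 'a \<Rightarrow> real ^ 'n) f \<gamma> a b M. harm h \<longrightarrow> dominated f h \<longrightarrow> a < b \<longrightarrow>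
    continuous_on {a..b} \<gamma> \<longrightarrow> \<gamma> ` {a..b} \<subseteq> K \<longrightarrow> \<gamma> a \<in> V0 \<longrightarrow> \<gamma> b \<in> V0 \<longrightarrow> \<gamma> a \<noteq> \<gamma> b \<longrightarrow>
    length_le (\<lambda>t. h (\<gamma> t)) a b M \<longrightarrow>
    (\<exists>m. \<eta> * sqrt (total_energy h) \<le> m \<and> m \<le> M \<and>
      (\<forall>Q\<ge>0. path_bound TYPE('n) Q \<longrightarrow> \<bar>f (\<gamma> b) - f (\<gamma> a)\<bar> \<le> (1 + \<epsilon>) * m + Q * (M - m)))"
proof -
  obtain \<eta> where \<eta>: "\<eta> > 0" "\<And>(h :: 'a \<Rightarrow> real ^ 'n) f (\<gamma> :: real \<Rightarrow> 'a) a b. harm h \<Longrightarrow> dominated f h \<Longrightarrow> a < b \<Longrightarrow>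
    continuous_on {a..b} \<gamma> \<Longrightarrow> \<gamma> ` {a..b} \<subseteq> K \<Longrightarrow> \<gamma> a \<in> V0 \<Longrightarrow> \<gamma> b \<in> V0 \<Longrightarrow> \<gamma> a \<noteq> \<gamma> b \<Longrightarrow>
    sqrt (total_energy h) \<le> sqrt (4 * CP) * norm (\<chi> j. Dop D (\<lambda>z. h z $ j) (\<gamma> a)) \<Longrightarrow>
    (\<exists>n t. a < t \<and> t < b \<and> \<gamma> t \<in> Vn n \<and> \<bar>f (\<gamma> t) - f (\<gamma> a)\<bar> \<le> (1 + \<epsilon>) * norm (h (\<gamma> t) - h (\<gamma> a)) \<and>
      \<eta> * sqrt (total_energy h) \<le> norm (h (\<gamma> t) - h (\<gamma> a)))"
    using path_good_segment[OF \<epsilon>, where 'n = 'n] by blast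
  have forward: "\<exists>m. \<eta> * sqrt (total_energy h) \<le> m \<and> m \<le> M \<and>
      (\<forall>Q\<ge>0. path_bound TYPE('n) Q \<longrightarrow> \<bar>f (\<gamma> b) - f (\<gamma> a)\<bar> \<le> (1 + \<epsilon>) * m + Q * (M - m))"
    if h: "harm h" "dominated f h" and \<gamma>: "a < b" "continuous_on {a..b} \<gamma>" "\<gamma> ` {a..b} \<subseteq> K" "\<gamma> a \<in> V0" "\<gamma> b \<in> V0" "\<gamma> a \<noteq> \<gamma> b"
      and len: "length_le (\<lambda>t. h (\<gamma> t)) a b M"
      and big: "sqrt (total_energy h) \<le> sqrt (4 * CP) * norm (\<chi> j. Dop D (\<lambda>z. h z $ j) (\<gamma> a))"
    for h :: "'a \<Rightarrow> real ^ 'n" and f and \<gamma> :: "real \<Rightarrow> 'a" and a b M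
  proof -
    obtain n t where t: "a < t" "t < b" "\<gamma> t \<in> Vn n" "\<bar>f (\<gamma> t) - f (\<gamma> a)\<bar> \<le> (1 + \<epsilon>) * norm (h (\<gamma> t) - h (\<gamma> a))"
      "\<eta> * sqrt (total_energy h) \<le> norm (h (\<gamma> t) - h (\<gamma> a))"
      using \<eta>(2)[OF h \<gamma> big] by blast
    define m where "m = norm (h (\<gamma> t) - h (\<gamma> a))"
    have tail: "length_le (\<lambda>t. h (\<gamma> t)) t b (M - m)"
      unfolding m_def using length_le_tail[OF len t(1,2)] by simp
    have nn: "0 \<le> M - m" using length_le_nonneg[OF tail t(2)] .
    have "\<bar>f (\<gamma> b) - f (\<gamma> a)\<bar> \<le> (1 + \<epsilon>) * m + Q * (M - m)" if Q: "0 \<le> Q" "path_bound TYPE('n) Q" for Q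
    proof -
      have "\<bar>f (\<gamma> b) - f (\<gamma> t)\<bar> \<le> Q * (M - m)"
      proof (rule path_bound_Vn[OF Q(2,1) h])
        show "continuous_on {t..b} \<gamma>" using \<gamma>(2) t by (auto intro: continuous_on_subset)
        show "\<gamma> ` {t..b} \<subseteq> K" using \<gamma>(3) t by fastforce
        show "\<gamma> b \<in> Vn n" using V0_subset_Vn \<gamma>(5) by blast
      qed (use t tail nn in auto)
      then show ?thesis using t(4) by (simp add: m_def)
    qed
    then show ?thesis using t(5) nn by (intro exI[of _ m]) (auto simp: m_def)
  qed
  have "\<exists>m. \<eta> * sqrt (total_energy h) \<le> m \<and> m \<le> M \<and>
      (\<forall>Q\<ge>0. path_bound TYPE('n) Q \<longrightarrow> \<bar>f (\<gamma> b) - f (\<gamma> a)\<bar> \<le> (1 + \<epsilon>) * m + Q * (M - m))"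
    if h: "harm h" "dominated f h" and \<gamma>: "a < b" "continuous_on {a..b} \<gamma>" "\<gamma> ` {a..b} \<subseteq> K" "\<gamma> a \<in> V0" "\<gamma> b \<in> V0" "\<gamma> a \<noteq> \<gamma> b"
      and len: "length_le (\<lambda>t. h (\<gamma> t)) a b M"
    for h :: "'a \<Rightarrow> real ^ 'n" and f and \<gamma> :: "real \<Rightarrow> 'a" and a b M
  proof -
    define X where "X = norm (\<chi> j. Dop D (\<lambda>z. h z $ j) (\<gamma> a))"
    define Y where "Y = norm (\<chi> j. Dop D (\<lambda>z. h z $ j) (\<gamma> b))"
    have T: "total_energy h \<le> 2 * CP * (X\<^sup>2 + Y\<^sup>2)"
      unfolding X_def Y_def by (rule normal_derivatives_control_energy[OF \<gamma>(4-6)])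
    have XY: "X \<ge> 0" "Y \<ge> 0" by (auto simp: X_def Y_def)
    have le: "sqrt (total_energy h) \<le> sqrt (4 * CP) * Z" if Z: "Z \<ge> 0" "X \<le> Z" "Y \<le> Z" for Z
    proof -
      have "2 * CP * (X\<^sup>2 + Y\<^sup>2) \<le> 2 * CP * (Z\<^sup>2 + Z\<^sup>2)"
        using CP(1) Z XY by (intro mult_left_mono add_mono power_mono) auto
      also have "\<dots> = 4 * CP * Z\<^sup>2" by (simp add: algebra_simps)
      finally have "sqrt (total_energy h) \<le> sqrt (4 * CP * Z\<^sup>2)" using T by (intro real_sqrt_le_mono) (rule order_trans)
      then show ?thesis using Z(1) by (simp add: real_sqrt_mult)
    qed
    show ?thesis
    proof (cases "Y \<le> X")
      case True
      then show ?thesis using forward[OF h \<gamma> len] le[OF XY(1)] by (simp add: X_def)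
    next
      case False
      define \<gamma>' where "\<gamma>' t = \<gamma> (a + b - t)" for t
      have im: "(\<lambda>t. a + b - t) ` {a..b} \<subseteq> {a..b}" by auto
      have c: "continuous_on {a..b} \<gamma>'"
        unfolding \<gamma>'_def by (rule continuous_on_compose2[OF \<gamma>(2) _ im]) (intro continuous_intros)
      have k: "\<gamma>' ` {a..b} \<subseteq> K" using \<gamma>(3) by (auto simp: \<gamma>'_def)
      have l: "length_le (\<lambda>t. h (\<gamma>' t)) a b M"
        using length_le_reverse[OF len, of "a + b"] by (simp add: \<gamma>'_def)
      have e: "\<gamma>' a = \<gamma> b" "\<gamma>' b = \<gamma> a" by (auto simp: \<gamma>'_def)
      have big: "sqrt (total_energy h) \<le> sqrt (4 * CP) * norm (\<chi> j. Dop D (\<lambda>z. h z $ j) (\<gamma>' a))"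
        using le[OF XY(2)] False by (simp add: Y_def e)
      from forward[OF h \<gamma>(1) c k _ _ _ l big] \<gamma> show ?thesis by (simp add: e abs_minus_commute)
    qed
  qed
  then show ?thesis using \<eta>(1) by (intro exI[of _ \<eta>]) blast
qed

text \<open>The oscillation of \<open>f\<close> is at most
  \<open>CS * sqrt (total_energy h)\<close>, whereas a curve joining different vertices has length
  at least a fixed multiple of \<open>sqrt (total_energy h)\<close>.\<close>

lemma path_bound_initial: "\<exists>Q\<ge>0. path_bound TYPE('n::finite) Q"
proof -
  obtain \<eta> where \<eta>: "\<eta> > 0" "\<And>(h :: 'a \<Rightarrow> real ^ 'n) f (\<gamma> :: real \<Rightarrow> 'a) a b M. harm h \<Longrightarrow> dominated f h \<Longrightarrow> a < b \<Longrightarrow>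
    continuous_on {a..b} \<gamma> \<Longrightarrow> \<gamma> ` {a..b} \<subseteq> K \<Longrightarrow> \<gamma> a \<in> V0 \<Longrightarrow> \<gamma> b \<in> V0 \<Longrightarrow> \<gamma> a \<noteq> \<gamma> b \<Longrightarrow>
    length_le (\<lambda>t. h (\<gamma> t)) a b M \<Longrightarrow> (\<exists>m. \<eta> * sqrt (total_energy h) \<le> m \<and> m \<le> M \<and>
      (\<forall>Q\<ge>0. path_bound TYPE('n) Q \<longrightarrow> \<bar>f (\<gamma> b) - f (\<gamma> a)\<bar> \<le> (1 + 1) * m + Q * (M - m)))"
    using path_split_good[OF zero_less_one, where 'n = 'n] by blast
  have "path_bound TYPE('n) (CS / \<eta>)"
    unfolding path_bound_def
  proof (intro allI impI)
    fix h :: "'a \<Rightarrow> real ^ 'n" and f and \<gamma> :: "real \<Rightarrow> 'a" and a b M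
    assume h: "harm h" "dominated f h" and \<gamma>: "a < b" "continuous_on {a..b} \<gamma>" "\<gamma> ` {a..b} \<subseteq> K" "\<gamma> a \<in> V0" "\<gamma> b \<in> V0"
      and len: "length_le (\<lambda>t. h (\<gamma> t)) a b M"
    show "\<bar>f (\<gamma> b) - f (\<gamma> a)\<bar> \<le> CS / \<eta> * M"
    proof (cases "\<gamma> a = \<gamma> b")
      case True
      then show ?thesis using \<eta>(1) CS(1) length_le_nonneg[OF len \<gamma>(1)] by simp
    next
      case False
      have "\<bar>f (\<gamma> b) - f (\<gamma> a)\<bar> \<le> CS * sqrt (total_energy h)" using \<gamma> by (intro dominated_osc[OF h]) auto
      also have "\<dots> = CS / \<eta> * (\<eta> * sqrt (total_energy h))" using \<eta>(1) by simp
      also have "\<dots> \<le> CS / \<eta> * M"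
      proof (rule mult_left_mono)
        show "\<eta> * sqrt (total_energy h) \<le> M" using \<eta>(2)[OF h \<gamma> False len] by linarith
      qed (use \<eta>(1) CS(1) in simp)
      finally show ?thesis .
    qed
  qed
  then show ?thesis using \<eta>(1) CS(1) by (intro exI[of _ "CS / \<eta>"]) auto
qed

lemma path_bound_mono: "path_bound TYPE('n::finite) Q \<Longrightarrow> Q \<le> Q' \<Longrightarrow> path_bound TYPE('n) Q'"
  unfolding path_bound_def by (meson length_le_nonneg mult_right_mono order_trans)

text \<open>Self-improvement: the constant contracts towards \<open>1 + \<epsilon>\<close>.\<close>

lemma path_bound_improve:
  assumes \<epsilon>: "0 < \<epsilon>"
  shows "\<exists>\<theta>. 0 < \<theta> \<and> \<theta> \<le> 1 \<and> (\<forall>Q\<ge>1 + \<epsilon>. path_bound TYPE('n::finite) Q \<longrightarrow> path_bound TYPE('n) (1 + \<epsilon> + (1 - \<theta>) * (Q - (1 + \<epsilon>))))"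
proof -
  obtain \<eta> where \<eta>: "\<eta> > 0" "\<And>(h :: 'a \<Rightarrow> real ^ 'n) f (\<gamma> :: real \<Rightarrow> 'a) a b M. harm h \<Longrightarrow> dominated f h \<Longrightarrow> a < b \<Longrightarrow>
    continuous_on {a..b} \<gamma> \<Longrightarrow> \<gamma> ` {a..b} \<subseteq> K \<Longrightarrow> \<gamma> a \<in> V0 \<Longrightarrow> \<gamma> b \<in> V0 \<Longrightarrow> \<gamma> a \<noteq> \<gamma> b \<Longrightarrow>
    length_le (\<lambda>t. h (\<gamma> t)) a b M \<Longrightarrow>
    (\<exists>m. \<eta> * sqrt (total_energy h) \<le> m \<and> m \<le> M \<and>
      (\<forall>Q\<ge>0. path_bound TYPE('n) Q \<longrightarrow> \<bar>f (\<gamma> b) - f (\<gamma> a)\<bar> \<le> (1 + \<epsilon>) * m + Q * (M - m)))"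
    using path_split_good[OF \<epsilon>, where 'n = 'n] by blast
  \<comment> \<open>If \<open>M\<close> is at least \<open>CS * sqrt (total_energy h)\<close>, the
    oscillation bound gives the constant 1 directly. Otherwise the good part \<open>m\<close>, being
    at least \<open>\<eta> * sqrt (total_energy h)\<close>, makes up at least the proportion
    \<open>\<theta>\<close> of \<open>M\<close>.\<close>
  define \<theta> where "\<theta> = min 1 (\<eta> / CS)"
  have \<theta>: "0 < \<theta>" "\<theta> \<le> 1" "\<theta> * CS \<le> \<eta>"
  proof -
    show "0 < \<theta>" "\<theta> \<le> 1" using \<eta>(1) CS(1) by (auto simp: \<theta>_def)
    have "\<theta> * CS \<le> \<eta> / CS * CS" using CS(1) by (intro mult_right_mono) (auto simp: \<theta>_def)
    then show "\<theta> * CS \<le> \<eta>" using CS(1) by simp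
  qed
  have "path_bound TYPE('n) (1 + \<epsilon> + (1 - \<theta>) * (Q - (1 + \<epsilon>)))" if Q: "Q \<ge> 1 + \<epsilon>" "path_bound TYPE('n) Q" for Q
    unfolding path_bound_def
  proof (intro allI impI)
    fix h :: "'a \<Rightarrow> real ^ 'n" and f and \<gamma> :: "real \<Rightarrow> 'a" and a b M
    assume h: "harm h" "dominated f h" and \<gamma>: "a < b" "continuous_on {a..b} \<gamma>" "\<gamma> ` {a..b} \<subseteq> K" "\<gamma> a \<in> V0" "\<gamma> b \<in> V0"
      and len: "length_le (\<lambda>t. h (\<gamma> t)) a b M"
    let ?Q = "1 + \<epsilon> + (1 - \<theta>) * (Q - (1 + \<epsilon>))"
    have M: "M \<ge> 0" using length_le_nonneg[OF len \<gamma>(1)] .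
    have "0 \<le> (1 - \<theta>) * (Q - (1 + \<epsilon>))" using \<theta>(2) Q(1) by (intro mult_nonneg_nonneg) auto
    then have Q1: "?Q \<ge> 1" using \<epsilon> by linarith
    show "\<bar>f (\<gamma> b) - f (\<gamma> a)\<bar> \<le> ?Q * M"
    proof (cases "\<gamma> a = \<gamma> b \<or> CS * sqrt (total_energy h) \<le> M")
      case True
      have "\<bar>f (\<gamma> b) - f (\<gamma> a)\<bar> \<le> 1 * M"
        using True M dominated_osc[OF h, of "\<gamma> b" "\<gamma> a"] \<gamma> by auto
      also have "\<dots> \<le> ?Q * M" using Q1 M by (intro mult_right_mono) auto
      finally show ?thesis .
    next
      case False
      then obtain m where m: "\<eta> * sqrt (total_energy h) \<le> m" "m \<le> M"
        "\<bar>f (\<gamma> b) - f (\<gamma> a)\<bar> \<le> (1 + \<epsilon>) * m + Q * (M - m)"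
        using \<eta>(2)[OF h \<gamma> _ len] Q \<epsilon> by force
      have "\<theta> * M \<le> \<theta> * (CS * sqrt (total_energy h))" using False \<theta>(1) by (intro mult_left_mono) auto
      also have "\<dots> = (\<theta> * CS) * sqrt (total_energy h)" by simp
      also have "\<dots> \<le> \<eta> * sqrt (total_energy h)" using \<theta>(3) total_energy_nonneg[of h] by (intro mult_right_mono) auto
      finally have "\<theta> * M \<le> m" using m(1) by simp
      then have "(Q - (1 + \<epsilon>)) * (\<theta> * M) \<le> (Q - (1 + \<epsilon>)) * m" using Q(1) by (intro mult_left_mono) auto
      then show ?thesis using m(3) by (simp add: algebra_simps)
    qed
  qed
  then show ?thesis using \<theta> by blast
qed

lemma path_bound_limit:
  assumes "\<And>k. path_bound TYPE('n::finite) (Q k)" "Q \<longlonglongrightarrow> q" shows "path_bound TYPE('n) q"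
  unfolding path_bound_def
proof (intro allI impI)
  fix h :: "'a \<Rightarrow> real ^ 'n" and f and \<gamma> :: "real \<Rightarrow> 'a" and a b M
  assume "harm h" "dominated f h" "a < b" "continuous_on {a..b} \<gamma>" "\<gamma> ` {a..b} \<subseteq> K" "\<gamma> a \<in> V0" "\<gamma> b \<in> V0"
    "length_le (\<lambda>t. h (\<gamma> t)) a b M"
  then have "\<bar>f (\<gamma> b) - f (\<gamma> a)\<bar> \<le> Q k * M" for k using assms(1)[of k] unfolding path_bound_def by blast
  moreover have "(\<lambda>k. Q k * M) \<longlonglongrightarrow> q * M" using assms(2) by (intro tendsto_intros)
  ultimately show "\<bar>f (\<gamma> b) - f (\<gamma> a)\<bar> \<le> q * M" by (intro LIMSEQ_le_const) auto
qed

lemma path_bound_1: "path_bound TYPE('n::finite) 1"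
proof -
  have "path_bound TYPE('n) (1 + \<epsilon>)" if \<epsilon>: "0 < \<epsilon>" for \<epsilon>
  proof -
    obtain Q0 where "path_bound TYPE('n) Q0" using path_bound_initial by blast
    define Q1 where "Q1 = max Q0 (1 + \<epsilon>)"
    have Q1: "path_bound TYPE('n) Q1" "1 + \<epsilon> \<le> Q1"
      using path_bound_mono[OF \<open>path_bound TYPE('n) Q0\<close>, of Q1] by (auto simp: Q1_def)
    obtain \<theta> where \<theta>: "0 < \<theta>" "\<theta> \<le> 1" "\<And>Q. Q \<ge> 1 + \<epsilon> \<Longrightarrow> path_bound TYPE('n) Q \<Longrightarrow>
        path_bound TYPE('n) (1 + \<epsilon> + (1 - \<theta>) * (Q - (1 + \<epsilon>)))"
      using path_bound_improve[OF \<epsilon>, where 'n = 'n] by blast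
    have it: "path_bound TYPE('n) (1 + \<epsilon> + (1 - \<theta>) ^ k * (Q1 - (1 + \<epsilon>)))" for k
    proof (induction k)
      case (Suc k)
      have "0 \<le> (1 - \<theta>) ^ k * (Q1 - (1 + \<epsilon>))" using \<theta> Q1 by simp
      then show ?case using \<theta>(3)[OF _ Suc] by (simp add: mult.assoc)
    qed (use Q1 in simp)
    have "(\<lambda>k. 1 + \<epsilon> + (1 - \<theta>) ^ k * (Q1 - (1 + \<epsilon>))) \<longlonglongrightarrow> 1 + \<epsilon> + 0 * (Q1 - (1 + \<epsilon>))"
      using \<theta> by (intro tendsto_intros LIMSEQ_realpow_zero) auto
    from path_bound_limit[OF it this] show ?thesis by simp
  qed
  then have "path_bound TYPE('n) (1 + 1 / real (Suc k))" for k by simp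
  moreover have "(\<lambda>k. 1 + 1 / real (Suc k)) \<longlonglongrightarrow> 1 + 0"
    by (intro tendsto_intros LIMSEQ_Suc[OF lim_1_over_n])
  ultimately show ?thesis using path_bound_limit[where 'n = 'n, of "\<lambda>k. 1 + 1 / real (Suc k)" "1 + 0"] by simp
qed

text \<open>The end points need not be vertices. Cut at the first and last visits to
  \<open>Vn n\<close>, the curve has outer pieces inside single cells, on which \<open>f\<close>
  varies by less than \<open>e / 2\<close>.\<close>

theorem dominated_le_length:
  fixes h :: "'a \<Rightarrow> real ^ 'n::finite"
  assumes h: "harm h" "dominated f h" and \<gamma>: "continuous_on {0..1} \<gamma>" "\<gamma> ` {0..1} \<subseteq> K"
    and len: "length_le (\<lambda>t. h (\<gamma> t)) 0 1 M"
  shows "f (\<gamma> 1) - f (\<gamma> 0) \<le> M"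
proof (rule field_le_epsilon)
  fix e :: real assume e: "e > 0"
  have M: "0 \<le> M" using length_le_nonneg[OF len] by simp
  have fc: "continuous_on K f" using h(2) by (simp add: dominated_def form_domain_continuous)
  obtain n where n: "\<forall>w\<in>words n. \<forall>x\<in>K. \<forall>y\<in>K. dist (f (psi_word w x)) (f (psi_word w y)) < e / 2"
    using uniform_on_cells[OF fc, of "e / 2"] e by auto
  have seg: "\<bar>f (\<gamma> t) - f (\<gamma> s)\<bar> \<le> e / 2"
    if "0 \<le> s" "s \<le> t" "t \<le> 1" and avoid: "\<And>x. s < x \<Longrightarrow> x < t \<Longrightarrow> \<gamma> x \<notin> Vn n" for s t
  proof (cases "s = t")
    case False
    have c: "continuous_on {s..t} \<gamma>" using \<gamma>(1) that by (auto intro: continuous_on_subset)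
    have k: "\<gamma> ` {s..t} \<subseteq> K" using \<gamma>(2) that by fastforce
    have st: "s < t" using False that by simp
    obtain w where w: "w \<in> words n" "\<gamma> ` {s..t} \<subseteq> psi_word w ` K"
      by (rule path_segment_in_cell[OF c k st avoid])
    have "\<gamma> s \<in> psi_word w ` K" "\<gamma> t \<in> psi_word w ` K" using w(2) that by auto
    then show ?thesis using n w(1) by (force simp: dist_real_def)
  qed (use e in simp)
  define T where "T = {0..1} \<inter> \<gamma> -` Vn n"
  show "f (\<gamma> 1) - f (\<gamma> 0) \<le> M + e"
  proof (cases "T = {}")
    case True
    have "\<gamma> x \<notin> Vn n" if "0 < x" "x < 1" for x
    proof
      assume "\<gamma> x \<in> Vn n"
      then have "x \<in> T" using that by (simp add: T_def)
      then show False using True by blast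
    qed
    then have "\<bar>f (\<gamma> 1) - f (\<gamma> 0)\<bar> \<le> e / 2" by (intro seg) simp_all
    then show ?thesis using M e abs_ge_self[of "f (\<gamma> 1) - f (\<gamma> 0)"] by linarith
  next
    case False
    have "closed T" unfolding T_def
      by (intro continuous_closed_preimage[OF \<gamma>(1) closed_atLeastAtMost finite_imp_closed] finite_Vn)
    then have cT: "compact T"
      using compact_Int_closed[OF compact_Icc[of 0 1], of T] by (simp add: T_def Int_assoc[symmetric])
    obtain s where s: "s \<in> T" "\<And>x. x \<in> T \<Longrightarrow> s \<le> x" using compact_attains_inf[OF cT False] by blast
    obtain t where t: "t \<in> T" "\<And>x. x \<in> T \<Longrightarrow> x \<le> t" using compact_attains_sup[OF cT False] by blast
    have st: "0 \<le> s" "s \<le> t" "t \<le> 1" "\<gamma> s \<in> Vn n" "\<gamma> t \<in> Vn n" using s t by (auto simp: T_def)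
    have 1: "\<bar>f (\<gamma> s) - f (\<gamma> 0)\<bar> \<le> e / 2"
    proof (rule seg)
      fix x assume "0 < x" "x < s"
      then have "\<gamma> x \<in> Vn n \<Longrightarrow> x \<in> T" using st by (simp add: T_def)
      then show "\<gamma> x \<notin> Vn n" using s(2)[of x] \<open>x < s\<close> by auto
    qed (use st in simp_all)
    have 2: "\<bar>f (\<gamma> 1) - f (\<gamma> t)\<bar> \<le> e / 2"
    proof (rule seg)
      fix x assume "t < x" "x < 1"
      then have "\<gamma> x \<in> Vn n \<Longrightarrow> x \<in> T" using st by (simp add: T_def)
      then show "\<gamma> x \<notin> Vn n" using t(2)[of x] \<open>t < x\<close> by auto
    qed (use st in simp_all)
    have "\<bar>f (\<gamma> t) - f (\<gamma> s)\<bar> \<le> 1 * M"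
    proof (rule path_bound_Vn[OF path_bound_1 _ h])
      show "continuous_on {s..t} \<gamma>" using \<gamma>(1) st by (auto intro: continuous_on_subset)
      show "\<gamma> ` {s..t} \<subseteq> K" using \<gamma>(2) st by fastforce
      show "length_le (\<lambda>t. h (\<gamma> t)) s t M" if "s < t"
        using length_le_sub[OF len, of s t] st that by (auto intro: length_le_mono)
    qed (use st M in auto)
    then show ?thesis using abs_le_D1[OF 1] abs_le_D1[OF 2] abs_le_D1[of "f (\<gamma> t) - f (\<gamma> s)" M] by simp
  qed
qed

lemma dominated_le_geodesic_dist:
  fixes h :: "'a \<Rightarrow> real ^ 'n::finite"
  assumes h: "harm h" "dominated f h"
  shows "ereal (f y - f x) \<le> geodesic_dist K h x y"
  unfolding geodesic_dist_def
proof (rule INF_greatest)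
  fix \<gamma> :: "real \<Rightarrow> 'a" assume "\<gamma> \<in> {\<gamma>. path \<gamma> \<and> path_image \<gamma> \<subseteq> K \<and> pathstart \<gamma> = x \<and> pathfinish \<gamma> = y}"
  then have \<gamma>: "continuous_on {0..1} \<gamma>" "\<gamma> ` {0..1} \<subseteq> K" "\<gamma> 0 = x" "\<gamma> 1 = y"
    by (auto simp: path_def path_image_def pathstart_def pathfinish_def)
  show "ereal (f y - f x) \<le> curve_length h 0 1 \<gamma>"
  proof (rule ereal_le_real)
    fix z assume "curve_length h 0 1 \<gamma> \<le> ereal z"
    then show "ereal (f y - f x) \<le> ereal z"
      using dominated_le_length[OF h \<gamma>(1,2)] \<gamma>(3,4) by (simp add: curve_length_le_iff)
  qed
qed

end

section \<open>Chains\<close>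

context self_similar_structure
begin

text \<open>A step \<open>(i, c, d)\<close> crosses the cell \<open>i\<close> from
  \<open>\<psi> i c\<close> to \<open>\<psi> i d\<close>. Its ends are recorded in the coordinates
  of the cell, so that a recursion can zoom in without inverting \<open>\<psi> i\<close>.\<close>

fun is_chain :: "('s \<times> 'a \<times> 'a) list \<Rightarrow> 'a \<Rightarrow> 'a \<Rightarrow> bool" where
  "is_chain [] a b \<longleftrightarrow> a = b"
| "is_chain ((i, c, d) # es) a b \<longleftrightarrow> \<psi> i c = a \<and> is_chain es (\<psi> i d) b"

lemma is_chain_append: "is_chain es a b \<Longrightarrow> is_chain es' b c \<Longrightarrow> is_chain (es @ es') a c"
  by (induction es a b rule: is_chain.induct) auto

lemma is_chain_appendD: "is_chain (es @ es') a c \<Longrightarrow> \<exists>b. is_chain es a b \<and> is_chain es' b c"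
  by (induction es a c rule: is_chain.induct) auto

lemma is_chain_remove_loop: "is_chain (xs @ [e] @ ys @ [e] @ zs) a b \<Longrightarrow> is_chain (xs @ [e] @ zs) a b"
proof -
  assume "is_chain (xs @ [e] @ ys @ [e] @ zs) a b"
  then obtain x where x: "is_chain xs a x" "is_chain ([e] @ ys @ [e] @ zs) x b" using is_chain_appendD by blast
  obtain i c d where e: "e = (i, c, d)" by (cases e)
  from x(2) have x2: "\<psi> i c = x" "is_chain (ys @ [e] @ zs) (\<psi> i d) b" by (auto simp: e)
  then obtain y where "is_chain ([e] @ zs) y b" using is_chain_appendD by blast
  then have "is_chain ([e] @ zs) x b" using x2(1) by (simp add: e)
  then show ?thesis using x(1) is_chain_append by blast
qed

definition cost :: "('s \<times> 'a \<times> 'a \<Rightarrow> real) \<Rightarrow> ('s \<times> 'a \<times> 'a) list \<Rightarrow> real" where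
  "cost W es = sum_list (map W es)"

lemma cost_simps [simp]: "cost W [] = 0" "cost W (e # es) = W e + cost W es" "cost W (es @ es') = cost W es + cost W es'"
  by (auto simp: cost_def)

text \<open>The path metric of a weighted graph; it is meaningful for nonnegative weights and pairs
  that are joined by some chain.\<close>

definition gdist :: "('s \<times> 'a \<times> 'a) set \<Rightarrow> ('s \<times> 'a \<times> 'a \<Rightarrow> real) \<Rightarrow> 'a \<Rightarrow> 'a \<Rightarrow> real" where
  "gdist T W a b = Inf (cost W ` {es. set es \<subseteq> T \<and> is_chain es a b})"

lemma cost_nonneg: "(\<And>e. e \<in> T \<Longrightarrow> 0 \<le> W e) \<Longrightarrow> set es \<subseteq> T \<Longrightarrow> 0 \<le> cost W es"
  by (induction es) auto

lemma cost_mono: "(\<And>e. e \<in> set es \<Longrightarrow> W e \<le> W' e) \<Longrightarrow> cost W es \<le> cost W' es"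
  by (induction es) (auto intro: add_mono)

lemma gdist_le:
  assumes "\<And>e. e \<in> T \<Longrightarrow> 0 \<le> W e" "set es \<subseteq> T" "is_chain es a b" shows "gdist T W a b \<le> cost W es"
  unfolding gdist_def
proof (rule cInf_lower)
  show "bdd_below (cost W ` {es. set es \<subseteq> T \<and> is_chain es a b})"
    using cost_nonneg[of T W, OF assms(1)] by (intro bdd_belowI2[of _ 0]) simp
qed (use assms in blast)

text \<open>A repeated step is removed together with the loop between its two occurrences, which
  does not raise the cost.\<close>

lemma ex_distinct_chain:
  assumes W: "\<And>e. e \<in> T \<Longrightarrow> 0 \<le> W e" and "set es \<subseteq> T" "is_chain es a b"
  shows "\<exists>es'. distinct es' \<and> set es' \<subseteq> T \<and> is_chain es' a b \<and> cost W es' \<le> cost W es"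
  using assms(2,3)
proof (induction "length es" arbitrary: es rule: less_induct)
  case less
  show ?case
  proof (cases "distinct es")
    case False
    then obtain xs ys zs e where e: "es = xs @ [e] @ ys @ [e] @ zs" using not_distinct_decomp by blast
    have "0 \<le> cost W ys" using W less.prems(1) by (intro cost_nonneg[of T]) (auto simp: e)
    moreover have "0 \<le> W e" using W less.prems(1) by (auto simp: e)
    ultimately have c: "cost W (xs @ [e] @ zs) \<le> cost W es" by (simp add: e)
    have "is_chain (xs @ [e] @ zs) a b" using less.prems(2) unfolding e by (rule is_chain_remove_loop)
    moreover have "set (xs @ [e] @ zs) \<subseteq> T" "length (xs @ [e] @ zs) < length es" using less.prems(1) by (auto simp: e)
    ultimately show ?thesis using less.hyps[of "xs @ [e] @ zs"] c order_trans by blast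
  qed (use less.prems in blast)
qed

lemma finite_distinct_chains: "finite T \<Longrightarrow> finite {es. distinct es \<and> set es \<subseteq> T \<and> is_chain es a b}"
proof (rule finite_subset)
  assume T: "finite T"
  show "finite {es. set es \<subseteq> T \<and> length es \<le> card T}" using T by (rule finite_lists_length_le)
  show "{es. distinct es \<and> set es \<subseteq> T \<and> is_chain es a b} \<subseteq> {es. set es \<subseteq> T \<and> length es \<le> card T}"
  proof
    fix es assume "es \<in> {es. distinct es \<and> set es \<subseteq> T \<and> is_chain es a b}"
    then have es: "distinct es" "set es \<subseteq> T" by blast+
    note distinct_card[OF es(1)]
    with es(2) have "set es \<subseteq> T \<and> length es \<le> card T" using card_mono[OF T, of "set es"] by argo
    then show "es \<in> {es. set es \<subseteq> T \<and> length es \<le> card T}" by (rule CollectI)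
  qed
qed

lemma gdist_attained:
  assumes T: "finite T" and W: "\<And>e. e \<in> T \<Longrightarrow> 0 \<le> W e" and ex: "set es \<subseteq> T" "is_chain es a b"
  shows "\<exists>es. distinct es \<and> set es \<subseteq> T \<and> is_chain es a b \<and> cost W es = gdist T W a b"
proof -
  let ?X = "{es. distinct es \<and> set es \<subseteq> T \<and> is_chain es a b}"
  have ne: "?X \<noteq> {}" using ex_distinct_chain[of T W, OF W ex] by blast
  have fin: "finite ?X" using finite_distinct_chains[OF T] .
  define m where "m = Min (cost W ` ?X)"
  have "m \<in> cost W ` ?X" unfolding m_def using ne fin by (intro Min_in) auto
  then obtain es0 where es0: "es0 \<in> ?X" "cost W es0 = m" by auto
  have "m \<le> cost W es'" if es': "set es' \<subseteq> T" "is_chain es' a b" for es'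
  proof -
    obtain es'' where "es'' \<in> ?X" "cost W es'' \<le> cost W es'" using ex_distinct_chain[of T W, OF W es'] by blast
    moreover have "m \<le> cost W es''" unfolding m_def using calculation(1) fin by (intro Min_le) auto
    ultimately show ?thesis by simp
  qed
  then have "m \<le> gdist T W a b"
    unfolding gdist_def using ex by (intro cInf_greatest) auto
  moreover have "gdist T W a b \<le> m" using gdist_le[of T W es0 a b] W es0 by auto
  ultimately show ?thesis using es0 by (intro exI[of _ es0]) auto
qed

lemma gdist_nonneg:
  assumes "\<And>e. e \<in> T \<Longrightarrow> 0 \<le> W e" "set es \<subseteq> T" "is_chain es a b" shows "0 \<le> gdist T W a b"
  unfolding gdist_def using assms cost_nonneg[of T W] by (intro cInf_greatest) auto

lemma gdist_triangle:
  assumes T: "finite T" and W: "\<And>e. e \<in> T \<Longrightarrow> 0 \<le> W e"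
    and "set es \<subseteq> T" "is_chain es a b" "set es' \<subseteq> T" "is_chain es' b c"
  shows "gdist T W a c \<le> gdist T W a b + gdist T W b c"
proof -
  obtain x where x: "set x \<subseteq> T" "is_chain x a b" "cost W x = gdist T W a b" using gdist_attained[of T W, OF T W assms(3,4)] by blast
  obtain y where y: "set y \<subseteq> T" "is_chain y b c" "cost W y = gdist T W b c" using gdist_attained[of T W, OF T W assms(5,6)] by blast
  have "gdist T W a c \<le> cost W (x @ y)" using x y W is_chain_append by (intro gdist_le) auto
  then show ?thesis using x y by simp
qed

text \<open>\<open>Q\<close> is a finite set of marked points that always contains the boundary; \<open>sub i Q\<close> are the points
  of \<open>K\<close> marked after zooming in on the cell \<open>\<psi> i ` K\<close>.\<close>

definition marked :: "'a set \<Rightarrow> bool" where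
  "marked Q \<longleftrightarrow> finite Q \<and> V0 \<subseteq> Q \<and> Q \<subseteq> K"

definition sub :: "'s \<Rightarrow> 'a set \<Rightarrow> 'a set" where
  "sub i Q = V0 \<union> {y \<in> K. \<psi> i y \<in> Q}"

definition edges :: "'a set \<Rightarrow> ('s \<times> 'a \<times> 'a) set" where
  "edges Q = {(i, c, d). i \<in> S \<and> c \<in> sub i Q \<and> d \<in> sub i Q}"

text \<open>Shortest chains through first-level cells, each step being measured by the distance of
  the next lower level for \<open>g\<close> zoomed into its cell. Unrolled, this is the length of a
  shortest chain through cells of level \<open>m\<close>; the marked points travel along in
  \<open>Q\<close>.\<close>

primrec \<rho> :: "nat \<Rightarrow> ('a \<Rightarrow> 'b::real_normed_vector) \<Rightarrow> 'a set \<Rightarrow> 'a \<Rightarrow> 'a \<Rightarrow> real" where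
  "\<rho> 0 = (\<lambda>g Q a b. norm (g b - g a))"
| "\<rho> (Suc m) = (\<lambda>g Q. gdist (edges Q) (\<lambda>(i, c, d). \<rho> m (g \<circ> \<psi> i) (sub i Q) c d))"

end

section \<open>Chain distances on marked sets\<close>

context pcf_self_similar_structure
begin

lemma marked_sub: "marked Q \<Longrightarrow> i \<in> S \<Longrightarrow> marked (sub i Q)"
proof -
  assume Q: "marked Q" and i: "i \<in> S"
  have "finite {y \<in> K. \<psi> i y \<in> Q}"
  proof (rule finite_imageD)
    show "finite (\<psi> i ` {y \<in> K. \<psi> i y \<in> Q})"
      by (rule finite_subset[of _ Q]) (use Q in \<open>auto simp: marked_def\<close>)
    show "inj_on (\<psi> i) {y \<in> K. \<psi> i y \<in> Q}" using psi_inj[OF i] by (rule inj_on_subset) auto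
  qed
  then show ?thesis using V0_subset by (auto simp: marked_def sub_def)
qed

lemma finite_edges: "marked Q \<Longrightarrow> finite (edges Q)"
proof -
  assume Q: "marked Q"
  have "edges Q \<subseteq> (\<Union>i\<in>S. {i} \<times> sub i Q \<times> sub i Q)" by (auto simp: edges_def)
  moreover have "finite (\<Union>i\<in>S. {i} \<times> sub i Q \<times> sub i Q)"
    using marked_sub[OF Q] finite_S by (auto simp: marked_def)
  ultimately show ?thesis by (rule finite_subset)
qed

lemma marked_decomp:
  assumes "marked Q" "a \<in> Q" obtains i c where "i \<in> S" "c \<in> sub i Q" "a = \<psi> i c"
proof -
  have "a \<in> K" using assms by (auto simp: marked_def)
  then obtain i y where "i \<in> S" "y \<in> K" "a = \<psi> i y" by (rule ex_cell1)
  then show ?thesis using that assms by (auto simp: sub_def)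
qed

lemma ex_chain:
  assumes "i \<in> S" "c \<in> sub i Q" "j \<in> S" "d \<in> sub j Q"
  shows "\<exists>es. set es \<subseteq> edges Q \<and> is_chain es (\<psi> i c) (\<psi> j d)"
proof -
  have "(\<psi> i c, \<psi> j d) \<in> (link (\<lambda>i. sub i Q))\<^sup>*"
    using assms by (intro link_connected) (auto simp: sub_def)
  then show ?thesis
  proof (induction rule: rtrancl_induct)
    case base
    show ?case by (rule exI[of _ "[]"]) auto
  next
    case (step y z)
    then obtain es where es: "set es \<subseteq> edges Q" "is_chain es (\<psi> i c) y" by blast
    obtain k c' d' where k: "k \<in> S" "c' \<in> sub k Q" "d' \<in> sub k Q" "y = \<psi> k c'" "z = \<psi> k d'"
      using step(2) by (auto simp: link_def)
    then have "is_chain (es @ [(k, c', d')]) (\<psi> i c) z" using es by (intro is_chain_append) auto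
    then show ?case using es k by (intro exI[of _ "es @ [(k, c', d')]"]) (auto simp: edges_def)
  qed
qed

lemma ex_chain_marked:
  assumes "marked Q" "a \<in> Q" "b \<in> Q" shows "\<exists>es. set es \<subseteq> edges Q \<and> is_chain es a b"
proof -
  obtain i c where "i \<in> S" "c \<in> sub i Q" "a = \<psi> i c" using assms(1,2) by (rule marked_decomp)
  moreover obtain j d where "j \<in> S" "d \<in> sub j Q" "b = \<psi> j d" using assms(1,3) by (rule marked_decomp)
  ultimately show ?thesis using ex_chain by blast
qed

lemma \<rho>_nonneg: "marked Q \<Longrightarrow> a \<in> Q \<Longrightarrow> b \<in> Q \<Longrightarrow> 0 \<le> \<rho> m g Q a b"
proof (induction m arbitrary: g Q a b)
  case (Suc m)
  obtain es where es: "set es \<subseteq> edges Q" "is_chain es a b" using ex_chain_marked[OF Suc.prems] by blast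
  show ?case unfolding \<rho>.simps
  proof (rule gdist_nonneg[OF _ es])
    fix e assume "e \<in> edges Q"
    then show "0 \<le> (case e of (i, c, d) \<Rightarrow> \<rho> m (g \<circ> \<psi> i) (sub i Q) c d)"
      using Suc.IH marked_sub[OF Suc.prems(1)] by (auto simp: edges_def)
  qed
qed simp

lemma edge_weight_nonneg:
  assumes Q: "marked Q" and e: "e \<in> edges Q"
  shows "0 \<le> (case e of (i, c, d) \<Rightarrow> \<rho> m (g \<circ> \<psi> i) (sub i Q) c d)"
proof -
  obtain i c d where "e = (i, c, d)" "i \<in> S" "c \<in> sub i Q" "d \<in> sub i Q" using e by (auto simp: edges_def)
  then show ?thesis using \<rho>_nonneg[OF marked_sub[OF Q]] by simp
qed

lemma \<rho>_self: "marked Q \<Longrightarrow> a \<in> Q \<Longrightarrow> \<rho> m g Q a a = 0"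
proof (cases m)
  case (Suc m')
  assume "marked Q" "a \<in> Q"
  then have "\<rho> m g Q a a \<le> cost (\<lambda>(i, c, d). \<rho> m' (g \<circ> \<psi> i) (sub i Q) c d) []"
    unfolding Suc \<rho>.simps using edge_weight_nonneg by (intro gdist_le[of "edges Q"]) auto
  then show ?thesis using \<rho>_nonneg[OF \<open>marked Q\<close> \<open>a \<in> Q\<close> \<open>a \<in> Q\<close>, of m g] by simp
qed simp

lemma \<rho>_triangle:
  assumes "marked Q" "a \<in> Q" "b \<in> Q" "c \<in> Q"
  shows "\<rho> m g Q a c \<le> \<rho> m g Q a b + \<rho> m g Q b c"
proof (cases m)
  case 0
  then show ?thesis using norm_triangle_ineq[of "g b - g a" "g c - g b"] by simp
next
  case (Suc m')
  obtain es where es: "set es \<subseteq> edges Q" "is_chain es a b" using ex_chain_marked[OF assms(1,2,3)] by blast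
  obtain es' where es': "set es' \<subseteq> edges Q" "is_chain es' b c" using ex_chain_marked[OF assms(1,3,4)] by blast
  show ?thesis unfolding Suc \<rho>.simps
    using edge_weight_nonneg[OF assms(1)] by (intro gdist_triangle[OF finite_edges[OF assms(1)] _ es es']) auto
qed

lemma norm_le_cost: "is_chain es a b \<Longrightarrow> norm (g b - g a) \<le> cost (\<lambda>(i, c, d). \<rho> 0 (g \<circ> \<psi> i) (sub i Q) c d) es"
proof (induction es a b rule: is_chain.induct)
  case (2 i c d es a b)
  have "norm (g b - g a) \<le> norm (g (\<psi> i d) - g a) + norm (g b - g (\<psi> i d))"
    using norm_triangle_ineq[of "g (\<psi> i d) - g a" "g b - g (\<psi> i d)"] by simp
  then show ?case using 2 by simp
qed simp

lemma \<rho>_attained: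
  assumes "marked Q" "a \<in> Q" "b \<in> Q"
  shows "\<exists>es. distinct es \<and> set es \<subseteq> edges Q \<and> is_chain es a b \<and>
    cost (\<lambda>(i, c, d). \<rho> m (g \<circ> \<psi> i) (sub i Q) c d) es = \<rho> (Suc m) g Q a b"
proof -
  obtain es where es: "set es \<subseteq> edges Q" "is_chain es a b" using ex_chain_marked[OF assms] by blast
  show ?thesis unfolding \<rho>.simps
    using edge_weight_nonneg[OF assms(1)] by (intro gdist_attained[OF finite_edges[OF assms(1)] _ es]) auto
qed

text \<open>Refining a chain can only make it longer: at level 0 by the triangle inequality, higher
  up by comparing the weights of each step.\<close>

lemma \<rho>_mono_Suc: "marked Q \<Longrightarrow> a \<in> Q \<Longrightarrow> b \<in> Q \<Longrightarrow> \<rho> m g Q a b \<le> \<rho> (Suc m) g Q a b"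
proof (induction m arbitrary: g Q a b)
  case 0
  obtain es where "is_chain es a b" "cost (\<lambda>(i, c, d). \<rho> 0 (g \<circ> \<psi> i) (sub i Q) c d) es = \<rho> (Suc 0) g Q a b"
    using \<rho>_attained[OF 0] by blast
  then show ?case using norm_le_cost[of es a b g Q] by simp
next
  case (Suc m)
  obtain es where es: "set es \<subseteq> edges Q" "is_chain es a b"
    "cost (\<lambda>(i, c, d). \<rho> (Suc m) (g \<circ> \<psi> i) (sub i Q) c d) es = \<rho> (Suc (Suc m)) g Q a b"
    using \<rho>_attained[OF Suc.prems] by blast
  have "\<rho> (Suc m) g Q a b \<le> cost (\<lambda>(i, c, d). \<rho> m (g \<circ> \<psi> i) (sub i Q) c d) es"
    unfolding \<rho>.simps(2)[of m] using edge_weight_nonneg[OF Suc.prems(1)] es by (intro gdist_le) auto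
  also have "\<dots> \<le> cost (\<lambda>(i, c, d). \<rho> (Suc m) (g \<circ> \<psi> i) (sub i Q) c d) es"
  proof (rule cost_mono)
    fix e assume "e \<in> set es"
    then have "e \<in> edges Q" using es by auto
    then show "(case e of (i, c, d) \<Rightarrow> \<rho> m (g \<circ> \<psi> i) (sub i Q) c d) \<le> (case e of (i, c, d) \<Rightarrow> \<rho> (Suc m) (g \<circ> \<psi> i) (sub i Q) c d)"
      using Suc.IH marked_sub[OF Suc.prems(1)] by (auto simp: edges_def simp del: \<rho>.simps)
  qed
  finally show ?case using es(3) by simp
qed

end

context fixed_vertex_structure
begin

text \<open>McShane extension, applied successively at all levels up to \<open>m\<close>.\<close>

lemma ex_extension:
  fixes g :: "'a \<Rightarrow> real ^ 'n::finite"
  assumes "marked Q" "\<And>a b. a \<in> Q \<Longrightarrow> b \<in> Q \<Longrightarrow> \<phi> b - \<phi> a \<le> \<rho> m g Q a b"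
    and "\<And>w x y. w \<in> words m \<Longrightarrow> x \<in> K \<Longrightarrow> y \<in> K \<Longrightarrow> norm (g (psi_word w x) - g (psi_word w y)) \<le> \<epsilon>"
  shows "\<exists>F\<in>form_domain. (\<forall>q\<in>V0. F q = \<phi> q) \<and> (\<forall>a\<in>Q. \<bar>F a - \<phi> a\<bar> \<le> 2 * \<epsilon>) \<and>
    (\<forall>w\<in>words m. energy (F \<circ> psi_word w) (F \<circ> psi_word w) \<le>
      (\<Sum>j\<in>UNIV. E0 D (\<lambda>z. g (psi_word w z) $ j) (\<lambda>z. g (psi_word w z) $ j)))"
  using assms
proof (induction m arbitrary: g Q \<phi>)
  case 0
  note Q = 0(1) and lip = 0(2) and osc = 0(3)[of "[]", simplified]
  have VQ: "V0 \<subseteq> Q" "Q \<subseteq> K" using Q by (auto simp: marked_def)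
  have abs: "\<bar>\<phi> b - \<phi> a\<bar> \<le> norm (g b - g a)" if "a \<in> Q" "b \<in> Q" for a b
    using lip[OF that] lip[OF that(2,1)] by (simp add: abs_le_iff norm_minus_commute)
  \<comment> \<open>At level 0 the Lipschitz condition bounds the increments of
    \<open>\<phi>\<close> by those of \<open>g\<close>, and the form is monotone in increments.
    Marked points outside \<open>V0\<close> are matched only up to the oscillation, whence the error
    \<open>2 * \<epsilon>\<close>.\<close>
  have "E0 D \<phi> \<phi> \<le> (\<Sum>j\<in>UNIV. E0 D (\<lambda>z. g z $ j) (\<lambda>z. g z $ j))"
  proof -
    have "(\<phi> q - \<phi> q')\<^sup>2 \<le> (\<Sum>j\<in>UNIV. (g q $ j - g q' $ j)\<^sup>2)" if "q \<in> V0" "q' \<in> V0" for q q'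
    proof -
      have "(\<phi> q - \<phi> q')\<^sup>2 \<le> (norm (g q - g q'))\<^sup>2"
        using abs[of q' q] that VQ by (simp flip: abs_le_square_iff add: subset_iff)
      then show ?thesis by (simp add: norm_vec_def L2_set_def sum_nonneg)
    qed
    then show ?thesis
      using E0_sum_mono[where I = "{()}" and J = UNIV and f = "\<lambda>_. \<phi>" and g = "\<lambda>j z. g z $ j"] by simp
  qed
  moreover have "\<bar>H \<phi> a - \<phi> a\<bar> \<le> 2 * \<epsilon>" if a: "a \<in> Q" for a
  proof -
    obtain q where q: "q \<in> V0" using V0_nonempty by auto
    have c: "\<bar>\<phi> x - \<phi> q\<bar> \<le> \<epsilon>" if "x \<in> Q" for x
      using abs[of q x] osc[of x q] that q VQ by (meson order_trans subsetD)
    have "\<phi> q - \<epsilon> \<le> \<phi> x" "\<phi> x \<le> \<phi> q + \<epsilon>" if "x \<in> V0" for x using c[of x] that VQ by auto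
    then have "\<phi> q - \<epsilon> \<le> H \<phi> a" "H \<phi> a \<le> \<phi> q + \<epsilon>" using H_bounds[of "\<phi> q - \<epsilon>" \<phi> "\<phi> q + \<epsilon>" a] a VQ by auto
    then show ?thesis using c[OF a] by (simp add: abs_le_iff)
  qed
  ultimately show ?case
    using H_form_domain[of \<phi>] by (intro bexI[of _ "H \<phi>"]) (auto simp: energy_H_self)
next
  case (Suc m)
  note Q = Suc.prems(1) and lip = Suc.prems(2) and osc = Suc.prems(3)
  have VQ: "V0 \<subseteq> Q" "Q \<subseteq> K" "finite Q" using Q by (auto simp: marked_def)
  have QN: "Q \<noteq> {}" using VQ V0_nonempty by auto
  define W where "W = (\<lambda>(i, c, d). \<rho> m (g \<circ> \<psi> i) (sub i Q) c d)"
  have W: "0 \<le> W e" if "e \<in> edges Q" for e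
    using edge_weight_nonneg[OF Q that, of m g] by (simp add: W_def)
  define X where "X = {\<psi> i c | i c. i \<in> S \<and> c \<in> sub i Q}"
  have QX: "Q \<subseteq> X" using marked_decomp[OF Q] unfolding X_def by blast
  have ch: "\<exists>es. set es \<subseteq> edges Q \<and> is_chain es x y" if "x \<in> X" "y \<in> X" for x y
    using that ex_chain by (fastforce simp: X_def)
  \<comment> \<open>McShane's formula for the chain distance. The function agrees with
    \<open>\<phi>\<close> on \<open>Q\<close>, and inside each cell it is Lipschitz for the distance
    of the next lower level, as the induction hypothesis requires.\<close>
  define \<Phi> where "\<Phi> z = Min ((\<lambda>a. \<phi> a + gdist (edges Q) W a z) ` Q)" for z
  have \<Phi>_le: "\<Phi> z \<le> \<phi> a + gdist (edges Q) W a z" if "a \<in> Q" for a z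
    unfolding \<Phi>_def using that VQ(3) by (intro Min_le) auto
  have \<Phi>_eq: "\<exists>a\<in>Q. \<Phi> z = \<phi> a + gdist (edges Q) W a z" for z
  proof -
    have "\<Phi> z \<in> (\<lambda>a. \<phi> a + gdist (edges Q) W a z) ` Q" unfolding \<Phi>_def using QN VQ(3) by (intro Min_in) auto
    then show ?thesis by auto
  qed
  have \<Phi>Q: "\<Phi> a = \<phi> a" if a: "a \<in> Q" for a
  proof (rule antisym)
    have "gdist (edges Q) W a a \<le> cost W []" using W by (intro gdist_le) auto
    then show "\<Phi> a \<le> \<phi> a" using \<Phi>_le[OF a, of a] by simp
    obtain a' where "a' \<in> Q" "\<Phi> a = \<phi> a' + gdist (edges Q) W a' a" using \<Phi>_eq by blast
    then show "\<phi> a \<le> \<Phi> a" using lip[of a' a] a by (simp add: W_def)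
  qed
  have \<Phi>_lip: "\<Phi> (\<psi> i d) - \<Phi> (\<psi> i c) \<le> \<rho> m (g \<circ> \<psi> i) (sub i Q) c d"
    if i: "i \<in> S" and c: "c \<in> sub i Q" and d: "d \<in> sub i Q" for i c d
  proof -
    have X: "\<psi> i c \<in> X" "\<psi> i d \<in> X" using i c d by (auto simp: X_def)
    obtain a where a: "a \<in> Q" "\<Phi> (\<psi> i c) = \<phi> a + gdist (edges Q) W a (\<psi> i c)" using \<Phi>_eq by blast
    obtain es where es: "set es \<subseteq> edges Q" "is_chain es a (\<psi> i c)" using ch X(1) a(1) QX by blast
    have e: "set [(i, c, d)] \<subseteq> edges Q" "is_chain [(i, c, d)] (\<psi> i c) (\<psi> i d)" using i c d by (auto simp: edges_def)
    have "gdist (edges Q) W a (\<psi> i d) \<le> gdist (edges Q) W a (\<psi> i c) + gdist (edges Q) W (\<psi> i c) (\<psi> i d)"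
      using W by (intro gdist_triangle[OF finite_edges[OF Q] _ es e]) auto
    moreover have "gdist (edges Q) W (\<psi> i c) (\<psi> i d) \<le> cost W [(i, c, d)]" using W by (intro gdist_le[OF _ e]) auto
    ultimately show ?thesis using \<Phi>_le[OF a(1), of "\<psi> i d"] a(2) by (simp add: W_def)
  qed
  have "\<exists>F\<in>form_domain. (\<forall>q\<in>V0. F q = (\<Phi> \<circ> \<psi> i) q) \<and> (\<forall>a\<in>sub i Q. \<bar>F a - (\<Phi> \<circ> \<psi> i) a\<bar> \<le> 2 * \<epsilon>) \<and>
    (\<forall>w\<in>words m. energy (F \<circ> psi_word w) (F \<circ> psi_word w) \<le>
      (\<Sum>j\<in>UNIV. E0 D (\<lambda>z. (g \<circ> \<psi> i) (psi_word w z) $ j) (\<lambda>z. (g \<circ> \<psi> i) (psi_word w z) $ j)))" if i: "i \<in> S" for i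
  proof (rule Suc.IH)
    show "marked (sub i Q)" using Q i by (rule marked_sub)
    show "(\<Phi> \<circ> \<psi> i) b - (\<Phi> \<circ> \<psi> i) a \<le> \<rho> m (g \<circ> \<psi> i) (sub i Q) a b" if "a \<in> sub i Q" "b \<in> sub i Q" for a b
      using \<Phi>_lip[OF i that] by simp
    show "norm ((g \<circ> \<psi> i) (psi_word w x) - (g \<circ> \<psi> i) (psi_word w y)) \<le> \<epsilon>" if "w \<in> words m" "x \<in> K" "y \<in> K" for w x y
      using osc[of "i # w" x y] that i by (simp add: words_Cons_iff psi_word_Cons)
  qed
  then have "\<forall>i\<in>S. \<exists>F. F \<in> form_domain \<and> (\<forall>q\<in>V0. F q = \<Phi> (\<psi> i q)) \<and> (\<forall>a\<in>sub i Q. \<bar>F a - \<Phi> (\<psi> i a)\<bar> \<le> 2 * \<epsilon>) \<and>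
    (\<forall>w\<in>words m. energy (F \<circ> psi_word w) (F \<circ> psi_word w) \<le>
      (\<Sum>j\<in>UNIV. E0 D (\<lambda>z. g (\<psi> i (psi_word w z)) $ j) (\<lambda>z. g (\<psi> i (psi_word w z)) $ j)))"
    unfolding o_def by blast
  from bchoice[OF this] obtain F where "\<forall>i\<in>S. F i \<in> form_domain \<and> (\<forall>q\<in>V0. F i q = \<Phi> (\<psi> i q)) \<and>
    (\<forall>a\<in>sub i Q. \<bar>F i a - \<Phi> (\<psi> i a)\<bar> \<le> 2 * \<epsilon>) \<and>
    (\<forall>w\<in>words m. energy (F i \<circ> psi_word w) (F i \<circ> psi_word w) \<le>
      (\<Sum>j\<in>UNIV. E0 D (\<lambda>z. g (\<psi> i (psi_word w z)) $ j) (\<lambda>z. g (\<psi> i (psi_word w z)) $ j)))" by blast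
  then have F: "\<And>i. i \<in> S \<Longrightarrow> F i \<in> form_domain" "\<And>i q. i \<in> S \<Longrightarrow> q \<in> V0 \<Longrightarrow> F i q = \<Phi> (\<psi> i q)"
    "\<And>i a. i \<in> S \<Longrightarrow> a \<in> sub i Q \<Longrightarrow> \<bar>F i a - \<Phi> (\<psi> i a)\<bar> \<le> 2 * \<epsilon>"
    "\<And>i w. i \<in> S \<Longrightarrow> w \<in> words m \<Longrightarrow> energy (F i \<circ> psi_word w) (F i \<circ> psi_word w) \<le>
      (\<Sum>j\<in>UNIV. E0 D (\<lambda>z. g (\<psi> i (psi_word w z)) $ j) (\<lambda>z. g (\<psi> i (psi_word w z)) $ j))"
    by blast+
  obtain G where G: "G \<in> form_domain" "\<And>i x. i \<in> S \<Longrightarrow> x \<in> K \<Longrightarrow> G (\<psi> i x) = F i x"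
    by (rule glue[of F]) (use F in auto)
  show ?case
  proof (intro bexI[of _ G] conjI ballI G(1))
    fix q assume q: "q \<in> V0"
    then obtain i c where "i \<in> S" "c \<in> V0" "q = \<psi> i c" by (rule V0_subset_V1)
    then show "G q = \<phi> q" using G(2) F(2) \<Phi>Q VQ q by auto
  next
    fix a assume a: "a \<in> Q"
    obtain i c where c: "i \<in> S" "c \<in> sub i Q" "a = \<psi> i c" using Q a by (rule marked_decomp)
    have "c \<in> K" using c(2) V0_subset by (auto simp: sub_def)
    then show "\<bar>G a - \<phi> a\<bar> \<le> 2 * \<epsilon>" using F(3)[OF c(1,2)] G(2) c \<Phi>Q[OF a] by simp
  next
    fix w assume "w \<in> words (Suc m)"
    then obtain i u where u: "w = i # u" "i \<in> S" "u \<in> words m" by (auto simp: words_Suc)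
    have "energy (G \<circ> psi_word w) (G \<circ> psi_word w) = energy (F i \<circ> psi_word u) (F i \<circ> psi_word u)"
      using u G(2) by (intro energy_cong) (auto simp: psi_word_Cons)
    also have "\<dots> \<le> (\<Sum>j\<in>UNIV. E0 D (\<lambda>z. g (psi_word w z) $ j) (\<lambda>z. g (psi_word w z) $ j))"
      using F(4)[OF u(2,3)] by (simp add: u(1) psi_word_Cons)
    finally show "energy (G \<circ> psi_word w) (G \<circ> psi_word w) \<le> (\<Sum>j\<in>UNIV. E0 D (\<lambda>z. g (psi_word w z) $ j) (\<lambda>z. g (psi_word w z) $ j))" .
  qed
qed

end

section \<open>Limits of chain distances\<close>

text \<open>Tychonoff's theorem. Functions on the whole type are taken, for which the product
  topology is that of the type class.\<close>

lemma compact_box: "compact {f :: 'a \<Rightarrow> real. \<forall>x. \<bar>f x\<bar> \<le> M}"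
proof -
  have "compactin (product_topology (\<lambda>_::'a. euclidean) UNIV) (PiE UNIV (\<lambda>_. {-M..M}))"
    by (simp add: compactin_PiE)
  then have "compact (PiE UNIV (\<lambda>_::'a. {-M..M}))"
    by (simp only: euclidean_product_topology compactin_euclidean_iff)
  moreover have "PiE UNIV (\<lambda>_::'a. {-M..M}) = {f. \<forall>x. \<bar>f x\<bar> \<le> M}" by (auto simp: PiE_def Pi_def abs_le_iff minus_le_iff)
  ultimately show ?thesis by simp
qed

context fixed_vertex_structure
begin

text \<open>An extension built at level \<open>m\<close> is controlled on cells of level up to
  \<open>m\<close> only, so full domination is reached through finite levels.\<close>

definition dominated_upto :: "nat \<Rightarrow> ('a \<Rightarrow> real) \<Rightarrow> ('a \<Rightarrow> real ^ 'n) \<Rightarrow> bool" where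
  "dominated_upto k f g \<longleftrightarrow> f \<in> form_domain \<and>
    (\<forall>n\<le>k. \<forall>w\<in>words n. cell_energy w f \<le> (\<Sum>j\<in>UNIV. cell_energy w (\<lambda>z. g z $ j)))"

definition fin_energy :: "('a \<Rightarrow> real ^ 'n) \<Rightarrow> bool" where
  "fin_energy g \<longleftrightarrow> (\<forall>j. (\<lambda>z. g z $ j) \<in> form_domain)"

lemma fin_energy_psi: "fin_energy g \<Longrightarrow> i \<in> S \<Longrightarrow> fin_energy (g \<circ> \<psi> i)"
  using form_domain_psi_word[of _ "[i]" "Suc 0"] by (auto simp: fin_energy_def o_def words_1 psi_word_Cons)

lemma fin_energy_continuous: "fin_energy g \<Longrightarrow> continuous_on K g"
proof -
  assume "fin_energy g"
  then have "continuous_on K (\<lambda>z. \<chi> j. g z $ j)"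
    by (intro continuous_on_vec_lambda form_domain_continuous) (simp add: fin_energy_def)
  then show ?thesis by simp
qed

text \<open>The function \<open>\<rho> m g Q a\<close> on \<open>Q\<close> is extended at a level
  \<open>m \<ge> k\<close> where \<open>g\<close> oscillates by less than
  \<open>\<epsilon> / 4\<close> on cells. Its energies on cells of level \<open>m\<close> are
  compared with those of \<open>g\<close> and summed up to the coarser cells.\<close>

lemma ex_dominated_upto:
  fixes g :: "'a \<Rightarrow> real ^ 'n::finite"
  assumes g: "fin_energy g" and Q: "marked Q" "a \<in> Q" "b \<in> Q" and \<epsilon>: "\<epsilon> > 0"
  shows "\<exists>F. dominated_upto k F g \<and> \<rho> k g Q a b - \<epsilon> \<le> F b - F a"
proof -
  obtain m0 where m0: "\<forall>m\<ge>m0. \<forall>w\<in>words m. \<forall>x\<in>K. \<forall>y\<in>K. dist (g (psi_word w x)) (g (psi_word w y)) < \<epsilon> / 4"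
    using uniform_on_cells_ge[OF fin_energy_continuous[OF g], of "\<epsilon> / 4"] \<epsilon> by auto
  define m where "m = max m0 k"
  have "\<exists>F\<in>form_domain. (\<forall>q\<in>V0. F q = \<rho> m g Q a q) \<and> (\<forall>z\<in>Q. \<bar>F z - \<rho> m g Q a z\<bar> \<le> 2 * (\<epsilon> / 4)) \<and>
    (\<forall>w\<in>words m. energy (F \<circ> psi_word w) (F \<circ> psi_word w) \<le>
      (\<Sum>j\<in>UNIV. E0 D (\<lambda>z. g (psi_word w z) $ j) (\<lambda>z. g (psi_word w z) $ j)))"
  proof (rule ex_extension[OF Q(1)])
    show "\<rho> m g Q a d - \<rho> m g Q a c \<le> \<rho> m g Q c d" if "c \<in> Q" "d \<in> Q" for c d
      using \<rho>_triangle[OF Q(1,2) that, of m g] by simp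
    show "norm (g (psi_word w x) - g (psi_word w y)) \<le> \<epsilon> / 4" if "w \<in> words m" "x \<in> K" "y \<in> K" for w x y
      using m0[rule_format, of m w x y] that by (simp add: dist_norm m_def)
  qed
  then obtain F where F: "F \<in> form_domain" "\<And>z. z \<in> Q \<Longrightarrow> \<bar>F z - \<rho> m g Q a z\<bar> \<le> \<epsilon> / 2"
    "\<And>w. w \<in> words m \<Longrightarrow> energy (F \<circ> psi_word w) (F \<circ> psi_word w) \<le>
      (\<Sum>j\<in>UNIV. E0 D (\<lambda>z. g (psi_word w z) $ j) (\<lambda>z. g (psi_word w z) $ j))" by auto
  have gj: "(\<lambda>z. g z $ j) \<in> form_domain" for j using g by (simp add: fin_energy_def)
  have cell: "cell_energy w F \<le> (\<Sum>j\<in>UNIV. cell_energy w (\<lambda>z. g z $ j))" if w: "w \<in> words m" for w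
  proof -
    have "E0 D (\<lambda>z. g (psi_word w z) $ j) (\<lambda>z. g (psi_word w z) $ j)
        \<le> energy ((\<lambda>z. g z $ j) \<circ> psi_word w) ((\<lambda>z. g z $ j) \<circ> psi_word w)" for j
      using E0_le_energy[OF form_domain_psi_word[OF gj w]] by (simp add: o_def)
    then have "energy (F \<circ> psi_word w) (F \<circ> psi_word w)
        \<le> (\<Sum>j\<in>UNIV. energy ((\<lambda>z. g z $ j) \<circ> psi_word w) ((\<lambda>z. g z $ j) \<circ> psi_word w))"
      by (intro order_trans[OF F(3)[OF w] sum_mono])
    then show ?thesis
      unfolding cell_energy_def sum_distrib_left[symmetric]
      using rw_pos[OF words_imp[OF w]] by (intro mult_left_mono) auto
  qed
  have "cell_energy w F \<le> (\<Sum>j\<in>UNIV. cell_energy w (\<lambda>z. g z $ j))" if n: "n \<le> k" and w: "w \<in> words n" for n w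
  proof -
    have "w @ u \<in> words m" if "u \<in> words (m - n)" for u
      using words_append[OF w that] n by (simp add: m_def)
    then have "cell_energy w F \<le> (\<Sum>u\<in>words (m - n). \<Sum>j\<in>UNIV. cell_energy (w @ u) (\<lambda>z. g z $ j))"
      unfolding cell_energy_eq_sum[OF F(1) w, where m = "m - n"] by (intro sum_mono cell) auto
    also have "\<dots> = (\<Sum>j\<in>UNIV. cell_energy w (\<lambda>z. g z $ j))"
      unfolding cell_energy_eq_sum[OF gj w, where m = "m - n"] by (rule sum.swap)
    finally show ?thesis .
  qed
  then have "dominated_upto k F g" using F(1) by (simp add: dominated_upto_def)
  moreover have "\<rho> k g Q a b - \<epsilon> \<le> F b - F a"
  proof -
    have "\<rho> k g Q a b \<le> \<rho> m g Q a b"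
      by (rule lift_Suc_mono_le[of "\<lambda>n. \<rho> n g Q a b"]) (use \<rho>_mono_Suc[OF Q] in \<open>simp_all add: m_def\<close>)
    moreover have "\<rho> m g Q a b - \<epsilon> / 2 \<le> F b" "F a \<le> \<epsilon> / 2"
      using F(2)[OF Q(3)] F(2)[OF Q(2)] \<rho>_self[OF Q(1,2), of m g] by linarith+
    ultimately show ?thesis by linarith
  qed
  ultimately show ?thesis by blast
qed

lemma dominated_upto_osc:
  assumes g: "fin_energy g" and F: "dominated_upto k F g" and w: "w \<in> words n" and x: "x \<in> K" "y \<in> K"
  shows "\<bar>F (psi_word w x) - F (psi_word w y)\<bar> \<le> CS * sqrt (rmax ^ n * (\<Sum>j\<in>UNIV. energy (\<lambda>z. g z $ j) (\<lambda>z. g z $ j)))"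
proof -
  have Fd: "F \<in> form_domain" using F by (simp add: dominated_upto_def)
  have "energy F F \<le> (\<Sum>j\<in>UNIV. energy (\<lambda>z. g z $ j) (\<lambda>z. g z $ j))"
    using F by (fastforce simp: dominated_upto_def)
  then have "energy (F \<circ> psi_word w) (F \<circ> psi_word w) \<le> rmax ^ n * (\<Sum>j\<in>UNIV. energy (\<lambda>z. g z $ j) (\<lambda>z. g z $ j))"
    using energy_psi_word_le[OF Fd w] rmax(1) by (meson mult_left_mono order_trans zero_le_power less_imp_le)
  then have "CS * sqrt (energy (F \<circ> psi_word w) (F \<circ> psi_word w)) \<le> CS * sqrt (rmax ^ n * (\<Sum>j\<in>UNIV. energy (\<lambda>z. g z $ j) (\<lambda>z. g z $ j)))"
    using CS(1) by simp
  with CS(2)[OF form_domain_psi_word[OF Fd w] x] show ?thesis unfolding o_def by linarith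
qed

lemma form_domain_cellwise:
  assumes "\<And>w n x y. w \<in> words n \<Longrightarrow> x \<in> K \<Longrightarrow> y \<in> K \<Longrightarrow> \<bar>f (psi_word w x) - f (psi_word w y)\<bar> \<le> CS * sqrt (rmax ^ n * E)"
    and "\<And>m. Em D r m f f \<le> E"
  shows "f \<in> form_domain"
proof (rule form_domainI[OF _ assms(2)])
  show "continuous_on K f"
  proof (rule continuous_on_cellwise)
    fix \<epsilon> :: real assume "\<epsilon> > 0"
    have "(\<lambda>n. CS * sqrt (rmax ^ n * E)) \<longlonglongrightarrow> CS * sqrt (0 * E)"
      using rmax by (intro tendsto_intros LIMSEQ_realpow_zero) auto
    then have "\<forall>\<^sub>F n in sequentially. CS * sqrt (rmax ^ n * E) < \<epsilon>"
      using \<open>\<epsilon> > 0\<close> by (intro order_tendstoD) auto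
    then obtain n where "CS * sqrt (rmax ^ n * E) < \<epsilon>" by (auto simp: eventually_sequentially)
    then have "\<forall>w\<in>words n. \<forall>x\<in>K. \<forall>y\<in>K. dist (f (psi_word w x)) (f (psi_word w y)) < \<epsilon>"
      using assms(1)[of _ n] unfolding dist_real_def by (meson le_less_trans)
    then show "\<exists>n. \<forall>w\<in>words n. \<forall>x\<in>K. \<forall>y\<in>K. dist (f (psi_word w x)) (f (psi_word w y)) < \<epsilon>" ..
  qed
qed

text \<open>All constraints are closed conditions on finitely many values, so a limit exists by compactness of the
  product topology.\<close>

lemma ex_dominated_limit:
  fixes g :: "'a \<Rightarrow> real ^ 'n::finite"
  assumes g: "fin_energy g" and ab: "a \<in> K" "b \<in> K" and c: "incseq c"
    and ex: "\<And>k. \<exists>F. dominated_upto k F g \<and> c k \<le> F b - F a"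
  shows "\<exists>f. (\<forall>k. dominated_upto k f g) \<and> (\<forall>k. c k \<le> f b - f a)"
proof -
  define E where "E = (\<Sum>j\<in>UNIV. energy (\<lambda>z. g z $ j) (\<lambda>z. g z $ j))"
  define C where "C w = rw w * (\<Sum>j\<in>UNIV. cell_energy w (\<lambda>z. g z $ j))" for w
  \<comment> \<open>Energy bounds on cells up to level \<open>k\<close>, an oscillation bound that
    makes the limit continuous, and the required increment. The sets decrease in \<open>k\<close>
    because \<open>c\<close> increases.\<close>
  define T where "T k =
    (\<Inter>n\<in>{..k}. \<Inter>w\<in>words n. \<Inter>m. {f. Em D r m (f \<circ> psi_word w) (f \<circ> psi_word w) \<le> C w}) \<inter>
    (\<Inter>n. \<Inter>w\<in>words n. \<Inter>x\<in>K. \<Inter>y\<in>K. {f. \<bar>f (psi_word w x) - f (psi_word w y)\<bar> \<le> CS * sqrt (rmax ^ n * E)}) \<inter>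
    {f. c k \<le> f b - f a}" for k
  have cont: "continuous_on UNIV (\<lambda>f. f x :: real)" for x :: 'a by (rule continuous_on_product_coordinates)
  have cl: "closed (T k)" for k
    unfolding T_def Int_assoc
    by (intro closed_Int closed_INT ballI closed_Collect_le)
      (auto simp: Em_def E0_def Dop_def intro!: continuous_intros cont)
  have ne: "{f. \<forall>x. \<bar>f x\<bar> \<le> CS * sqrt E} \<inter> T k \<noteq> {}" for k
  proof -
    obtain F where F: "dominated_upto k F g" "c k \<le> F b - F a" using ex by blast
    \<comment> \<open>Subtracting \<open>F a\<close> and setting the function to 0 off
      \<open>K\<close> places it in the compact box without changing increments on \<open>K\<close>
      or energies.\<close>
    define G where "G x = (if x \<in> K then F x - F a else 0)" for x
    have Gd: "(\<lambda>x. F x - F a) \<in> form_domain"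
      using F(1) by (intro form_domain_diff form_domain_const) (simp add: dominated_upto_def)
    have "G \<in> {f. \<forall>x. \<bar>f x\<bar> \<le> CS * sqrt E} \<inter> T k"
      unfolding T_def
    proof (intro IntI INT_I CollectI allI)
      have E: "0 \<le> E" unfolding E_def using g by (intro sum_nonneg energy_nonneg) (simp add: fin_energy_def)
      show "\<bar>G x\<bar> \<le> CS * sqrt E" for x
        using dominated_upto_osc[OF g F(1), of "[]" 0 x a] ab E CS(1) by (simp add: G_def E_def)
      show "\<bar>G (psi_word w x) - G (psi_word w y)\<bar> \<le> CS * sqrt (rmax ^ n * E)"
        if "w \<in> words n" "x \<in> K" "y \<in> K" for n w x y
        using dominated_upto_osc[OF g F(1) that] that by (simp add: G_def E_def)
      show "c k \<le> G b - G a" using F(2) ab by (simp add: G_def)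
      fix n w m assume n: "n \<in> {..k}" and w: "w \<in> words n"
      have "Em D r m (G \<circ> psi_word w) (G \<circ> psi_word w) = Em D r m ((F \<circ> psi_word w)) ((F \<circ> psi_word w))"
        unfolding Em_def E0_eq_sum_diff using w by (intro sum.cong refl arg_cong2[where f = "(*)"] arg_cong2[where f = "(/)"])
          (auto simp: G_def)
      also have "\<dots> \<le> energy (F \<circ> psi_word w) (F \<circ> psi_word w)"
        using F(1) w by (intro Em_le_energy form_domain_psi_word) (auto simp: dominated_upto_def)
      also have "\<dots> \<le> C w"
        unfolding energy_psi_word[OF w] C_def using F(1) n w rw_pos[OF words_imp[OF w]]
        by (intro mult_left_mono) (auto simp: dominated_upto_def)
      finally show "Em D r m (G \<circ> psi_word w) (G \<circ> psi_word w) \<le> C w" .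
    qed
    then show ?thesis by blast
  qed
  have fip: "{f. \<forall>x. \<bar>f x\<bar> \<le> CS * sqrt E} \<inter> (\<Inter>k\<in>I. T k) \<noteq> {}" if "finite I" for I
  proof -
    have "T (Max I) \<subseteq> T k" if k: "k \<in> I" for k
    proof -
      have kI: "k \<le> Max I" using \<open>finite I\<close> k by simp
      show ?thesis unfolding T_def using incseqD[OF c kI] kI by (intro Int_mono INF_superset_mono) auto
    qed
    then show ?thesis using ne[of "Max I"] by blast
  qed
  have "{f. \<forall>x. \<bar>f x\<bar> \<le> CS * sqrt E} \<inter> \<Inter> (range T) \<noteq> {}"
    by (rule compact_imp_fip_image[OF compact_box cl fip])
  then obtain f where f: "f \<in> T k" for k by auto
  have "C [] = E" by (simp add: C_def E_def)
  then have Em: "Em D r m f f \<le> E" for m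
    using f[of 0] by (auto simp: T_def)
  have fd: "f \<in> form_domain"
    using f[of 0] Em by (intro form_domain_cellwise[of f E]) (auto simp: T_def)
  have "cell_energy w f \<le> (\<Sum>j\<in>UNIV. cell_energy w (\<lambda>z. g z $ j))" if w: "w \<in> words n" for n w
  proof -
    have "energy (f \<circ> psi_word w) (f \<circ> psi_word w) \<le> C w"
      using f[of n] w by (intro energy_leI form_domain_psi_word[OF fd w]) (auto simp: T_def)
    then show ?thesis
      using rw_pos[OF words_imp[OF w]] by (simp add: energy_psi_word[OF w] C_def)
  qed
  then have "\<forall>k. dominated_upto k f g" using fd by (simp add: dominated_upto_def)
  moreover have "\<forall>k. c k \<le> f b - f a" using f by (simp add: T_def)
  ultimately show ?thesis by blast
qed

definition \<delta> :: "('a \<Rightarrow> real ^ 'n::finite) \<Rightarrow> 'a set \<Rightarrow> 'a \<Rightarrow> 'a \<Rightarrow> real" where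
  "\<delta> g Q a b = (SUP m. \<rho> m g Q a b)"

lemma \<rho>_incseq: "marked Q \<Longrightarrow> a \<in> Q \<Longrightarrow> b \<in> Q \<Longrightarrow> incseq (\<lambda>m. \<rho> m g Q a b)"
  by (intro incseq_SucI \<rho>_mono_Suc)

lemma ex_dominated_\<rho>:
  fixes g :: "'a \<Rightarrow> real ^ 'n::finite"
  assumes g: "fin_energy g" and Q: "marked Q" "a \<in> Q" "b \<in> Q"
  shows "\<exists>f. (\<forall>k. dominated_upto k f g) \<and> (\<forall>m. \<rho> m g Q a b \<le> f b - f a)"
proof -
  \<comment> \<open>The slack \<open>1 / real (Suc k)\<close> pays for the \<open>\<epsilon>\<close>
    in \<open>ex_dominated_upto\<close>; as it decreases, \<open>c\<close> is increasing.\<close>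
  define c where "c k = \<rho> k g Q a b - 1 / real (Suc k)" for k
  have "incseq c"
    unfolding c_def using \<rho>_mono_Suc[OF Q, of _ g] by (intro incseq_SucI diff_mono) (auto simp: field_simps)
  then obtain f where f: "\<forall>k. dominated_upto k f g" "\<And>k. c k \<le> f b - f a"
    using ex_dominated_limit[OF g, of a b c] ex_dominated_upto[OF g Q] Q by (auto simp: c_def marked_def subset_iff)
  have "\<rho> m g Q a b \<le> f b - f a" for m
  proof (rule LIMSEQ_le_const2)
    have "(\<lambda>k. \<rho> m g Q a b - 1 / real (Suc k)) \<longlonglongrightarrow> \<rho> m g Q a b - 0"
      by (intro tendsto_intros LIMSEQ_Suc[OF lim_1_over_n])
    then show "(\<lambda>k. \<rho> m g Q a b - 1 / real (Suc k)) \<longlonglongrightarrow> \<rho> m g Q a b" by simp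
    have "\<rho> m g Q a b - 1 / real (Suc k) \<le> f b - f a" if "m \<le> k" for k
      using incseqD[OF \<rho>_incseq[OF Q] that, of g] f(2)[of k] by (simp add: c_def)
    then show "\<exists>N. \<forall>k\<ge>N. \<rho> m g Q a b - 1 / real (Suc k) \<le> f b - f a" by blast
  qed
  then show ?thesis using f(1) by blast
qed

lemma \<rho>_bdd: "fin_energy g \<Longrightarrow> marked Q \<Longrightarrow> a \<in> Q \<Longrightarrow> b \<in> Q \<Longrightarrow> bdd_above (range (\<lambda>m. \<rho> m g Q a b))"
  using ex_dominated_\<rho>[of g Q a b] by (auto intro: bdd_aboveI2)

lemma \<rho>_le_\<delta>: "fin_energy g \<Longrightarrow> marked Q \<Longrightarrow> a \<in> Q \<Longrightarrow> b \<in> Q \<Longrightarrow> \<rho> m g Q a b \<le> \<delta> g Q a b"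
  unfolding \<delta>_def by (intro cSUP_upper \<rho>_bdd) auto

lemma \<rho>_tendsto_\<delta>:
  "fin_energy g \<Longrightarrow> marked Q \<Longrightarrow> a \<in> Q \<Longrightarrow> b \<in> Q \<Longrightarrow> (\<lambda>m. \<rho> m g Q a b) \<longlonglongrightarrow> \<delta> g Q a b"
  unfolding \<delta>_def by (intro LIMSEQ_incseq_SUP \<rho>_bdd \<rho>_incseq)

lemma ex_dominated_\<delta>:
  fixes g :: "'a \<Rightarrow> real ^ 'n::finite"
  assumes "fin_energy g" "marked Q" "a \<in> Q" "b \<in> Q"
  shows "\<exists>f. (\<forall>k. dominated_upto k f g) \<and> \<delta> g Q a b \<le> f b - f a"
proof -
  obtain f where "\<forall>k. dominated_upto k f g" "\<forall>m. \<rho> m g Q a b \<le> f b - f a"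
    using ex_dominated_\<rho>[OF assms] by blast
  then show ?thesis unfolding \<delta>_def by (intro exI[of _ f] conjI cSUP_least) auto
qed

text \<open>Costs increase with \<open>m\<close>, so a chain that exceeds
  \<open>\<delta> g Q a b\<close> at some level does so at all later ones. If every simple chain
  failed, all of them would fail at the largest of these levels, where a minimal one is known to
  comply.\<close>

lemma ex_minimal_chain:
  assumes g: "fin_energy g" and Q: "marked Q" "a \<in> Q" "b \<in> Q"
  shows "\<exists>es. es \<noteq> [] \<and> set es \<subseteq> edges Q \<and> is_chain es a b \<and>
    cost (\<lambda>(i, c, d). \<delta> (g \<circ> \<psi> i) (sub i Q) c d) es \<le> \<delta> g Q a b"
proof -
  define W where "W m = (\<lambda>(i, c, d). \<rho> m (g \<circ> \<psi> i) (sub i Q) c d)" for m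
  define X where "X = {es. distinct es \<and> set es \<subseteq> edges Q \<and> is_chain es a b}"
  have fin: "finite X" unfolding X_def using finite_edges[OF Q(1)] by (rule finite_distinct_chains)
  have ex: "\<exists>es\<in>X. cost (W m) es \<le> \<delta> g Q a b" for m
  proof -
    obtain es where es: "distinct es" "set es \<subseteq> edges Q" "is_chain es a b" "cost (W m) es = \<rho> (Suc m) g Q a b"
      using \<rho>_attained[OF Q, of m g] unfolding W_def by blast
    have "cost (W m) es \<le> \<delta> g Q a b" using \<rho>_le_\<delta>[OF g Q, of "Suc m"] es(4) by simp
    then show ?thesis using es by (auto simp: X_def)
  qed
  have Wmono: "cost (W m) es \<le> cost (W n) es" if "m \<le> n" "es \<in> X" for m n es
  proof (rule cost_mono)
    fix e assume "e \<in> set es"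
    then obtain i c d where "e = (i, c, d)" "i \<in> S" "c \<in> sub i Q" "d \<in> sub i Q"
      using \<open>es \<in> X\<close> by (force simp: X_def edges_def)
    then show "W m e \<le> W n e"
      using incseqD[OF \<rho>_incseq[OF marked_sub[OF Q(1)]] \<open>m \<le> n\<close>] by (simp add: W_def)
  qed
  have "\<exists>es\<in>X. \<forall>m. cost (W m) es \<le> \<delta> g Q a b"
  proof (rule ccontr)
    assume "\<not> ?thesis"
    then have "\<forall>es\<in>X. \<exists>m. \<delta> g Q a b < cost (W m) es" by (auto simp: not_le)
    from bchoice[OF this] obtain M where M: "\<And>es. es \<in> X \<Longrightarrow> \<delta> g Q a b < cost (W (M es)) es" by blast
    obtain es where es: "es \<in> X" "cost (W (Max (M ` X))) es \<le> \<delta> g Q a b" using ex by blast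
    have "M es \<le> Max (M ` X)" using fin es(1) by (intro Max_ge) auto
    then show False using M[OF es(1)] Wmono[OF _ es(1)] es(2) by fastforce
  qed
  then obtain es where es: "es \<in> X" "\<And>m. cost (W m) es \<le> \<delta> g Q a b" by blast
  have "(\<lambda>m. cost (W m) xs) \<longlonglongrightarrow> cost (\<lambda>(i, c, d). \<delta> (g \<circ> \<psi> i) (sub i Q) c d) xs"
    if "set xs \<subseteq> edges Q" for xs using that
  proof (induction xs)
    case (Cons e xs)
    obtain i c d where e: "e = (i, c, d)" "i \<in> S" "c \<in> sub i Q" "d \<in> sub i Q"
      using Cons.prems by (force simp: edges_def)
    have "(\<lambda>m. W m e) \<longlonglongrightarrow> \<delta> (g \<circ> \<psi> i) (sub i Q) c d"
      unfolding W_def e(1) prod.case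
      using \<rho>_tendsto_\<delta>[OF fin_energy_psi[OF g e(2)] marked_sub[OF Q(1) e(2)] e(3,4)] .
    then show ?case using Cons.IH Cons.prems e(1) by (simp add: o_def tendsto_add)
  qed simp
  then have le: "cost (\<lambda>(i, c, d). \<delta> (g \<circ> \<psi> i) (sub i Q) c d) es \<le> \<delta> g Q a b"
    using es LIMSEQ_le_const2 by (fastforce simp: X_def)
  show ?thesis
  proof (cases "es = []")
    case False
    then show ?thesis using es(1) le by (auto simp: X_def)
  next
    \<comment> \<open>For \<open>a = b\<close> the chain may be empty, while a concatenation of
      curves needs at least one piece; a trivial step inside a cell containing \<open>a\<close>
      costs nothing.\<close>
    case True
    then have ab: "a = b" using es(1) by (simp add: X_def)
    obtain i c where c: "i \<in> S" "c \<in> sub i Q" "a = \<psi> i c" using Q(1,2) by (rule marked_decomp)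
    have "\<delta> (g \<circ> \<psi> i) (sub i Q) c c = 0"
      unfolding \<delta>_def \<rho>_self[OF marked_sub[OF Q(1) c(1)] c(2)] by simp
    then show ?thesis
      using c ab le True by (intro exI[of _ "[(i, c, c)]"]) (auto simp: edges_def)
  qed
qed

end

section \<open>Concatenation of curves\<close>

lemma psum_affine: "psum (\<lambda>t. g (k * t + c)) a b s \<Longrightarrow> 0 < k \<Longrightarrow> psum g (k * a + c) (k * b + c) s"
proof (induction rule: psum.induct)
  case (single a b)
  then show ?case using psum.single[of "k * a + c" "k * b + c" g] by simp
next
  case (step a d b s)
  then show ?case using psum.step[of "k * a + c" "k * d + c" g "k * b + c" s] by simp
qed

lemma length_le_affine: "length_le g (k * a + c) (k * b + c) M \<Longrightarrow> 0 < k \<Longrightarrow> length_le (\<lambda>t. g (k * t + c)) a b M"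
  using psum_affine unfolding length_le_def by blast

lemma psum_split:
  "psum g a b s \<Longrightarrow> a < c \<Longrightarrow> c < b \<Longrightarrow> \<exists>s1 s2. psum g a c s1 \<and> psum g c b s2 \<and> s \<le> s1 + s2"
proof (induction rule: psum.induct)
  case (single a b)
  have "norm (g b - g a) \<le> norm (g c - g a) + norm (g b - g c)"
    using norm_triangle_ineq[of "g c - g a" "g b - g c"] by simp
  then show ?case using psum.single[of a c g] psum.single[of c b g] single by blast
next
  case (step a d b s)
  have db: "d < b" using psum_less[OF step(2)] .
  consider "d < c" | "d = c" | "c < d" by linarith
  then show ?case
  proof cases
    case 1
    then obtain s1 s2 where s: "psum g d c s1" "psum g c b s2" "s \<le> s1 + s2" using step.IH step.prems by blast
    have "psum g a c (norm (g d - g a) + s1)" by (rule psum.step[OF step(1) s(1)])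
    moreover have "norm (g d - g a) + s \<le> norm (g d - g a) + s1 + s2" using s(3) by simp
    ultimately show ?thesis using s(2) by blast
  next
    case 2
    then show ?thesis using psum.single[of a c g] step by blast
  next
    case 3
    have "psum g a c (norm (g c - g a))" using step.prems by (intro psum.single)
    moreover have "psum g c b (norm (g d - g c) + s)" using 3 step(2) by (rule psum.step)
    moreover have "norm (g d - g a) + s \<le> norm (g c - g a) + (norm (g d - g c) + s)"
      using norm_triangle_ineq[of "g c - g a" "g d - g c"] by simp
    ultimately show ?thesis by blast
  qed
qed

lemma length_le_join:
  assumes "length_le g a c M" "length_le g c b M'" "a < c" "c < b" shows "length_le g a b (M + M')"
  unfolding length_le_def
proof (intro allI impI)
  fix s assume "psum g a b s"
  then obtain s1 s2 where "psum g a c s1" "psum g c b s2" "s \<le> s1 + s2" using psum_split assms(3,4) by blast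
  moreover have "s1 \<le> M" "s2 \<le> M'" using calculation assms(1,2) by (auto simp: length_le_def)
  ultimately show "s \<le> M + M'" by linarith
qed

lemma length_le_joinpaths:
  assumes "length_le p 0 1 M" "length_le q 0 1 M'" "p 1 = q 0"
  shows "length_le (p +++ q) 0 1 (M + M')"
proof (rule length_le_join)
  have "length_le (\<lambda>t. p (2 * t + 0)) 0 (1 / 2) M" using assms(1) by (intro length_le_affine) auto
  then show "length_le (p +++ q) 0 (1 / 2) M" by (rule length_le_cong) (auto simp: joinpaths_def)
  have "length_le (\<lambda>t. q (2 * t + (-1))) (1 / 2) 1 M'" using assms(2) by (intro length_le_affine) auto
  then show "length_le (p +++ q) (1 / 2) 1 M'"
  proof (rule length_le_cong)
    fix t :: real assume "1 / 2 \<le> t"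
    then consider "t = 1 / 2" | "1 / 2 < t" by fastforce
    then show "q (2 * t + - 1) = (p +++ q) t"
    proof cases
      case 1
      show ?thesis unfolding 1 using assms(3) by (simp add: joinpaths_def)
    qed (simp add: joinpaths_def)
  qed
qed auto

text \<open>Lower semicontinuity of length: each partition sum of the limit is a limit of sums over
  the same partition.\<close>

lemma length_le_limit:
  assumes len: "\<And>n. length_le (f n) a b M" and lim: "\<And>t. a \<le> t \<Longrightarrow> t \<le> b \<Longrightarrow> (\<lambda>n. f n t) \<longlonglongrightarrow> g t"
  shows "length_le g a b M"
  unfolding length_le_def
proof (intro allI impI)
  fix s assume "psum g a b s"
  then have "\<exists>S. (\<forall>n. psum (f n) a b (S n)) \<and> S \<longlonglongrightarrow> s"
    using lim
  proof (induction rule: psum.induct)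
    case (single a b)
    have "(\<lambda>n. norm (f n b - f n a)) \<longlonglongrightarrow> norm (g b - g a)" using single by (intro tendsto_intros) auto
    moreover have "\<forall>n. psum (f n) a b (norm (f n b - f n a))" using single by (auto intro: psum.single)
    ultimately show ?case by (intro exI[of _ "\<lambda>n. norm (f n b - f n a)"]) blast
  next
    case (step a c b s)
    have cb: "c < b" using psum_less[OF step(2)] .
    then obtain S where S: "\<forall>n. psum (f n) c b (S n)" "S \<longlonglongrightarrow> s" using step.IH step.prems step(1) by force
    have "(\<lambda>n. norm (f n c - f n a) + S n) \<longlonglongrightarrow> norm (g c - g a) + s" using step cb S(2) by (intro tendsto_intros) auto
    moreover have "\<forall>n. psum (f n) a b (norm (f n c - f n a) + S n)" using step(1) S(1) by (auto intro: psum.step)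
    ultimately show ?case by (intro exI[of _ "\<lambda>n. norm (f n c - f n a) + S n"]) blast
  qed
  then obtain S where "\<forall>n. psum (f n) a b (S n)" "S \<longlonglongrightarrow> s" by blast
  then show "s \<le> M" using len by (intro LIMSEQ_le_const2[of S]) (auto simp: length_le_def)
qed

text \<open>A single piece keeps its parametrisation, and each further piece halves the interval
  left to the others, so the subdivision depends on the number of pieces only.\<close>

fun joinlist :: "(real \<Rightarrow> 'b) list \<Rightarrow> real \<Rightarrow> 'b" where
  "joinlist [] = undefined"
| "joinlist [\<gamma>] = \<gamma>"
| "joinlist (\<gamma> # \<gamma>' # \<gamma>s) = (\<lambda>t. if t \<le> 1 / 2 then \<gamma> (2 * t) else joinlist (\<gamma>' # \<gamma>s) (2 * t - 1))"

lemma joinlist_Cons: "\<gamma>s \<noteq> [] \<Longrightarrow> joinlist (\<gamma> # \<gamma>s) = (\<lambda>t. if t \<le> 1 / 2 then \<gamma> (2 * t) else joinlist \<gamma>s (2 * t - 1))"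
  by (cases \<gamma>s) auto

text \<open>A parameter falls into the same piece of a concatenation, at the same place, whatever the pieces are.\<close>

lemma joinlist_piece:
  fixes es :: "'e list"
  assumes "es \<noteq> []" "0 \<le> t" "t \<le> 1"
  shows "\<exists>e\<in>set es. \<exists>t'\<in>{0..1}. \<forall>f :: 'e \<Rightarrow> real \<Rightarrow> 'b. joinlist (map f es) t = f e t'"
  using assms
proof (induction es arbitrary: t)
  case (Cons e es)
  consider "es = []" | "es \<noteq> []" "t \<le> 1 / 2" | "es \<noteq> []" "1 / 2 < t" by fastforce
  then show ?case
  proof cases
    case 1
    then show ?thesis using Cons.prems by (intro bexI[of _ e] bexI[of _ t]) auto
  next
    case 2
    then show ?thesis using Cons.prems by (intro bexI[of _ e] bexI[of _ "2 * t"]) (auto simp: joinlist_Cons)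
  next
    case 3
    have "\<exists>e\<in>set es. \<exists>t'\<in>{0..1}. \<forall>f :: 'e \<Rightarrow> real \<Rightarrow> 'b. joinlist (map f es) (2 * t - 1) = f e t'"
      by (intro Cons.IH) (use 3 Cons.prems in auto)
    then obtain e' t' where e: "e' \<in> set es" "t' \<in> {0..1}" "\<And>f :: 'e \<Rightarrow> real \<Rightarrow> 'b. joinlist (map f es) (2 * t - 1) = f e' t'" by blast
    show ?thesis using e(1,2) 3 e(3) by (intro bexI[of _ e'] bexI[of _ t']) (auto simp: joinlist_Cons)
  qed
qed simp

context self_similar_structure
begin

lemma joinlist_chain:
  assumes "es \<noteq> []" "is_chain es a b"
    and ends: "\<And>i c d. (i, c, d) \<in> set es \<Longrightarrow> f (i, c, d) 0 = \<psi> i c \<and> f (i, c, d) 1 = \<psi> i d"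
  shows "joinlist (map f es) 0 = a \<and> joinlist (map f es) 1 = b"
  using assms
proof (induction es a b rule: is_chain.induct)
  case (2 i c d es a b)
  show ?case
  proof (cases "es = []")
    case False
    then have "joinlist (map f es) 1 = b" using 2 by auto
    then show ?thesis using False 2 by (simp add: joinlist_Cons)
  qed (use 2 in auto)
qed simp

text \<open>Serves for length bounds, where the weights add up, and for \<open>near_cont\<close>,
  where the weight is ignored.\<close>

lemma joinlist_chain_induct:
  assumes "es \<noteq> []" "is_chain es a b"
    and ends: "\<And>i c d. (i, c, d) \<in> set es \<Longrightarrow> f (i, c, d) 0 = \<psi> i c \<and> f (i, c, d) 1 = \<psi> i d"
    and P: "\<And>e. e \<in> set es \<Longrightarrow> P (f e) (W e)"
    and join: "\<And>\<gamma> \<gamma>' M M'. P \<gamma> M \<Longrightarrow> P \<gamma>' M' \<Longrightarrow> \<gamma> 1 = \<gamma>' 0 \<Longrightarrow> P (\<gamma> +++ \<gamma>') (M + M')"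
  shows "P (joinlist (map f es)) (cost W es)"
  using assms(1-4)
proof (induction es a b rule: is_chain.induct)
  case (2 i c d es a b)
  show ?case
  proof (cases "es = []")
    case False
    have es: "is_chain es (\<psi> i d) b" "\<And>i c d. (i, c, d) \<in> set es \<Longrightarrow> f (i, c, d) 0 = \<psi> i c \<and> f (i, c, d) 1 = \<psi> i d"
      using 2 by auto
    have "P (joinlist (map f es)) (cost W es)" using 2 False by auto
    moreover have "f (i, c, d) 1 = joinlist (map f es) 0" using joinlist_chain[OF False es] 2(4) by simp
    moreover have "joinlist (map f ((i, c, d) # es)) = f (i, c, d) +++ joinlist (map f es)"
      using False by (simp add: joinlist_Cons joinpaths_def)
    ultimately show ?thesis using join 2(5) by simp
  qed (use 2 in auto)
qed simp

end

text \<open>Continuity up to a fixed error, with \<open>\<epsilon>\<close> at the end points and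
  \<open>2 * \<epsilon>\<close> elsewhere: at a junction two end errors add up to one interior
  error, so concatenation does not make it grow.\<close>

definition near_cont :: "real \<Rightarrow> (real \<Rightarrow> 'b::metric_space) \<Rightarrow> bool" where
  "near_cont \<epsilon> \<gamma> \<longleftrightarrow> (\<exists>d>0. (\<forall>s\<in>{0..1}. \<forall>t\<in>{0..1}. \<bar>s - t\<bar> < d \<longrightarrow> dist (\<gamma> s) (\<gamma> t) \<le> 2 * \<epsilon>) \<and>
    (\<forall>t\<in>{0..1}. t < d \<longrightarrow> dist (\<gamma> t) (\<gamma> 0) \<le> \<epsilon>) \<and> (\<forall>t\<in>{0..1}. 1 - t < d \<longrightarrow> dist (\<gamma> t) (\<gamma> 1) \<le> \<epsilon>))"

lemma near_cont_join:
  assumes "near_cont \<epsilon> p" "near_cont \<epsilon> q" "p 1 = q 0" shows "near_cont \<epsilon> (p +++ q)"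
proof -
  obtain d1 where d1: "d1 > 0" "\<And>s t. s \<in> {0..1} \<Longrightarrow> t \<in> {0..1} \<Longrightarrow> \<bar>s - t\<bar> < d1 \<Longrightarrow> dist (p s) (p t) \<le> 2 * \<epsilon>"
    "\<And>t. t \<in> {0..1} \<Longrightarrow> t < d1 \<Longrightarrow> dist (p t) (p 0) \<le> \<epsilon>" "\<And>t. t \<in> {0..1} \<Longrightarrow> 1 - t < d1 \<Longrightarrow> dist (p t) (p 1) \<le> \<epsilon>"
    using assms(1) unfolding near_cont_def by metis
  obtain d2 where d2: "d2 > 0" "\<And>s t. s \<in> {0..1} \<Longrightarrow> t \<in> {0..1} \<Longrightarrow> \<bar>s - t\<bar> < d2 \<Longrightarrow> dist (q s) (q t) \<le> 2 * \<epsilon>"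
    "\<And>t. t \<in> {0..1} \<Longrightarrow> t < d2 \<Longrightarrow> dist (q t) (q 0) \<le> \<epsilon>" "\<And>t. t \<in> {0..1} \<Longrightarrow> 1 - t < d2 \<Longrightarrow> dist (q t) (q 1) \<le> \<epsilon>"
    using assms(2) unfolding near_cont_def by metis
  define d where "d = min (1 / 2) (min (d1 / 2) (d2 / 2))"
  have d: "d > 0" "d \<le> 1 / 2" "2 * d \<le> d1" "2 * d \<le> d2" using d1(1) d2(1) by (auto simp: d_def)
  have le: "(p +++ q) t = p (2 * t)" if "t \<le> 1 / 2" for t using that by (simp add: joinpaths_def)
  have ge: "(p +++ q) t = q (2 * t - 1)" if "t > 1 / 2" for t using that by (simp add: joinpaths_def)
  have main: "dist ((p +++ q) s) ((p +++ q) t) \<le> 2 * \<epsilon>" if st: "s \<in> {0..1}" "t \<in> {0..1}" "\<bar>s - t\<bar> < d" "s \<le> t" for s t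
  proof -
    consider "t \<le> 1 / 2" | "s > 1 / 2" | "s \<le> 1 / 2" "t > 1 / 2" by linarith
    then show ?thesis
    proof cases
      case 1
      have "dist (p (2 * s)) (p (2 * t)) \<le> 2 * \<epsilon>" using 1 st d by (intro d1(2)) auto
      then show ?thesis using 1 st by (simp add: le)
    next
      case 2
      have "dist (q (2 * s - 1)) (q (2 * t - 1)) \<le> 2 * \<epsilon>" using 2 st d by (intro d2(2)) auto
      then show ?thesis using 2 st by (simp add: ge)
    next
      case 3
      have "dist (p (2 * s)) (p 1) \<le> \<epsilon>" using 3 st d by (intro d1(4)) auto
      moreover have "dist (q (2 * t - 1)) (q 0) \<le> \<epsilon>" using 3 st d by (intro d2(3)) auto
      ultimately show ?thesis
        using dist_triangle2[of "p (2 * s)" "q (2 * t - 1)" "q 0"] assms(3) 3 by (simp add: le ge)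
    qed
  qed
  show ?thesis
    unfolding near_cont_def
  proof (intro exI[of _ d] conjI d(1) ballI impI)
    fix s t :: real assume "s \<in> {0..1}" "t \<in> {0..1}" "\<bar>s - t\<bar> < d"
    then show "dist ((p +++ q) s) ((p +++ q) t) \<le> 2 * \<epsilon>"
      using main[of s t] main[of t s] by (cases "s \<le> t") (auto simp: dist_commute abs_minus_commute)
  next
    fix t :: real assume t: "t \<in> {0..1}" "t < d"
    then have "dist (p (2 * t)) (p 0) \<le> \<epsilon>" using d by (intro d1(3)) auto
    then show "dist ((p +++ q) t) ((p +++ q) 0) \<le> \<epsilon>" using t d by (simp add: le)
  next
    fix t :: real assume t: "t \<in> {0..1}" "1 - t < d"
    then have "dist (q (2 * t - 1)) (q 1) \<le> \<epsilon>" using d by (intro d2(4)) auto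
    then show "dist ((p +++ q) t) ((p +++ q) 1) \<le> \<epsilon>" using t d by (simp add: ge)
  qed
qed

lemma near_cont_imp_continuous:
  assumes "\<And>\<epsilon>. \<epsilon> > 0 \<Longrightarrow> near_cont \<epsilon> \<gamma>" shows "continuous_on {0..1} \<gamma>"
  unfolding continuous_on_iff
proof (intro ballI allI impI)
  fix t \<epsilon> :: real assume t: "t \<in> {0..1}" "\<epsilon> > 0"
  then obtain d where "d > 0" "\<forall>s\<in>{0..1}. \<forall>t\<in>{0..1}. \<bar>s - t\<bar> < d \<longrightarrow> dist (\<gamma> s) (\<gamma> t) \<le> 2 * (\<epsilon> / 3)"
    using assms[of "\<epsilon> / 3"] unfolding near_cont_def by auto
  then show "\<exists>d>0. \<forall>s\<in>{0..1}. dist s t < d \<longrightarrow> dist (\<gamma> s) (\<gamma> t) < \<epsilon>"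
    using t by (intro exI[of _ d]) (fastforce simp: dist_real_def)
qed

section \<open>A curve of minimal length\<close>

context fixed_vertex_structure
begin

definition min_chain :: "('a \<Rightarrow> real ^ 'n::finite) \<Rightarrow> 'a set \<Rightarrow> 'a \<Rightarrow> 'a \<Rightarrow> ('s \<times> 'a \<times> 'a) list" where
  "min_chain g Q a b = (SOME es. es \<noteq> [] \<and> set es \<subseteq> edges Q \<and> is_chain es a b \<and>
    cost (\<lambda>(i, c, d). \<delta> (g \<circ> \<psi> i) (sub i Q) c d) es \<le> \<delta> g Q a b)"

text \<open>Minimal chains are refined \<open>n\<close> times, and the innermost steps are traversed
  by a jump right after parameter 0. Such a jump has exactly the length of its increment, so
  continuity is needed in the limit only.\<close>

primrec \<Gamma> :: "nat \<Rightarrow> ('a \<Rightarrow> real ^ 'n::finite) \<Rightarrow> 'a set \<Rightarrow> 'a \<Rightarrow> 'a \<Rightarrow> real \<Rightarrow> 'a" where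
  "\<Gamma> 0 = (\<lambda>g Q a b t. if t \<le> 0 then a else b)"
| "\<Gamma> (Suc n) = (\<lambda>g Q a b. joinlist (map (\<lambda>(i, c, d). \<psi> i \<circ> \<Gamma> n (g \<circ> \<psi> i) (sub i Q) c d) (min_chain g Q a b)))"

definition state :: "('a \<Rightarrow> real ^ 'n::finite) \<Rightarrow> 'a set \<Rightarrow> 'a \<Rightarrow> 'a \<Rightarrow> bool" where
  "state g Q a b \<longleftrightarrow> fin_energy g \<and> marked Q \<and> a \<in> Q \<and> b \<in> Q"

lemma min_chain:
  assumes "state g Q a b"
  shows "min_chain g Q a b \<noteq> []" "set (min_chain g Q a b) \<subseteq> edges Q" "is_chain (min_chain g Q a b) a b"
    "cost (\<lambda>(i, c, d). \<delta> (g \<circ> \<psi> i) (sub i Q) c d) (min_chain g Q a b) \<le> \<delta> g Q a b"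
  using someI_ex[OF ex_minimal_chain[of g Q a b]] assms unfolding min_chain_def state_def by blast+

lemma state_sub:
  assumes "state g Q a b" "(i, c, d) \<in> set (min_chain g Q a b)"
  shows "i \<in> S" "state (g \<circ> \<psi> i) (sub i Q) c d"
proof -
  have "(i, c, d) \<in> edges Q" using min_chain(2)[OF assms(1)] assms(2) by blast
  then have "i \<in> S" "c \<in> sub i Q" "d \<in> sub i Q" by (auto simp: edges_def)
  then show "i \<in> S" "state (g \<circ> \<psi> i) (sub i Q) c d"
    using assms(1) fin_energy_psi marked_sub by (auto simp: state_def)
qed

lemma state_in_K: "state g Q a b \<Longrightarrow> a \<in> K \<and> b \<in> K"
  by (auto simp: state_def marked_def)

lemma \<Gamma>_ends: "state g Q a b \<Longrightarrow> \<Gamma> n g Q a b 0 = a \<and> \<Gamma> n g Q a b 1 = b"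
proof (induction n arbitrary: g Q a b)
  case (Suc n)
  show ?case
    unfolding \<Gamma>.simps
  proof (rule joinlist_chain[OF min_chain(1,3)[OF Suc.prems]])
    fix i c d assume "(i, c, d) \<in> set (min_chain g Q a b)"
    from Suc.IH[OF state_sub(2)[OF Suc.prems this]] show
      "(case (i, c, d) of (i, c, d) \<Rightarrow> \<psi> i \<circ> \<Gamma> n (g \<circ> \<psi> i) (sub i Q) c d) 0 = \<psi> i c \<and>
       (case (i, c, d) of (i, c, d) \<Rightarrow> \<psi> i \<circ> \<Gamma> n (g \<circ> \<psi> i) (sub i Q) c d) 1 = \<psi> i d"
      by (simp add: o_def)
  qed
qed simp

text \<open>By \<open>joinlist_piece\<close> the piece containing a parameter is determined by the
  minimal chains alone, so deeper approximations stay in the cell reached at depth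
  \<open>n\<close>.\<close>

lemma \<Gamma>_cell:
  assumes "state g Q a b" "0 \<le> t" "t \<le> 1"
  shows "\<exists>w\<in>words n. \<forall>m\<ge>n. \<Gamma> m g Q a b t \<in> psi_word w ` K"
  using assms
proof (induction n arbitrary: g Q a b t)
  case 0
  have "\<Gamma> m g Q a b t \<in> K" for m
    using 0
  proof (induction m arbitrary: g Q a b t)
    case 0
    then show ?case using state_in_K by auto
  next
    case (Suc m)
    obtain e t' where e: "e \<in> set (min_chain g Q a b)" "t' \<in> {0..1}"
      "\<And>f :: _ \<Rightarrow> real \<Rightarrow> 'a. joinlist (map f (min_chain g Q a b)) t = f e t'"
      using joinlist_piece[OF min_chain(1)[OF Suc.prems(1)] Suc.prems(2,3)] by blast
    obtain i c d where icd: "e = (i, c, d)" by (cases e)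
    have s: "i \<in> S" "state (g \<circ> \<psi> i) (sub i Q) c d" using state_sub[OF Suc.prems(1)] e(1) by (auto simp: icd)
    show ?case using psi_in_K[OF s(1) Suc.IH[OF s(2), of t']] e(2) by (simp add: e(3) icd o_def)
  qed
  then show ?case by simp
next
  case (Suc n)
  obtain e t' where e: "e \<in> set (min_chain g Q a b)" "t' \<in> {0..1}"
    "\<And>f :: _ \<Rightarrow> real \<Rightarrow> 'a. joinlist (map f (min_chain g Q a b)) t = f e t'"
    using joinlist_piece[OF min_chain(1)[OF Suc.prems(1)] Suc.prems(2,3)] by blast
  obtain i c d where icd: "e = (i, c, d)" by (cases e)
  have s: "i \<in> S" "state (g \<circ> \<psi> i) (sub i Q) c d" using state_sub[OF Suc.prems(1)] e(1) by (auto simp: icd)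
  then obtain w where w: "w \<in> words n" "\<And>m. m \<ge> n \<Longrightarrow> \<Gamma> m (g \<circ> \<psi> i) (sub i Q) c d t' \<in> psi_word w ` K"
    using Suc.IH[OF s(2), of t'] e(2) by (auto simp: o_def)
  have "\<Gamma> m g Q a b t \<in> psi_word (i # w) ` K" if mn: "m \<ge> Suc n" for m
  proof -
    obtain m' where m: "m = Suc m'" "m' \<ge> n" using mn by (cases m) auto
    have "\<Gamma> m g Q a b t = \<psi> i (\<Gamma> m' (g \<circ> \<psi> i) (sub i Q) c d t')" by (simp add: m(1) e(3) icd)
    then show ?thesis using w(2)[OF m(2)] by (auto simp: psi_word_Cons)
  qed
  moreover have "i # w \<in> words (Suc n)" using s(1) w(1) by (simp add: words_Cons_iff)
  ultimately show ?case by blast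
qed

definition \<gamma> :: "('a \<Rightarrow> real ^ 'n::finite) \<Rightarrow> 'a set \<Rightarrow> 'a \<Rightarrow> 'a \<Rightarrow> real \<Rightarrow> 'a" where
  "\<gamma> g Q a b t = lim (\<lambda>n. \<Gamma> n g Q a b t)"

lemma \<Gamma>_tendsto:
  assumes "state g Q a b" "0 \<le> t" "t \<le> 1"
  shows "(\<lambda>n. \<Gamma> n g Q a b t) \<longlonglongrightarrow> \<gamma> g Q a b t" and "\<gamma> g Q a b t \<in> K"
proof -
  have inK: "\<forall>n. \<Gamma> n g Q a b t \<in> K" using \<Gamma>_cell[OF assms, of 0] by simp
  have "Cauchy (\<lambda>n. \<Gamma> n g Q a b t)"
    unfolding Cauchy_def
  proof (intro allI impI)
    fix \<epsilon> :: real assume "\<epsilon> > 0"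
    then obtain n where n: "\<forall>w\<in>words n. \<forall>x\<in>K. \<forall>y\<in>K. dist (psi_word w x) (psi_word w y) < \<epsilon>"
      using cells_small by blast
    obtain w where w: "w \<in> words n" "\<And>m. m \<ge> n \<Longrightarrow> \<Gamma> m g Q a b t \<in> psi_word w ` K"
      using \<Gamma>_cell[OF assms, of n] by blast
    have "dist (\<Gamma> l g Q a b t) (\<Gamma> m g Q a b t) < \<epsilon>" if "l \<ge> n" "m \<ge> n" for l m
      using w(2)[OF that(1)] w(2)[OF that(2)] n w(1) by auto
    then show "\<exists>n. \<forall>l\<ge>n. \<forall>m\<ge>n. dist (\<Gamma> l g Q a b t) (\<Gamma> m g Q a b t) < \<epsilon>" by blast
  qed
  then obtain l where l: "l \<in> K" "(\<lambda>n. \<Gamma> n g Q a b t) \<longlonglongrightarrow> l"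
    using compact_imp_complete[OF compact_K, unfolded complete_def, rule_format, of "\<lambda>n. \<Gamma> n g Q a b t"] inK by auto
  have "\<gamma> g Q a b t = l" unfolding \<gamma>_def using l(2) by (rule limI)
  then show "(\<lambda>n. \<Gamma> n g Q a b t) \<longlonglongrightarrow> \<gamma> g Q a b t" "\<gamma> g Q a b t \<in> K" using l by simp_all
qed

lemma \<gamma>_ends: "state g Q a b \<Longrightarrow> \<gamma> g Q a b 0 = a \<and> \<gamma> g Q a b 1 = b"
proof -
  assume "state g Q a b"
  then have "\<Gamma> n g Q a b 0 = a" "\<Gamma> n g Q a b 1 = b" for n using \<Gamma>_ends by blast+
  then show ?thesis by (simp add: \<gamma>_def)
qed

text \<open>The recursion for \<open>\<Gamma>\<close> passes to the limit, as the piece containing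
  \<open>t\<close> and the position inside it are the same for all depths.\<close>

lemma \<gamma>_unfold:
  assumes s: "state g Q a b" and t: "0 \<le> t" "t \<le> 1"
  shows "\<gamma> g Q a b t = joinlist (map (\<lambda>(i, c, d). \<psi> i \<circ> \<gamma> (g \<circ> \<psi> i) (sub i Q) c d) (min_chain g Q a b)) t"
proof -
  obtain e t' where e: "e \<in> set (min_chain g Q a b)" "t' \<in> {0..1}"
    "\<And>f :: _ \<Rightarrow> real \<Rightarrow> 'a. joinlist (map f (min_chain g Q a b)) t = f e t'"
    using joinlist_piece[OF min_chain(1)[OF s] t] by blast
  obtain i c d where icd: "e = (i, c, d)" by (cases e)
  have i: "i \<in> S" and s': "state (g \<circ> \<psi> i) (sub i Q) c d" using state_sub[OF s] e(1) by (auto simp: icd)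
  have t': "0 \<le> t'" "t' \<le> 1" using e(2) by auto
  have "\<forall>n. \<Gamma> n (g \<circ> \<psi> i) (sub i Q) c d t' \<in> K" using \<Gamma>_cell[OF s' t', of 0] by simp
  then have "(\<lambda>n. \<psi> i (\<Gamma> n (g \<circ> \<psi> i) (sub i Q) c d t')) \<longlonglongrightarrow> \<psi> i (\<gamma> (g \<circ> \<psi> i) (sub i Q) c d t')"
    using continuous_on_tendsto_compose[OF psi_continuous[OF i] \<Gamma>_tendsto[OF s' t']] by simp
  moreover have "\<psi> i (\<Gamma> n (g \<circ> \<psi> i) (sub i Q) c d t') = \<Gamma> (Suc n) g Q a b t" for n
    by (simp add: e(3) icd)
  ultimately have "(\<lambda>n. \<Gamma> (Suc n) g Q a b t) \<longlonglongrightarrow> \<psi> i (\<gamma> (g \<circ> \<psi> i) (sub i Q) c d t')" by simp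
  moreover have "(\<lambda>n. \<Gamma> (Suc n) g Q a b t) \<longlonglongrightarrow> \<gamma> g Q a b t"
    using \<Gamma>_tendsto(1)[OF s t] by (rule LIMSEQ_Suc)
  ultimately have "\<gamma> g Q a b t = \<psi> i (\<gamma> (g \<circ> \<psi> i) (sub i Q) c d t')" by (rule LIMSEQ_unique[rotated])
  then show ?thesis by (simp add: e(3) icd)
qed

lemma near_cont_cong:
  "near_cont \<epsilon> f \<Longrightarrow> (\<And>t. 0 \<le> t \<Longrightarrow> t \<le> 1 \<Longrightarrow> f t = g t) \<Longrightarrow> near_cont \<epsilon> g"
proof -
  assume f: "near_cont \<epsilon> f" and "\<And>t. 0 \<le> t \<Longrightarrow> t \<le> 1 \<Longrightarrow> f t = g t"
  then have "g t = f t" if "t \<in> {0..1}" for t using that by simp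
  then show ?thesis using f by (simp add: near_cont_def)
qed

text \<open>The observable \<open>\<xi>\<close> is arbitrary because zooming into a cell replaces it
  by \<open>\<xi> \<circ> \<psi> i\<close>. After \<open>n\<close> refinements every piece lies in
  one cell of level \<open>n\<close>, where \<open>\<xi>\<close> varies by at most
  \<open>\<epsilon>\<close>.\<close>

lemma \<gamma>_near_cont:
  assumes "state g Q a b" "\<And>u x y. u \<in> words n \<Longrightarrow> x \<in> K \<Longrightarrow> y \<in> K \<Longrightarrow> dist (\<xi> (psi_word u x)) (\<xi> (psi_word u y)) \<le> \<epsilon>"
  shows "near_cont \<epsilon> (\<xi> \<circ> \<gamma> g Q a b)"
  using assms
proof (induction n arbitrary: g Q a b \<xi>)
  case 0
  have "dist (\<xi> x) (\<xi> y) \<le> \<epsilon>" if "x \<in> K" "y \<in> K" for x y using 0(2)[of "[]" x y] that by simp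
  then have le: "dist (\<xi> (\<gamma> g Q a b s)) (\<xi> (\<gamma> g Q a b t)) \<le> \<epsilon>" if "s \<in> {0..1}" "t \<in> {0..1}" for s t
    using \<Gamma>_tendsto(2)[OF 0(1)] that by simp
  moreover have "0 \<le> \<epsilon>" using le[of 0 0] by simp
  ultimately have "dist (\<xi> (\<gamma> g Q a b s)) (\<xi> (\<gamma> g Q a b t)) \<le> 2 * \<epsilon>" if "s \<in> {0..1}" "t \<in> {0..1}" for s t
    using le[OF that] by linarith
  with le show ?case
    unfolding near_cont_def o_def by (intro exI[of _ 1]) simp
next
  case (Suc n)
  note mc = min_chain[OF Suc.prems(1)]
  define f where "f = (\<lambda>(i, c, d). \<psi> i \<circ> \<gamma> (g \<circ> \<psi> i) (sub i Q) c d)"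
  have ends: "f (i, c, d) 0 = \<psi> i c \<and> f (i, c, d) 1 = \<psi> i d" if "(i, c, d) \<in> set (min_chain g Q a b)" for i c d
    using \<gamma>_ends[OF state_sub(2)[OF Suc.prems(1) that]] by (simp add: f_def)
  have "near_cont \<epsilon> (\<xi> \<circ> joinlist (map f (min_chain g Q a b)))"
  proof (rule joinlist_chain_induct[OF mc(1,3) ends, where P = "\<lambda>\<gamma> _. near_cont \<epsilon> (\<xi> \<circ> \<gamma>)" and W = "\<lambda>_. 0"])
    fix e assume "e \<in> set (min_chain g Q a b)"
    moreover obtain i c d where "e = (i, c, d)" by (cases e)
    ultimately have e: "e = (i, c, d)" "(i, c, d) \<in> set (min_chain g Q a b)" by simp_all
    have "near_cont \<epsilon> ((\<xi> \<circ> \<psi> i) \<circ> \<gamma> (g \<circ> \<psi> i) (sub i Q) c d)"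
    proof (rule Suc.IH[OF state_sub(2)[OF Suc.prems(1) e(2)]])
      fix u x y assume "u \<in> words n" "x \<in> K" "y \<in> K"
      then show "dist ((\<xi> \<circ> \<psi> i) (psi_word u x)) ((\<xi> \<circ> \<psi> i) (psi_word u y)) \<le> \<epsilon>"
        using Suc.prems(2)[of "i # u" x y] state_sub(1)[OF Suc.prems(1) e(2)] by (simp add: words_Cons_iff psi_word_Cons)
    qed
    then show "near_cont \<epsilon> (\<xi> \<circ> f e)" by (simp add: f_def e(1) o_assoc)
  next
    fix p q :: "real \<Rightarrow> 'a" assume "near_cont \<epsilon> (\<xi> \<circ> p)" "near_cont \<epsilon> (\<xi> \<circ> q)" "p 1 = q 0"
    then show "near_cont \<epsilon> (\<xi> \<circ> (p +++ q))"
      using near_cont_join[of \<epsilon> "\<xi> \<circ> p" "\<xi> \<circ> q"] by (simp add: path_compose_join)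
  qed
  then show ?case
    by (rule near_cont_cong) (simp add: \<gamma>_unfold[OF Suc.prems(1)] f_def)
qed

lemma \<gamma>_continuous: "state g Q a b \<Longrightarrow> continuous_on {0..1} (\<gamma> g Q a b)"
proof (rule near_cont_imp_continuous)
  fix \<epsilon> :: real assume s: "state g Q a b" and "\<epsilon> > 0"
  then obtain n where "\<forall>w\<in>words n. \<forall>x\<in>K. \<forall>y\<in>K. dist (psi_word w x) (psi_word w y) < \<epsilon>" using cells_small by blast
  then have "near_cont \<epsilon> (id \<circ> \<gamma> g Q a b)" by (intro \<gamma>_near_cont[OF s, of n]) (auto intro: less_imp_le)
  then show "near_cont \<epsilon> (\<gamma> g Q a b)" by simp
qed

text \<open>The costs along a minimal chain sum to at most \<open>\<delta> g Q a b\<close>, so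
  refinement does not enlarge the bound.\<close>

lemma \<Gamma>_length: "state g Q a b \<Longrightarrow> length_le (\<lambda>t. g (\<Gamma> n g Q a b t)) 0 1 (\<delta> g Q a b)"
proof (induction n arbitrary: g Q a b)
  case 0
  have "length_le (\<lambda>t. g (\<Gamma> 0 g Q a b t)) 0 1 (norm (g b - g a))"
    unfolding length_le_def
  proof (intro allI impI)
    \<comment> \<open>Only the interval of a partition that starts at 0 sees the jump of
      \<open>\<Gamma> 0\<close>.\<close>
    have *: "psum (\<lambda>t. g (\<Gamma> 0 g Q a b t)) x y s \<Longrightarrow> 0 \<le> x \<Longrightarrow> s = (if x = 0 then norm (g b - g a) else 0)" for x y s
      by (induction rule: psum.induct) (auto dest: psum_less)
    show "psum (\<lambda>t. g (\<Gamma> 0 g Q a b t)) 0 1 s \<Longrightarrow> s \<le> norm (g b - g a)" for s using *[of 0 1 s] by simp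
  qed
  moreover have "norm (g b - g a) \<le> \<delta> g Q a b"
    using \<rho>_le_\<delta>[of g Q a b 0] 0 by (simp add: state_def)
  ultimately show ?case by (rule length_le_mono)
next
  case (Suc n)
  note mc = min_chain[OF Suc.prems]
  define f where "f = (\<lambda>(i, c, d). \<psi> i \<circ> \<Gamma> n (g \<circ> \<psi> i) (sub i Q) c d)"
  define W where "W = (\<lambda>(i, c, d). \<delta> (g \<circ> \<psi> i) (sub i Q) c d)"
  have ends: "f (i, c, d) 0 = \<psi> i c \<and> f (i, c, d) 1 = \<psi> i d" if "(i, c, d) \<in> set (min_chain g Q a b)" for i c d
    using \<Gamma>_ends[OF state_sub(2)[OF Suc.prems that]] by (simp add: f_def)
  have "length_le (g \<circ> joinlist (map f (min_chain g Q a b))) 0 1 (cost W (min_chain g Q a b))"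
  proof (rule joinlist_chain_induct[OF mc(1,3) ends, where P = "\<lambda>\<gamma> M. length_le (g \<circ> \<gamma>) 0 1 M" and W = W])
    fix e assume "e \<in> set (min_chain g Q a b)"
    moreover obtain i c d where "e = (i, c, d)" by (cases e)
    ultimately have e: "e = (i, c, d)" "(i, c, d) \<in> set (min_chain g Q a b)" by simp_all
    show "length_le (g \<circ> f e) 0 1 (W e)"
      using Suc.IH[OF state_sub(2)[OF Suc.prems e(2)]] by (simp add: f_def W_def e(1) o_def)
  next
    fix p q :: "real \<Rightarrow> 'a" and M M' assume "length_le (g \<circ> p) 0 1 M" "length_le (g \<circ> q) 0 1 M'" "p 1 = q 0"
    then show "length_le (g \<circ> (p +++ q)) 0 1 (M + M')"
      using length_le_joinpaths[of "g \<circ> p" M "g \<circ> q" M'] by (simp add: path_compose_join)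
  qed
  then have "length_le (g \<circ> joinlist (map f (min_chain g Q a b))) 0 1 (\<delta> g Q a b)"
    by (rule length_le_mono) (use mc(4) in \<open>simp add: W_def\<close>)
  then show ?case by (simp add: f_def o_def)
qed

lemma \<gamma>_length:
  assumes s: "state g Q a b" shows "length_le (\<lambda>t. g (\<gamma> g Q a b t)) 0 1 (\<delta> g Q a b)"
proof (rule length_le_limit[OF \<Gamma>_length[OF s]])
  fix t :: real assume t: "0 \<le> t" "t \<le> 1"
  have c: "continuous_on K g" using fin_energy_continuous[of g] s by (simp add: state_def)
  have "\<forall>n. \<Gamma> n g Q a b t \<in> K" using \<Gamma>_cell[OF s t, of 0] by simp
  then show "(\<lambda>n. g (\<Gamma> n g Q a b t)) \<longlonglongrightarrow> g (\<gamma> g Q a b t)"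
    using continuous_on_tendsto_compose[OF c \<Gamma>_tendsto[OF s t]] by simp
qed

lemma geodesic_dist_le_intrinsic_dist:
  fixes h :: "'a \<Rightarrow> real ^ 'n::finite"
  assumes h: "fin_energy h" and xy: "x \<in> K" "y \<in> K"
  shows "geodesic_dist K h x y \<le> intrinsic_dist h x y"
proof -
  \<comment> \<open>The end points are marked in addition to \<open>V0\<close>, since they need not
    be vertices of any level.\<close>
  define Q where "Q = insert x (insert y V0)"
  have Q: "marked Q" "x \<in> Q" "y \<in> Q" using xy by (auto simp: marked_def Q_def)
  then have s: "state h Q x y" using h by (simp add: state_def)
  have "geodesic_dist K h x y \<le> curve_length h 0 1 (\<gamma> h Q x y)"
    unfolding geodesic_dist_def
    using \<gamma>_continuous[OF s] \<gamma>_ends[OF s] \<Gamma>_tendsto(2)[OF s]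
    by (intro INF_lower) (auto simp: path_def path_image_def pathstart_def pathfinish_def)
  also have "\<dots> \<le> ereal (\<delta> h Q x y)"
    using \<gamma>_length[OF s] by (simp add: curve_length_le_iff)
  also obtain f where f: "\<forall>k. dominated_upto k f h" "\<delta> h Q x y \<le> f y - f x"
    using ex_dominated_\<delta>[OF h Q] by blast
  then have "ereal (\<delta> h Q x y) \<le> ereal (f y - f x)" by simp
  also have "\<dots> \<le> intrinsic_dist h x y"
    unfolding intrinsic_dist_def
  proof (rule SUP_upper, intro CollectI conjI ballI)
    show f': "f \<in> form_domain" using f(1) by (simp add: dominated_upto_def)
    fix Y assume "Y \<in> sets (restrict_space borel K)"
    then show "emeasure (energy_measure f) Y \<le> (\<Sum>j\<in>UNIV. emeasure (energy_measure (\<lambda>z. h z $ j)) Y)"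
      using f(1) h by (intro energy_measure_dominated[OF f']) (auto simp: dominated_upto_def fin_energy_def)
  qed
  finally show ?thesis .
qed

lemma energy_measure_cong:
  assumes "\<And>x. x \<in> K \<Longrightarrow> f x = f' x" shows "energy_measure f = energy_measure f'"
proof -
  have "energy f (\<lambda>x. f x * \<phi> x) = energy f' (\<lambda>x. f' x * \<phi> x)" "energy (\<lambda>x. (f x)\<^sup>2) \<phi> = energy (\<lambda>x. (f' x)\<^sup>2) \<phi>" for \<phi>
    using assms by (intro energy_cong; simp)+
  then show ?thesis by (simp only: energy_measure_def)
qed

end

context three_vertex_structure
begin

lemma intrinsic_dist_le_geodesic_dist:
  fixes h :: "'a \<Rightarrow> real ^ 'n::finite"
  assumes h: "harm h" shows "intrinsic_dist h x y \<le> geodesic_dist K h x y"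
  unfolding intrinsic_dist_def
proof (rule SUP_least)
  fix f assume "f \<in> {f \<in> form_domain. \<forall>Y\<in>sets (restrict_space borel K).
    emeasure (energy_measure f) Y \<le> (\<Sum>j\<in>UNIV. emeasure (energy_measure (\<lambda>z. h z $ j)) Y)}"
  then have f: "f \<in> form_domain" and dom: "\<And>Y. Y \<in> sets (restrict_space borel K) \<Longrightarrow>
      emeasure (energy_measure f) Y \<le> (\<Sum>j\<in>UNIV. emeasure (energy_measure (\<lambda>z. h z $ j)) Y)" by auto
  have hH: "h x $ j = H (\<lambda>z. h z $ j) x" if "x \<in> K" for x j using h that by (simp add: harm_def)
  have "energy_measure (\<lambda>z. h z $ j) = energy_measure (H (\<lambda>z. h z $ j))" for j
    using hH by (intro energy_measure_cong)
  note em = this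
  have "cell_energy w f \<le> (\<Sum>j\<in>UNIV. cell_energy w (\<lambda>z. h z $ j))" if w: "w \<in> words m" for m w
  proof -
    have "cell_energy w f \<le> (\<Sum>j\<in>UNIV. cell_energy w (H (\<lambda>z. h z $ j)))"
      by (rule cell_energy_dominated[OF f finite_class.finite_UNIV _ w]) (use dom em in simp)
    also have "\<dots> = (\<Sum>j\<in>UNIV. cell_energy w (\<lambda>z. h z $ j))"
      unfolding cell_energy_def using w hH by (intro sum.cong refl arg_cong2[where f = "(*)"] energy_cong) auto
    finally show ?thesis .
  qed
  then have "dominated f h" using f by (simp add: dominated_def)
  then show "ereal (f y - f x) \<le> geodesic_dist K h x y" by (rule dominated_le_geodesic_dist[OF h])
qed

end

theorem theorem2p3:
  fixes K :: "'a::metric_space set"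
    and S :: "'s set"
    and \<psi> :: "'s \<Rightarrow> 'a \<Rightarrow> 'a"
    and \<pi> :: "(nat \<Rightarrow> 's) \<Rightarrow> 'a"
    and D :: "'a \<Rightarrow> 'a \<Rightarrow> real"
    and r :: "'s \<Rightarrow> real"
    and \<mu> :: "'a measure"
    and v :: "'s \<Rightarrow> 'a \<Rightarrow> real"
    and h :: "'a \<Rightarrow> real ^ 'n"
  defines "V0 \<equiv> self_similar_structure.V0 K S \<psi> \<pi>"
    and "S0 \<equiv> self_similar_structure.S0 K S \<psi> \<pi>"
  assumes "regular_harmonic_structure K S \<psi> \<pi> D r"
    and "sets \<mu> = sets (restrict_space borel K)" and "finite_measure \<mu>"
    and "\<And>U. openin (top_of_set K) U \<Longrightarrow> U \<noteq> {} \<Longrightarrow> 0 < emeasure \<mu> U"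
    and v: "\<And>i. i \<in> S0 \<Longrightarrow> regular_harmonic_structure.nonneg_eigenvector K S \<psi> \<pi> D r i (v i)"
    and B1: "card V0 = 3"
    and B2: "\<And>p. p \<in> V0 \<Longrightarrow> connected (K - {p})"
    and B3: "card S0 = 3"
      "\<And>p. p \<in> V0 \<Longrightarrow> \<exists>i\<in>S0. p = self_similar_structure.fixpt K \<psi> i"
      "\<And>i q. i \<in> S0 \<Longrightarrow> q \<in> V0 - {self_similar_structure.fixpt K \<psi> i} \<Longrightarrow>
         self_similar_structure.Dop K S \<psi> \<pi> D (v i) q < 0"
    and B4: "\<And>i. i \<in> S0 \<Longrightarrow> bij_betw (regular_harmonic_structure.A K S \<psi> \<pi> D r i)
               (extensional V0) (extensional V0)"
    and h: "\<And>j. regular_harmonic_structure.harmonic K S \<psi> \<pi> D r (\<lambda>z. h z $ j)"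
  shows "\<forall>x\<in>K. \<forall>y\<in>K.
     regular_harmonic_structure.intrinsic_dist K S \<psi> \<pi> D r h x y = geodesic_dist K h x y"
proof -
  interpret regular_harmonic_structure K S \<psi> \<pi> D r by fact
  interpret three_vertex_structure K S \<psi> \<pi> D r v
    using v B1 B2 B3 unfolding assms(1,2) by unfold_locales auto
  have "harm h" using harmonic_eq_H[OF h] by (simp add: harm_def)
  moreover have "fin_energy h" by (simp add: fin_energy_def harmonic_form_domain[OF h])
  ultimately show ?thesis
    by (intro ballI antisym intrinsic_dist_le_geodesic_dist geodesic_dist_le_intrinsic_dist)
qed

end
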